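(* Let $\mathfrak g=\mathfrak{gl}(1|n)$ with the distinguished Borel subalgebra and let $\lambda\in\mathfrak h^*$ be an atypical weight. Let $p\le n$ be such that $(\lambda+\rho,\varepsilon_1-\delta_p)=0$ and $(\lambda+\rho,\varepsilon_1-\delta_j)\neq 0$ for all $j<p$. Then $\{\varepsilon_1-\delta_i\}\in\mathcal S(\lambda)$ if and only if $i\ge p$ and $(\lambda+\rho,\varepsilon_1-\delta_i)\in\mathbb Z_{\le 0}$.
   Context: Work over $\mathbb C$. For $\mathfrak g=\mathfrak{gl}(m|n)$ (here $m=1$), $\mathfrak h$ is the diagonal Cartan subalgebra, $\mathfrak h^*$ has the standard basis $\varepsilon_1,\dots,\varepsilon_m,\delta_1,\dots,\delta_n$ and the form $(\varepsilon_i,\varepsilon_i)=1$, $(\delta_j,\delta_j)=-1$, all other pairings of basis vectors being $0$. The distinguished Borel subalgebra $\mathfrak b$ has positive roots $\varepsilon_i-\varepsilon_j$ ($i<j$), $\delta_i-\delta_j$ ($i<j$) (even) and $\varepsilon_i-\delta_j$ (all $i,j$; odd). $\rho$ is half the sum of the positive even roots minus half the sum of the positive odd roots. A weight $\lambda$ is atypical if $(\lambda+\rho,\gamma)=0$ for some odd root $\gamma$. $M(\lambda)$ is the Verma module $U(\mathfrak g)\otimes_{U(\mathfrak b)}\mathbb C_\lambda$. Let $X=\{x\in\mathfrak g_{\bar 1}\mid [x,x]=0\}$, and for a $\mathfrak g$-module $M$ let $X_M=\{x\in X\mid xM\neq\ker(x|_M)\}$. Let $\mathcal S$ be the set of all subsets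 $S$ (including $\emptyset$) of mutually orthogonal, linearly independent odd isotropic roots; for $S=\{\alpha_1,\dots,\alpha_k\}\in\mathcal S$ let $x_S=x_1+\dots+x_k$ with $0\neq x_i\in\mathfrak g_{\alpha_i}$, whose orbit $\Phi(S)=B_{\bar 0}x_S$ under the Borel subgroup $B_{\bar 0}$ (with Lie algebra $\mathfrak b_{\bar 0}=\mathfrak b\cap \mathfrak g_{\bar 0}$) is independent of choices. Then $\mathcal S(\lambda)=\{S\in\mathcal S\mid \Phi(S)\subset X_{M(\lambda)}\}$. *)

theory Defs
  imports "HOL-Analysis.Analysis" "HOL-Algebra.Free_Abelian_Groups"
begin

section \<open>The Lie superalgebra gl(m|n)\<close>

text \<open>
  The superspace C^(m|n) has basis indexed by the sum type 'm + 'n, the summand 'm being the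
  even part.  The finite linear orders 'm and 'n play the roles of 1 < ... < m and 1 < ... < n.
\<close>

type_synonym ('m, 'n) gl = "complex ^ ('m + 'n) ^ ('m + 'n)"
type_synonym ('m, 'n) weight = "complex ^ ('m + 'n)"

definition parity :: "'m + 'n \<Rightarrow> nat" where
  "parity k = (case k of Inl _ \<Rightarrow> 0 | Inr _ \<Rightarrow> 1)"

text \<open>Projection to the homogeneous component of parity p, for p = 0, 1.\<close>

definition gpart :: "nat \<Rightarrow> ('m::finite, 'n::finite) gl \<Rightarrow> ('m, 'n) gl" where
  "gpart p x = (\<chi> i j. if (parity i + parity j) mod 2 = p then x $ i $ j else 0)"

definition homogeneous :: "nat \<Rightarrow> ('m::finite, 'n::finite) gl set" where
  "homogeneous p = {x. gpart p x = x}"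

definition mscale :: "complex \<Rightarrow> ('m::finite, 'n::finite) gl \<Rightarrow> ('m, 'n) gl" where
  "mscale c x = map_matrix ((*) c) x"

definition sbracket :: "('m::finite, 'n::finite) gl \<Rightarrow> ('m, 'n) gl \<Rightarrow> ('m, 'n) gl" where
  "sbracket x y = (\<Sum>p\<in>{0, 1}. \<Sum>q\<in>{0, 1}.
     gpart p x ** gpart q y - mscale ((-1) ^ (p * q)) (gpart q y ** gpart p x))"

text \<open>The set X of odd self-commuting elements.\<close>

definition self_commuting :: "('m::finite, 'n::finite) gl set" where
  "self_commuting = {x \<in> homogeneous 1. sbracket x x = 0}"


section \<open>Weights and roots\<close>

text \<open>
  An element of the dual of the diagonal Cartan subalgebra is given by its coordinates in the
  basis eps, del; so its value on a matrix h is the sum of the products of its coordinates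
  with the diagonal entries of h.
\<close>

definition eps :: "'m::finite \<Rightarrow> ('m, 'n::finite) weight" where
  "eps i = axis (Inl i) 1"

definition del :: "'n::finite \<Rightarrow> ('m::finite, 'n) weight" where
  "del j = axis (Inr j) 1"

definition cartan :: "('m::finite, 'n::finite) gl set" where
  "cartan = {h. \<forall>i j. i \<noteq> j \<longrightarrow> h $ i $ j = 0}"

definition wt_eval :: "('m::finite, 'n::finite) weight \<Rightarrow> ('m, 'n) gl \<Rightarrow> complex" where
  "wt_eval \<mu> h = (\<Sum>k\<in>UNIV. \<mu> $ k * h $ k $ k)"

definition wt_form :: "('m::finite, 'n::finite) weight \<Rightarrow> ('m, 'n) weight \<Rightarrow> complex" where
  "wt_form \<mu> \<nu> = (\<Sum>k\<in>UNIV. (-1) ^ parity k * \<mu> $ k * \<nu> $ k)"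

definition pos_even_roots :: "('m::{finite,linorder}, 'n::{finite,linorder}) weight set" where
  "pos_even_roots = {eps i - eps j |i j. i < j} \<union> {del i - del j |i j. i < j}"

definition pos_odd_roots :: "('m::finite, 'n::finite) weight set" where
  "pos_odd_roots = {eps i - del j |i j. True}"

definition odd_roots :: "('m::finite, 'n::finite) weight set" where
  "odd_roots = pos_odd_roots \<union> uminus ` pos_odd_roots"

definition rho :: "('m::{finite,linorder}, 'n::{finite,linorder}) weight" where
  "rho = (1 / 2) *\<^sub>R (\<Sum>\<alpha>\<in>pos_even_roots. \<alpha>) - (1 / 2) *\<^sub>R (\<Sum>\<alpha>\<in>pos_odd_roots. \<alpha>)"

definition atypical :: "('m::{finite,linorder}, 'n::{finite,linorder}) weight \<Rightarrow> bool" where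
  "atypical \<Lambda> \<longleftrightarrow> (\<exists>\<gamma>\<in>odd_roots. wt_form (\<Lambda> + rho) \<gamma> = 0)"

definition root_space :: "('m::finite, 'n::finite) weight \<Rightarrow> ('m, 'n) gl set" where
  "root_space \<alpha> = {x. \<forall>h\<in>cartan. sbracket h x = mscale (wt_eval \<alpha> h) x}"

text \<open>
  The distinguished Borel subalgebra: the entry of a matrix at (i, j) has weight
  axis i 1 - axis j 1.
\<close>

definition borel :: "('m::{finite,linorder}, 'n::{finite,linorder}) gl set" where
  "borel = {x. \<forall>i j. x $ i $ j \<noteq> 0 \<longrightarrow>
     i = j \<or> axis i 1 - axis j 1 \<in> pos_even_roots \<union> pos_odd_roots}"

text \<open>
  The even part of borel is the associative algebra of block diagonal, upper triangular
  matrices; the connected subgroup of GL(m) x GL(n) with this Lie algebra is its group of units.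
\<close>

definition borel_group0 :: "('m::{finite,linorder}, 'n::{finite,linorder}) gl set" where
  "borel_group0 = {b \<in> borel \<inter> homogeneous 0. invertible b}"


section \<open>The tensor algebra and the enveloping algebra\<close>

abbreviation (input) lookup :: "('a \<Rightarrow>\<^sub>0 'b::zero) \<Rightarrow> 'a \<Rightarrow> 'b" where
  "lookup \<equiv> Poly_Mapping.lookup"

datatype 'a free_monoid = Word (letters: "'a list")

instantiation free_monoid :: (type) monoid_add
begin

definition zero_free_monoid :: "'a free_monoid" where
  "0 = Word []"

definition plus_free_monoid :: "'a free_monoid \<Rightarrow> 'a free_monoid \<Rightarrow> 'a free_monoid" where
  "v + w = Word (letters v @ letters w)"

instance
  by standard (simp_all add: zero_free_monoid_def plus_free_monoid_def)

end

text \<open>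
  The free associative algebra on the set gl(m|n).  The tensor algebra is its quotient by the
  linearity relations, and these are included among the relations of the enveloping algebra.
\<close>

type_synonym ('m, 'n) free_gl = "('m, 'n) gl free_monoid \<Rightarrow>\<^sub>0 complex"

definition gen :: "('m::finite, 'n::finite) gl \<Rightarrow> ('m, 'n) free_gl" where
  "gen x = Poly_Mapping.single (Word [x]) 1"

definition scalar :: "complex \<Rightarrow> ('m::finite, 'n::finite) free_gl" where
  "scalar c = Poly_Mapping.single 0 c"

definition U_relations :: "('m::finite, 'n::finite) free_gl set" where
  "U_relations =
     {gen (x + y) - gen x - gen y |x y. True} \<union>
     {gen (mscale c x) - scalar c * gen x |c x. True} \<union>
     {gen x * gen y - (-1) ^ (p * q) * (gen y * gen x) - gen (sbracket x y) |x y p q.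
        p \<in> {0, 1} \<and> q \<in> {0, 1} \<and> x \<in> homogeneous p \<and> y \<in> homogeneous q}"

inductive_set ideal_gen :: "'a::ring_1 set \<Rightarrow> 'a set" for R where
  zero: "0 \<in> ideal_gen R"
| add: "a \<in> ideal_gen R \<Longrightarrow> b \<in> ideal_gen R \<Longrightarrow> a + b \<in> ideal_gen R"
| mult: "r \<in> R \<Longrightarrow> a * r * b \<in> ideal_gen R"

lemma ideal_gen_uminus: "a \<in> ideal_gen R \<Longrightarrow> - a \<in> ideal_gen R"
proof (induction rule: ideal_gen.induct)
  case zero
  then show ?case by (simp add: ideal_gen.zero)
next
  case (add a b)
  then have "- a + - b \<in> ideal_gen R" by (rule_tac ideal_gen.add)
  then show ?case by simp
next
  case (mult r a b)
  then show ?case using ideal_gen.mult[of r R "- a" b] by simp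
qed

lemma ideal_gen_lmult: "a \<in> ideal_gen R \<Longrightarrow> c * a \<in> ideal_gen R"
proof (induction rule: ideal_gen.induct)
  case zero
  then show ?case by (simp add: ideal_gen.zero)
next
  case (add a b)
  then show ?case by (simp add: distrib_left ideal_gen.add)
next
  case (mult r a b)
  then show ?case using ideal_gen.mult[of r R "c * a" b] by (simp add: mult.assoc)
qed

lemma ideal_gen_rmult: "a \<in> ideal_gen R \<Longrightarrow> a * c \<in> ideal_gen R"
proof (induction rule: ideal_gen.induct)
  case zero
  then show ?case by (simp add: ideal_gen.zero)
next
  case (add a b)
  then show ?case by (simp add: distrib_right ideal_gen.add)
next
  case (mult r a b)
  then show ?case using ideal_gen.mult[of r R a "b * c"] by (simp add: mult.assoc)
qed

definition U_eq :: "('m::finite, 'n::finite) free_gl \<Rightarrow> ('m, 'n) free_gl \<Rightarrow> bool" where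
  "U_eq a b \<longleftrightarrow> a - b \<in> ideal_gen U_relations"

lemma equivp_U_eq: "equivp (U_eq :: ('m::finite, 'n::finite) free_gl \<Rightarrow> _)"
  (is "equivp ?E")
proof (rule equivpI)
  show "reflp ?E"
    by (rule reflpI) (simp add: U_eq_def ideal_gen.zero)
  show "symp ?E"
  proof (rule sympI)
    fix a b :: "('m, 'n) free_gl"
    assume "U_eq a b"
    then show "U_eq b a"
      using ideal_gen_uminus[of "a - b"] by (simp add: U_eq_def)
  qed
  show "transp ?E"
  proof (rule transpI)
    fix a b c :: "('m, 'n) free_gl"
    assume "U_eq a b" "U_eq b c"
    then show "U_eq a c" using ideal_gen.add[of "a - b" _ "b - c"] by (simp add: U_eq_def)
  qed
qed

quotient_type ('m, 'n) U_gl = "('m::finite, 'n::finite) free_gl" / U_eq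
  by (rule equivp_U_eq)

lemma lookup_mult_0:
  fixes a b :: "'a free_monoid \<Rightarrow>\<^sub>0 complex"
  shows "lookup (a * b) 0 = lookup a 0 * lookup b 0"
proof -
  have split0: "0 = v + w \<longleftrightarrow> v = 0 \<and> w = 0" for v w :: "'a free_monoid"
    by (cases v; cases w) (auto simp: zero_free_monoid_def plus_free_monoid_def)
  have inner: "(\<Sum>w. lookup b w when 0 = v + w) = (lookup b 0 when v = 0)" for v
    by (cases "v = 0") (simp_all add: split0 when_def)
  have "lookup (a * b) 0 = (\<Sum>v. lookup a v * (\<Sum>w. lookup b w when 0 = v + w))"
    by (simp add: lookup_mult)
  also have "\<dots> = (\<Sum>v. (lookup a v * lookup b 0) when v = 0)"
    unfolding inner by (rule Sum_any.cong) (simp add: when_def)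
  finally show ?thesis by simp
qed

lemma one_notin_U_ideal: "(1 :: ('m::finite, 'n::finite) free_gl) \<notin> ideal_gen U_relations"
proof
  have gen0: "lookup (gen x) 0 = 0" for x :: "('m, 'n) gl"
    by (simp add: gen_def zero_free_monoid_def lookup_single)
  have rel0: "lookup r 0 = 0" if "r \<in> U_relations" for r :: "('m, 'n) free_gl"
    using that by (auto simp: U_relations_def lookup_minus lookup_add gen0 lookup_mult_0)
  have ideal0: "lookup a 0 = 0" if "a \<in> ideal_gen U_relations" for a :: "('m, 'n) free_gl"
    using that by induction (auto simp: lookup_add lookup_mult_0 rel0)
  assume "(1 :: ('m, 'n) free_gl) \<in> ideal_gen U_relations"
  from ideal0[OF this] show False by (simp add: lookup_one)
qed

instantiation U_gl :: (finite, finite) ring_1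
begin

lift_definition zero_U_gl :: "('a, 'b) U_gl" is 0 .
lift_definition one_U_gl :: "('a, 'b) U_gl" is 1 .
lift_definition plus_U_gl :: "('a, 'b) U_gl \<Rightarrow> ('a, 'b) U_gl \<Rightarrow> ('a, 'b) U_gl" is "(+)"
proof -
  fix a a' b b' :: "('a, 'b) free_gl"
  assume "U_eq a a'" "U_eq b b'"
  then show "U_eq (a + b) (a' + b')"
    using ideal_gen.add[of "a - a'" _ "b - b'"] by (simp add: U_eq_def algebra_simps)
qed
lift_definition uminus_U_gl :: "('a, 'b) U_gl \<Rightarrow> ('a, 'b) U_gl" is uminus
proof -
  fix a a' :: "('a, 'b) free_gl"
  assume "U_eq a a'"
  then show "U_eq (- a) (- a')"
    using ideal_gen_uminus[of "a - a'"] by (simp add: U_eq_def algebra_simps)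
qed
lift_definition minus_U_gl :: "('a, 'b) U_gl \<Rightarrow> ('a, 'b) U_gl \<Rightarrow> ('a, 'b) U_gl" is minus
proof -
  fix a a' b b' :: "('a, 'b) free_gl"
  assume "U_eq a a'" "U_eq b b'"
  then show "U_eq (a - b) (a' - b')"
    using ideal_gen.add[of "a - a'" _ "- (b - b')"] ideal_gen_uminus[of "b - b'"]
    by (simp add: U_eq_def algebra_simps)
qed
lift_definition times_U_gl :: "('a, 'b) U_gl \<Rightarrow> ('a, 'b) U_gl \<Rightarrow> ('a, 'b) U_gl" is times
proof -
  fix a a' b b' :: "('a, 'b) free_gl"
  assume "U_eq a a'" "U_eq b b'"
  then have "(a - a') * b + a' * (b - b') \<in> ideal_gen U_relations"
    unfolding U_eq_def by (intro ideal_gen.add ideal_gen_lmult ideal_gen_rmult)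
  then show "U_eq (a * b) (a' * b')"
    by (simp add: U_eq_def algebra_simps)
qed

instance
proof
  show "(0 :: ('a, 'b) U_gl) \<noteq> 1"
    by transfer (use one_notin_U_ideal ideal_gen_uminus in \<open>fastforce simp: U_eq_def\<close>)
qed (transfer, simp add: U_eq_def ideal_gen.zero algebra_simps)+

end

definition U_class :: "('m::finite, 'n::finite) free_gl \<Rightarrow> ('m, 'n) U_gl" where
  "U_class = abs_U_gl"

lemma U_class_hom:
  "U_class 0 = 0" "U_class 1 = 1" "U_class (a + b) = U_class a + U_class b"
  "U_class (a * b) = U_class a * U_class b"
  by (simp_all add: U_class_def zero_U_gl.abs_eq one_U_gl.abs_eq plus_U_gl.abs_eq times_U_gl.abs_eq)

definition \<iota> :: "('m::finite, 'n::finite) gl \<Rightarrow> ('m, 'n) U_gl" where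
  "\<iota> x = U_class (gen x)"


section \<open>Verma modules\<close>

text \<open>
  The tensor product over a ring of a right module A (here a type) and a left module N (also a
  type) is the free abelian group on A x N modulo the subgroup generated by the following
  elements, the ring acting through ract and lact.  Only the images of the ring in the
  endomorphisms of A and of N matter, so one may replace a ring by another one mapping onto it.
\<close>

definition tensor_relations ::
    "'r set \<Rightarrow> ('a::plus \<Rightarrow> 'r \<Rightarrow> 'a) \<Rightarrow> ('r \<Rightarrow> 'b::plus \<Rightarrow> 'b) \<Rightarrow> ('a \<times> 'b \<Rightarrow>\<^sub>0 int) set" where
  "tensor_relations B ract lact =
     {frag_of (a + a', z) - frag_of (a, z) - frag_of (a', z) |a a' z. True} \<union>
     {frag_of (a, z + z') - frag_of (a, z) - frag_of (a, z') |a z z'. True} \<union>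
     {frag_of (ract a t, z) - frag_of (a, lact t z) |a t z. t \<in> B}"

text \<open>The free algebra on borel, which maps onto the enveloping algebra of borel.\<close>

definition free_borel :: "('m::{finite,linorder}, 'n::{finite,linorder}) free_gl set" where
  "free_borel = {t. \<forall>w\<in>Poly_Mapping.keys t. set (letters w) \<subseteq> borel}"

text \<open>
  The action on the one-dimensional module C_lambda: a letter x in borel acts by the value of
  lambda on its diagonal part.
\<close>

definition C_act :: "('m::finite, 'n::finite) weight \<Rightarrow> ('m, 'n) free_gl \<Rightarrow> complex \<Rightarrow> complex" where
  "C_act \<Lambda> t z =
     (\<Sum>w\<in>Poly_Mapping.keys t. lookup t w * prod_list (map (wt_eval \<Lambda>) (letters w))) * z"

type_synonym ('m, 'n) pre_verma = "('m, 'n) U_gl \<times> complex \<Rightarrow>\<^sub>0 int"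

definition pre_verma :: "('m::finite, 'n::finite) pre_verma monoid" where
  "pre_verma = free_Abelian_group UNIV"

definition verma_relations ::
    "('m::{finite,linorder}, 'n::{finite,linorder}) weight \<Rightarrow> ('m, 'n) pre_verma set" where
  "verma_relations \<Lambda> =
     generate pre_verma (tensor_relations free_borel (\<lambda>u t. u * U_class t) (C_act \<Lambda>))"

definition verma ::
    "('m::{finite,linorder}, 'n::{finite,linorder}) weight \<Rightarrow> ('m, 'n) pre_verma set monoid" where
  "verma \<Lambda> = pre_verma Mod verma_relations \<Lambda>"

definition pre_act :: "('m::finite, 'n::finite) gl \<Rightarrow> ('m, 'n) pre_verma \<Rightarrow> ('m, 'n) pre_verma" where
  "pre_act x = frag_extend (\<lambda>(u, z). frag_of (\<iota> x * u, z))"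

definition verma_act ::
    "('m::{finite,linorder}, 'n::{finite,linorder}) weight \<Rightarrow> ('m, 'n) gl
      \<Rightarrow> ('m, 'n) pre_verma set \<Rightarrow> ('m, 'n) pre_verma set" where
  "verma_act \<Lambda> x C = verma_relations \<Lambda> <#>\<^bsub>pre_verma\<^esub> (pre_act x ` C)"

text \<open>The action is well defined on cosets.\<close>

lemma pre_act_verma_relations:
  assumes "c \<in> verma_relations \<Lambda>"
  shows "pre_act x c \<in> verma_relations \<Lambda>"
proof -
  let ?T = "tensor_relations free_borel (\<lambda>u t. u * U_class t) (C_act \<Lambda>)"
  have T: "pre_act x c \<in> ?T" if c: "c \<in> ?T" for c
  proof -
    consider (1) a a' z where "c = frag_of (a + a', z) - frag_of (a, z) - frag_of (a', z)"
      | (2) a z z' where "c = frag_of (a, z + z') - frag_of (a, z) - frag_of (a, z')"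
      | (3) a t z where "t \<in> free_borel" "c = frag_of (a * U_class t, z) - frag_of (a, C_act \<Lambda> t z)"
      using c unfolding tensor_relations_def by blast
    then show ?thesis
    proof cases
      case 1
      then have "pre_act x c =
          frag_of (\<iota> x * a + \<iota> x * a', z) - frag_of (\<iota> x * a, z) - frag_of (\<iota> x * a', z)"
        by (simp add: pre_act_def frag_extend_diff distrib_left)
      then show ?thesis unfolding tensor_relations_def by blast
    next
      case 2
      then have "pre_act x c =
          frag_of (\<iota> x * a, z + z') - frag_of (\<iota> x * a, z) - frag_of (\<iota> x * a, z')"
        by (simp add: pre_act_def frag_extend_diff)
      then show ?thesis unfolding tensor_relations_def by blast
    next
      case 3
      then have "pre_act x c =
          frag_of ((\<iota> x * a) * U_class t, z) - frag_of (\<iota> x * a, C_act \<Lambda> t z)"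
        by (simp add: pre_act_def frag_extend_diff mult.assoc)
      then show ?thesis using 3(1) unfolding tensor_relations_def by blast
    qed
  qed
  show ?thesis
    using assms unfolding verma_relations_def
  proof (induction rule: generate.induct)
    case one
    then show ?case
      using generate.one[of pre_verma ?T] by (simp add: pre_verma_def pre_act_def)
  next
    case (incl h)
    then show ?case by (intro generate.incl T)
  next
    case (inv h)
    then show ?case
      using generate.inv[OF T[OF inv], of pre_verma]
      by (simp add: pre_verma_def pre_act_def frag_extend_minus)
  next
    case (eng h1 h2)
    then show ?case
      using generate.eng[of "pre_act x h1" pre_verma ?T "pre_act x h2"]
      by (simp add: pre_verma_def pre_act_def frag_extend_add)
  qed
qed

lemma verma_act_coset:
  "verma_act \<Lambda> x (verma_relations \<Lambda> #>\<^bsub>pre_verma\<^esub> c) = verma_relations \<Lambda> #>\<^bsub>pre_verma\<^esub> pre_act x c"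
proof -
  have add: "r + s \<in> verma_relations \<Lambda>" if "r \<in> verma_relations \<Lambda>" "s \<in> verma_relations \<Lambda>" for r s
    using generate.eng[OF that[unfolded verma_relations_def]]
    by (simp add: verma_relations_def pre_verma_def)
  have zero: "0 \<in> verma_relations \<Lambda>"
    using generate.one[of pre_verma] by (simp add: verma_relations_def pre_verma_def)
  have act_add: "pre_act x (r + c) = pre_act x r + pre_act x c" for r c
    by (simp add: pre_act_def frag_extend_add)
  have act_zero: "pre_act x 0 = 0"
    by (simp add: pre_act_def)
  show ?thesis
  proof (intro equalityI subsetI)
    fix d
    assume "d \<in> verma_act \<Lambda> x (verma_relations \<Lambda> #>\<^bsub>pre_verma\<^esub> c)"
    then obtain r s where "r \<in> verma_relations \<Lambda>" "s \<in> verma_relations \<Lambda>" "d = r + pre_act x (s + c)"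
      by (auto simp: verma_act_def set_mult_def r_coset_def pre_verma_def)
    moreover from this have "d = (r + pre_act x s) + pre_act x c"
      by (simp add: act_add add.assoc)
    ultimately show "d \<in> verma_relations \<Lambda> #>\<^bsub>pre_verma\<^esub> pre_act x c"
      by (auto simp: r_coset_def pre_verma_def intro!: add pre_act_verma_relations)
  next
    fix d
    assume "d \<in> verma_relations \<Lambda> #>\<^bsub>pre_verma\<^esub> pre_act x c"
    then obtain r where "r \<in> verma_relations \<Lambda>" "d = r + pre_act x c"
      by (auto simp: r_coset_def pre_verma_def)
    moreover have "c \<in> verma_relations \<Lambda> #>\<^bsub>pre_verma\<^esub> c"
      using zero by (force simp: r_coset_def pre_verma_def)
    ultimately show "d \<in> verma_act \<Lambda> x (verma_relations \<Lambda> #>\<^bsub>pre_verma\<^esub> c)"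
      by (auto simp: verma_act_def set_mult_def pre_verma_def)
  qed
qed


section \<open>The sets X_M and S(lambda)\<close>

text \<open>X_M, for a module given by its additive group M and the action.\<close>

definition X_mod :: "'v monoid \<Rightarrow> (('m::finite, 'n::finite) gl \<Rightarrow> 'v \<Rightarrow> 'v) \<Rightarrow> ('m, 'n) gl set" where
  "X_mod M act = {x \<in> self_commuting. act x ` carrier M \<noteq> kernel M M (act x)}"

definition iso_sets :: "('m::finite, 'n::finite) weight set set" where
  "iso_sets = {S. S \<subseteq> odd_roots \<and> (\<forall>\<alpha>\<in>S. wt_form \<alpha> \<alpha> = 0) \<and>
     (\<forall>\<alpha>\<in>S. \<forall>\<beta>\<in>S. \<alpha> \<noteq> \<beta> \<longrightarrow> wt_form \<alpha> \<beta> = 0) \<and> vec.independent S}"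

text \<open>
  The orbit of x_S.  It does not depend on the choice of nonzero root vectors, and is
  written as the union over all such choices.
\<close>

definition \<Phi> :: "('m::{finite,linorder}, 'n::{finite,linorder}) weight set \<Rightarrow> ('m, 'n) gl set" where
  "\<Phi> S = {b ** (\<Sum>\<alpha>\<in>S. x \<alpha>) ** matrix_inv b |b x.
     b \<in> borel_group0 \<and> (\<forall>\<alpha>\<in>S. x \<alpha> \<in> root_space \<alpha> \<and> x \<alpha> \<noteq> 0)}"

definition S_set :: "('m::{finite,linorder}, 'n::{finite,linorder}) weight \<Rightarrow> ('m, 'n) weight set set" where
  "S_set \<Lambda> = {S \<in> iso_sets. \<Phi> S \<subseteq> X_mod (verma \<Lambda>) (verma_act \<Lambda>)}"

end

theory Submission
  imports Defs
begin

text \<open>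
  Write \<open>a\<^sub>j = (\<Lambda> + \<rho>, \<epsilon>\<^sub>1 - \<delta>\<^sub>j) = \<Lambda>(E\<^sub>0\<^sub>0) + \<Lambda>(E\<^sub>j\<^sub>j) + 1 - j\<close>, where the even index is \<open>0\<close>.
  Conjugation by the Borel subgroup preserves the left ideal defining the Verma module, so the
  question is whether \<open>x = E\<^sub>0\<^sub>i\<close> has trivial homology on it.  By the Poincare-Birkhoff-Witt theorem
  the Verma module is a Fock space with even letters \<open>z\<^sub>M\<^sub>k\<close> (\<open>k < M\<close>, for \<open>E\<^sub>M\<^sub>k\<close>) and odd letters
  \<open>\<theta>\<^sub>M\<close> (for \<open>E\<^sub>M\<^sub>0\<close>).  A Koszul homotopy removes the letters \<open>z\<^sub>M\<^sub>i\<close> and \<open>\<theta>\<^sub>M\<close> with \<open>M > i\<close>.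

  If \<open>a\<^sub>i\<close> is not a nonpositive integer, then \<open>E\<^sub>i\<^sub>0\<close> is a contracting homotopy for \<open>x\<close> on what is
  left, since \<open>E\<^sub>0\<^sub>0 + E\<^sub>i\<^sub>i\<close> has the eigenvalues \<open>a\<^sub>i + m\<close>, \<open>m \<ge> 0\<close>, there.  If \<open>a\<^sub>1, \<dots>, a\<^sub>i \<noteq> 0\<close>, then
  \<open>E\<^sub>0\<^sub>1 \<cdots> E\<^sub>0\<^sub>i E\<^sub>i\<^sub>0 \<cdots> E\<^sub>1\<^sub>0\<close> acts on the vectors without odd letters as the nonzero scalar
  \<open>a\<^sub>1 \<cdots> a\<^sub>i\<close>, so that the module is free over the exterior algebra in \<open>E\<^sub>0\<^sub>1, \<dots>, E\<^sub>0\<^sub>i\<close>.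

  Finally let \<open>a\<^sub>j = 0\<close> and \<open>a\<^sub>i = - s\<close> with \<open>j \<le> i\<close>.  For the even subalgebra there is a vector \<open>w\<close>
  without odd letters that is killed by \<open>E\<^sub>k\<^sub>i\<close> (\<open>k < i\<close>) and has weight
  \<open>\<Lambda> - s(\<delta>\<^sub>j - \<delta>\<^sub>i)\<close>.  Then \<open>f = E\<^sub>i\<^sub>-\<^sub>1\<^sub>,\<^sub>0 \<cdots> E\<^sub>1\<^sub>0 w\<close> is killed by \<open>x\<close>.  If \<open>f = x g\<close>, where \<open>g\<close> may be
  taken to be a weight vector, then \<open>g\<close> contains all the letters \<open>\<theta>\<^sub>1, \<dots>, \<theta>\<^sub>i\<close>, so \<open>E\<^sub>i\<^sub>0 g = 0\<close>, and
  \<open>E\<^sub>i\<^sub>0 f = (E\<^sub>0\<^sub>0 + E\<^sub>i\<^sub>i) g = 0\<close>, because \<open>g\<close> has the eigenvalue \<open>a\<^sub>j = 0\<close>.  But \<open>E\<^sub>i\<^sub>0 f \<noteq> 0\<close>.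
\<close>

section \<open>Additive extensions\<close>

text \<open>The equation a_j - a_i = s says that the dot reflection in the root \<delta>_j -
  \<delta>_i lowers the weight by s times this root, which is why w exists. The obstacle is that the
  root is in general not simple: w is then not a power of a single lowering operator, and it has to
  be seen that w is nonzero and involves only indices up to i. Conjugation by formal complex powers
  of simple lowering operators produces w from the case of a simple root, and its projection to the
  monomials in simple letters shows that it is nonzero. Fock space has the independence of monomials
  built in. It is identified with the quotient of the enveloping algebra by two maps: its operators
  satisfy the defining relations, so the algebra acts on the vacuum; and ordered monomials lead
  back, compatibly with the action modulo the left ideal. Conjugation by b preserves this ideal
  because it maps upper triangular matrices to such matrices and keeps their diagonals, hence the
  character given by \<Lambda>.\<close>

definition pmext :: "('k \<Rightarrow> 'b \<Rightarrow> 'a::comm_monoid_add) \<Rightarrow> ('k \<Rightarrow>\<^sub>0 'b::zero) \<Rightarrow> 'a" where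
  "pmext \<phi> f = (\<Sum>k\<in>Poly_Mapping.keys f. \<phi> k (lookup f k))"

lemma pmext_superset:
  assumes "\<And>k. \<phi> k 0 = 0" "finite A" "Poly_Mapping.keys f \<subseteq> A"
  shows "pmext \<phi> f = (\<Sum>k\<in>A. \<phi> k (lookup f k))"
  unfolding pmext_def
  by (rule sum.mono_neutral_left) (use assms in \<open>auto simp: in_keys_iff\<close>)

lemma pmext_add:
  fixes f g :: "'k \<Rightarrow>\<^sub>0 'b::comm_monoid_add"
  assumes "\<And>k. \<phi> k 0 = 0" "\<And>k x y. \<phi> k (x + y) = \<phi> k x + \<phi> k y"
  shows "pmext \<phi> (f + g) = pmext \<phi> f + pmext \<phi> g"
proof -
  let ?A = "Poly_Mapping.keys f \<union> Poly_Mapping.keys g"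
  have "pmext \<phi> (f + g) = (\<Sum>k\<in>?A. \<phi> k (lookup (f + g) k))"
    by (rule pmext_superset) (use assms Poly_Mapping.keys_add[of f g] in auto)
  also have "\<dots> = (\<Sum>k\<in>?A. \<phi> k (lookup f k)) + (\<Sum>k\<in>?A. \<phi> k (lookup g k))"
    by (simp add: lookup_add assms sum.distrib)
  also have "\<dots> = pmext \<phi> f + pmext \<phi> g"
    by (subst (1 2) pmext_superset[where A = ?A]) (use assms in auto)
  finally show ?thesis .
qed

lemma pmext_single:
  assumes "\<And>k. \<phi> k 0 = 0"
  shows "pmext \<phi> (Poly_Mapping.single k x) = \<phi> k x"
  using assms by (cases "x = 0") (simp_all add: pmext_def)

lemma pmext_zero [simp]: "pmext \<phi> 0 = 0"
  by (simp add: pmext_def)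

lemma pm_induct [case_names zero plus]:
  fixes f :: "'k \<Rightarrow>\<^sub>0 'b::ab_group_add"
  assumes "P 0" and "\<And>k x f. P f \<Longrightarrow> P (Poly_Mapping.single k x + f)"
  shows "P f"
proof -
  have "finite (Poly_Mapping.keys f)" by simp
  then show ?thesis
  proof (induction "Poly_Mapping.keys f" arbitrary: f rule: finite_induct)
    case empty
    then have "f = 0" by (intro poly_mapping_eqI) (metis empty_iff in_keys_iff lookup_zero)
    with assms(1) show ?case by simp
  next
    case (insert k A)
    let ?g = "f - Poly_Mapping.single k (lookup f k)"
    have "Poly_Mapping.keys ?g = A"
      using insert.hyps(2,4)
      by (auto simp: in_keys_iff lookup_minus lookup_single when_def set_eq_iff split: if_splits)
    with insert.hyps(3) have "P ?g" by blast
    from assms(2)[OF this, of k "lookup f k"] show ?case by simp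
  qed
qed

lemma pmext_decompose: "f = pmext Poly_Mapping.single f"
  for f :: "'k \<Rightarrow>\<^sub>0 'b::ab_group_add"
proof (induction f rule: pm_induct)
  case (plus k x f)
  have "pmext Poly_Mapping.single (Poly_Mapping.single k x + f)
      = pmext Poly_Mapping.single (Poly_Mapping.single k x) + pmext Poly_Mapping.single f"
    by (rule pmext_add) (simp_all add: single_add)
  with plus show ?case by (simp add: pmext_single)
qed simp

section \<open>Linear operators on a space with a basis\<close>

definition vscale :: "complex \<Rightarrow> ('s \<Rightarrow>\<^sub>0 complex) \<Rightarrow> ('s \<Rightarrow>\<^sub>0 complex)" where
  "vscale c f = Poly_Mapping.map ((*) c) f"

lemma lookup_vscale [simp]: "lookup (vscale c f) s = c * lookup f s"
  by (simp add: vscale_def Poly_Mapping.map.rep_eq when_def)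

lemma vscale_add: "vscale c (f + g) = vscale c f + vscale c g"
  by (rule poly_mapping_eqI) (simp add: lookup_add algebra_simps)

lemma vscale_add_left: "vscale (c + d) f = vscale c f + vscale d f"
  by (rule poly_mapping_eqI) (simp add: lookup_add algebra_simps)

lemma vscale_minus: "vscale c (- f) = - vscale c f"
  by (rule poly_mapping_eqI) simp

lemma vscale_diff: "vscale c (f - g) = vscale c f - vscale c g"
  by (rule poly_mapping_eqI) (simp add: lookup_minus algebra_simps)

lemma vscale_zero [simp]: "vscale c 0 = 0" "vscale 0 f = 0"
  by (rule poly_mapping_eqI, simp)+

lemma vscale_one [simp]: "vscale 1 f = f"
  by (rule poly_mapping_eqI) simp

lemma vscale_vscale [simp]: "vscale c (vscale d f) = vscale (c * d) f"
  by (rule poly_mapping_eqI) simp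

lemma vscale_single [simp]: "vscale c (Poly_Mapping.single s x) = Poly_Mapping.single s (c * x)"
  by (rule poly_mapping_eqI) (simp add: lookup_single when_def)

text \<open>As a type with a \<open>ring_1\<close> instance, linear operators and the enveloping
  algebra can be treated by one and the same locale of relations.\<close>

typedef 's lin = "{A :: ('s \<Rightarrow>\<^sub>0 complex) \<Rightarrow> ('s \<Rightarrow>\<^sub>0 complex).
    (\<forall>f g. A (f + g) = A f + A g) \<and> (\<forall>c f. A (vscale c f) = vscale c (A f))}"
  morphisms app Lin
  by (rule exI[of _ "\<lambda>_. 0"]) simp

setup_lifting type_definition_lin

lemma app_add [simp]: "app A (f + g) = app A f + app A g"
  using app[of A] by simp

lemma app_vscale [simp]: "app A (vscale c f) = vscale c (app A f)"
  using app[of A] by simp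

lemma app_zero [simp]: "app A 0 = 0"
  using app_vscale[of A 0 0] by simp

lemma app_uminus [simp]: "app A (- f) = - app A f"
  using app_add[of A f "- f"] by (simp add: add_eq_0_iff)

instantiation lin :: (type) ring_1
begin

lift_definition zero_lin :: "'a lin" is "\<lambda>_. 0" by simp
lift_definition one_lin :: "'a lin" is "\<lambda>f. f" by simp
lift_definition plus_lin :: "'a lin \<Rightarrow> 'a lin \<Rightarrow> 'a lin" is "\<lambda>A B f. A f + B f"
  by (simp add: vscale_add algebra_simps)
lift_definition uminus_lin :: "'a lin \<Rightarrow> 'a lin" is "\<lambda>A f. - A f"
  by (simp add: vscale_minus)
lift_definition minus_lin :: "'a lin \<Rightarrow> 'a lin \<Rightarrow> 'a lin" is "\<lambda>A B f. A f - B f"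
  by (simp add: vscale_diff)
lift_definition times_lin :: "'a lin \<Rightarrow> 'a lin \<Rightarrow> 'a lin" is "\<lambda>A B f. A (B f)" by simp

instance
proof
  show "(0 :: 'a lin) \<noteq> 1"
  proof
    assume "(0 :: 'a lin) = 1"
    then have "app (0 :: 'a lin) (Poly_Mapping.single undefined 1) =
        app (1 :: 'a lin) (Poly_Mapping.single undefined 1)" by simp
    then have "0 = (Poly_Mapping.single undefined 1 :: 'a \<Rightarrow>\<^sub>0 complex)"
      by (simp add: zero_lin.rep_eq one_lin.rep_eq)
    then show False by (metis lookup_single_eq lookup_zero zero_neq_one)
  qed
qed (transfer, simp add: fun_eq_iff algebra_simps)+

end

lemma app_lin [simp]:
  "app 0 f = 0" "app 1 f = f" "app (A + B) f = app A f + app B f"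
  "app (A - B) f = app A f - app B f" "app (- A) f = - app A f"
  "app (A * B) f = app A (app B f)"
  by (simp_all add: zero_lin.rep_eq one_lin.rep_eq plus_lin.rep_eq minus_lin.rep_eq
      uminus_lin.rep_eq times_lin.rep_eq)

lemma app_sum [simp]: "app (\<Sum>i\<in>I. A i) f = (\<Sum>i\<in>I. app (A i) f)"
  by (induction I rule: infinite_finite_induct) auto

lift_definition scal :: "complex \<Rightarrow> 's lin" is vscale
  by (simp add: vscale_add mult.commute)

lemma app_scal [simp]: "app (scal c) f = vscale c f"
  by (simp add: scal.rep_eq)

lemma lin_eqI: "(\<And>f. app A f = app B f) \<Longrightarrow> A = B"
  by (metis app_inject ext)

lemma single_eq_vscale: "Poly_Mapping.single s c = vscale c (Poly_Mapping.single s 1)"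
  by simp

lemma lin_eqI_single:
  assumes "\<And>s. app A (Poly_Mapping.single s 1) = app B (Poly_Mapping.single s 1)"
  shows "A = B"
proof (rule lin_eqI)
  fix f
  show "app A f = app B f"
  proof (induction f rule: pm_induct)
    case (plus k x f)
    then show ?case
      by (subst (1 2) single_eq_vscale) (simp only: app_add app_vscale assms)
  qed simp
qed

lemma scal_central: "scal c * A = A * scal c"
  by (rule lin_eqI) simp

lemma scal_hom: "scal 1 = 1" "scal 0 = 0" "scal (c + d) = scal c + scal d"
  "scal (c * d) = scal c * scal d" "scal (- c) = - scal c" "scal (c - d) = scal c - scal d"
  by (rule lin_eqI, rule poly_mapping_eqI, simp add: lookup_add lookup_minus algebra_simps)+

text \<open>Letters, derivatives and diagonal operators all send a basis vector to a multiple of a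
  basis vector, so identities between them can be checked on single states.\<close>

definition mop :: "('s \<Rightarrow> 's) \<Rightarrow> ('s \<Rightarrow> complex) \<Rightarrow> 's lin" where
  "mop t c = Lin (pmext (\<lambda>s x. Poly_Mapping.single (t s) (c s * x)))"

lemma app_mop: "app (mop t c) f = pmext (\<lambda>s x. Poly_Mapping.single (t s) (c s * x)) f"
proof -
  let ?F = "pmext (\<lambda>s x. Poly_Mapping.single (t s) (c s * x))"
  have add: "?F (f + g) = ?F f + ?F g" for f g
    by (rule pmext_add) (simp_all add: single_add distrib_left)
  have "?F (vscale d f) = vscale d (?F f)" for d f
  proof (induction f rule: pm_induct)
    case (plus k x f)
    then show ?case
      by (simp add: vscale_add add pmext_single mult.left_commute)
  qed simp
  with add have "?F \<in> {A. (\<forall>f g. A (f + g) = A f + A g) \<and> (\<forall>c f. A (vscale c f) = vscale c (A f))}"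
    by simp
  from Lin_inverse[OF this] show ?thesis
    by (simp add: mop_def)
qed

lemma app_mop_single [simp]:
  "app (mop t c) (Poly_Mapping.single s x) = Poly_Mapping.single (t s) (c s * x)"
  by (simp add: app_mop pmext_single)

abbreviation diag :: "('s \<Rightarrow> complex) \<Rightarrow> 's lin" where
  "diag \<equiv> mop (\<lambda>s. s)"

lemma lookup_diag [simp]: "lookup (app (diag g) f) s = g s * lookup f s"
proof (induction f rule: pm_induct)
  case (plus k x f)
  then show ?case by (simp add: lookup_add lookup_single when_def algebra_simps)
qed simp

lemma diag_add: "diag g + diag h = diag (\<lambda>s. g s + h s)"
  by (rule lin_eqI, rule poly_mapping_eqI) (simp add: lookup_add algebra_simps)

lemma scal_eq_diag: "scal c = diag (\<lambda>_. c)"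
  by (rule lin_eqI, rule poly_mapping_eqI) simp

text \<open>Compare matrix entries of both sides. Together with \<open>diag_intertwineI\<close> this
  passes from g to any function of g, such as its inverse or the indicator of one
  eigenvalue.\<close>

lemma diag_intertwine_support:
  assumes "A * diag g = diag g' * A" "lookup (app A (Poly_Mapping.single s 1)) t \<noteq> 0"
  shows "g s = g' t"
proof -
  have "app (A * diag g) (Poly_Mapping.single s 1) = vscale (g s) (app A (Poly_Mapping.single s 1))"
    by (simp flip: app_vscale)
  then have "lookup (app (diag g' * A) (Poly_Mapping.single s 1)) t
      = lookup (vscale (g s) (app A (Poly_Mapping.single s 1))) t"
    using assms(1) by metis
  with assms(2) show ?thesis by simp
qed

lemma diag_intertwineI:
  assumes "\<And>s t. lookup (app A (Poly_Mapping.single s 1)) t \<noteq> 0 \<Longrightarrow> g s = g' t"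
  shows "A * diag g = diag g' * A"
proof (rule lin_eqI_single, rule poly_mapping_eqI)
  fix s t
  have "app (A * diag g) (Poly_Mapping.single s 1) = vscale (g s) (app A (Poly_Mapping.single s 1))"
    by (simp flip: app_vscale)
  then show "lookup (app (A * diag g) (Poly_Mapping.single s 1)) t =
      lookup (app (diag g' * A) (Poly_Mapping.single s 1)) t"
    using assms[of s t] by auto
qed

section \<open>Bosonic and fermionic oscillators\<close>

text \<open>The state \<open>(T, e)\<close> is the monomial with even letters \<open>z\<^sub>a\<^sub>b\<close> to the powers \<open>e (a, b)\<close> and odd
  letters \<open>\<theta>\<^sub>N\<close>, \<open>N \<in> T\<close>, in increasing order; this order is the source of the sign below.\<close>

type_synonym state = "nat set \<times> (nat \<times> nat \<Rightarrow> nat)"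

definition jw_sign :: "nat set \<Rightarrow> nat \<Rightarrow> complex" where
  "jw_sign T N = (-1) ^ card {M\<in>T. M < N}"

lemma jw_sign_insert: "jw_sign (insert M T) N = (if M < N \<and> M \<notin> T then - jw_sign T N else jw_sign T N)"
proof -
  have "{K \<in> insert M T. K < N} = (if M < N then insert M {K\<in>T. K < N} else {K\<in>T. K < N})"
    by auto
  then show ?thesis
    by (auto simp: jw_sign_def card_insert_if)
qed

lemma jw_sign_remove: "jw_sign (T - {M}) N = (if M < N \<and> M \<in> T then - jw_sign T N else jw_sign T N)"
proof (cases "M \<in> T")
  case True
  then have "insert M (T - {M}) = T" by auto
  then show ?thesis using jw_sign_insert[of M "T - {M}" N] True by auto
qed auto

lemma jw_sign_sq [simp]: "jw_sign T N * jw_sign T N = 1"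
  by (simp add: jw_sign_def flip: power_mult_distrib)

definition zop :: "nat \<Rightarrow> nat \<Rightarrow> state lin" where
  "zop a b = mop (\<lambda>(T, e). (T, e((a, b) := Suc (e (a, b))))) (\<lambda>_. 1)"

text \<open>At exponent 0 the truncated subtraction does no harm, since the coefficient is 0
  there.\<close>

definition dop :: "nat \<Rightarrow> nat \<Rightarrow> state lin" where
  "dop a b = mop (\<lambda>(T, e). (T, e((a, b) := e (a, b) - 1))) (\<lambda>(T, e). of_nat (e (a, b)))"

definition tht :: "nat \<Rightarrow> state lin" where
  "tht N = mop (\<lambda>(T, e). (insert N T, e)) (\<lambda>(T, e). if N \<in> T then 0 else jw_sign T N)"

definition dth :: "nat \<Rightarrow> state lin" where
  "dth N = mop (\<lambda>(T, e). (T - {N}, e)) (\<lambda>(T, e). if N \<in> T then jw_sign T N else 0)"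

lemmas osc_defs = zop_def dop_def tht_def dth_def

lemma boson_comm:
  "zop a b * zop c d = zop c d * zop a b"
  "dop a b * dop c d = dop c d * dop a b"
  "dop a b * zop c d = zop c d * dop a b + (if (a, b) = (c, d) then 1 else 0)"
proof -
  show "zop a b * zop c d = zop c d * zop a b"
    by (rule lin_eqI_single) (auto simp: osc_defs fun_upd_twist)
  show "dop a b * dop c d = dop c d * dop a b"
    by (rule lin_eqI_single) (auto simp: osc_defs fun_upd_twist mult.commute)
  show "dop a b * zop c d = zop c d * dop a b + (if (a, b) = (c, d) then 1 else 0)"
  proof (rule lin_eqI_single)
    fix s :: state
    obtain T e where s: "s = (T, e)" by (cases s)
    show "app (dop a b * zop c d) (Poly_Mapping.single s 1) =
      app (zop c d * dop a b + (if (a, b) = (c, d) then 1 else 0)) (Poly_Mapping.single s 1)"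
    proof (cases "(a, b) = (c, d)")
      case True
      then show ?thesis
        by (cases "e (c, d)") (auto simp: osc_defs s fun_upd_idem simp flip: single_add)
    qed (auto simp: osc_defs s fun_upd_twist)
  qed
qed

lemma boson_fermion_comm:
  "zop a b * tht N = tht N * zop a b" "zop a b * dth N = dth N * zop a b"
  "dop a b * tht N = tht N * dop a b" "dop a b * dth N = dth N * dop a b"
  by (rule lin_eqI_single; auto simp: osc_defs mult.commute)+

lemma fermion_anticomm:
  "tht M * tht N = - (tht N * tht M)"
  "dth M * dth N = - (dth N * dth M)"
  "dth M * tht N = - (tht N * dth M) + (if M = N then 1 else 0)"
proof -
  show "tht M * tht N = - (tht N * tht M)"
    by (rule lin_eqI_single)
       (auto simp: osc_defs jw_sign_insert insert_commute mult.commute simp flip: single_uminus split: prod.splits)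
  show "dth M * dth N = - (dth N * dth M)"
    by (rule lin_eqI_single)
       (auto simp: osc_defs jw_sign_remove Diff_insert2[symmetric] insert_commute mult.commute simp flip: single_uminus Diff_insert split: prod.splits)
  show "dth M * tht N = - (tht N * dth M) + (if M = N then 1 else 0)"
  proof (rule lin_eqI_single)
    fix s :: state
    obtain T e where s: "s = (T, e)" by (cases s)
    show "app (dth M * tht N) (Poly_Mapping.single s 1) =
      app (- (tht N * dth M) + (if M = N then 1 else 0)) (Poly_Mapping.single s 1)"
    proof (cases "M = N")
      case True
      then show ?thesis
        by (auto simp: osc_defs s jw_sign_insert jw_sign_remove insert_absorb simp flip: single_uminus)
    next
      case False
      then have "insert N T - {M} = insert N (T - {M})" by auto
      with False show ?thesis
        by (auto simp: osc_defs s jw_sign_insert jw_sign_remove mult.commute simp flip: single_uminus)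
    qed
  qed
qed

lemma fermion_sq: "tht N * tht N = 0" "dth N * dth N = 0"
  by (rule lin_eqI_single; auto simp: osc_defs split: prod.splits)+

lemma number_op:
  "zop a b * dop a b = diag (\<lambda>(T, e). of_nat (e (a, b)))"
  "tht N * dth N = diag (\<lambda>(T, e). if N \<in> T then 1 else 0)"
proof -
  show "zop a b * dop a b = diag (\<lambda>(T, e). of_nat (e (a, b)))"
  proof (rule lin_eqI_single)
    fix s :: state
    obtain T e where s: "s = (T, e)" by (cases s)
    show "app (zop a b * dop a b) (Poly_Mapping.single s 1) =
        app (diag (\<lambda>(T, e). of_nat (e (a, b)))) (Poly_Mapping.single s 1)"
      by (cases "e (a, b)") (auto simp: osc_defs s fun_upd_idem)
  qed
  show "tht N * dth N = diag (\<lambda>(T, e). if N \<in> T then 1 else 0)"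
    by (rule lin_eqI_single)
       (auto simp: osc_defs jw_sign_remove insert_absorb split: prod.splits)
qed

section \<open>The relations of gl(1|N) and adjoining a last index\<close>

text \<open>\<open>G a b\<close>, \<open>X b\<close>, \<open>Y a\<close> and \<open>H\<close> stand
  for the matrix units E_ab, E_0b, E_a0 and E_00. The squares are listed separately because
  anticommutation only yields that twice the square vanishes. Nothing is claimed for indices outside
  1, ..., N.\<close>

locale gl1n =
  fixes N :: nat and G :: "nat \<Rightarrow> nat \<Rightarrow> 'a::ring_1" and X Y :: "nat \<Rightarrow> 'a" and H :: 'a
  assumes GG: "\<lbrakk>a \<in> {1..N}; b \<in> {1..N}; c \<in> {1..N}; e \<in> {1..N}\<rbrakk> \<Longrightarrow>
      G a b * G c e = G c e * G a b + (if b = c then G a e else 0) - (if a = e then G c b else 0)"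
    and GX: "\<lbrakk>a \<in> {1..N}; b \<in> {1..N}; c \<in> {1..N}\<rbrakk> \<Longrightarrow>
      G a b * X c = X c * G a b - (if a = c then X b else 0)"
    and GY: "\<lbrakk>a \<in> {1..N}; b \<in> {1..N}; c \<in> {1..N}\<rbrakk> \<Longrightarrow>
      G a b * Y c = Y c * G a b + (if b = c then Y a else 0)"
    and XY: "\<lbrakk>a \<in> {1..N}; b \<in> {1..N}\<rbrakk> \<Longrightarrow>
      X a * Y b = - (Y b * X a) + G b a + (if a = b then H else 0)"
    and XX: "\<lbrakk>a \<in> {1..N}; b \<in> {1..N}\<rbrakk> \<Longrightarrow> X a * X b = - (X b * X a)"
    and XX0: "a \<in> {1..N} \<Longrightarrow> X a * X a = 0"
    and YY: "\<lbrakk>a \<in> {1..N}; b \<in> {1..N}\<rbrakk> \<Longrightarrow> Y a * Y b = - (Y b * Y a)"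
    and YY0: "a \<in> {1..N} \<Longrightarrow> Y a * Y a = 0"
    and HG: "\<lbrakk>a \<in> {1..N}; b \<in> {1..N}\<rbrakk> \<Longrightarrow> H * G a b = G a b * H"
    and HX: "a \<in> {1..N} \<Longrightarrow> H * X a = X a * H + X a"
    and HY: "a \<in> {1..N} \<Longrightarrow> H * Y a = Y a * H - Y a"

lemma left_comm: "x * y = y * x \<Longrightarrow> x * (y * w) = y * (x * w)" for x :: "'a::semigroup_mult"
  by (simp flip: mult.assoc)

text \<open>In a product associated to the right a rule for x * y does not match; this gives its
  companion, so that simplification can move operators into normal order.\<close>

lemma nest: "x * y = r \<Longrightarrow> x * (y * w) = r * w" for x :: "'a::semigroup_mult"
  by (simp flip: mult.assoc)

locale peel = old: gl1n N G' X' Y' H'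
  for N and G' :: "nat \<Rightarrow> nat \<Rightarrow> 'a::ring_1" and X' Y' :: "nat \<Rightarrow> 'a" and H' :: 'a +
  fixes z d :: "nat \<Rightarrow> 'a" and th dt c :: 'a
  assumes no_2_torsion: "\<And>v :: 'a. v + v = 0 \<Longrightarrow> v = 0"
    and c_central: "\<And>v :: 'a. v * c = c * v"
    and osc: "\<And>k l. z k * z l = z l * z k" "\<And>k l. d k * d l = d l * d k"
      "\<And>k l. d k * z l = z l * d k + (if k = l then 1 else 0)"
      "\<And>k. th * z k = z k * th" "\<And>k. dt * z k = z k * dt"
      "\<And>k. d k * th = th * d k" "\<And>k. dt * d k = d k * dt"
      "th * th = 0" "dt * dt = 0" "dt * th = 1 - th * dt"
    and G'_osc: "\<And>a b k. G' a b * z k = z k * G' a b" "\<And>a b k. G' a b * d k = d k * G' a b"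
      "\<And>a b. G' a b * th = th * G' a b" "\<And>a b. G' a b * dt = dt * G' a b"
    and X'_osc: "\<And>a k. X' a * z k = z k * X' a" "\<And>a k. X' a * d k = d k * X' a"
      "\<And>a. X' a * th = - (th * X' a)" "\<And>a. X' a * dt = - (dt * X' a)"
    and Y'_osc: "\<And>a k. Y' a * z k = z k * Y' a" "\<And>a k. Y' a * d k = d k * Y' a"
      "\<And>a. Y' a * th = - (th * Y' a)" "\<And>a. Y' a * dt = - (dt * Y' a)"
    and H'_osc: "\<And>k. H' * z k = z k * H'" "\<And>k. H' * d k = d k * H'"
      "H' * th = th * H'" "H' * dt = dt * H'"
begin

text \<open>Let \<open>G'\<close>, \<open>X'\<close>, \<open>Y'\<close>, \<open>H'\<close> act on a Verma module of gl(1|N).  On its tensor product with the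
  polynomials in \<open>z\<^sub>1, \<dots>, z\<^sub>N\<close> (even) and \<open>\<theta>\<close> (odd), let the new lowering operators
  \<open>E\<^sub>N\<^sub>+\<^sub>1\<^sub>,\<^sub>k\<close> and \<open>E\<^sub>N\<^sub>+\<^sub>1\<^sub>,\<^sub>0\<close> be the multiplications by \<open>z\<^sub>k\<close> and \<open>\<theta>\<close>.  Moving the other
  generators to the right past these letters gives the formulas below; \<open>c\<close> is the eigenvalue of
  \<open>E\<^sub>N\<^sub>+\<^sub>1\<^sub>,\<^sub>N\<^sub>+\<^sub>1\<close> on the highest weight vector.\<close>

definition "g a b = G' a b - z b * d a"
definition "x b = X' b + z b * dt"
definition "y a = Y' a - th * d a"
definition "h = H' - th * dt"
definition "S a = (\<Sum>k\<in>{1..N}. g a k * d k)"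
definition "R = (\<Sum>k\<in>{1..N}. x k * d k)"
definition "Q = (\<Sum>k\<in>{1..N}. z k * d k)"
text \<open>\<open>P a\<close>, \<open>Z\<close> and \<open>E\<close> represent E_{a,N+1}, E_{0,N+1}
  and E_{N+1,N+1}. In the old operators, \<open>P a\<close> is the sum of the
  \<open>G' a k * d k\<close>, plus \<open>Y' a * dt\<close>, minus \<open>E * d a\<close>: removing
  a letter by a bracket with E_{a,N+1} leaves E_ak, E_a0 or - E_{N+1,N+1}, which then acts on the
  remaining letters.\<close>

definition "P a = S a + y a * dt - c * d a"
definition "Z = R + h * dt + c * dt"
definition "E = c + Q + th * dt"

lemmas osc' = osc osc(1,2)[THEN left_comm] osc(3-10)[THEN nest]

lemmas order = osc' G'_osc G'_osc[THEN nest] X'_osc X'_osc[THEN nest]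
  Y'_osc Y'_osc[THEN nest] H'_osc H'_osc[THEN nest]

lemmas alg = distrib_left distrib_right left_diff_distrib right_diff_distrib mult.assoc

section \<open>Commutation of the extended operators with letters and derivatives\<close>

lemma g_osc:
  "g a b * z k = z k * g a b - (if a = k then z b else 0)"
  "g a b * d k = d k * g a b + (if b = k then d a else 0)"
  "g a b * th = th * g a b" "g a b * dt = dt * g a b"
  by (simp_all add: g_def alg order)

lemma x_osc:
  "x b * z k = z k * x b" "x b * d k = d k * x b - (if b = k then dt else 0)"
  "x b * th = - (th * x b) + z b" "x b * dt = - (dt * x b)"
  by (simp_all add: x_def alg order)

lemma y_osc:
  "y a * z k = z k * y a - (if a = k then th else 0)" "y a * d k = d k * y a"
  "y a * th = - (th * y a)" "y a * dt = - (dt * y a) - d a"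
  by (simp_all add: y_def alg order)

lemma h_osc:
  "h * z k = z k * h" "h * d k = d k * h" "h * th = th * h - th" "h * dt = dt * h + dt"
  by (simp_all add: h_def alg order)

lemma gg:
  assumes "a \<in> {1..N}" "b \<in> {1..N}" "e \<in> {1..N}" "f \<in> {1..N}"
  shows "g a b * g e f = g e f * g a b + (if b = e then g a f else 0) - (if a = f then g e b else 0)"
  using old.GG[OF assms] by (auto simp add: g_def alg order)

lemma gx:
  assumes "a \<in> {1..N}" "b \<in> {1..N}" "e \<in> {1..N}"
  shows "g a b * x e = x e * g a b - (if a = e then x b else 0)"
  using old.GX[OF assms] by (auto simp add: g_def x_def alg order)

lemma gy:
  assumes "a \<in> {1..N}" "b \<in> {1..N}" "e \<in> {1..N}"
  shows "g a b * y e = y e * g a b + (if b = e then y a else 0)"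
  using old.GY[OF assms] by (auto simp add: g_def y_def alg order)

lemma xy:
  assumes "a \<in> {1..N}" "b \<in> {1..N}"
  shows "x a * y b = - (y b * x a) + g b a + (if a = b then h else 0)"
  using old.XY[OF assms] by (auto simp add: g_def x_def y_def h_def alg order)

lemma xx:
  assumes "a \<in> {1..N}" "b \<in> {1..N}"
  shows "x a * x b = - (x b * x a)"
  using old.XX[OF assms] by (auto simp add: x_def alg order)

lemma xx0: "a \<in> {1..N} \<Longrightarrow> x a * x a = 0"
  using old.XX0 by (auto simp add: x_def alg order)

lemma yy:
  assumes "a \<in> {1..N}" "b \<in> {1..N}"
  shows "y a * y b = - (y b * y a)"
  using old.YY[OF assms] by (auto simp add: y_def alg order)

lemma yy0: "a \<in> {1..N} \<Longrightarrow> y a * y a = 0"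
  using old.YY0 by (auto simp add: y_def alg order)

lemma hg: "a \<in> {1..N} \<Longrightarrow> b \<in> {1..N} \<Longrightarrow> h * g a b = g a b * h"
  using old.HG by (auto simp add: g_def h_def alg order)

lemma hx: "a \<in> {1..N} \<Longrightarrow> h * x a = x a * h + x a"
  using old.HX by (auto simp add: x_def h_def alg order)

lemma hy: "a \<in> {1..N} \<Longrightarrow> h * y a = y a * h - y a"
  using old.HY by (auto simp add: y_def h_def alg order)

lemmas g_osc' = g_osc g_osc[THEN nest]
lemmas x_osc' = x_osc x_osc[THEN nest]
lemmas y_osc' = y_osc y_osc[THEN nest]
lemmas h_osc' = h_osc h_osc[THEN nest]
lemmas sums = sum_distrib_left sum_distrib_right sum.distrib sum_subtractf sum.delta sum.delta' sum_negf

section \<open>The Euler operator and the sums from which the raising operators are built\<close>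

lemma Q_osc: "Q * z b = z b * Q + (if b \<in> {1..N} then z b else 0)"
  "Q * d b = d b * Q - (if b \<in> {1..N} then d b else 0)"
  "Q * th = th * Q" "Q * dt = dt * Q"
proof -
  have 1: "z k * d k * z b = z b * (z k * d k) + (if k = b then z k else 0)" for k
    by (simp add: alg osc')
  have 2: "z k * d k * d b = d b * (z k * d k) - (if k = b then d k else 0)" for k
    by (simp add: alg osc')
  have 3: "z k * d k * th = th * (z k * d k)" "z k * d k * dt = dt * (z k * d k)" for k
    by (simp_all add: alg osc')
  show "Q * z b = z b * Q + (if b \<in> {1..N} then z b else 0)"
    unfolding Q_def sum_distrib_right 1 by (simp add: sums)
  show "Q * d b = d b * Q - (if b \<in> {1..N} then d b else 0)"
    unfolding Q_def sum_distrib_right 2 by (simp add: sums)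
  show "Q * th = th * Q" "Q * dt = dt * Q"
    unfolding Q_def sum_distrib_right 3 by (simp_all add: sums)
qed

lemma S_osc:
  assumes "a \<in> {1..N}"
  shows "b \<in> {1..N} \<Longrightarrow> S a * z b = z b * S a + g a b - (if a = b then Q else 0)"
    "b \<in> {1..N} \<Longrightarrow> S a * d b = d b * S a + d a * d b"
    "S a * th = th * S a" "S a * dt = dt * S a"
proof -
  have 1: "g a k * d k * z b = z b * (g a k * d k) + (if k = b then g a k else 0)
      - (if a = b then z k * d k else 0)" for k b
    by (simp add: alg osc' g_osc')
  have 2: "g a k * d k * d b = d b * (g a k * d k) + (if k = b then d a * d k else 0)" for k b
    by (simp add: alg osc' g_osc')
  have 3: "g a k * d k * th = th * (g a k * d k)" "g a k * d k * dt = dt * (g a k * d k)" for k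
    by (simp_all add: alg osc' g_osc')
  show "S a * z b = z b * S a + g a b - (if a = b then Q else 0)" if "b \<in> {1..N}"
    using that unfolding S_def Q_def sum_distrib_right 1 by (simp add: sums)
  show "S a * d b = d b * S a + d a * d b" if "b \<in> {1..N}"
    using that unfolding S_def sum_distrib_right 2 by (simp add: sums)
  show "S a * th = th * S a" "S a * dt = dt * S a"
    unfolding S_def sum_distrib_right 3 by (simp_all add: sums)
qed

lemma R_osc:
  shows "b \<in> {1..N} \<Longrightarrow> R * z b = z b * R + x b"
    "b \<in> {1..N} \<Longrightarrow> R * d b = d b * R - dt * d b"
    "R * th = - (th * R) + Q" "R * dt = - (dt * R)"
proof -
  have 1: "x k * d k * z b = z b * (x k * d k) + (if k = b then x k else 0)" for k b
    by (simp add: alg osc' x_osc')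
  have 2: "x k * d k * d b = d b * (x k * d k) - (if k = b then dt * d k else 0)" for k b
    by (simp add: alg osc' x_osc')
  have 3: "x k * d k * th = - (th * (x k * d k)) + z k * d k" "x k * d k * dt = - (dt * (x k * d k))" for k
    by (simp_all add: alg osc' x_osc')
  show "R * z b = z b * R + x b" if "b \<in> {1..N}"
    using that unfolding R_def sum_distrib_right 1 by (simp add: sums)
  show "R * d b = d b * R - dt * d b" if "b \<in> {1..N}"
    using that unfolding R_def sum_distrib_right 2 by (simp add: sums)
  show "R * th = - (th * R) + Q" "R * dt = - (dt * R)"
    unfolding R_def Q_def sum_distrib_right 3 by (simp_all add: sums)
qed

lemma g_S:
  assumes "a \<in> {1..N}" "b \<in> {1..N}" "e \<in> {1..N}"
  shows "g a b * S e = S e * g a b + (if b = e then S a else 0)"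
proof -
  have "g a b * (g e k * d k) = (g e k * d k) * g a b + (if b = e then g a k * d k else 0)
      + ((if k = b then g e k * d a else 0) - (if k = a then g e b * d k else 0))" if "k \<in> {1..N}" for k
    using gg[OF assms that] gg[OF assms that, THEN nest] by (simp add: alg g_osc' split del: if_split) (simp add: alg g_osc')
  then have "g a b * S e = (\<Sum>k\<in>{1..N}. (g e k * d k) * g a b + (if b = e then g a k * d k else 0)
      + ((if k = b then g e k * d a else 0) - (if k = a then g e b * d k else 0)))"
    unfolding S_def sum_distrib_left by (rule sum.cong[OF refl])
  then show ?thesis using assms by (simp add: sums S_def)
qed

lemma g_Q:
  assumes "a \<in> {1..N}" "b \<in> {1..N}"
  shows "g a b * Q = Q * g a b"
proof -
  have "g a b * (z k * d k) = (z k * d k) * g a b + ((if k = b then z k * d a else 0)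
      - (if k = a then z b * d k else 0))" for k
    by (simp add: alg g_osc')
  then show ?thesis using assms by (simp add: Q_def sums)
qed

lemma g_R:
  assumes "a \<in> {1..N}" "b \<in> {1..N}"
  shows "g a b * R = R * g a b"
proof -
  have "g a b * (x k * d k) = (x k * d k) * g a b + ((if k = b then x k * d a else 0)
      - (if k = a then x b * d k else 0))" if "k \<in> {1..N}" for k
    using that assms by (simp add: gx[THEN nest] alg g_osc')
  then have "g a b * R = (\<Sum>k\<in>{1..N}. (x k * d k) * g a b + ((if k = b then x k * d a else 0)
      - (if k = a then x b * d k else 0)))"
    unfolding R_def sum_distrib_left by (rule sum.cong[OF refl])
  then show ?thesis using assms by (simp add: sums R_def)
qed

lemma x_S:
  assumes "b \<in> {1..N}" "e \<in> {1..N}"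
  shows "x b * S e = S e * x b - g e b * dt + (if e = b then R else 0)"
proof -
  have "x b * (g e k * d k) = (g e k * d k) * x b + (if e = b then x k * d k else 0)
      - (if k = b then g e k * dt else 0)" if "k \<in> {1..N}" for k
  proof -
    have "x b * g e k = g e k * x b + (if e = b then x k else 0)"
      using gx[of e k b] that assms by simp
    note this this[THEN nest]
    then show ?thesis by (simp add: alg x_osc')
  qed
  then have "x b * S e = (\<Sum>k\<in>{1..N}. (g e k * d k) * x b + (if e = b then x k * d k else 0)
      - (if k = b then g e k * dt else 0))"
    unfolding S_def sum_distrib_left by (rule sum.cong[OF refl])
  then show ?thesis using assms by (simp add: sums S_def R_def)
qed

lemma x_R:
  assumes "b \<in> {1..N}"
  shows "x b * R = - (R * x b) + x b * dt"
proof -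
  have "x b * (x k * d k) = - ((x k * d k) * x b) + (if k = b then x k * dt else 0)" if "k \<in> {1..N}" for k
    by (simp add: alg x_osc' xx[OF assms that] xx[OF assms that, THEN nest] xx0 split del: if_split) (use assms in \<open>simp add: alg xx0 x_osc\<close>)
  then have "x b * R = (\<Sum>k\<in>{1..N}. - ((x k * d k) * x b) + (if k = b then x k * dt else 0))"
    unfolding R_def sum_distrib_left by (rule sum.cong[OF refl])
  then show ?thesis using assms by (simp add: sums R_def)
qed

lemma x_Q:
  assumes "b \<in> {1..N}"
  shows "x b * Q = Q * x b - z b * dt"
proof -
  have "x b * (z k * d k) = (z k * d k) * x b - (if k = b then z k * dt else 0)" for k
    by (simp add: alg x_osc')
  then show ?thesis using assms by (simp add: Q_def sums)
qed

lemma y_S: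
  assumes "b \<in> {1..N}" "e \<in> {1..N}"
  shows "y b * S e = S e * y b - y e * d b"
proof -
  have "y b * (g e k * d k) = (g e k * d k) * y b - (if k = b then y e * d k else 0)"
    if "k \<in> {1..N}" for k
  proof -
    have "y b * g e k = g e k * y b - (if k = b then y e else 0)"
      using gy[of e k b] that assms by simp
    note this this[THEN nest]
    then show ?thesis by (simp add: alg y_osc')
  qed
  then have "y b * S e = (\<Sum>k\<in>{1..N}. (g e k * d k) * y b - (if k = b then y e * d k else 0))"
    unfolding S_def sum_distrib_left by (rule sum.cong[OF refl])
  then show ?thesis using assms by (simp add: sums S_def)
qed

lemma y_R:
  assumes "b \<in> {1..N}"
  shows "y b * R = - (R * y b) + S b + h * d b"
proof -
  have "y b * (x k * d k) = - ((x k * d k) * y b) + g b k * d k + (if k = b then h * d k else 0)"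
    if "k \<in> {1..N}" for k
  proof -
    have "y b * x k = - (x k * y b) + g b k + (if k = b then h else 0)"
      using xy[of k b] that assms by simp
    note this this[THEN nest]
    then show ?thesis by (simp add: alg y_osc')
  qed
  then have "y b * R = (\<Sum>k\<in>{1..N}. - ((x k * d k) * y b) + g b k * d k + (if k = b then h * d k else 0))"
    unfolding R_def sum_distrib_left by (rule sum.cong[OF refl])
  then show ?thesis using assms by (simp add: sums S_def R_def)
qed

lemma y_Q:
  assumes "b \<in> {1..N}"
  shows "y b * Q = Q * y b - th * d b"
proof -
  have "y b * (z k * d k) = (z k * d k) * y b - (if k = b then th * d k else 0)" for k
    by (simp add: alg y_osc')
  then show ?thesis using assms by (simp add: Q_def sums)
qed

lemma h_S:
  assumes "e \<in> {1..N}"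
  shows "h * S e = S e * h"
proof -
  have "h * (g e k * d k) = (g e k * d k) * h" if "k \<in> {1..N}" for k
    by (simp add: alg hg[OF assms that, THEN nest] h_osc')
  then show ?thesis unfolding S_def sum_distrib_left sum_distrib_right by (rule sum.cong[OF refl])
qed

lemma h_R: "h * R = R * h + R"
proof -
  have "h * (x k * d k) = (x k * d k) * h + x k * d k" if "k \<in> {1..N}" for k
    by (simp add: alg hx[OF that, THEN nest] h_osc')
  then have "h * R = (\<Sum>k\<in>{1..N}. (x k * d k) * h + x k * d k)"
    unfolding R_def sum_distrib_left by (rule sum.cong[OF refl])
  then show ?thesis by (simp add: sums R_def)
qed

lemma h_Q: "h * Q = Q * h"
  by (simp add: Q_def sums alg h_osc')

lemma c_comm: "z k * c = c * z k" "d k * c = c * d k" "th * c = c * th" "dt * c = c * dt"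
  "g a b * c = c * g a b" "x a * c = c * x a" "y a * c = c * y a" "h * c = c * h"
  "S a * c = c * S a" "R * c = c * R" "Q * c = c * Q" "P a * c = c * P a" "Z * c = c * Z"
  by (rule c_central)+

lemmas c_comm' = c_comm c_comm[THEN nest]
lemmas brackets = gx gx[THEN nest] gy gy[THEN nest] xy xy[THEN nest] hg hg[THEN nest]
  hx hx[THEN nest] hy hy[THEN nest]
lemmas all_osc = osc' g_osc' x_osc' y_osc' h_osc' Q_osc Q_osc[THEN nest] S_osc S_osc[THEN nest]
  R_osc R_osc[THEN nest] c_comm'

section \<open>Relations that involve the new index N + 1\<close>

lemma g_P:
  assumes "a \<in> {1..N}" "b \<in> {1..N}" "e \<in> {1..N}"
  shows "g a b * P e = P e * g a b + (if b = e then P a else 0)"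
  using assms by (simp add: P_def alg all_osc brackets g_S)

lemma x_P:
  assumes "b \<in> {1..N}" "e \<in> {1..N}"
  shows "x b * P e = P e * x b + (if b = e then Z else 0)"
  using assms by (simp add: P_def Z_def alg all_osc brackets x_S)

lemma y_P:
  assumes "b \<in> {1..N}" "e \<in> {1..N}"
  shows "y b * P e = P e * y b"
  using assms yy[of b e] yy[of b e, THEN nest] by (simp add: P_def alg all_osc brackets y_S)

lemma h_P:
  assumes "e \<in> {1..N}"
  shows "h * P e = P e * h"
  using assms by (simp add: P_def alg all_osc brackets h_S)

lemma P_osc:
  assumes "a \<in> {1..N}" "b \<in> {1..N}"
  shows "P a * z b = z b * P a + g a b - (if a = b then E else 0)"
    "P a * th = th * P a + y a"
    "P a * d b = d b * P a + d a * d b"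
    "P a * dt = dt * P a + dt * d a"
  using assms by (simp_all add: P_def E_def alg all_osc)

lemma g_Z:
  assumes "a \<in> {1..N}" "b \<in> {1..N}"
  shows "g a b * Z = Z * g a b"
  using assms by (simp add: Z_def alg all_osc gx gx[THEN nest] hg[symmetric] g_R)

lemma x_Z:
  assumes "b \<in> {1..N}"
  shows "x b * Z = - (Z * x b)"
  using assms by (simp add: Z_def alg all_osc brackets x_R)

lemma y_Z:
  assumes "b \<in> {1..N}"
  shows "y b * Z = - (Z * y b) + P b"
  using assms by (simp add: Z_def P_def alg all_osc brackets y_R)

lemma h_Z: "h * Z = Z * h + Z"
  by (simp add: Z_def alg all_osc h_R)

lemma Z_osc:
  assumes "b \<in> {1..N}"
  shows "Z * z b = z b * Z + x b"
    "Z * d b = d b * Z - dt * d b"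
  using assms by (simp_all add: Z_def alg all_osc)

lemma Z_osc':
  "Z * th = - (th * Z) + E + h" "Z * dt = - (dt * Z)"
  by (simp_all add: Z_def E_def alg all_osc)

lemma E_comm:
  "b \<in> {1..N} \<Longrightarrow> E * z b = z b * E + z b" "b \<in> {1..N} \<Longrightarrow> E * d b = d b * E - d b"
  "E * th = th * E + th" "E * dt = dt * E - dt"
  "E * h = h * E"
  by (simp_all add: E_def alg all_osc h_Q)

lemma E_gxy:
  assumes "a \<in> {1..N}" "b \<in> {1..N}"
  shows "E * g a b = g a b * E" "E * x b = x b * E" "E * y b = y b * E"
  using assms by (simp_all add: E_def alg all_osc g_Q x_Q y_Q)

lemma E_P:
  assumes "b \<in> {1..N}"
  shows "E * P b = P b * E - P b"
proof -
  have "E * (g b k * d k) = (g b k * d k) * E - g b k * d k" if "k \<in> {1..N}" for k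
    using assms that by (simp add: alg E_gxy[THEN nest] E_comm)
  then have "E * S b = S b * E - S b"
    by (simp add: S_def sums)
  with assms show ?thesis
    by (simp add: P_def alg E_gxy(3)[of b, THEN nest] E_comm c_comm' c_central[of E] c_central[of E, THEN nest])
qed

lemma E_Z: "E * Z = Z * E - Z"
proof -
  have "E * (x k * d k) = (x k * d k) * E - x k * d k" if "k \<in> {1..N}" for k
    using that by (simp add: alg E_gxy(2)[of k, THEN nest] E_comm)
  then have "E * R = R * E - R"
    by (simp add: R_def sums)
  then show ?thesis
    by (simp add: Z_def alg E_comm(5)[THEN nest] E_comm c_comm' c_central[of E] c_central[of E, THEN nest])
qed

text \<open>Only the factor \<open>P b\<close> is expanded. Passing \<open>P a\<close> through its
  summands with the relations known so far produces the two extra terms \<open>P b * d a\<close> and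
  \<open>- P b * d a\<close>.\<close>

lemma P_P:
  assumes a: "a \<in> {1..N}" and b: "b \<in> {1..N}"
  shows "P a * P b = P b * P a"
proof -
  have 1: "P a * (g b k * d k) = (g b k * d k) * P a + g b k * d k * d a - (if k = a then P b * d k else 0)"
    if k: "k \<in> {1..N}" for k
  proof -
    have "P a * g b k = g b k * P a - (if k = a then P b else 0)"
      using g_P[OF b k a] by simp
    note this[THEN nest]
    then show ?thesis using a k by (simp add: alg P_osc osc')
  qed
  have "P a * S b = (\<Sum>k\<in>{1..N}. (g b k * d k) * P a + g b k * d k * d a - (if k = a then P b * d k else 0))"
    unfolding S_def sum_distrib_left by (rule sum.cong[OF refl 1])
  then have S: "P a * S b = S b * P a + S b * d a - P b * d a"
    using a by (simp add: sums S_def)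
  have "P a * (y b * dt) = y b * dt * P a + y b * dt * d a"
    using y_P[OF b a, symmetric, THEN nest] P_osc[OF a b] by (simp add: alg)
  moreover have "P a * (c * d b) = c * d b * P a + c * d b * d a"
    using P_osc[OF a b] by (simp add: alg c_comm' osc')
  moreover have "P a * P b = P a * S b + P a * (y b * dt) - P a * (c * d b)"
    unfolding P_def[of b] by (simp only: distrib_left right_diff_distrib)
  ultimately have "P a * P b = (S b + y b * dt - c * d b) * P a + (S b + y b * dt - c * d b) * d a - P b * d a"
    using S by (simp add: distrib_right left_diff_distrib)
  then show ?thesis by (simp flip: P_def)
qed

lemma P_Z:
  assumes a: "a \<in> {1..N}"
  shows "P a * Z = Z * P a"
proof -
  have 1: "P a * (x k * d k) = (x k * d k) * P a + x k * d k * d a - (if k = a then Z * d k else 0)"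
    if k: "k \<in> {1..N}" for k
  proof -
    have "P a * x k = x k * P a - (if k = a then Z else 0)"
      using x_P[OF k a] by simp
    note this[THEN nest]
    then show ?thesis using a k by (simp add: alg P_osc osc')
  qed
  have "P a * R = (\<Sum>k\<in>{1..N}. (x k * d k) * P a + x k * d k * d a - (if k = a then Z * d k else 0))"
    unfolding R_def sum_distrib_left by (rule sum.cong[OF refl 1])
  then have R: "P a * R = R * P a + R * d a - Z * d a"
    using a by (simp add: sums R_def)
  have "P a * (h * dt) = h * dt * P a + h * dt * d a"
    using h_P[OF a, symmetric, THEN nest] P_osc[OF a a] by (simp add: alg)
  moreover have "P a * (c * dt) = c * dt * P a + c * dt * d a"
    using P_osc[OF a a] by (simp add: alg c_comm' osc')
  moreover have "P a * Z = P a * R + P a * (h * dt) + P a * (c * dt)"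
    unfolding Z_def by (simp only: distrib_left)
  ultimately have "P a * Z = (R + h * dt + c * dt) * P a + (R + h * dt + c * dt) * d a - Z * d a"
    using R by (simp add: distrib_right)
  then show ?thesis by (simp flip: Z_def)
qed

text \<open>Expanding one factor gives Z Z = - Z Z + (R - Z) dt. The last term is zero because dt dt
  = 0, and it remains to divide by 2.\<close>

lemma Z_Z: "Z * Z = 0"
proof -
  have 1: "Z * (x k * d k) = - ((x k * d k) * Z) + x k * d k * dt" if k: "k \<in> {1..N}" for k
  proof -
    have "Z * x k = - (x k * Z)"
      using x_Z[OF k] by simp
    note this[THEN nest]
    then show ?thesis using k by (simp add: alg Z_osc osc')
  qed
  have "Z * R = (\<Sum>k\<in>{1..N}. - ((x k * d k) * Z) + x k * d k * dt)"
    unfolding R_def sum_distrib_left by (rule sum.cong[OF refl 1])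
  then have R: "Z * R = - (R * Z) + R * dt"
    by (simp add: sums R_def)
  have Zh: "Z * h = h * Z - Z"
    using h_Z by simp
  have "Z * (h * dt) = - (h * dt * Z) - Z * dt"
    using Zh[THEN nest] by (simp add: alg Z_osc')
  moreover have "Z * (c * dt) = - (c * dt * Z)"
    using Z_osc'(2) by (simp add: alg c_comm')
  moreover have "Z * Z = Z * R + Z * (h * dt) + Z * (c * dt)"
    by (subst (2) Z_def) (simp only: distrib_left)
  ultimately have "Z * Z = - ((R + h * dt + c * dt) * Z) + R * dt - Z * dt"
    using R by (simp add: distrib_right)
  then have "Z * Z = - (Z * Z) + R * dt - Z * dt"
    by (simp flip: Z_def)
  moreover have "Z * dt = R * dt"
    by (simp add: Z_def alg osc')
  ultimately have "Z * Z = - (Z * Z)" by simp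
  then have "Z * Z + Z * Z = 0" by (simp only: eq_neg_iff_add_eq_0)
  then show ?thesis by (rule no_2_torsion)
qed

definition "G_ext a b = (if a \<le> N then if b \<le> N then g a b else P a else if b \<le> N then z b else E)"
definition "X_ext b = (if b \<le> N then x b else Z)"
definition "Y_ext a = (if a \<le> N then y a else th)"

lemma ext_gl1n: "gl1n (Suc N) G_ext X_ext Y_ext h"
proof
  have split: "a \<in> {1..N} \<or> a = Suc N" if "a \<in> {1..Suc N}" for a
    using that by auto
  note defs = G_ext_def X_ext_def Y_ext_def
  fix a b e f
  assume a: "a \<in> {1..Suc N}"
  show "X_ext a * X_ext a = 0"
    using split[OF a] by (auto simp: defs xx0 Z_Z)
  show "Y_ext a * Y_ext a = 0"
    using split[OF a] by (auto simp: defs yy0 osc)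
  show "h * X_ext a = X_ext a * h + X_ext a"
    using split[OF a] by (auto simp: defs hx h_Z)
  show "h * Y_ext a = Y_ext a * h - Y_ext a"
    using split[OF a] by (auto simp: defs hy h_osc)
  assume b: "b \<in> {1..Suc N}"
  show "X_ext a * Y_ext b = - (Y_ext b * X_ext a) + G_ext b a + (if a = b then h else 0)"
    using split[OF a] split[OF b] by (auto simp: defs xy x_osc y_Z Z_osc')
  show "X_ext a * X_ext b = - (X_ext b * X_ext a)"
    using split[OF a] split[OF b] xx[of a b] x_Z[of a] x_Z[of b] by (elim disjE) (simp_all add: defs Z_Z)
  show "Y_ext a * Y_ext b = - (Y_ext b * Y_ext a)"
    using split[OF a] split[OF b] yy[of a b] y_osc(3)[of a] y_osc(3)[of b]
    by (elim disjE) (simp_all add: defs osc(8))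
  show "h * G_ext a b = G_ext a b * h"
    using split[OF a] split[OF b] by (auto simp: defs hg h_osc h_P E_comm)
  assume e: "e \<in> {1..Suc N}"
  show "G_ext a b * X_ext e = X_ext e * G_ext a b - (if a = e then X_ext b else 0)"
    using split[OF a] split[OF b] split[OF e]
    by (auto simp: defs gx g_Z x_P P_Z Z_osc x_osc E_gxy E_Z)
  show "G_ext a b * Y_ext e = Y_ext e * G_ext a b + (if b = e then Y_ext a else 0)"
    using split[OF a] split[OF b] split[OF e]
    by (auto simp: defs gy g_osc y_P P_osc y_osc osc E_gxy E_comm)
  assume f: "f \<in> {1..Suc N}"
  show "G_ext a b * G_ext e f = G_ext e f * G_ext a b + (if b = e then G_ext a f else 0)
      - (if a = f then G_ext e b else 0)"
  proof (cases "a = Suc N"; cases "b = Suc N"; cases "e = Suc N"; cases "f = Suc N")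
  qed (use a b e f in \<open>simp_all add: defs gg[of a b e f] g_P P_P g_osc P_osc osc E_comm E_gxy E_P\<close>)
qed

end

lemma diag_diff: "diag g - diag h = diag (\<lambda>s. g s - h s)"
  by (rule lin_eqI, rule poly_mapping_eqI) (simp add: lookup_minus algebra_simps)

lemma diag_sum: "(\<Sum>k\<in>A. diag (g k)) = diag (\<lambda>s. \<Sum>k\<in>A. g k s)"
  by (rule lin_eqI, rule poly_mapping_eqI) (simp add: lookup_sum sum_distrib_right)

section \<open>The Fock space model of the Verma module\<close>

context
  fixes \<alpha> :: complex and \<beta> :: "nat \<Rightarrow> complex"
begin

text \<open>Here \<alpha> and \<beta> j are the eigenvalues of E_00 and E_jj on the highest weight
  vector. The \<open>Suc\<close> clauses are the operators of \<open>peel\<close> written out, with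
  \<open>\<beta> (Suc N)\<close> for c. All levels act on the same space of states, where the
  operators of level N ignore the letters of larger index.\<close>

fun mG :: "nat \<Rightarrow> nat \<Rightarrow> nat \<Rightarrow> state lin"
  and mX :: "nat \<Rightarrow> nat \<Rightarrow> state lin"
  and mY :: "nat \<Rightarrow> nat \<Rightarrow> state lin"
  and mH :: "nat \<Rightarrow> state lin"
where
  "mG 0 a b = 0"
| "mG (Suc N) a b =
    (if a \<le> N then
      if b \<le> N then mG N a b - zop (Suc N) b * dop (Suc N) a
      else (\<Sum>k\<in>{1..N}. (mG N a k - zop (Suc N) k * dop (Suc N) a) * dop (Suc N) k)
        + (mY N a - tht (Suc N) * dop (Suc N) a) * dth (Suc N) - scal (\<beta> (Suc N)) * dop (Suc N) a
     else
      if b \<le> N then zop (Suc N) b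
      else scal (\<beta> (Suc N)) + (\<Sum>k\<in>{1..N}. zop (Suc N) k * dop (Suc N) k)
        + tht (Suc N) * dth (Suc N))"
| "mX 0 b = 0"
| "mX (Suc N) b =
    (if b \<le> N then mX N b + zop (Suc N) b * dth (Suc N)
     else (\<Sum>k\<in>{1..N}. (mX N k + zop (Suc N) k * dth (Suc N)) * dop (Suc N) k)
       + (mH N - tht (Suc N) * dth (Suc N)) * dth (Suc N) + scal (\<beta> (Suc N)) * dth (Suc N))"
| "mY 0 a = 0"
| "mY (Suc N) a = (if a \<le> N then mY N a - tht (Suc N) * dop (Suc N) a else tht (Suc N))"
| "mH 0 = scal \<alpha>"
| "mH (Suc N) = mH N - tht (Suc N) * dth (Suc N)"

lemma osc_comm_higher:
  assumes "N < M" "L \<le> N"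
  shows "zop L a * zop M k = zop M k * zop L a" "zop L a * dop M k = dop M k * zop L a"
    "dop L a * zop M k = zop M k * dop L a" "dop L a * dop M k = dop M k * dop L a"
    "tht L * tht M = - (tht M * tht L)" "dth L * tht M = - (tht M * dth L)"
    "tht L * dth M = - (dth M * tht L)" "dth L * dth M = - (dth M * dth L)"
  using assms boson_comm(3)[of M k L a] boson_comm(1)[of L a M k] boson_comm(2)[of L a M k]
    boson_comm(3)[of L a M k]
    fermion_anticomm(1)[of L M] fermion_anticomm(2)[of L M] fermion_anticomm(3)[of L M]
    fermion_anticomm(3)[of M L]
  by auto

lemma mod_boson_aux:
  "N < M \<Longrightarrow>
    (\<forall>a b. mG N a b * zop M k = zop M k * mG N a b \<and> mG N a b * dop M k = dop M k * mG N a b) \<and>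
    (\<forall>a. mX N a * zop M k = zop M k * mX N a \<and> mX N a * dop M k = dop M k * mX N a) \<and>
    (\<forall>a. mY N a * zop M k = zop M k * mY N a \<and> mY N a * dop M k = dop M k * mY N a) \<and>
    mH N * zop M k = zop M k * mH N \<and> mH N * dop M k = dop M k * mH N"
proof (induction N)
  case (Suc N)
  have lt: "N < M" "Suc N < M" using Suc.prems by auto
  have IH: "mG N a b * zop M k = zop M k * mG N a b" "mG N a b * dop M k = dop M k * mG N a b"
    "mX N a * zop M k = zop M k * mX N a" "mX N a * dop M k = dop M k * mX N a"
    "mY N a * zop M k = zop M k * mY N a" "mY N a * dop M k = dop M k * mY N a"
    "mH N * zop M k = zop M k * mH N" "mH N * dop M k = dop M k * mH N" for a b
    using Suc.IH[OF lt(1)] by blast+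
  note d = distrib_left distrib_right left_diff_distrib right_diff_distrib mult.assoc
  note higher = osc_comm_higher(1-4)[OF lt(2) order.refl]
  note rules = d higher higher[THEN nest]
    boson_fermion_comm(1-4)[symmetric] boson_fermion_comm(1-4)[symmetric, THEN nest]
    scal_central[of _ "zop M k"] scal_central[of _ "zop M k", THEN nest]
    scal_central[of _ "dop M k"] scal_central[of _ "dop M k", THEN nest]
    IH IH[THEN nest] sum_distrib_left sum_distrib_right
  show ?case
    by (simp add: rules)
qed (auto simp: scal_central)

lemma mod_boson:
  assumes "N < M"
  shows "mG N a b * zop M k = zop M k * mG N a b" "mG N a b * dop M k = dop M k * mG N a b"
    "mX N a * zop M k = zop M k * mX N a" "mX N a * dop M k = dop M k * mX N a"
    "mY N a * zop M k = zop M k * mY N a" "mY N a * dop M k = dop M k * mY N a"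
    "mH N * zop M k = zop M k * mH N" "mH N * dop M k = dop M k * mH N"
  using mod_boson_aux[OF assms] by blast+

text \<open>Because of the sign in \<open>tht\<close> and \<open>dth\<close>, the odd operators of
  level N anticommute with odd letters of larger index; this is the sign convention that
  \<open>peel\<close> requires.\<close>

lemma mod_fermion_aux:
  "N < M \<Longrightarrow>
    (\<forall>a b. mG N a b * tht M = tht M * mG N a b \<and> mG N a b * dth M = dth M * mG N a b) \<and>
    (\<forall>a. mX N a * tht M = - (tht M * mX N a) \<and> mX N a * dth M = - (dth M * mX N a)) \<and>
    (\<forall>a. mY N a * tht M = - (tht M * mY N a) \<and> mY N a * dth M = - (dth M * mY N a)) \<and>
    mH N * tht M = tht M * mH N \<and> mH N * dth M = dth M * mH N"
proof (induction N)
  case (Suc N)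
  have lt: "N < M" "Suc N < M" using Suc.prems by auto
  have IH: "mG N a b * tht M = tht M * mG N a b" "mG N a b * dth M = dth M * mG N a b"
    "mX N a * tht M = - (tht M * mX N a)" "mX N a * dth M = - (dth M * mX N a)"
    "mY N a * tht M = - (tht M * mY N a)" "mY N a * dth M = - (dth M * mY N a)"
    "mH N * tht M = tht M * mH N" "mH N * dth M = dth M * mH N" for a b
    using Suc.IH[OF lt(1)] by blast+
  have higher: "tht (Suc N) * tht M = - (tht M * tht (Suc N))" "dth (Suc N) * tht M = - (tht M * dth (Suc N))"
    "tht (Suc N) * dth M = - (dth M * tht (Suc N))" "dth (Suc N) * dth M = - (dth M * dth (Suc N))"
    using osc_comm_higher(5-8)[OF lt(2) order.refl] .
  note d = distrib_left distrib_right left_diff_distrib right_diff_distrib mult.assoc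
  note rules = d higher higher[THEN nest] boson_fermion_comm(1-4) boson_fermion_comm(1-4)[THEN nest]
    scal_central[of _ "tht M"] scal_central[of _ "tht M", THEN nest]
    scal_central[of _ "dth M"] scal_central[of _ "dth M", THEN nest]
    IH IH[THEN nest]
    sum_distrib_left sum_distrib_right sum_negf sum.distrib sum_subtractf
  show ?case
    by (simp add: rules)
qed (auto simp: scal_central)

lemma mod_fermion:
  assumes "N < M"
  shows "mG N a b * tht M = tht M * mG N a b" "mG N a b * dth M = dth M * mG N a b"
    "mX N a * tht M = - (tht M * mX N a)" "mX N a * dth M = - (dth M * mX N a)"
    "mY N a * tht M = - (tht M * mY N a)" "mY N a * dth M = - (dth M * mY N a)"
    "mH N * tht M = tht M * mH N" "mH N * dth M = dth M * mH N"
  using mod_fermion_aux[OF assms] by blast+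

lemma lin_no_2_torsion: "v + v = 0 \<Longrightarrow> v = 0" for v :: "'s lin"
proof (rule lin_eqI, rule poly_mapping_eqI)
  fix f s
  assume "v + v = 0"
  then have "lookup (app (v + v) f) s = 0" by simp
  then show "lookup (app v f) s = lookup (app 0 f) s"
    by (simp add: lookup_add)
qed

lemma mod_gl1n: "gl1n N (mG N) (mX N) (mY N) (mH N)"
proof (induction N)
  case 0
  show ?case by standard auto
next
  case (Suc N)
  interpret old: gl1n N "mG N" "mX N" "mY N" "mH N" by (rule Suc.IH)
  have lt: "N < Suc N" by simp
  interpret peel N "mG N" "mX N" "mY N" "mH N" "zop (Suc N)" "dop (Suc N)" "tht (Suc N)" "dth (Suc N)"
    "scal (\<beta> (Suc N))"
  proof
    show "dth (Suc N) * tht (Suc N) = 1 - tht (Suc N) * dth (Suc N)"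
      by (simp add: fermion_anticomm(3))
  qed (use mod_boson[OF lt] mod_fermion[OF lt] in
      \<open>auto intro: lin_no_2_torsion boson_comm boson_fermion_comm boson_fermion_comm[symmetric]
        scal_central[symmetric] simp: boson_comm(3) fermion_sq\<close>)
  have 1: "G_ext = mG (Suc N)"
    by (intro ext) (simp add: G_ext_def P_def S_def E_def Q_def g_def y_def)
  have 2: "X_ext = mX (Suc N)"
    by (intro ext) (simp add: X_ext_def Z_def R_def x_def h_def)
  have 3: "Y_ext = mY (Suc N)"
    by (intro ext) (simp add: Y_ext_def y_def)
  have 4: "h = mH (Suc N)"
    by (simp add: h_def)
  show ?case using ext_gl1n by (simp only: 1 2 3 4)
qed

text \<open>The letters z_jk and \<theta>_j stand for matrix units in row j and count +1; the
  letters z_Mj stand for matrix units in column j and count -1.\<close>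

lemma mG_diag:
  assumes "j \<in> {1..n}"
  shows "mG n j j = diag (\<lambda>(T, e). \<beta> j + (\<Sum>k\<in>{1..<j}. of_nat (e (j, k))) + (if j \<in> T then 1 else 0)
      - (\<Sum>M\<in>{Suc j..n}. of_nat (e (M, j))))"
  using assms
proof (induction n)
  case (Suc n)
  show ?case
  proof (cases "j \<le> n")
    case True
    then show ?thesis using Suc
      by (simp add: number_op diag_diff case_prod_unfold algebra_simps)
  next
    case False
    then have "j = Suc n" using Suc.prems by auto
    then show ?thesis
      by (simp add: number_op scal_eq_diag diag_add diag_sum case_prod_unfold atLeastLessThanSuc_atLeastAtMost)
  qed
qed auto

lemma mH_diag: "mH n = diag (\<lambda>(T, e). \<alpha> - (\<Sum>M\<in>{1..n}. if M \<in> T then 1 else 0))"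
proof (induction n)
  case 0
  show ?case by (simp add: scal_eq_diag case_prod_unfold)
next
  case (Suc n)
  show ?case
    by (simp add: Suc number_op diag_diff case_prod_unfold algebra_simps)
qed

lemma mX_eq:
  assumes "i \<le> n" "1 \<le> i"
  shows "mX n i = mX i i + (\<Sum>M\<in>{Suc i..n}. zop M i * dth M)"
  using assms
proof (induction n)
  case (Suc n)
  show ?case
  proof (cases "i = Suc n")
    case False
    with Suc show ?thesis by (simp add: algebra_simps)
  qed simp
qed simp

end

section \<open>States of bounded level\<close>

text \<open>The type \<open>state\<close> also contains monomials in letters that do not exist, such
  as z_ab with a \<le> b, and infinite sets of odd letters. The valid states of level N are the
  ordered monomials of gl(1|N).\<close>

definition valid :: "nat \<Rightarrow> state \<Rightarrow> bool" where
  "valid N s \<longleftrightarrow> fst s \<subseteq> {1..N} \<and> (\<forall>a b. snd s (a, b) \<noteq> 0 \<longrightarrow> 1 \<le> b \<and> b < a \<and> a \<le> N)"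

text \<open>The set \<Theta> restricts the odd letters separately from the level: it is empty for
  the purely even part and {1..i} once the odd letters above i have been removed.\<close>

definition Vs :: "nat \<Rightarrow> nat set \<Rightarrow> (state \<Rightarrow>\<^sub>0 complex) set" where
  "Vs N \<Theta> = {f. \<forall>s\<in>Poly_Mapping.keys f. valid N s \<and> fst s \<subseteq> \<Theta>}"

definition vac :: "state \<Rightarrow>\<^sub>0 complex" where
  "vac = Poly_Mapping.single ({}, \<lambda>_. 0) 1"

lemma VsI: "(\<And>s. lookup f s \<noteq> 0 \<Longrightarrow> valid N s \<and> fst s \<subseteq> \<Theta>) \<Longrightarrow> f \<in> Vs N \<Theta>"
  by (auto simp: Vs_def in_keys_iff)

lemma VsD: "f \<in> Vs N \<Theta> \<Longrightarrow> lookup f s \<noteq> 0 \<Longrightarrow> valid N s \<and> fst s \<subseteq> \<Theta>"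
  by (auto simp: Vs_def in_keys_iff)

lemma Vs_zero [simp]: "0 \<in> Vs N \<Theta>"
  by (simp add: Vs_def)

lemma Vs_add [intro]: "f \<in> Vs N \<Theta> \<Longrightarrow> g \<in> Vs N \<Theta> \<Longrightarrow> f + g \<in> Vs N \<Theta>"
  using Poly_Mapping.keys_add[of f g] by (auto simp: Vs_def)

lemma Vs_vscale [intro]: "f \<in> Vs N \<Theta> \<Longrightarrow> vscale c f \<in> Vs N \<Theta>"
  by (auto simp: Vs_def in_keys_iff)

lemma Vs_uminus [intro]: "f \<in> Vs N \<Theta> \<Longrightarrow> - f \<in> Vs N \<Theta>"
  by (auto simp: Vs_def in_keys_iff)

lemma Vs_diff [intro]: "f \<in> Vs N \<Theta> \<Longrightarrow> g \<in> Vs N \<Theta> \<Longrightarrow> f - g \<in> Vs N \<Theta>"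
  using Vs_add[of f N \<Theta> "- g"] Vs_uminus[of g] by simp

lemma Vs_sum: "(\<And>i. i \<in> I \<Longrightarrow> f i \<in> Vs N \<Theta>) \<Longrightarrow> (\<Sum>i\<in>I. f i) \<in> Vs N \<Theta>"
  by (induction I rule: infinite_finite_induct) auto

lemma valid_mono: "valid N s \<Longrightarrow> N \<le> M \<Longrightarrow> valid M s"
  unfolding valid_def by fastforce

lemma Vs_mono: "f \<in> Vs N \<Theta> \<Longrightarrow> N \<le> M \<Longrightarrow> \<Theta> \<subseteq> \<Theta>' \<Longrightarrow> f \<in> Vs M \<Theta>'"
  unfolding Vs_def using valid_mono by blast

lemma vac_Vs [simp]: "vac \<in> Vs N \<Theta>"
  by (simp add: vac_def Vs_def valid_def)

lemma Vs_single: "valid N s \<Longrightarrow> fst s \<subseteq> \<Theta> \<Longrightarrow> Poly_Mapping.single s c \<in> Vs N \<Theta>"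
  by (simp add: Vs_def)

lemma mop_Vs:
  assumes "\<And>s. valid N s \<Longrightarrow> fst s \<subseteq> \<Theta> \<Longrightarrow> c s \<noteq> 0 \<Longrightarrow> valid N (t s) \<and> fst (t s) \<subseteq> \<Theta>"
    and "f \<in> Vs N \<Theta>"
  shows "app (mop t c) f \<in> Vs N \<Theta>"
  unfolding app_mop pmext_def
proof (rule Vs_sum)
  fix s assume "s \<in> Poly_Mapping.keys f"
  then have "valid N s" "fst s \<subseteq> \<Theta>" using assms(2) by (auto simp: Vs_def)
  then show "Poly_Mapping.single (t s) (c s * lookup f s) \<in> Vs N \<Theta>"
    using assms(1)[of s] by (cases "c s = 0") (auto intro: Vs_single)
qed

lemma mop_zero:
  assumes "\<And>s. valid N s \<Longrightarrow> fst s \<subseteq> \<Theta> \<Longrightarrow> c s = 0" and "f \<in> Vs N \<Theta>"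
  shows "app (mop t c) f = 0"
  unfolding app_mop pmext_def by (rule sum.neutral) (use assms in \<open>auto simp: Vs_def\<close>)

lemma zop_Vs: "f \<in> Vs N \<Theta> \<Longrightarrow> 1 \<le> b \<Longrightarrow> b < a \<Longrightarrow> a \<le> N \<Longrightarrow> app (zop a b) f \<in> Vs N \<Theta>"
  unfolding zop_def by (rule mop_Vs) (auto simp: valid_def split: if_splits)

lemma valid_le: "valid N (T, e) \<Longrightarrow> T' \<subseteq> T \<Longrightarrow> (\<And>p. e' p \<le> e p) \<Longrightarrow> valid N (T', e')"
  unfolding valid_def by (metis fst_conv le_zero_eq snd_conv subset_trans)

lemma dop_Vs: "f \<in> Vs N \<Theta> \<Longrightarrow> app (dop a b) f \<in> Vs N \<Theta>"
  unfolding dop_def by (rule mop_Vs) (auto intro: valid_le)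

lemma tht_Vs: "f \<in> Vs N \<Theta> \<Longrightarrow> 1 \<le> M \<Longrightarrow> M \<le> N \<Longrightarrow> M \<in> \<Theta> \<Longrightarrow> app (tht M) f \<in> Vs N \<Theta>"
  unfolding tht_def by (rule mop_Vs) (auto simp: valid_def split: if_splits)

lemma dth_Vs: "f \<in> Vs N \<Theta> \<Longrightarrow> app (dth M) f \<in> Vs N \<Theta>"
  unfolding dth_def by (rule mop_Vs) (auto intro: valid_le)

lemma diag_Vs: "f \<in> Vs N \<Theta> \<Longrightarrow> app (diag g) f \<in> Vs N \<Theta>"
  by (rule mop_Vs) auto

lemma dop_kill: "f \<in> Vs N \<Theta> \<Longrightarrow> N < M \<Longrightarrow> app (dop M b) f = 0"
  unfolding dop_def by (rule mop_zero[of N \<Theta>]) (force simp: valid_def)+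

lemma dth_kill: "f \<in> Vs N \<Theta> \<Longrightarrow> N < M \<or> M \<notin> \<Theta> \<Longrightarrow> app (dth M) f = 0"
  unfolding dth_def by (rule mop_zero[of N \<Theta>]) (force simp: valid_def)+

lemma single_induct_Vs:
  assumes "valid N s" "fst s \<subseteq> \<Theta>"
    and vac: "\<And>c. P (vscale c vac)"
    and z: "\<And>M k g. \<lbrakk>1 \<le> k; k < M; M \<le> N; g \<in> Vs M \<Theta>; P g\<rbrakk> \<Longrightarrow> P (app (zop M k) g)"
    and th: "\<And>M g. \<lbrakk>1 \<le> M; M \<le> N; M \<in> \<Theta>; g \<in> Vs M \<Theta>; P g\<rbrakk> \<Longrightarrow> P (app (tht M) g)"
  shows "P (Poly_Mapping.single s c)"
  using assms
proof (induction N arbitrary: s c)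
  case 0
  then have "s = ({}, \<lambda>_. 0)"
    by (cases s) (auto simp: valid_def fun_eq_iff)
  then show ?case using 0(3)[of c] by (simp add: vac_def)
next
  case (Suc N)
  obtain T e where s: "s = (T, e)" by (cases s)
  \<comment> \<open>The number of letters of index N + 1, which the inner induction strips off one
    at a time.\<close>
  define cnt where "cnt = (\<lambda>(T, e). (if Suc N \<in> T then 1 else 0) + (\<Sum>k\<in>{1..N}. e (Suc N, k)) :: nat)"
  have "valid (Suc N) s' \<Longrightarrow> fst s' \<subseteq> \<Theta> \<Longrightarrow> cnt s' = m \<Longrightarrow> P (Poly_Mapping.single s' c)" for m s' c
  proof (induction m arbitrary: s' c)
    case 0
    obtain T e where s': "s' = (T, e)" by (cases s')
    from 0(3) have T: "Suc N \<notin> T" and e: "\<And>k. k \<in> {1..N} \<Longrightarrow> e (Suc N, k) = 0"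
      by (simp_all add: s' cnt_def split: if_splits)
    have "valid N s'"
      unfolding valid_def s' fst_conv snd_conv
    proof (intro conjI allI impI subsetI)
      fix k assume "k \<in> T"
      then have "k \<in> {1..Suc N}" "k \<noteq> Suc N" using 0(1) T by (auto simp: valid_def s')
      then show "k \<in> {1..N}" by auto
    next
      fix a b assume ab: "e (a, b) \<noteq> 0"
      then have *: "1 \<le> b \<and> b < a \<and> a \<le> Suc N" using 0(1) by (simp add: valid_def s')
      show "1 \<le> b" "b < a" using * by auto
      have "a \<noteq> Suc N" using * ab e[of b] by auto
      then show "a \<le> N" using * by auto
    qed
    then show ?case
      using 0(2) Suc.IH[of s' c] Suc.prems(3,4,5) by (meson le_SucI)
  next
    case (Suc m s')
    note z = \<open>\<And>M k g. \<lbrakk>1 \<le> k; k < M; M \<le> Suc N; g \<in> Vs M \<Theta>; P g\<rbrakk> \<Longrightarrow> P (app (zop M k) g)\<close>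
    note th = \<open>\<And>M g. \<lbrakk>1 \<le> M; M \<le> Suc N; M \<in> \<Theta>; g \<in> Vs M \<Theta>; P g\<rbrakk> \<Longrightarrow> P (app (tht M) g)\<close>
    obtain T e where s': "s' = (T, e)" by (cases s')
    show ?case
    proof (cases "Suc N \<in> T")
      case True
      let ?s = "(T - {Suc N}, e)"
      have v: "valid (Suc N) ?s" "fst ?s \<subseteq> \<Theta>" "cnt ?s = m"
        using Suc.prems True by (auto simp: valid_def s' cnt_def)
      \<comment> \<open>The sign is put into the coefficient in advance: \<open>tht\<close>
        contributes it a second time, and its square is 1.\<close>
      have "P (app (tht (Suc N)) (Poly_Mapping.single ?s (jw_sign T (Suc N) * c)))"
        using v True Suc.prems(2) by (intro th Vs_single Suc.IH) (auto simp: s')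
      moreover have "app (tht (Suc N)) (Poly_Mapping.single ?s (jw_sign T (Suc N) * c)) = Poly_Mapping.single s' c"
        using True by (simp add: tht_def s' jw_sign_remove insert_absorb flip: mult.assoc)
      ultimately show ?thesis by simp
    next
      case False
      then have "(\<Sum>k\<in>{1..N}. e (Suc N, k)) \<noteq> 0" using Suc.prems by (simp add: s' cnt_def)
      then obtain k where k: "k \<in> {1..N}" "e (Suc N, k) \<noteq> 0" by (meson sum.neutral)
      let ?s = "(T, e((Suc N, k) := e (Suc N, k) - 1))"
      have "(\<Sum>j\<in>{1..N}. e (Suc N, j)) = Suc (\<Sum>j\<in>{1..N}. (e((Suc N, k) := e (Suc N, k) - 1)) (Suc N, j))"
      proof -
        have "(\<Sum>j\<in>{1..N} - {k}. (e((Suc N, k) := e (Suc N, k) - 1)) (Suc N, j)) = (\<Sum>j\<in>{1..N} - {k}. e (Suc N, j))"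
          by (rule sum.cong) auto
        then show ?thesis
          using k by (simp add: sum.remove[OF _ k(1)] del: One_nat_def)
      qed
      then have v: "valid (Suc N) ?s" "fst ?s \<subseteq> \<Theta>" "cnt ?s = m"
        using Suc.prems False k by (auto simp: valid_def s' cnt_def split: if_splits)
      have "P (app (zop (Suc N) k) (Poly_Mapping.single ?s c))"
        using v k by (intro z Vs_single Suc.IH) auto
      moreover have "app (zop (Suc N) k) (Poly_Mapping.single ?s c) = Poly_Mapping.single s' c"
        using k by (simp add: zop_def s' fun_upd_idem)
      ultimately show ?thesis by simp
    qed
  qed
  then show ?case using Suc.prems(1,2) by blast
qed

text \<open>The letter multiplied last has the largest index, since g has level M. On such vectors
  multiplication by z_Mk or \<theta>_M is the action of E_Mk or E_M0 (\<open>mod_lower\<close>,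
  \<open>mod_lower_odd\<close>), so this induction generates the module from the highest weight
  vector.\<close>

lemma Vs_induct [consumes 1, case_names zero add vac z th]:
  assumes "f \<in> Vs N \<Theta>" and "P 0" and "\<And>f g. P f \<Longrightarrow> P g \<Longrightarrow> P (f + g)"
    and "\<And>c. P (vscale c vac)"
    and "\<And>M k g. \<lbrakk>1 \<le> k; k < M; M \<le> N; g \<in> Vs M \<Theta>; P g\<rbrakk> \<Longrightarrow> P (app (zop M k) g)"
    and "\<And>M g. \<lbrakk>1 \<le> M; M \<le> N; M \<in> \<Theta>; g \<in> Vs M \<Theta>; P g\<rbrakk> \<Longrightarrow> P (app (tht M) g)"
  shows "P f"
proof -
  have "P (\<Sum>s\<in>A. Poly_Mapping.single s (lookup f s))" if "finite A" "A \<subseteq> Poly_Mapping.keys f" for A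
    using that
  proof (induction A rule: finite_induct)
    case (insert s A)
    then have "valid N s" "fst s \<subseteq> \<Theta>" using assms(1) by (auto simp: Vs_def)
    then have "P (Poly_Mapping.single s (lookup f s))"
      by (rule single_induct_Vs) (use assms in auto)
    with insert show ?case by (simp add: assms(3))
  qed (use assms(2) in simp)
  from this[of "Poly_Mapping.keys f"] show ?thesis
    using pmext_decompose[of f] by (simp add: pmext_def)
qed

lemma mod_Vs:
  assumes "{1..N} \<subseteq> \<Theta>" "N \<le> M" "f \<in> Vs M \<Theta>"
  shows "a \<in> {1..N} \<Longrightarrow> b \<in> {1..N} \<Longrightarrow> app (mG \<alpha> \<beta> N a b) f \<in> Vs M \<Theta>"
    and "b \<in> {1..N} \<Longrightarrow> app (mX \<alpha> \<beta> N b) f \<in> Vs M \<Theta>"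
    and "a \<in> {1..N} \<Longrightarrow> app (mY \<alpha> \<beta> N a) f \<in> Vs M \<Theta>"
    and "app (mH \<alpha> \<beta> N) f \<in> Vs M \<Theta>"
proof -
  have "{1..N} \<subseteq> \<Theta> \<Longrightarrow> N \<le> M \<Longrightarrow> \<forall>f\<in>Vs M \<Theta>.
      (\<forall>a\<in>{1..N}. \<forall>b\<in>{1..N}. app (mG \<alpha> \<beta> N a b) f \<in> Vs M \<Theta>) \<and>
      (\<forall>b\<in>{1..N}. app (mX \<alpha> \<beta> N b) f \<in> Vs M \<Theta>) \<and>
      (\<forall>a\<in>{1..N}. app (mY \<alpha> \<beta> N a) f \<in> Vs M \<Theta>) \<and> app (mH \<alpha> \<beta> N) f \<in> Vs M \<Theta>"
  proof (induction N)
    case (Suc N)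
    have sub: "{1..N} \<subseteq> \<Theta>" "Suc N \<in> \<Theta>" "N \<le> M" "Suc N \<le> M" using Suc.prems by auto
    note IH = Suc.IH[OF sub(1,3)]
    have IH: "f \<in> Vs M \<Theta> \<Longrightarrow> a \<in> {1..N} \<Longrightarrow> b \<in> {1..N} \<Longrightarrow> app (mG \<alpha> \<beta> N a b) f \<in> Vs M \<Theta>"
      "f \<in> Vs M \<Theta> \<Longrightarrow> b \<in> {1..N} \<Longrightarrow> app (mX \<alpha> \<beta> N b) f \<in> Vs M \<Theta>"
      "f \<in> Vs M \<Theta> \<Longrightarrow> a \<in> {1..N} \<Longrightarrow> app (mY \<alpha> \<beta> N a) f \<in> Vs M \<Theta>"
      "f \<in> Vs M \<Theta> \<Longrightarrow> app (mH \<alpha> \<beta> N) f \<in> Vs M \<Theta>" for f a b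
      using IH by blast+
    show ?case
      using sub
      by (auto simp del: One_nat_def intro!: Vs_add Vs_diff Vs_sum Vs_vscale zop_Vs dop_Vs dth_Vs tht_Vs IH)
  qed (simp add: Vs_vscale)
  with assms show "a \<in> {1..N} \<Longrightarrow> b \<in> {1..N} \<Longrightarrow> app (mG \<alpha> \<beta> N a b) f \<in> Vs M \<Theta>"
    and "b \<in> {1..N} \<Longrightarrow> app (mX \<alpha> \<beta> N b) f \<in> Vs M \<Theta>"
    and "a \<in> {1..N} \<Longrightarrow> app (mY \<alpha> \<beta> N a) f \<in> Vs M \<Theta>"
    and "app (mH \<alpha> \<beta> N) f \<in> Vs M \<Theta>" by blast+
qed

text \<open>Unfolding the recursion, each term of \<open>mX\<close>, and each term of
  \<open>mG\<close> that involves odd letters, applies some \<open>dth\<close>, which kills vectors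
  without odd letters.\<close>

lemma mod_theta_free:
  assumes "N \<le> M" "f \<in> Vs M {}"
  shows "a \<in> {1..N} \<Longrightarrow> b \<in> {1..N} \<Longrightarrow> app (mG \<alpha> \<beta> N a b) f \<in> Vs M {}"
    and "b \<in> {1..N} \<Longrightarrow> app (mX \<alpha> \<beta> N b) f = 0"
proof -
  have "N \<le> M \<Longrightarrow> \<forall>f\<in>Vs M {}.
      (\<forall>a\<in>{1..N}. \<forall>b\<in>{1..N}. app (mG \<alpha> \<beta> N a b) f \<in> Vs M {}) \<and>
      (\<forall>b\<in>{1..N}. app (mX \<alpha> \<beta> N b) f = 0)"
  proof (induction N)
    case (Suc N)
    have sub: "N \<le> M" "Suc N \<le> M" using Suc.prems by auto
    have IH: "f \<in> Vs M {} \<Longrightarrow> a \<in> {1..N} \<Longrightarrow> b \<in> {1..N} \<Longrightarrow> app (mG \<alpha> \<beta> N a b) f \<in> Vs M {}"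
      "f \<in> Vs M {} \<Longrightarrow> b \<in> {1..N} \<Longrightarrow> app (mX \<alpha> \<beta> N b) f = 0" for f a b
      using Suc.IH[OF sub(1)] by blast+
    have dth: "app (dth k) f = 0" if "f \<in> Vs M {}" for k f
      using that by (rule dth_kill) simp
    show ?case
      using sub
      by (auto simp del: One_nat_def simp: dth IH(2) dop_Vs
          intro!: Vs_add Vs_diff Vs_sum Vs_vscale zop_Vs dop_Vs IH(1) sum.neutral)
  qed simp
  with assms show "a \<in> {1..N} \<Longrightarrow> b \<in> {1..N} \<Longrightarrow> app (mG \<alpha> \<beta> N a b) f \<in> Vs M {}"
    and "b \<in> {1..N} \<Longrightarrow> app (mX \<alpha> \<beta> N b) f = 0" by blast+
qed

text \<open>The corrections added at higher levels all act first by a derivative in a letter that f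
  does not contain.\<close>

lemma mod_drop:
  assumes "N \<le> n" "f \<in> Vs N \<Theta>"
  shows "a \<in> {1..N} \<Longrightarrow> b \<in> {1..N} \<Longrightarrow> app (mG \<alpha> \<beta> n a b) f = app (mG \<alpha> \<beta> N a b) f"
    and "b \<in> {1..N} \<Longrightarrow> app (mX \<alpha> \<beta> n b) f = app (mX \<alpha> \<beta> N b) f"
    and "a \<in> {1..N} \<Longrightarrow> app (mY \<alpha> \<beta> n a) f = app (mY \<alpha> \<beta> N a) f"
    and "app (mH \<alpha> \<beta> n) f = app (mH \<alpha> \<beta> N) f"
proof -
  have kill: "app (dop (Suc n) k) f = 0" "app (dth (Suc n)) f = 0" if "N \<le> n" for n k
    using that assms(2) by (auto intro: dop_kill dth_kill)
  show "app (mG \<alpha> \<beta> n a b) f = app (mG \<alpha> \<beta> N a b) f" if "a \<in> {1..N}" "b \<in> {1..N}"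
    using assms(1) by (induction n rule: dec_induct) (use that in \<open>auto simp: kill\<close>)
  show "app (mX \<alpha> \<beta> n b) f = app (mX \<alpha> \<beta> N b) f" if "b \<in> {1..N}"
    using assms(1) by (induction n rule: dec_induct) (use that in \<open>auto simp: kill\<close>)
  show "app (mY \<alpha> \<beta> n a) f = app (mY \<alpha> \<beta> N a) f" if "a \<in> {1..N}"
    using assms(1) by (induction n rule: dec_induct) (use that in \<open>auto simp: kill\<close>)
  show "app (mH \<alpha> \<beta> n) f = app (mH \<alpha> \<beta> N) f"
    using assms(1) by (induction n rule: dec_induct) (auto simp: kill)
qed

lemma mod_lower:
  assumes "1 \<le> k" "k < M" "M \<le> n" "f \<in> Vs M \<Theta>"
  shows "app (mG \<alpha> \<beta> n M k) f = app (zop M k) f"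
proof -
  obtain M' where "M = Suc M'" using assms by (cases M) auto
  then show ?thesis using mod_drop(1)[OF assms(3,4), of M k] assms by simp
qed

lemma mod_lower_odd:
  assumes "1 \<le> M" "M \<le> n" "f \<in> Vs M \<Theta>"
  shows "app (mY \<alpha> \<beta> n M) f = app (tht M) f"
proof -
  obtain M' where "M = Suc M'" using assms by (cases M) auto
  then show ?thesis using mod_drop(3)[OF assms(2,3), of M] assms by simp
qed

lemma mod_vac:
  shows "a \<in> {1..n} \<Longrightarrow> b \<in> {1..n} \<Longrightarrow> a < b \<Longrightarrow> app (mG \<alpha> \<beta> n a b) vac = 0"
    and "a \<in> {1..n} \<Longrightarrow> app (mG \<alpha> \<beta> n a a) vac = vscale (\<beta> a) vac"
    and "app (mH \<alpha> \<beta> n) vac = vscale \<alpha> vac"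
    and "b \<in> {1..n} \<Longrightarrow> app (mX \<alpha> \<beta> n b) vac = 0"
proof -
  have kill: "app (dop j k) vac = 0" "app (dth j) vac = 0" for j k
    by (simp_all add: vac_def dop_def dth_def)
  show "app (mG \<alpha> \<beta> n a b) vac = 0" if "a \<in> {1..n}" "b \<in> {1..n}" "a < b"
    using that by (induction n) (auto simp: kill)
  show "app (mG \<alpha> \<beta> n a a) vac = vscale (\<beta> a) vac" if "a \<in> {1..n}"
    using that by (induction n) (auto simp: kill le_Suc_eq)
  show "app (mH \<alpha> \<beta> n) vac = vscale \<alpha> vac"
    by (induction n) (auto simp: kill)
  show "app (mX \<alpha> \<beta> n b) vac = 0" if "b \<in> {1..n}"
    using that by (induction n) (auto simp: kill)
qed

section \<open>Exactness from contracting homotopies\<close>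

text \<open>The anticommutator of X and K commutes with X, hence so does its inverse on the nonzero
  eigenspaces. As 1 / 0 = 0, the operator \<open>diag (\<lambda>s. 1 / g s)\<close> is this inverse,
  extended by zero, and f0 is the component of f with eigenvalue 0.\<close>

lemma exact_homotopy:
  fixes X K :: "'s lin"
  assumes XX: "X * X = 0" and XK: "X * K + K * X = diag g" and f: "app X f = 0"
  defines "f0 \<equiv> app (diag (\<lambda>s. if g s = 0 then 1 else 0)) f"
  shows "f = app X (app K (app (diag (\<lambda>s. 1 / g s)) f)) + f0" "app X f0 = 0"
proof -
  let ?R = "diag (\<lambda>s. 1 / g s)"
  have "X * diag g = X * K * X" "diag g * X = X * K * X"
    unfolding XK[symmetric] by (simp_all add: distrib_left distrib_right mult.assoc[symmetric] XX)
      (simp add: mult.assoc XX)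
  then have comm: "X * diag g = diag g * X" by simp
  have "X * ?R = ?R * X"
    by (rule diag_intertwineI) (simp add: diag_intertwine_support[OF comm])
  moreover have "app (?R * X) f = 0"
    by (simp add: f)
  ultimately have XR: "app X (app ?R f) = 0"
    by (metis app_lin(6))
  have "app X (app K (app ?R f)) = app (X * K + K * X) (app ?R f)"
    by (simp add: XR)
  also have "\<dots> = app (diag g) (app ?R f)"
    by (simp only: XK)
  also have "\<dots> = f - f0"
    by (rule poly_mapping_eqI) (simp add: f0_def lookup_minus)
  finally show 1: "f = app X (app K (app ?R f)) + f0" by simp
  have "app X f = app (X * X) (app K (app ?R f)) + app X f0"
    by (subst 1) simp
  then show "app X f0 = 0"
    using f XX by simp
qed

lemma mX_sq: "i \<in> {1..n} \<Longrightarrow> mX \<alpha> \<beta> n i * mX \<alpha> \<beta> n i = 0"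
  using gl1n.XX0[OF mod_gl1n] .

definition deg_above :: "nat \<Rightarrow> nat \<Rightarrow> state \<Rightarrow> nat" where
  "deg_above n i s = (\<Sum>M\<in>{Suc i..n}. snd s (M, i) + (if M \<in> fst s then 1 else 0))"

lemma of_nat_if: "complex_of_nat (if P then 1 else 0) = (if P then 1 else 0)"
  by simp

text \<open>In the letters \<open>z\<^sub>M\<^sub>i\<close> and \<open>\<theta>\<^sub>M\<close> with \<open>M > i\<close>, the operator \<open>mX \<alpha> \<beta> n i\<close> is a Koszul
  differential.\<close>

lemma koszul_homotopy:
  assumes "i \<in> {1..n}"
  defines "K \<equiv> (\<Sum>M\<in>{Suc i..n}. tht M * dop M i)"
  shows "mX \<alpha> \<beta> n i * K + K * mX \<alpha> \<beta> n i = diag (\<lambda>s. of_nat (deg_above n i s))"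
proof -
  define A where "A M = zop M i * dth M" for M
  define B where "B M = tht M * dop M i" for M
  let ?I = "{Suc i..n}"
  note d = distrib_left distrib_right left_diff_distrib right_diff_distrib mult.assoc
  \<comment> \<open>The summand \<open>mX \<alpha> \<beta> i i\<close> of \<open>mX_eq\<close> only
    knows indices up to i and anticommutes with each term of the homotopy, so that only the Koszul
    part contributes.\<close>
  have anti: "mX \<alpha> \<beta> i i * B M + B M * mX \<alpha> \<beta> i i = 0" if "M \<in> ?I" for M
    using that mod_boson(4)[of i M \<alpha> \<beta> i i] mod_fermion(3)[of i M \<alpha> \<beta> i]
      mod_fermion(3)[of i M \<alpha> \<beta> i, THEN nest]
    by (simp add: B_def d)
  have "A M * B L + B L * A M = (if M = L then diag (\<lambda>s. of_nat (snd s (M, i) + (if M \<in> fst s then 1 else 0))) else 0)" for M L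
  proof -
    have "A M * B L = - (zop M i * tht L * dth M * dop L i) + (if M = L then zop M i * dop L i else 0)"
      by (simp add: A_def B_def d fermion_anticomm(3)[THEN nest])
    moreover have "B L * A M = zop M i * tht L * dth M * dop L i + (if M = L then tht L * dth M else 0)"
      by (simp add: A_def B_def d boson_comm(3) boson_comm(3)[THEN nest] boson_fermion_comm boson_fermion_comm[THEN nest])
    ultimately show ?thesis
      by (simp add: number_op diag_add case_prod_unfold of_nat_if)
  qed
  note AB = this
  have "(\<Sum>M\<in>?I. A M) * (\<Sum>L\<in>?I. B L) + (\<Sum>L\<in>?I. B L) * (\<Sum>M\<in>?I. A M)
      = (\<Sum>M\<in>?I. \<Sum>L\<in>?I. A M * B L + B L * A M)"
    unfolding sum_product by (subst (2) sum.swap) (simp add: sum.distrib)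
  also have "\<dots> = diag (\<lambda>s. of_nat (deg_above n i s))"
    by (simp add: AB deg_above_def diag_sum)
  finally have "(\<Sum>M\<in>?I. A M) * K + K * (\<Sum>M\<in>?I. A M) = diag (\<lambda>s. of_nat (deg_above n i s))"
    by (simp add: K_def B_def)
  moreover have "mX \<alpha> \<beta> i i * K + K * mX \<alpha> \<beta> i i = 0"
    using anti by (simp add: K_def sum_distrib_left sum_distrib_right B_def flip: sum.distrib)
  moreover have "mX \<alpha> \<beta> n i = mX \<alpha> \<beta> i i + (\<Sum>M\<in>?I. A M)"
    using assms mX_eq[of i n] by (simp add: A_def)
  moreover have "(x + a) * k + k * (x + a) = (x * k + k * x) + (a * k + k * a)" for x a k :: "state lin"
    by (simp add: distrib_left distrib_right)
  ultimately show ?thesis by (simp only: add_0_left)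
qed

lemma koszul_reduction:
  assumes i: "i \<in> {1..n}" and f: "f \<in> Vs n {1..n}" "app (mX \<alpha> \<beta> n i) f = 0"
  obtains g f0 where "g \<in> Vs n {1..n}" "f0 \<in> Vs n {1..n}" "f = app (mX \<alpha> \<beta> n i) g + f0"
    "app (mX \<alpha> \<beta> n i) f0 = 0" "\<And>s. lookup f0 s \<noteq> 0 \<Longrightarrow> deg_above n i s = 0"
proof -
  let ?K = "\<Sum>M\<in>{Suc i..n}. tht M * dop M i"
  let ?f0 = "app (diag (\<lambda>s. if (of_nat (deg_above n i s) :: complex) = 0 then 1 else 0)) f"
  note ex = exact_homotopy[OF mX_sq[OF i] koszul_homotopy[OF i] f(2)]
  have "app ?K (app (diag (\<lambda>s. 1 / of_nat (deg_above n i s))) f) \<in> Vs n {1..n}"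
    using f i by (auto intro!: Vs_sum tht_Vs dop_Vs diag_Vs)
  moreover have "?f0 \<in> Vs n {1..n}"
    using f by (intro diag_Vs)
  ultimately show ?thesis
    using ex by (rule that) (simp split: if_splits)
qed

lemma deg_above_zero:
  assumes "deg_above n i s = 0" "M \<in> {Suc i..n}"
  shows "snd s (M, i) = 0" "M \<notin> fst s"
  using assms by (auto simp: deg_above_def split: if_splits)

theorem exact_if_not_nonpos:
  assumes i: "i \<in> {1..n}" and f: "f \<in> Vs n {1..n}" "app (mX \<alpha> \<beta> n i) f = 0"
    and ne: "\<And>m::nat. \<alpha> + \<beta> i + 1 - of_nat i + of_nat m \<noteq> 0"
  shows "\<exists>g\<in>Vs n {1..n}. f = app (mX \<alpha> \<beta> n i) g"
proof -
  obtain g f0 where g: "g \<in> Vs n {1..n}" "f0 \<in> Vs n {1..n}" "f = app (mX \<alpha> \<beta> n i) g + f0"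
    "app (mX \<alpha> \<beta> n i) f0 = 0" "\<And>s. lookup f0 s \<noteq> 0 \<Longrightarrow> deg_above n i s = 0"
    using koszul_reduction[OF i f] by blast
  define h :: "state \<Rightarrow> complex" where "h = (\<lambda>(T, e). \<beta> i + (\<Sum>k\<in>{1..<i}. of_nat (e (i, k))) + (if i \<in> T then 1 else 0)
      - (\<Sum>M\<in>{Suc i..n}. of_nat (e (M, i))) + (\<alpha> - (\<Sum>M\<in>{1..n}. if M \<in> T then 1 else 0)))"
  have XY: "mX \<alpha> \<beta> n i * mY \<alpha> \<beta> n i + mY \<alpha> \<beta> n i * mX \<alpha> \<beta> n i = diag h"
    using gl1n.XY[OF mod_gl1n i i, of \<alpha> \<beta>] mG_diag[OF i, of \<alpha> \<beta>] mH_diag[of \<alpha> \<beta> n]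
    by (simp add: diag_add h_def case_prod_unfold)
  have h: "h s \<noteq> 0" if s: "lookup f0 s \<noteq> 0" for s
  proof -
    obtain T e where Te: "s = (T, e)" by (cases s)
    note z = deg_above_zero[OF g(5)[OF s]]
    have "(\<Sum>M\<in>{Suc i..n}. of_nat (e (M, i))) = (0::complex)"
      using z(1) by (intro sum.neutral) (simp add: Te)
    moreover have "(\<Sum>M\<in>{1..n}. if M \<in> T then 1 else 0) =
        (\<Sum>M\<in>{1..<i}. if M \<in> T then 1 else 0) + ((if i \<in> T then 1 else 0) :: complex)"
    proof -
      have split: "{1..n} = {1..<i} \<union> ({i} \<union> {Suc i..n})" using i by auto
      have "(\<Sum>M\<in>{1..n}. if M \<in> T then 1 else 0) = (\<Sum>M\<in>{1..<i}. if M \<in> T then 1 else 0) +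
          (((if i \<in> T then 1 else 0) :: complex) + (\<Sum>M\<in>{Suc i..n}. if M \<in> T then 1 else 0))"
        unfolding split by (subst sum.union_disjoint; (subst sum.union_disjoint)?) auto
      also have "(\<Sum>M\<in>{Suc i..n}. if M \<in> T then 1 else (0::complex)) = 0"
        using z(2) by (intro sum.neutral) (simp add: Te)
      finally show ?thesis by simp
    qed
    moreover have "(\<Sum>M\<in>{1..<i}. if M \<in> T then 1 else 0) = of_nat i - 1 - (\<Sum>M\<in>{1..<i}. if M \<in> T then 0 else (1::complex))"
    proof -
      have "(\<Sum>M\<in>{1..<i}. if M \<in> T then 1 else 0) + (\<Sum>M\<in>{1..<i}. if M \<in> T then 0 else (1::complex)) = (\<Sum>M\<in>{1..<i}. 1)"
        unfolding sum.distrib[symmetric] by (rule sum.cong) auto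
      also have "\<dots> = of_nat i - 1" using i by (simp add: of_nat_diff)
      finally show ?thesis by (simp add: eq_diff_eq)
    qed
    \<comment> \<open>The integer m is the number of letters z_ik plus the number of odd letters
      \<theta>_M, M < i, that are absent: each one present lowers the eigenvalue of E_00 by one, and
      the constant 1 - i accounts for all of them being present. The letter \<theta>_i cancels
      between E_ii and E_00.\<close>
    ultimately have "h s = \<alpha> + \<beta> i + 1 - of_nat i +
        of_nat ((\<Sum>k\<in>{1..<i}. e (i, k)) + (\<Sum>M\<in>{1..<i}. if M \<in> T then 0 else 1))"
      by (simp add: h_def Te algebra_simps of_nat_sum if_distrib cong: if_cong)
    then show ?thesis by (simp only: ne not_False_eq_True)
  qed
  have "app (diag (\<lambda>s. if h s = 0 then 1 else 0)) f0 = 0"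
    by (rule poly_mapping_eqI) (use h in auto)
  with exact_homotopy(1)[OF mX_sq[OF i] XY g(4)]
  have "f0 = app (mX \<alpha> \<beta> n i) (app (mY \<alpha> \<beta> n i) (app (diag (\<lambda>s. 1 / h s)) f0))" by simp
  with g(3) have "f = app (mX \<alpha> \<beta> n i) (g + app (mY \<alpha> \<beta> n i) (app (diag (\<lambda>s. 1 / h s)) f0))"
    by simp
  moreover have "g + app (mY \<alpha> \<beta> n i) (app (diag (\<lambda>s. 1 / h s)) f0) \<in> Vs n {1..n}"
    using g i by (intro Vs_add mod_Vs(3)[of n] diag_Vs) auto
  ultimately show ?thesis by blast
qed

section \<open>Singular vectors in Verma modules of gl(N)\<close>

definition cm :: "complex \<Rightarrow> 's lin \<Rightarrow> 's lin" where "cm c A = scal c * A"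

lemma cm_simps:
  "A * cm c B = cm c (A * B)" "cm c A * B = cm c (A * B)"
  "cm c (A + B) = cm c A + cm c B" "cm c (A - B) = cm c A - cm c B" "cm c (- A) = - cm c A"
  "cm c (cm d A) = cm (c * d) A" "cm c 0 = 0" "cm 0 A = 0" "cm 1 A = A"
  unfolding cm_def by (simp_all add: distrib_left right_diff_distrib scal_hom mult.assoc)
    (metis mult.assoc scal_central)

lemma cm_add: "cm (c + d) A = cm c A + cm d A" "cm (c - d) A = cm c A - cm d A" "cm (- c) A = - cm c A"
  by (simp_all add: cm_def scal_hom algebra_simps)

lemma cm_minus_two: "cm (- 2) A = - A - A"
  using cm_add(2)[of "- 1" 1 A] by (simp add: cm_add(3) cm_simps)

lemma scal_cm: "A * scal c = cm c A" "scal c * A = cm c A"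
  by (simp_all add: cm_def scal_central)

definition com :: "'a::ring_1 \<Rightarrow> 'a \<Rightarrow> 'a" where "com x y = x * y - y * x"

lemma com_mult: "com e (x * y) = com e x * y + x * com e y"
  by (simp add: com_def algebra_simps)

lemma com_lin: "com e (x + y) = com e x + com e y" "com e 0 = 0" "com e (- x) = - com e x"
  "com e (x - y) = com e x - com e y"
  by (simp_all add: com_def algebra_simps)

lemma com_left: "com (x - y) e = com x e - com y e" "com 0 e = 0"
  by (simp_all add: com_def algebra_simps)

lemma com_sum: "com e (\<Sum>i\<in>I. x i) = (\<Sum>i\<in>I. com e (x i))"
  by (simp add: com_def sum_distrib_left sum_distrib_right sum_subtractf)

lemma com_cm: "com e (cm c x) = cm c (com e x)"
  by (simp add: com_def cm_simps)

lemma com_jacobi: "com e (com f x) = com (com e f) x + com f (com e x)"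
  by (simp add: com_def algebra_simps)

lemma com_pow_zero: "com e f = 0 \<Longrightarrow> com e (f ^ p) = 0"
  by (induction p) (simp_all add: com_mult com_lin, simp add: com_def)

locale gln =
  fixes N :: nat and G :: "nat \<Rightarrow> nat \<Rightarrow> 's lin"
  assumes GG: "\<lbrakk>a \<in> {1..N}; b \<in> {1..N}; c \<in> {1..N}; e \<in> {1..N}\<rbrakk> \<Longrightarrow>
      com (G a b) (G c e) = (if b = c then G a e else 0) - (if a = e then G c b else 0)"
begin

text \<open>Noncommutative polynomials in the lowering operators \<open>G a b\<close>, \<open>b \<ge> m - 1\<close>, with \<open>d\<close> letters
  \<open>G a m\<close> and \<open>k\<close> letters \<open>G a (m - 1)\<close>.\<close>

inductive Qs :: "nat \<Rightarrow> nat \<Rightarrow> nat \<Rightarrow> 's lin \<Rightarrow> bool" for m where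
  one: "Qs m 0 0 1"
| zero: "Qs m d k 0"
| add: "Qs m d k x \<Longrightarrow> Qs m d k y \<Longrightarrow> Qs m d k (x + y)"
| cm: "Qs m d k x \<Longrightarrow> Qs m d k (cm c x)"
| l1: "m < a \<Longrightarrow> a \<le> N \<Longrightarrow> Qs m d k x \<Longrightarrow> Qs m (Suc d) k (G a m * x)"
| l2: "m < a \<Longrightarrow> a \<le> N \<Longrightarrow> Qs m d k x \<Longrightarrow> Qs m d (Suc k) (G a (m - 1) * x)"
| l0: "m < b \<Longrightarrow> b < a \<Longrightarrow> a \<le> N \<Longrightarrow> Qs m d k x \<Longrightarrow> Qs m d k (G a b * x)"

lemma Qs_mult: "Qs m d k x \<Longrightarrow> Qs m d' k' y \<Longrightarrow> Qs m (d + d') (k + k') (x * y)"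
  by (induction rule: Qs.induct) (auto simp: distrib_right cm_simps mult.assoc simp del: One_nat_def intro: Qs.intros)

lemma Qs_sum: "(\<And>i. i \<in> I \<Longrightarrow> Qs m d k (x i)) \<Longrightarrow> Qs m d k (\<Sum>i\<in>I. x i)"
  by (induction I rule: infinite_finite_induct) (auto intro: Qs.intros)

lemma Qs_uminus: "Qs m d k x \<Longrightarrow> Qs m d k (- x)"
  using Qs.cm[of m d k x "- 1"] by (simp add: cm_add(3) cm_simps)

lemma Qs_pow:
  assumes "m < a" "a \<le> N"
  shows "Qs m p 0 (G a m ^ p)"
  by (induction p) (auto intro: Qs.intros assms)

text \<open>For the smaller index the letters of column m + 1 are no longer counted, and those of
  column m move from the second degree to the first.\<close>

lemma Qs_shift: "Qs (Suc m) d k x \<Longrightarrow> Qs m k 0 x"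
proof (induction rule: Qs.induct)
  case (l1 a d k x)
  then show ?case by (intro l0) auto
next
  case (l2 a d k x)
  then show ?case using Qs.l1[of m a k 0 x] by simp
next
  case (l0 b a d k x)
  then show ?case by (intro Qs.l0) auto
qed (auto intro: Qs.intros)

text \<open>The derivation turns a letter \<open>G a (Suc m)\<close> into \<open>- G a m\<close> and
  commutes with all other letters. So it trades one unit of the first degree for one of the second,
  and after d + 1 applications nothing is left.\<close>

lemma Qs_ad:
  assumes "Qs (Suc m) d k x" "1 \<le> m" "Suc m \<le> N"
  shows "(d = 0 \<longrightarrow> com (G (Suc m) m) x = 0) \<and>
    (\<forall>d'. d = Suc d' \<longrightarrow> Qs (Suc m) d' (Suc k) (com (G (Suc m) m) x))"
  using assms(1)
proof (induction rule: Qs.induct)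
  case one
  show ?case by (simp add: com_def)
next
  case (l1 a d k x)
  have c: "com (G (Suc m) m) (G a (Suc m)) = - G a m"
    using GG[of "Suc m" m a "Suc m"] assms l1 by auto
  have 1: "Qs (Suc m) d (Suc k) (- G a m * x)"
    using Qs_uminus[OF Qs.l2[OF l1(1-3)]] by simp
  have 2: "Qs (Suc m) d (Suc k) (G a (Suc m) * com (G (Suc m) m) x)"
    using l1 by (cases d) (auto intro: Qs.intros)
  show ?case using Qs.add[OF 1 2] by (simp add: com_mult c)
next
  case (l2 a d k x)
  have c: "com (G (Suc m) m) (G a m) = 0"
    using GG[of "Suc m" m a m] assms l2 by auto
  show ?case using l2 Qs.l2[OF l2(1,2), of _ "Suc k" "com (G (Suc m) m) x"] by (auto simp: com_mult c)
next
  case (l0 b a d k x)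
  have c: "com (G (Suc m) m) (G a b) = 0"
    using GG[of "Suc m" m a b] assms l0 by auto
  show ?case using l0 by (auto simp: com_mult c intro: Qs.l0)
qed (auto simp: com_lin com_cm cm_simps intro: Qs.intros)

lemma Qs_ad_pow:
  assumes "Qs (Suc m) d 0 x" "1 \<le> m" "Suc m \<le> N"
  shows "k \<le> d \<Longrightarrow> Qs (Suc m) (d - k) k ((com (G (Suc m) m) ^^ k) x)"
    and "d < k \<Longrightarrow> (com (G (Suc m) m) ^^ k) x = 0"
proof -
  show 1: "Qs (Suc m) (d - k) k ((com (G (Suc m) m) ^^ k) x)" if "k \<le> d" for k
    using that
  proof (induction k)
    case (Suc k)
    then have "Qs (Suc m) (d - k) k ((com (G (Suc m) m) ^^ k) x)" "d - k = Suc (d - Suc k)" by auto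
    then show ?case using Qs_ad[of m "d - k" k] assms(2,3) by auto
  qed (use assms in simp)
  show "(com (G (Suc m) m) ^^ k) x = 0" if "d < k"
    using that
  proof (induction k)
    case (Suc k)
    show ?case
    proof (cases "k = d")
      case True
      then show ?thesis using 1[of d] Qs_ad[of m 0 d] assms(2,3) by auto
    next
      case False
      then show ?thesis using Suc by (simp add: com_lin)
    qed
  qed simp
qed

text \<open>The bracket of G j (j + 1) with a letter G a b is nonzero only if a = j + 1 or b = j,
  whereas here j < b and j + 1 < a.\<close>

lemma Qs_raise:
  assumes "Qs (Suc m) d k x" "k = 0" "1 \<le> j" "j \<le> m" "Suc m \<le> N"
  shows "com (G j (Suc j)) x = 0"
  using assms(1,2)
proof (induction rule: Qs.induct)
  case one
  show ?case by (simp add: com_def)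
next
  case (l1 a d k x)
  have "com (G j (Suc j)) (G a (Suc m)) = 0"
    using GG[of j "Suc j" a "Suc m"] assms(3-) l1 by auto
  then show ?case using l1 by (simp add: com_mult)
next
  case (l0 b a d k x)
  have "com (G j (Suc j)) (G a b) = 0"
    using GG[of j "Suc j" a b] assms(3-) l0 by auto
  then show ?case using l0 by (simp add: com_mult)
qed (auto simp: com_lin com_cm cm_simps)

definition has_wt :: "(nat \<Rightarrow> complex) \<Rightarrow> 's lin \<Rightarrow> bool" where
  "has_wt \<nu> x \<longleftrightarrow> (\<forall>c\<in>{1..N}. com (G c c) x = cm (\<nu> c) x)"

lemma has_wt_G:
  assumes "a \<in> {1..N}" "b \<in> {1..N}"
  shows "has_wt (\<lambda>c. (if c = a then 1 else 0) - (if c = b then 1 else 0)) (G a b)"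
  unfolding has_wt_def using assms by (auto simp: GG cm_simps cm_add)

lemma has_wt_mult: "has_wt \<nu> x \<Longrightarrow> has_wt \<nu>' y \<Longrightarrow> has_wt (\<lambda>c. \<nu> c + \<nu>' c) (x * y)"
  unfolding has_wt_def by (auto simp: com_mult cm_simps cm_add)

lemma has_wt_com:
  assumes "has_wt \<nu> x" "has_wt \<nu>' y"
  shows "has_wt (\<lambda>c. \<nu> c + \<nu>' c) (com x y)"
  using has_wt_mult[OF assms] has_wt_mult[OF assms(2,1)]
  by (auto simp: has_wt_def com_def[of x y] com_lin cm_simps add.commute)

lemma has_wt_pow: "has_wt \<nu> x \<Longrightarrow> has_wt (\<lambda>c. of_nat p * \<nu> c) (x ^ p)"
proof (induction p)
  case 0
  show ?case by (simp add: has_wt_def com_def cm_simps)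
next
  case (Suc p)
  from has_wt_mult[OF Suc.prems Suc.IH[OF Suc.prems]] show ?case by (simp add: distrib_right)
qed

lemma has_wt_ad_pow: "has_wt \<nu> x \<Longrightarrow> has_wt \<nu>' f \<Longrightarrow> has_wt (\<lambda>c. \<nu> c + of_nat p * \<nu>' c) ((com f ^^ p) x)"
proof (induction p)
  case (Suc p)
  from has_wt_com[OF Suc.prems(2) Suc.IH[OF Suc.prems]] show ?case
    by (simp add: distrib_right add.left_commute)
qed simp

lemma has_wt_sum: "(\<And>i. i \<in> I \<Longrightarrow> has_wt \<nu> (x i)) \<Longrightarrow> has_wt \<nu> (\<Sum>i\<in>I. x i)"
  by (induction I rule: infinite_finite_induct) (auto simp: has_wt_def com_lin cm_simps)

lemma has_wt_cm: "has_wt \<nu> x \<Longrightarrow> has_wt \<nu> (cm c x)"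
  by (simp add: has_wt_def com_cm cm_simps mult.commute)

lemma has_wtD: "has_wt \<nu> x \<Longrightarrow> c \<in> {1..N} \<Longrightarrow> com (G c c) x = cm (\<nu> c) x"
  by (simp add: has_wt_def)

end

section \<open>Computations with sl(2) triples and iterated derivations\<close>

lemma sl2_pow:
  assumes h: "com h f = cm r f"
  shows "h * f ^ p = f ^ p * h + cm (of_nat p * r) (f ^ p)"
proof (induction p)
  case (Suc p)
  have hf: "h * f = f * h + cm r f" using h by (simp add: com_def algebra_simps)
  have "h * f ^ Suc p = f * (h * f ^ p) + cm r (f ^ Suc p)"
    by (simp add: hf mult.assoc[symmetric]) (simp add: distrib_right cm_simps mult.assoc)
  also have "\<dots> = f ^ Suc p * h + cm (of_nat (Suc p) * r) (f ^ Suc p)"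
    by (simp add: Suc distrib_left cm_simps mult.assoc distrib_right cm_add)
  finally show ?case .
qed (simp add: cm_simps)

lemma sl2_raise:
  assumes ef: "com e f = h" and h: "com h f = cm (-2) f"
  shows "com e (f ^ p) = cm (of_nat p) (f ^ (p - 1) * (h - scal (of_nat p - 1)))"
proof (induction p)
  case 0
  show ?case by (simp add: com_def cm_simps)
next
  case (Suc p)
  have f: "cm (of_nat p) (f * (f ^ (p - 1) * x)) = cm (of_nat p) (f ^ p * x)" for x
    by (cases p) (simp_all add: cm_simps mult.assoc)
  have "com e (f ^ Suc p) = h * f ^ p + f * com e (f ^ p)"
    by (simp add: com_mult ef)
  also have "\<dots> = cm (of_nat (Suc p)) (f ^ p * (h - scal (of_nat (Suc p) - 1)))"
    unfolding sl2_pow[OF h] Suc cm_simps(1) f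
    by (simp add: right_diff_distrib scal_cm cm_simps cm_add algebra_simps)
      (simp add: mult.commute flip: cm_add(1))
  finally show ?case by simp
qed

text \<open>Here x is a highest weight vector of weight s for the adjoint action of the sl(2) triple
  e, h, f, and these are the standard formulas on its string.\<close>

lemma sl2_ad:
  assumes ef: "com e f = h" and h: "com h f = cm (-2) f" and ex: "com e x = 0"
    and hx: "com h x = cm (of_nat s) x"
  shows "com h ((com f ^^ k) x) = cm (of_nat s - 2 * of_nat k) ((com f ^^ k) x)"
    and "com e ((com f ^^ k) x) = cm (of_nat k * (of_nat s - of_nat k + 1)) ((com f ^^ (k - 1)) x)"
proof -
  show 1: "com h ((com f ^^ k) x) = cm (of_nat s - 2 * of_nat k) ((com f ^^ k) x)" for k
  proof (induction k)
    case (Suc k)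
    have "com (cm (-2) f) y = cm (-2) (com f y)" for y by (simp add: com_def cm_simps)
    then show ?case
      by (simp add: com_jacobi[of h f] h Suc com_cm flip: cm_add)
        (simp add: cm_add algebra_simps)
  qed (use hx in simp)
  show "com e ((com f ^^ k) x) = cm (of_nat k * (of_nat s - of_nat k + 1)) ((com f ^^ (k - 1)) x)"
  proof (induction k)
    case (Suc k)
    have f: "cm (of_nat k * c) (com f ((com f ^^ (k - Suc 0)) x)) = cm (of_nat k * c) ((com f ^^ k) x)" for c
      by (cases k) (simp_all add: cm_simps)
    have "com e ((com f ^^ Suc k) x) =
        cm (of_nat s - 2 * of_nat k) ((com f ^^ k) x) + cm (of_nat k * (of_nat s - of_nat k + 1)) ((com f ^^ k) x)"
      by (simp add: com_jacobi[of e f] ef 1 Suc com_cm f)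
    also have "\<dots> = cm (of_nat (Suc k) * (of_nat s - of_nat (Suc k) + 1)) ((com f ^^ k) x)"
      unfolding cm_add(1)[symmetric] by (simp add: algebra_simps)
    finally show ?case by simp
  qed (simp add: ex cm_simps)
qed

lemma com_pow_commute:
  assumes "com e f = 0"
  shows "com e ((com f ^^ k) x) = (com f ^^ k) (com e x)"
proof (induction k)
  case (Suc k)
  then show ?case by (simp add: com_jacobi[of e f] assms com_left)
qed simp

lemma com_pow_mult_commuting:
  assumes "com f y = 0"
  shows "(com f ^^ k) (x * y) = (com f ^^ k) x * y"
  by (induction k) (simp_all add: com_mult assms)

lemma com_pow_mult_step:
  assumes "com f y = - f"
  shows "(com f ^^ k) (x * y) = (com f ^^ k) x * y - cm (of_nat k) ((com f ^^ (k - 1)) x * f)"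
proof (induction k)
  case (Suc k)
  have f: "cm (of_nat k) (com f ((com f ^^ (k - Suc 0)) x) * f) = cm (of_nat k) ((com f ^^ k) x * f)"
    by (cases k) (simp_all add: cm_simps)
  have ff: "com f f = 0" by (simp add: com_def)
  show ?case
    by (simp add: Suc com_lin com_mult com_cm assms ff f cm_add cm_simps)
qed (simp add: cm_simps)

lemma gbinomial_step: "(x gchoose Suc k) * of_nat (Suc k) = (x gchoose k) * (x - of_nat k)"
  for x :: complex
  using gbinomial_mult_1[of x k] by (simp add: algebra_simps)

text \<open>Later \<open>pr\<close> is the projection to the monomials whose even letters are all of
  the form z_{b+1,b}. After it, lowering operators of simple roots become multiplications and all
  others vanish, so that the image of the singular vector is a single monomial, and the vector is
  nonzero.\<close>

locale gln_proj = gln N G for N and G :: "nat \<Rightarrow> nat \<Rightarrow> 's lin" +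
  fixes pr :: "'s lin" and \<zeta> :: "nat \<Rightarrow> 's lin"
  assumes proj: "\<lbrakk>1 \<le> b; b < a; a \<le> N\<rbrakk> \<Longrightarrow> pr * G a b = (if a = Suc b then \<zeta> b * pr else 0)"
begin

text \<open>For positive k there is a letter G a m with a > m + 1; its root is not simple, and the
  letters to its left are either killed or pass through the projection.\<close>

lemma proj_kill:
  assumes "Qs (Suc m) d k x" "0 < k" "1 \<le> m" "Suc m \<le> N"
  shows "pr * x = 0"
  using assms(1,2)
proof (induction rule: Qs.induct)
  case (l1 a d k x)
  have "pr * (G a (Suc m) * x) = (if a = Suc (Suc m) then \<zeta> (Suc m) * (pr * x) else 0)"
    using proj[of "Suc m" a, THEN nest] l1 by (simp add: mult.assoc)
  then show ?case using l1 by simp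
next
  case (l2 a d k x)
  have "pr * (G a m * x) = 0"
    using proj[of m a, THEN nest] l2 assms by (simp add: mult.assoc)
  then show ?case by simp
next
  case (l0 b a d k x)
  have "pr * (G a b * x) = (if a = Suc b then \<zeta> b * (pr * x) else 0)"
    using proj[of b a, THEN nest] l0 by (simp add: mult.assoc)
  then show ?case using l0 by simp
qed (simp_all add: distrib_left cm_simps)

lemma proj_pow:
  assumes "1 \<le> m" "Suc m \<le> N"
  shows "pr * G (Suc m) m ^ p = \<zeta> m ^ p * pr"
proof (induction p)
  case (Suc p)
  have "pr * G (Suc m) m ^ Suc p = \<zeta> m * (pr * G (Suc m) m ^ p)"
    using proj[of m "Suc m", THEN nest] assms by (simp add: mult.assoc)
  then show ?case by (simp add: Suc mult.assoc)
qed simp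

text \<open>Passing from \<open>m + 1\<close> to \<open>m\<close> is a formal version of the identity
  \<open>W = f\<^sup>x W' f\<^sup>s\<^sup>-\<^sup>x\<close> for the simple reflection with lowering operator \<open>f = G (m + 1) m\<close>, where \<open>x\<close>
  is an arbitrary complex number: expand \<open>f\<^sup>x W' f\<^sup>-\<^sup>x\<close> by the binomial series in the derivation
  \<open>com f\<close>, which is nilpotent on \<open>W'\<close>.\<close>

lemma singular_element:
  assumes "1 \<le> m" "m < N" "\<mu> m - \<mu> N + of_nat N - of_nat m = of_nat s"
  shows "\<exists>W. Qs m s 0 W \<and>
    has_wt (\<lambda>c. of_nat s * ((if c = N then 1 else 0) - (if c = m then 1 else 0))) W \<and>
    (\<forall>j\<in>{m..<N}. \<exists>A. com (G j (Suc j)) W = A * (G j j - G (Suc j) (Suc j) - scal (\<mu> j - \<mu> (Suc j))) \<and>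
      (j = m \<longrightarrow> (s = 0 \<longrightarrow> A = 0) \<and> (\<forall>s'. s = Suc s' \<longrightarrow> Qs m s' 0 A))) \<and>
    pr * W = prod_list (map (\<lambda>b. \<zeta> b ^ s) (rev [m..<N])) * pr"
  using assms
proof (induction "N - Suc m" arbitrary: m \<mu>)
  case 0
  then have N: "N = Suc m" by simp
  let ?f = "G N m" and ?e = "G m N" and ?h = "G m m - G N N"
  have ef: "com ?e ?f = ?h"
    using 0 N GG[of m N N m] by simp
  have "com (G m m) ?f = - ?f" "com (G N N) ?f = ?f"
    using 0 N GG[of m m N m] GG[of N N N m] by auto
  then have hf: "com ?h ?f = cm (-2) ?f"
    by (simp add: com_left cm_minus_two)
  have s: "\<mu> m - \<mu> N = of_nat s - 1" using 0 N by (simp add: algebra_simps)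
  have "com ?e (?f ^ s) = cm (of_nat s) (?f ^ (s - 1)) * (?h - scal (\<mu> m - \<mu> N))"
    unfolding sl2_raise[OF ef hf] s by (simp add: cm_simps)
  moreover have "Qs m s' 0 (cm (of_nat s) (?f ^ (s - 1)))" if "s = Suc s'" for s'
    using Qs.cm[OF Qs_pow[of m N s']] N that by simp
  moreover have "cm (of_nat s) (?f ^ (s - 1)) = 0" if "s = 0"
    using that by (simp add: cm_simps)
  moreover have "has_wt (\<lambda>c. of_nat s * ((if c = N then 1 else 0) - (if c = m then 1 else 0))) (?f ^ s)"
    using 0 by (intro has_wt_pow has_wt_G) auto
  moreover have "Qs m s 0 (?f ^ s)"
    using N by (intro Qs_pow) auto
  moreover have "pr * ?f ^ s = prod_list (map (\<lambda>b. \<zeta> b ^ s) (rev [m..<N])) * pr"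
    using proj_pow[of m s] 0 N by simp
  ultimately show ?case
    using N by (intro exI[of _ "?f ^ s"]) auto
next
  case (Suc r)
  let ?f = "G (Suc m) m" and ?e = "G m (Suc m)" and ?h = "G m m - G (Suc m) (Suc m)"
  \<comment> \<open>The dot reflection of \<mu> in the simple root at m has the coordinates \<mu> (m
    + 1) - 1 and \<mu> m + 1 at m and m + 1. The induction hypothesis for m + 1 reads the
    coordinates from m + 1 on.\<close>
  define \<mu>' where "\<mu>' = \<mu>(Suc m := \<mu> m + 1)"
  \<comment> \<open>In W = f^x W' f^(s-x) the right exponent s - x is \<mu> m - \<mu> (m + 1) + 1,
    the one that formally leads from \<mu> to its dot reflection.\<close>
  define x :: complex where "x = of_nat s - (\<mu> m - \<mu> (Suc m) + 1)"
  have mN: "1 \<le> m" "Suc m < N" using Suc.prems Suc.hyps(2) by auto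
  have "r = N - Suc (Suc m)" "1 \<le> Suc m" using Suc.hyps(2) by auto
  moreover have "\<mu>' (Suc m) - \<mu>' N + of_nat N - of_nat (Suc m) = of_nat s"
    using Suc.prems(3) mN by (simp add: \<mu>'_def algebra_simps)
  ultimately obtain W' where W': "Qs (Suc m) s 0 W'"
    and wt': "has_wt (\<lambda>c. of_nat s * ((if c = N then 1 else 0) - (if c = Suc m then 1 else 0))) W'"
    and A': "\<And>j. j \<in> {Suc m..<N} \<Longrightarrow> \<exists>A. com (G j (Suc j)) W' = A * (G j j - G (Suc j) (Suc j) - scal (\<mu>' j - \<mu>' (Suc j))) \<and>
      (j = Suc m \<longrightarrow> (s = 0 \<longrightarrow> A = 0) \<and> (\<forall>s'. s = Suc s' \<longrightarrow> Qs (Suc m) s' 0 A))"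
    and prW: "pr * W' = prod_list (map (\<lambda>b. \<zeta> b ^ s) (rev [Suc m..<N])) * pr"
    using Suc.hyps(1)[of "Suc m" \<mu>'] mN(2) by blast
  define b where "b k = x gchoose k" for k
  define D where "D k = (com ?f ^^ k) W'" for k
  \<comment> \<open>The binomial series of f^x W' f^(-x), multiplied by f^s on the right. It stops
    at k = s because W' has s letters of column m + 1, each of which the derivation can replace
    once.\<close>
  define W where "W = (\<Sum>k\<le>s. cm (b k) (D k * ?f ^ (s - k)))"
  have b_Suc: "b (Suc k) * of_nat (Suc k) = b k * (x - of_nat k)" for k
    unfolding b_def by (rule gbinomial_step)
  have mN': "1 \<le> m" "Suc m \<le> N" using mN by auto
  have DQ: "Qs m k 0 (D k)" if "k \<le> s" for k
    unfolding D_def using Qs_ad_pow(1)[OF W' mN' that] by (rule Qs_shift)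
  have fQ: "Qs m p 0 (?f ^ p)" for p
    using mN by (intro Qs_pow) auto
  have "Qs m s 0 (D k * ?f ^ (s - k))" if "k \<le> s" for k
    using Qs_mult[OF DQ[OF that] fQ[of "s - k"]] that by simp
  then have 1: "Qs m s 0 W"
    unfolding W_def by (intro Qs_sum Qs.cm) auto
  have wtf: "has_wt (\<lambda>c. (if c = Suc m then 1 else 0) - (if c = m then 1 else 0)) ?f"
    using mN by (intro has_wt_G) auto
  have "has_wt (\<lambda>c. of_nat s * ((if c = N then 1 else 0) - (if c = m then 1 else 0))) (D k * ?f ^ (s - k))"
    if "k \<le> s" for k
  proof -
    have "(\<lambda>c. of_nat s * ((if c = N then 1 else 0) - (if c = m then 1 else 0)) :: complex) =
      (\<lambda>c. (of_nat s * ((if c = N then 1 else 0) - (if c = Suc m then 1 else 0)) +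
          of_nat k * ((if c = Suc m then 1 else 0) - (if c = m then 1 else 0))) +
        of_nat (s - k) * ((if c = Suc m then 1 else 0) - (if c = m then 1 else 0)))"
      using that by (auto simp: fun_eq_iff of_nat_diff algebra_simps)
    then show ?thesis
      unfolding D_def by (simp only: has_wt_mult[OF has_wt_ad_pow[OF wt' wtf] has_wt_pow[OF wtf]])
  qed
  then have 2: "has_wt (\<lambda>c. of_nat s * ((if c = N then 1 else 0) - (if c = m then 1 else 0))) W"
    unfolding W_def by (intro has_wt_sum has_wt_cm) auto
  \<comment> \<open>For k > 0 the derivation has created k letters of column m, none of them
    belonging to a simple root; only the term k = 0 survives the projection.\<close>
  have "pr * D k = 0" if "k \<le> s" "k \<noteq> 0" for k
    unfolding D_def using Qs_ad_pow(1)[OF W' mN' that(1)] that(2) mN' by (intro proj_kill) auto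
  then have "pr * cm (b k) (D k * ?f ^ (s - k)) = (if k = 0 then pr * W' * ?f ^ s else 0)" if "k \<le> s" for k
    using that by (auto simp: cm_simps D_def b_def simp flip: mult.assoc)
  then have "pr * W = (\<Sum>k\<le>s. if k = 0 then pr * W' * ?f ^ s else 0)"
    unfolding W_def sum_distrib_left by (intro sum.cong) auto
  then have "pr * W = pr * W' * ?f ^ s"
    by simp
  also have "\<dots> = prod_list (map (\<lambda>b. \<zeta> b ^ s) (rev [m..<N])) * pr"
    using mN by (simp add: prW mult.assoc proj_pow upt_conv_Cons[of m])
  finally have 4: "pr * W = prod_list (map (\<lambda>b. \<zeta> b ^ s) (rev [m..<N])) * pr" .
  have ef: "com ?e ?f = ?h"
    using GG[of m "Suc m" "Suc m" m] mN by simp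
  have hf': "com (G m m) ?f = - ?f" "com (G (Suc m) (Suc m)) ?f = ?f"
    using GG[of m m "Suc m" m] GG[of "Suc m" "Suc m" "Suc m" m] mN by auto
  then have hf: "com ?h ?f = cm (-2) ?f"
    by (simp add: com_left cm_minus_two)
  have com_W: "com e W = (\<Sum>k\<le>s. cm (b k) (com e (D k) * ?f ^ (s - k) + D k * com e (?f ^ (s - k))))" for e
    by (simp add: W_def com_sum com_cm com_mult)
  have 3: "\<exists>A. com (G j (Suc j)) W = A * (G j j - G (Suc j) (Suc j) - scal (\<mu> j - \<mu> (Suc j))) \<and>
      (j = m \<longrightarrow> (s = 0 \<longrightarrow> A = 0) \<and> (\<forall>s'. s = Suc s' \<longrightarrow> Qs m s' 0 A))" if j: "j \<in> {m..<N}" for j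
  proof -
    let ?ej = "G j (Suc j)" and ?hj = "G j j - G (Suc j) (Suc j)"
    \<comment> \<open>For j > m + 1 both e_j and h_j commute with f. For j = m + 1 only e_j does,
      and the shift of h_j has to be compensated. For j = m the operators e_j, f form an sl(2)
      triple with h_j, and e_j commutes with W'.\<close>
    consider (same) "j = m" | (next1) "j = Suc m" | (far) "Suc m < j" using j by fastforce
    then show ?thesis
    proof cases
      case far
      obtain A where A: "com ?ej W' = A * (?hj - scal (\<mu> j - \<mu> (Suc j)))"
        using A'[of j] far j by (auto simp: \<mu>'_def)
      let ?Y = "?hj - scal (\<mu> j - \<mu> (Suc j))"
      have e0: "com ?ej ?f = 0"
        using GG[of j "Suc j" "Suc m" m] far j mN by auto
      have "com (G j j) ?f = 0" "com (G (Suc j) (Suc j)) ?f = 0"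
        using GG[of j j "Suc m" m] GG[of "Suc j" "Suc j" "Suc m" m] far j mN by auto
      then have Y: "?f * ?Y = ?Y * ?f"
        by (simp add: com_def algebra_simps scal_central)
      then have Y0: "com ?f ?Y = 0" by (simp add: com_def)
      have Yp: "?Y * ?f ^ p = ?f ^ p * ?Y" for p
        using power_commuting_commutes[OF Y, of p] by simp
      have "com ?ej W = (\<Sum>k\<le>s. cm (b k) ((com ?f ^^ k) A * ?f ^ (s - k) * ?Y))"
        unfolding com_W D_def com_pow_commute[OF e0] A com_pow_mult_commuting[OF Y0] com_pow_zero[OF e0]
        by (simp only: mult.assoc Yp mult_zero_right add_0_right)
      also have "\<dots> = (\<Sum>k\<le>s. cm (b k) ((com ?f ^^ k) A * ?f ^ (s - k))) * ?Y"
        by (simp only: sum_distrib_right cm_simps)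
      finally have eq: "com ?ej W = \<dots>" .
      show ?thesis by (rule exI, rule conjI, rule eq) (use far in simp)
    next
      case next1
      \<comment> \<open>The values of h_j on \<mu>' and on \<mu>. Since s - c' + c2 = x, moving the
        factor h_j - c' to the right of f^(s-k) turns it into h_j - c2 plus exactly x - k.\<close>
      define c' c2 where "c' = \<mu> m + 1 - \<mu> (Suc j)" and "c2 = \<mu> j - \<mu> (Suc j)"
      obtain A where A: "com ?ej W' = A * (?hj - scal c')"
        and A0: "s = 0 \<longrightarrow> A = 0" and AQ: "\<And>s'. s = Suc s' \<Longrightarrow> Qs (Suc m) s' 0 A"
        using A'[of j] next1 j by (auto simp: \<mu>'_def c'_def)
      \<comment> \<open>Here the degree statement about A for j = m + 1 in the induction hypothesis
        is needed: A has only s - 1 letters of column m + 1.\<close>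
      have As: "(com ?f ^^ s) A = 0"
      proof (cases s)
        case 0
        then show ?thesis using A0 by simp
      next
        case (Suc s')
        then show ?thesis using Qs_ad_pow(2)[OF AQ[OF Suc] mN', of s] by simp
      qed
      have e0: "com ?ej ?f = 0"
        using GG[of j "Suc j" "Suc m" m] next1 j mN by auto
      have "com (G j j) ?f = ?f" "com (G (Suc j) (Suc j)) ?f = 0"
        using GG[of j j "Suc m" m] GG[of "Suc j" "Suc j" "Suc m" m] next1 j mN by auto
      then have hjf: "com ?hj ?f = cm 1 ?f" "com ?f (?hj - scal c') = - ?f"
        by (simp_all add: com_def algebra_simps scal_central cm_simps)
      let ?A = "\<lambda>k. (com ?f ^^ k) A"
      have hp: "?hj * ?f ^ p = ?f ^ p * ?hj + cm (of_nat p) (?f ^ p)" for p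
        using sl2_pow[OF hjf(1)] by simp
      have t1: "?A k * (?hj - scal c') * ?f ^ (s - k) =
          ?A k * ?f ^ (s - k) * (?hj - scal c2) + cm (x - of_nat k) (?A k * ?f ^ (s - k))" if "k \<le> s" for k
      proof -
        have "(?hj - scal c') * ?f ^ (s - k) = ?f ^ (s - k) * (?hj - scal c2)
            + cm (of_nat (s - k) - c' + c2) (?f ^ (s - k))"
          by (simp add: left_diff_distrib[of _ "scal c'"] right_diff_distrib[of _ _ "scal c2"] hp scal_cm cm_add)
        moreover have "of_nat (s - k) - c' + c2 = x - of_nat k"
          using that next1 by (simp add: c'_def c2_def x_def of_nat_diff)
        ultimately show ?thesis by (simp add: mult.assoc distrib_left cm_simps)
      qed
      \<comment> \<open>By (k + 1) b (k + 1) = (x - k) b k, a shift of the index makes the Leibniz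
        terms equal to the remainders of \<open>t1\<close>, with which they cancel; the term k = s
        on the right is zero by \<open>As\<close>.\<close>
      have t2: "(\<Sum>k\<le>s. cm (b k * of_nat k) (?A (k - 1) * ?f * ?f ^ (s - k)))
          = (\<Sum>k\<le>s. cm (b k * (x - of_nat k)) (?A k * ?f ^ (s - k)))"
      proof -
        have "(\<Sum>k\<le>s. cm (b k * of_nat k) (?A (k - 1) * ?f * ?f ^ (s - k)))
          = (\<Sum>k<s. cm (b (Suc k) * of_nat (Suc k)) (?A k * ?f * ?f ^ (s - Suc k)))"
          by (subst sum.atMost_shift) (simp add: cm_simps)
        also have "\<dots> = (\<Sum>k<s. cm (b k * (x - of_nat k)) (?A k * ?f ^ (s - k)))"
          by (intro sum.cong refl, subst b_Suc)
            (simp add: mult.assoc Suc_diff_Suc flip: power_Suc)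
        also have "\<dots> = (\<Sum>k\<le>s. cm (b k * (x - of_nat k)) (?A k * ?f ^ (s - k)))"
          by (simp add: lessThan_Suc_atMost[symmetric] As cm_simps)
        finally show ?thesis .
      qed
      have "com ?ej W = (\<Sum>k\<le>s. cm (b k) (?A k * ?f ^ (s - k) * (?hj - scal c2))
          + cm (b k * (x - of_nat k)) (?A k * ?f ^ (s - k))
          - cm (b k * of_nat k) (?A (k - 1) * ?f * ?f ^ (s - k)))"
        unfolding com_W D_def com_pow_commute[OF e0] A com_pow_mult_step[OF hjf(2)] com_pow_zero[OF e0]
      proof (intro sum.cong refl)
        fix k assume "k \<in> {..s}"
        then have "k \<le> s" by simp
        from t1[OF this]
        show "cm (b k) ((?A k * (?hj - scal c') - cm (of_nat k) (?A (k - 1) * ?f)) * ?f ^ (s - k) + (com ?f ^^ k) W' * 0) =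
            cm (b k) (?A k * ?f ^ (s - k) * (?hj - scal c2)) + cm (b k * (x - of_nat k)) (?A k * ?f ^ (s - k))
            - cm (b k * of_nat k) (?A (k - 1) * ?f * ?f ^ (s - k))"
          by (simp only: left_diff_distrib[of _ "cm _ _"] cm_simps mult_zero_right add_0_right)
      qed
      also have "\<dots> = (\<Sum>k\<le>s. cm (b k) (?A k * ?f ^ (s - k) * (?hj - scal c2)))"
        by (simp add: sum.distrib sum_subtractf t2[simplified])
      also have "\<dots> = (\<Sum>k\<le>s. cm (b k) (?A k * ?f ^ (s - k))) * (?hj - scal c2)"
        by (simp only: sum_distrib_right cm_simps)
      finally have eq: "com ?ej W = \<dots>" .
      show ?thesis by (rule exI, rule conjI, rule eq[unfolded c2_def]) (use next1 in simp)
    next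
      case same
      define c1 where "c1 = \<mu> m - \<mu> (Suc m)"
      have eW: "com ?e W' = 0"
        using Qs_raise[OF W'] mN by auto
      have "com (G m m) W' = 0" "com (G (Suc m) (Suc m)) W' = - cm (of_nat s) W'"
        using has_wtD[OF wt', of m] has_wtD[OF wt', of "Suc m"] mN by (auto simp: cm_simps cm_add)
      then have hW: "com ?h W' = cm (of_nat s) W'"
        by (simp add: com_def algebra_simps)
      have 1: "com ?e (D k) = cm (of_nat k * (of_nat s - of_nat k + 1)) (D (k - 1))" for k
        unfolding D_def by (rule sl2_ad(2)[OF ef hf eW hW])
      have t1: "D k * com ?e (?f ^ (s - k)) =
          cm (of_nat (s - k)) (D k * ?f ^ (s - k - 1) * (?h - scal c1))
          + cm (of_nat (s - k) * (of_nat k - x)) (D k * ?f ^ (s - k - 1))" if "k \<le> s" for k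
      proof -
        have e: "of_nat (s - k) - 1 = c1 - (of_nat k - x)"
          using that by (simp add: c1_def x_def of_nat_diff)
        have "?h - scal (of_nat (s - k) - 1) = (?h - scal c1) + scal (of_nat k - x)"
          unfolding e scal_hom(6) by simp
        then show ?thesis
          unfolding sl2_raise[OF ef hf] by (simp only: distrib_left scal_cm cm_simps mult.assoc)
      qed
      \<comment> \<open>The same recurrence and index shift, now applied to the sl(2) string of W';
        the result cancels the remainders of \<open>t1\<close> and leaves a multiple of h -
        c1.\<close>
      have t2: "(\<Sum>k\<le>s. cm (b k * (of_nat k * (of_nat s - of_nat k + 1))) (D (k - 1) * ?f ^ (s - k)))
          = (\<Sum>k<s. cm (b k * (x - of_nat k) * of_nat (s - k)) (D k * ?f ^ (s - k - 1)))"
      proof -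
        have "(\<Sum>k\<le>s. cm (b k * (of_nat k * (of_nat s - of_nat k + 1))) (D (k - 1) * ?f ^ (s - k)))
          = (\<Sum>k<s. cm (b (Suc k) * (of_nat (Suc k) * (of_nat s - of_nat (Suc k) + 1))) (D k * ?f ^ (s - Suc k)))"
          by (subst sum.atMost_shift) (simp add: cm_simps)
        also have "\<dots> = (\<Sum>k<s. cm (b k * (x - of_nat k) * of_nat (s - k)) (D k * ?f ^ (s - k - 1)))"
          by (intro sum.cong refl) (simp add: of_nat_diff b_Suc[symmetric] mult.assoc del: of_nat_Suc, simp)
        finally show ?thesis .
      qed
      have "com ?e W = (\<Sum>k\<le>s. cm (b k * (of_nat k * (of_nat s - of_nat k + 1))) (D (k - 1) * ?f ^ (s - k))
          + cm (b k * of_nat (s - k)) (D k * ?f ^ (s - k - 1) * (?h - scal c1))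
          + cm (b k * (of_nat (s - k) * (of_nat k - x))) (D k * ?f ^ (s - k - 1)))"
        unfolding com_W
      proof (intro sum.cong refl)
        fix k assume "k \<in> {..s}"
        then have "k \<le> s" by simp
        then show "cm (b k) (com ?e (D k) * ?f ^ (s - k) + D k * com ?e (?f ^ (s - k))) =
          cm (b k * (of_nat k * (of_nat s - of_nat k + 1))) (D (k - 1) * ?f ^ (s - k))
          + cm (b k * of_nat (s - k)) (D k * ?f ^ (s - k - 1) * (?h - scal c1))
          + cm (b k * (of_nat (s - k) * (of_nat k - x))) (D k * ?f ^ (s - k - 1))"
          by (simp only: 1 t1 cm_simps add.assoc)
      qed
      also have "\<dots> = (\<Sum>k<s. cm (b k * (x - of_nat k) * of_nat (s - k)) (D k * ?f ^ (s - k - 1)))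
          + (\<Sum>k<s. cm (b k * of_nat (s - k)) (D k * ?f ^ (s - k - 1) * (?h - scal c1)))
          + (\<Sum>k<s. cm (b k * (of_nat (s - k) * (of_nat k - x))) (D k * ?f ^ (s - k - 1)))"
        unfolding sum.distrib t2 by (simp add: lessThan_Suc_atMost[symmetric] cm_simps)
      also have "\<dots> = (\<Sum>k<s. cm (b k * of_nat (s - k)) (D k * ?f ^ (s - k - 1) * (?h - scal c1)))"
      proof -
        have "cm (b k * (x - of_nat k) * of_nat (s - k)) y + cm (b k * (of_nat (s - k) * (of_nat k - x))) y = 0" for k y
          unfolding cm_add(1)[symmetric] by (simp add: algebra_simps cm_simps)
        then have "(\<Sum>k<s. cm (b k * (x - of_nat k) * of_nat (s - k)) (D k * ?f ^ (s - k - 1)))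
          + (\<Sum>k<s. cm (b k * (of_nat (s - k) * (of_nat k - x))) (D k * ?f ^ (s - k - 1))) = 0"
          unfolding sum.distrib[symmetric] by (intro sum.neutral) blast
        then show ?thesis by (simp add: add.commute add.left_commute)
      qed
      also have "\<dots> = (\<Sum>k<s. cm (b k * of_nat (s - k)) (D k * ?f ^ (s - k - 1))) * (?h - scal c1)"
        by (simp only: sum_distrib_right cm_simps)
      finally have "com ?e W = (\<Sum>k<s. cm (b k * of_nat (s - k)) (D k * ?f ^ (s - k - 1))) * (?h - scal c1)" .
      moreover have "Qs m s' 0 (\<Sum>k<s. cm (b k * of_nat (s - k)) (D k * ?f ^ (s - k - 1)))" if s: "s = Suc s'" for s'
      proof (intro Qs_sum Qs.cm)
        fix k assume "k \<in> {..<s}"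
        then show "Qs m s' 0 (D k * ?f ^ (s - k - 1))"
          using Qs_mult[OF DQ[of k] fQ[of "s - k - 1"]] s by simp
      qed
      moreover have "(\<Sum>k<s. cm (b k * of_nat (s - k)) (D k * ?f ^ (s - k - 1))) = 0" if "s = 0"
        using that by simp
      ultimately show ?thesis unfolding same c1_def by blast
    qed
  qed
  show ?case using 1 2 3 4 by blast
qed

end

section \<open>Application to the Fock space model\<close>

lemma mG_lower_eq:
  assumes "b < a" "a \<le> n" "1 \<le> b"
  shows "mG \<alpha> \<beta> n a b = zop a b - (\<Sum>M\<in>{Suc a..n}. zop M b * dop M a)"
  using assms
proof (induction n)
  case (Suc n)
  then show ?case by (cases "a = Suc n") (simp_all add: algebra_simps)
qed simp

definition simple_support :: "state lin" where
  "simple_support = diag (\<lambda>s. if \<forall>a b. snd s (a, b) \<noteq> 0 \<longrightarrow> a = Suc b then 1 else 0)"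

lemma simple_support_zop:
  "simple_support * zop a b = (if a = Suc b then zop (Suc b) b * simple_support else 0)"
proof (rule lin_eqI_single)
  fix s :: state
  obtain T e where s: "s = (T, e)" by (cases s)
  have key: "(\<forall>c d. (e((a, b) := Suc (e (a, b)))) (c, d) \<noteq> 0 \<longrightarrow> c = Suc d) \<longleftrightarrow>
      a = Suc b \<and> (\<forall>c d. e (c, d) \<noteq> 0 \<longrightarrow> c = Suc d)"
    by (metis fun_upd_apply nat.distinct(1) prod.inject)
  show "app (simple_support * zop a b) (Poly_Mapping.single s 1) =
      app (if a = Suc b then zop (Suc b) b * simple_support else 0) (Poly_Mapping.single s 1)"
  proof -
    have "app (simple_support * zop a b) (Poly_Mapping.single s 1) =
        Poly_Mapping.single (T, e((a, b) := Suc (e (a, b))))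
          (if \<forall>c d. (e((a, b) := Suc (e (a, b)))) (c, d) \<noteq> 0 \<longrightarrow> c = Suc d then 1 else 0)"
      by (simp add: simple_support_def zop_def s del: fun_upd_apply)
    then show ?thesis
      unfolding key by (cases "a = Suc b") (simp_all add: simple_support_def zop_def s)
  qed
qed

interpretation mG_gln: gln N "mG \<alpha> \<beta> N"
proof
  fix a b c e assume "a \<in> {1..N}" "b \<in> {1..N}" "c \<in> {1..N}" "e \<in> {1..N}"
  from gl1n.GG[OF mod_gl1n this, of \<alpha> \<beta>]
  show "com (mG \<alpha> \<beta> N a b) (mG \<alpha> \<beta> N c e) =
      (if b = c then mG \<alpha> \<beta> N a e else 0) - (if a = e then mG \<alpha> \<beta> N c b else 0)"
    by (simp add: com_def)
qed

interpretation mG_proj: gln_proj N "mG \<alpha> \<beta> N" simple_support "\<lambda>b. zop (Suc b) b"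
proof
  fix b a assume "1 \<le> b" "b < a" "a \<le> N"
  then show "simple_support * mG \<alpha> \<beta> N a b = (if a = Suc b then zop (Suc b) b * simple_support else 0)"
    by (simp add: mG_lower_eq right_diff_distrib sum_distrib_left simple_support_zop flip: mult.assoc)
qed

lemma Qs_theta_free:
  assumes "mG_gln.Qs N \<alpha> \<beta> m d k x" "k = 0" "1 \<le> m" "f \<in> Vs N {}"
  shows "app x f \<in> Vs N {}"
  using assms(1,2,4)
proof (induction arbitrary: f rule: mG_gln.Qs.induct)
  case (l1 a d k x)
  then show ?case using assms(3) mod_theta_free(1)[of N N "app x f" a m] by simp
next
  case (l0 b a d k x)
  then show ?case using assms(3) mod_theta_free(1)[of N N "app x f" a b] by simp
qed (auto simp: cm_def)

lemma zop_pow_single: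
  "\<exists>t'. app (zop a b ^ p) (Poly_Mapping.single t 1) = Poly_Mapping.single t' 1"
proof (induction p)
  case 0
  show ?case by (rule exI[of _ t]) simp
next
  case (Suc p)
  then obtain t' where "app (zop a b ^ p) (Poly_Mapping.single t 1) = Poly_Mapping.single t' 1"
    by blast
  then have "app (zop a b ^ Suc p) (Poly_Mapping.single t 1) =
      Poly_Mapping.single ((\<lambda>(T, e). (T, e((a, b) := Suc (e (a, b))))) t') 1"
    by (simp add: zop_def)
  then show ?case by (rule exI)
qed

lemma zop_prod_list_single:
  "\<exists>t. app (prod_list (map (\<lambda>b. zop (Suc b) b ^ s) l)) (Poly_Mapping.single u 1) = Poly_Mapping.single t 1"
proof (induction l)
  case (Cons b l)
  then obtain t where t: "app (prod_list (map (\<lambda>b. zop (Suc b) b ^ s) l)) (Poly_Mapping.single u 1) = Poly_Mapping.single t 1"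
    by blast
  then show ?case using zop_pow_single[of "Suc b" b s t] by simp
next
  case Nil
  show ?case by (rule exI[of _ u]) simp
qed

text \<open>Apply the element W for the weight \<beta> to the vacuum. For k \<ge> j the commutator
  with the simple raising operator ends in a factor that kills the vacuum, for k < j it is zero, and
  E_ki is an iterated bracket of simple raising operators. If j = i, then s = 0 and the vacuum
  itself will do.\<close>

lemma singular_vector:
  assumes j: "1 \<le> j" "j \<le> i" and s: "\<beta> j - \<beta> i + of_nat i - of_nat j = of_nat s"
  obtains w where "w \<in> Vs i {}" "w \<noteq> 0" "\<And>k. k \<in> {1..<i} \<Longrightarrow> app (mG \<alpha> \<beta> i k i) w = 0"
    "\<And>c. c \<in> {1..i} \<Longrightarrow> app (mG \<alpha> \<beta> i c c) w =
      vscale (\<beta> c + of_nat s * ((if c = i then 1 else 0) - (if c = j then 1 else 0))) w"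
proof (cases "j = i")
  case True
  then have "s = 0" using s by simp
  show ?thesis
  proof (rule that[of vac])
    show "vac \<noteq> 0" by (metis vac_def lookup_single_eq lookup_zero zero_neq_one)
  qed (use mod_vac \<open>s = 0\<close> in auto)
next
  case False
  let ?G = "mG \<alpha> \<beta> i"
  have ji: "j < i" using False j by simp
  obtain W where W: "mG_gln.Qs i \<alpha> \<beta> j s 0 W"
    and wt: "mG_gln.has_wt i \<alpha> \<beta> (\<lambda>c. of_nat s * ((if c = i then 1 else 0) - (if c = j then 1 else 0))) W"
    and A: "\<forall>k\<in>{j..<i}. \<exists>A. com (?G k (Suc k)) W = A * (?G k k - ?G (Suc k) (Suc k) - scal (\<beta> k - \<beta> (Suc k))) \<and>
      (k = j \<longrightarrow> (s = 0 \<longrightarrow> A = 0) \<and> (\<forall>s'. s = Suc s' \<longrightarrow> mG_gln.Qs i \<alpha> \<beta> j s' 0 A))"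
    and pr: "simple_support * W = prod_list (map (\<lambda>b. zop (Suc b) b ^ s) (rev [j..<i])) * simple_support"
    using mG_proj.singular_element[OF j(1) ji s, of \<alpha> \<beta>] by blast
  let ?w = "app W vac"
  have 1: "?w \<in> Vs i {}"
    using Qs_theta_free[OF W refl j(1)] by simp
  have "app simple_support vac = vac"
    by (simp add: simple_support_def vac_def)
  \<comment> \<open>The projection is a product of letters applied to the vacuum, that is, one
    monomial with coefficient 1.\<close>
  then have "app simple_support ?w = app (prod_list (map (\<lambda>b. zop (Suc b) b ^ s) (rev [j..<i]))) vac"
    using arg_cong[OF pr, of "\<lambda>x. app x vac"] by simp
  then obtain t where "app simple_support ?w = Poly_Mapping.single t 1"
    using zop_prod_list_single[of s "rev [j..<i]" "({}, \<lambda>_. 0)"] by (auto simp: vac_def)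
  then have 2: "?w \<noteq> 0"
    by (metis app_zero lookup_single_eq lookup_zero zero_neq_one)
  have simple: "app (?G k (Suc k)) ?w = 0" if k: "k \<in> {1..<i}" for k
  proof -
    have "app (com (?G k (Suc k)) W) vac = 0"
    proof (cases "j \<le> k")
      case True
      then obtain A where "com (?G k (Suc k)) W = A * (?G k k - ?G (Suc k) (Suc k) - scal (\<beta> k - \<beta> (Suc k)))"
        using A[rule_format, of k] k by auto
      moreover have "vscale (\<beta> k) vac - vscale (\<beta> (Suc k)) vac - vscale (\<beta> k - \<beta> (Suc k)) vac = 0"
        by (rule poly_mapping_eqI) (simp add: lookup_minus lookup_add algebra_simps)
      ultimately show ?thesis using k mod_vac(2)[of k i] mod_vac(2)[of "Suc k" i] by simp
    next
      case False
      then obtain m where m: "j = Suc m" "k \<le> m" using j by (cases j) auto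
      have "com (?G k (Suc k)) W = 0"
        using mG_gln.Qs_raise[OF W[unfolded m(1)] refl, of k] k m ji by simp
      then show ?thesis by simp
    qed
    moreover have "app (?G k (Suc k)) vac = 0"
      using k by (intro mod_vac(1)) auto
    ultimately show ?thesis by (simp add: com_def)
  qed
  have 3: "app (?G k i) ?w = 0" if k: "k \<in> {1..<i}" for k
    using k
  proof (induction "i - Suc k" arbitrary: k)
    case 0
    then have "i = Suc k" by auto
    then show ?case using simple[of k] 0 by simp
  next
    case (Suc r)
    then have r: "Suc k \<in> {1..<i}" "r = i - Suc (Suc k)" by auto
    have "com (?G k (Suc k)) (?G (Suc k) i) = ?G k i"
      using mG_gln.GG[of k i "Suc k" "Suc k" i] Suc.prems r by auto
    then have "app (?G k i) ?w = app (com (?G k (Suc k)) (?G (Suc k) i)) ?w" by simp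
    also have "\<dots> = 0"
      using Suc.hyps(1)[OF r(2,1)] simple[OF Suc.prems] by (simp add: com_def)
    finally show ?case .
  qed
  have 4: "app (?G c c) ?w = vscale (\<beta> c + of_nat s * ((if c = i then 1 else 0) - (if c = j then 1 else 0))) ?w"
    if c: "c \<in> {1..i}" for c
  proof -
    let ?\<nu> = "of_nat s * ((if c = i then 1 else 0) - (if c = j then 1 else 0))"
    have "app (com (?G c c) W) vac = vscale ?\<nu> ?w"
      using mG_gln.has_wtD[OF wt c] by (simp add: cm_def)
    then have "app (?G c c) ?w = vscale (\<beta> c) ?w + vscale ?\<nu> ?w"
      using mod_vac(2)[OF c] by (simp add: com_def algebra_simps)
    then show ?thesis by (simp only: vscale_add_left)
  qed
  show ?thesis using 1 2 3 4 by (rule that)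
qed

section \<open>Products of all odd lowering and raising operators\<close>

text \<open>The two products have opposite orders, so that in
  \<open>top_right X k * top_left Y k\<close> equal indices meet in the middle and can be removed
  from there.\<close>

primrec top_left :: "(nat \<Rightarrow> 'a::monoid_mult) \<Rightarrow> nat \<Rightarrow> 'a" where
  "top_left Y 0 = 1"
| "top_left Y (Suc k) = Y (Suc k) * top_left Y k"

primrec top_right :: "(nat \<Rightarrow> 'a::monoid_mult) \<Rightarrow> nat \<Rightarrow> 'a" where
  "top_right X 0 = 1"
| "top_right X (Suc k) = top_right X k * X (Suc k)"

context gl1n
begin

abbreviation "Yt \<equiv> top_left Y"
abbreviation "Xt \<equiv> top_right X"

lemma Y_Yt_zero: "1 \<le> a \<Longrightarrow> a \<le> k \<Longrightarrow> k \<le> N \<Longrightarrow> Y a * Yt k = 0"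
proof (induction k)
  case (Suc k)
  show ?case
  proof (cases "a = Suc k")
    case True
    then show ?thesis using Suc.prems YY0[of a] by (simp flip: mult.assoc)
  next
    case False
    then show ?thesis using Suc YY[of a "Suc k", THEN nest] by (simp add: mult.assoc)
  qed
qed simp

lemma Xt_X_zero: "1 \<le> a \<Longrightarrow> a \<le> k \<Longrightarrow> k \<le> N \<Longrightarrow> Xt k * X a = 0"
proof (induction k)
  case (Suc k)
  show ?case
  proof (cases "a = Suc k")
    case True
    then show ?thesis using Suc.prems XX0[of a] by (simp add: mult.assoc)
  next
    case False
    have "Xt k * (X (Suc k) * X a) = - (Xt k * X a * X (Suc k))"
      using Suc.prems XX[of "Suc k" a] by (simp add: mult.assoc)
    then show ?thesis using Suc False by (simp add: mult.assoc)
  qed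
qed simp

lemma G_Yt_commute:
  assumes "a \<in> {1..N}" "b \<in> {1..N}" "k < b"
  shows "G a b * Yt k = Yt k * G a b"
  using assms(3)
proof (induction k)
  case (Suc k)
  then show ?case using GY[OF assms(1,2), of "Suc k", THEN nest] assms by (simp add: mult.assoc)
qed simp

lemma H_Yt: "k \<le> N \<Longrightarrow> H * Yt k = Yt k * H - of_nat k * Yt k"
proof (induction k)
  case (Suc k)
  have "H * Yt (Suc k) = Y (Suc k) * (H * Yt k) - Y (Suc k) * Yt k"
    using HY[of "Suc k", THEN nest] Suc.prems by (simp add: left_diff_distrib mult.assoc)
  also have "\<dots> = Yt (Suc k) * H - Y (Suc k) * (of_nat k * Yt k) - Yt (Suc k)"
    using Suc by (simp add: right_diff_distrib mult.assoc)
  also have "Y (Suc k) * (of_nat k * Yt k) = of_nat k * Yt (Suc k)"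
    by (metis mult.assoc mult_of_nat_commute top_left.simps(2))
  finally show ?case by (simp add: distrib_right)
qed simp

lemma G_diag_Yt:
  assumes "a \<in> {1..N}"
  shows "k \<le> N \<Longrightarrow> G a a * Yt k = Yt k * G a a + (if a \<le> k then Yt k else 0)"
proof (induction k)
  case (Suc k)
  then have "G a a * Yt (Suc k) = Y (Suc k) * (G a a * Yt k) + (if a = Suc k then Yt (Suc k) else 0)"
    using GY[OF assms assms, of "Suc k", THEN nest] by (auto simp: mult.assoc distrib_right)
  with Suc show ?case by (auto simp: distrib_left mult.assoc)
qed (use assms in auto)

end

text \<open>Moving X_i past Y_{k+1} leaves E_{k+1,i}, which commutes with Y_1, ..., Y_k because k <
  i, and then kills w.\<close>

lemma X_Yt_app:
  assumes gl: "gl1n N G X Y (H :: 's lin)" and i: "i \<in> {1..N}"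
    and v: "\<And>k. k \<in> {1..<i} \<Longrightarrow> app (G k i) w = 0" "app (X i) w = 0"
  shows "k < i \<Longrightarrow> app (X i) (app (top_left Y k) w) = 0"
proof (induction k)
  case (Suc k)
  have "X i * top_left Y (Suc k) = - (Y (Suc k) * (X i * top_left Y k)) + top_left Y k * G (Suc k) i"
    using gl1n.XY[OF gl, of i "Suc k", THEN nest] gl1n.G_Yt_commute[OF gl, of "Suc k" i k] Suc.prems i
    by (simp add: mult.assoc distrib_right left_diff_distrib)
  from arg_cong[OF this, of "\<lambda>x. app x w"] show ?case using Suc v by simp
qed (use v in simp)

text \<open>The correction in \<open>mY\<close> at level N + 1 carries a factor \<theta>_{N+1}, so a
  further \<theta>_{N+1} in front annihilates it.\<close>

lemma theta_Yt_level:
  "k \<le> N \<Longrightarrow> tht (Suc N) * top_left (mY \<alpha> \<beta> (Suc N)) k = tht (Suc N) * top_left (mY \<alpha> \<beta> N) k"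
proof (induction k)
  case (Suc k)
  let ?t = "tht (Suc N)" and ?Y = "mY \<alpha> \<beta> N (Suc k)"
  have a: "?t * ?Y = - (?Y * ?t)"
    using mod_fermion(5)[of N "Suc N" \<alpha> \<beta> "Suc k"] by simp
  have "?t * (mY \<alpha> \<beta> (Suc N) (Suc k)) = ?t * ?Y"
    using Suc.prems fermion_sq(1)[of "Suc N", THEN nest] by (simp add: right_diff_distrib)
  note 1 = this[THEN nest]
  have "?t * (?Y * top_left (mY \<alpha> \<beta> (Suc N)) k) = - (?Y * (?t * top_left (mY \<alpha> \<beta> (Suc N)) k))"
    by (rule a[THEN nest, of _, unfolded mult_minus_left mult.assoc])
  also have "\<dots> = ?t * (?Y * top_left (mY \<alpha> \<beta> N) k)"
    using Suc.IH[OF Suc_leD[OF Suc.prems]] a[THEN nest] by (simp only: mult_minus_left mult.assoc)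
  finally show ?case using 1 by (simp only: top_left.simps mult.assoc)
qed simp

lemma Yt_level: "top_left (mY \<alpha> \<beta> (Suc N)) (Suc N) = tht (Suc N) * top_left (mY \<alpha> \<beta> N) N"
  using theta_Yt_level[of N N \<alpha> \<beta>] by simp

lemma dth_Yt:
  assumes "app (dth M) w = 0" "N < M"
  shows "app (dth M) (app (top_left (mY \<alpha> \<beta> N) k) w) = 0"
proof (induction k)
  case (Suc k)
  have "dth M * mY \<alpha> \<beta> N (Suc k) = - (mY \<alpha> \<beta> N (Suc k) * dth M)"
    using mod_fermion(6)[OF assms(2)] by simp
  from arg_cong[OF this, of "\<lambda>x. app x (app (top_left (mY \<alpha> \<beta> N) k) w)"] show ?case
    using Suc by simp
qed (use assms in simp)

text \<open>The derivative by \<theta>_{N+1} strips the outermost factor and thus leads back to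
  level N.\<close>

lemma Yt_nonzero:
  assumes "w \<in> Vs M {}" "w \<noteq> 0"
  shows "app (top_left (mY \<alpha> \<beta> N) N) w \<noteq> 0"
proof (induction N)
  case (Suc N)
  have d: "app (dth (Suc N)) w = 0" using assms(1) by (rule dth_kill) simp
  have "app (dth (Suc N)) (app (top_left (mY \<alpha> \<beta> (Suc N)) (Suc N)) w)
      = app (dth (Suc N) * tht (Suc N)) (app (top_left (mY \<alpha> \<beta> N) N) w)"
    unfolding Yt_level by simp
  also have "\<dots> = app (top_left (mY \<alpha> \<beta> N) N) w"
    unfolding fermion_anticomm(3) using dth_Yt[OF d, of N] by simp
  finally show ?case using Suc by (metis app_zero)
qed (use assms in simp)

lemma Yt_Vs:
  assumes "f \<in> Vs M \<Theta>" "{1..N} \<subseteq> \<Theta>" "N \<le> M" "k \<le> N"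
  shows "app (top_left (mY \<alpha> \<beta> N) k) f \<in> Vs M \<Theta>"
  using assms(4) by (induction k) (use assms in \<open>auto intro!: mod_Vs(3)\<close>)

section \<open>Non-exactness\<close>

text \<open>Descending in c, the letters z_Mc with M > c are already excluded, and the weight at c
  becomes a sum of nonnegative integers that has to be zero.\<close>

lemma valid_level_from_weights:
  assumes v: "valid n (T, e)" and i: "i \<le> n"
    and w: "\<And>c. c \<in> {Suc i..n} \<Longrightarrow> (\<Sum>k\<in>{1..<c}. of_nat (e (c, k))) + (if c \<in> T then 1 else 0)
      - (\<Sum>M\<in>{Suc c..n}. of_nat (e (M, c))) = (0 :: complex)"
  shows "valid i (T, e)"
proof -
  have "(\<forall>k. e (c, k) = 0) \<and> c \<notin> T" if c: "c \<in> {Suc i..n}" for c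
    using c
  proof (induction "n - c" arbitrary: c rule: less_induct)
    case less
    have "(\<Sum>M\<in>{Suc c..n}. of_nat (e (M, c))) = (0 :: complex)"
      using less.hyps less.prems by (intro sum.neutral) auto
    with w[OF less.prems] have "of_nat ((\<Sum>k\<in>{1..<c}. e (c, k)) + (if c \<in> T then 1 else 0)) = (0 :: complex)"
      by (cases "c \<in> T") (simp_all add: add.commute)
    then have *: "(\<Sum>k\<in>{1..<c}. e (c, k)) + (if c \<in> T then 1 else 0) = 0"
      by (simp only: of_nat_eq_0_iff)
    then have "e (c, k) = 0" if "k \<in> {1..<c}" for k
      using that by simp
    moreover have "e (c, k) = 0" if "k \<notin> {1..<c}" for k
      using v that unfolding valid_def snd_conv by (metis atLeastLessThan_iff)
    ultimately show ?case using * by (auto split: if_splits)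
  qed
  then have T: "c \<notin> T" and e: "e (c, k) = 0" if "c \<in> {Suc i..n}" for c k
    using that by auto
  show ?thesis
    unfolding valid_def fst_conv snd_conv
  proof (intro conjI allI impI subsetI)
    fix k assume k: "k \<in> T"
    then have "k \<in> {1..n}" using v by (auto simp: valid_def)
    then show "k \<in> {1..i}" using T[of k] k by fastforce
  next
    fix a b assume ab: "e (a, b) \<noteq> 0"
    then have *: "1 \<le> b \<and> b < a \<and> a \<le> n" using v by (simp add: valid_def)
    show "1 \<le> b" "b < a" using * by auto
    show "a \<le> i" using * e[of a b] ab by fastforce
  qed
qed

lemma weight_eigenvectorD:
  assumes "app (diag \<gamma>) f = vscale c f" "lookup f s \<noteq> 0"
  shows "\<gamma> s = c"
proof -
  have "\<gamma> s * lookup f s = c * lookup f s"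
    using arg_cong[OF assms(1), of "\<lambda>f. lookup f s"] by simp
  with assms(2) show ?thesis by simp
qed

theorem not_exact:
  assumes i: "i \<in> {1..n}" and j: "1 \<le> j" "j \<le> i"
    and s: "\<beta> j - \<beta> i + of_nat i - of_nat j = of_nat s"
    and a: "\<alpha> + \<beta> j + 1 - of_nat j = 0"
  obtains f where "f \<in> Vs n {1..n}" "app (mX \<alpha> \<beta> n i) f = 0" "\<And>g. g \<in> Vs n {1..n} \<Longrightarrow> f \<noteq> app (mX \<alpha> \<beta> n i) g"
proof -
  have ii: "i \<in> {1..i}" "i \<le> n" using i by auto
  let ?Y = "mY \<alpha> \<beta> i"
  define \<omega> where "\<omega> c = \<beta> c + of_nat s * ((if c = i then 1 else 0) - (if c = j then 1 else 0))" for c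
  obtain w where w: "w \<in> Vs i {}" "w \<noteq> 0" "\<And>k. k \<in> {1..<i} \<Longrightarrow> app (mG \<alpha> \<beta> i k i) w = 0"
    "\<And>c. c \<in> {1..i} \<Longrightarrow> app (mG \<alpha> \<beta> i c c) w = vscale (\<omega> c) w"
    using singular_vector[OF j s, of \<alpha>] unfolding \<omega>_def by blast
  interpret gl: gl1n i "mG \<alpha> \<beta> i" "mX \<alpha> \<beta> i" ?Y "mH \<alpha> \<beta> i" by (rule mod_gl1n)
  define f where "f = app (top_left ?Y (i - 1)) w"
  have f: "f \<in> Vs i {1..i}"
    unfolding f_def using w(1) by (intro Yt_Vs) (auto intro: Vs_mono)
  have wX: "app (mX \<alpha> \<beta> i i) w = 0"
    using mod_theta_free(2)[OF order.refl w(1) ii(1)] .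
  have Xf: "app (mX \<alpha> \<beta> i i) f = 0"
    unfolding f_def by (rule X_Yt_app[OF mod_gl1n ii(1) w(3) wX]) (use i in auto)
  have Yf: "app (?Y i) f \<noteq> 0"
  proof -
    have "app (?Y i) f = app (top_left ?Y i) w"
      using i by (cases i) (simp_all add: f_def del: mY.simps)
    then show ?thesis using Yt_nonzero[OF w(1,2)] by simp
  qed
  define \<gamma> :: "nat \<Rightarrow> state \<Rightarrow> complex" where "\<gamma> c = (\<lambda>(T, e). \<beta> c + (\<Sum>k\<in>{1..<c}. of_nat (e (c, k))) + (if c \<in> T then 1 else 0)
      - (\<Sum>M\<in>{Suc c..n}. of_nat (e (M, c))))" for c
  define \<eta> :: "state \<Rightarrow> complex" where "\<eta> = (\<lambda>(T, e). \<alpha> - (\<Sum>M\<in>{1..n}. if M \<in> T then 1 else 0))"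
  have G: "mG \<alpha> \<beta> n c c = diag (\<gamma> c)" if "c \<in> {1..n}" for c
    unfolding \<gamma>_def by (rule mG_diag[OF that])
  have H: "mH \<alpha> \<beta> n = diag \<eta>"
    unfolding \<eta>_def by (rule mH_diag)
  \<comment> \<open>The weight of f: each factor Y_c with c < i adds one at c to the weight of w,
    and above i the weight is that of the vacuum.\<close>
  define \<nu> where "\<nu> c = (if c \<le> i then \<omega> c + (if c < i then 1 else 0) else \<beta> c)" for c
  have f\<gamma>: "\<gamma> c t = \<nu> c" if c: "c \<in> {1..n}" and t: "lookup f t \<noteq> 0" for c t
  proof (cases "c \<le> i")
    case True
    then have c': "c \<in> {1..i}" using c by auto
    have "app (mG \<alpha> \<beta> n c c) f = app (mG \<alpha> \<beta> i c c) f"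
      using mod_drop(1)[OF ii(2) f c' c'] .
    also have "\<dots> = app (mG \<alpha> \<beta> i c c * top_left ?Y (i - 1)) w"
      by (simp add: f_def)
    also have "\<dots> = vscale (\<omega> c) f + (if c < i then f else 0)"
      using gl.G_diag_Yt[OF c', of "i - 1"] w(4)[OF c'] i by (auto simp: f_def)
    also have "\<dots> = vscale (\<nu> c) f"
      using True by (auto simp: \<nu>_def vscale_add_left)
    finally show ?thesis using weight_eigenvectorD[OF _ t] G[OF c] by simp
  next
    case False
    obtain T e where Te: "t = (T, e)" by (cases t)
    have v: "valid i (T, e)" using VsD[OF f t] by (simp add: Te)
    have "e (c, k) = 0" "e (M, c) = 0" if "M > c" for k M
      using v False that unfolding valid_def snd_conv by (meson le_trans less_imp_le not_le)+
    then have "e (c, k) = 0" "\<And>M. M > c \<Longrightarrow> e (M, c) = 0" for k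
      by (meson lessI, blast)
    moreover have "c \<notin> T" using v False by (auto simp: valid_def)
    ultimately show ?thesis using False by (simp add: \<gamma>_def \<nu>_def Te)
  qed
  have f\<eta>: "\<eta> t = \<alpha> - (of_nat i - 1)" if t: "lookup f t \<noteq> 0" for t
  proof -
    have "app (mH \<alpha> \<beta> n) f = app (mH \<alpha> \<beta> i) f"
      using mod_drop(4)[OF ii(2) f] .
    also have "\<dots> = app (mH \<alpha> \<beta> i * top_left ?Y (i - 1)) w"
      by (simp add: f_def)
    also have "\<dots> = app (top_left ?Y (i - 1)) (app (mH \<alpha> \<beta> i) w) - vscale (of_nat (i - 1)) f"
    proof -
      have "of_nat k = (scal (of_nat k) :: state lin)" for k
        by (induction k) (simp_all add: scal_hom)
      then show ?thesis
        using gl.H_Yt[of "i - 1"] by (simp add: f_def)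
    qed
    also have "app (mH \<alpha> \<beta> i) w = vscale \<alpha> w"
    proof (rule poly_mapping_eqI)
      fix t
      show "lookup (app (mH \<alpha> \<beta> i) w) t = lookup (vscale \<alpha> w) t"
        using VsD[OF w(1), of t] by (cases "lookup w t = 0") (auto simp: mH_diag case_prod_unfold)
    qed
    also have "app (top_left ?Y (i - 1)) (vscale \<alpha> w) - vscale (of_nat (i - 1)) f = vscale (\<alpha> - (of_nat i - 1)) f"
      using i by (simp add: f_def of_nat_diff) (rule poly_mapping_eqI, simp add: lookup_minus algebra_simps)
    finally show ?thesis using weight_eigenvectorD[OF _ t] H by simp
  qed
  let ?X = "mX \<alpha> \<beta> n i"
  have Xn: "app ?X f = 0"
    using mod_drop(2)[OF ii(2) f ii(1)] Xf by simp
  have "f \<noteq> app ?X g" if g: "g \<in> Vs n {1..n}" for g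
  proof
    assume fg: "f = app ?X g"
    \<comment> \<open>Since X_i lowers the weight at i by one and raises that of E_00 by one,
      \<open>P\<close> describes the weight of a preimage of f and \<open>P'\<close> that of f. The
      projections to these weights are intertwined by X_i, so g may be replaced by its component of
      this weight.\<close>
    define P where "P t \<longleftrightarrow> (\<forall>c\<in>{1..n}. \<gamma> c t = \<nu> c + (if c = i then 1 else 0)) \<and> \<eta> t = \<alpha> - of_nat i" for t
    define P' where "P' t \<longleftrightarrow> (\<forall>c\<in>{1..n}. \<gamma> c t = \<nu> c) \<and> \<eta> t = \<alpha> - (of_nat i - 1)" for t
    have comm: "?X * diag (\<gamma> c) = diag (\<lambda>t. \<gamma> c t + (if c = i then 1 else 0)) * ?X" if c: "c \<in> {1..n}" for c
      using gl1n.GX[OF mod_gl1n c c i, of \<alpha> \<beta>] G[OF c]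
      by (simp add: distrib_right scal_eq_diag[symmetric] scal_hom flip: diag_add)
    have \<gamma>X: "\<gamma> c t = \<gamma> c u + (if c = i then 1 else 0)"
      if "c \<in> {1..n}" "lookup (app ?X (Poly_Mapping.single t 1)) u \<noteq> 0" for c t u
      by (rule diag_intertwine_support[OF comm[OF that(1)] that(2)])
    have comm\<eta>: "?X * diag \<eta> = diag (\<lambda>t. \<eta> t - 1) * ?X"
      using gl1n.HX[OF mod_gl1n i, of \<alpha> \<beta>] H
      by (simp add: left_diff_distrib scal_eq_diag[symmetric] scal_hom flip: diag_diff)
    have \<eta>X: "\<eta> t = \<eta> u - 1" if "lookup (app ?X (Poly_Mapping.single t 1)) u \<noteq> 0" for t u
      by (rule diag_intertwine_support[OF comm\<eta> that])
    have "P t \<longleftrightarrow> P' u" if "lookup (app ?X (Poly_Mapping.single t 1)) u \<noteq> 0" for t u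
    proof -
      have "\<eta> t = \<alpha> - of_nat i \<longleftrightarrow> \<eta> u = \<alpha> - (of_nat i - 1)"
        unfolding \<eta>X[OF that] by (auto simp: algebra_simps)
      then show ?thesis
        using \<gamma>X[OF _ that] unfolding P_def P'_def by auto
    qed
    then have XP: "?X * diag (\<lambda>t. if P t then 1 else 0) = diag (\<lambda>t. if P' t then 1 else 0) * ?X"
      by (intro diag_intertwineI) auto
    define g' where "g' = app (diag (\<lambda>t. if P t then 1 else 0)) g"
    have "app (diag (\<lambda>t. if P' t then 1 else 0)) f = f"
    proof (rule poly_mapping_eqI)
      fix t
      have "P' t" if "lookup f t \<noteq> 0"
        using f\<gamma>[OF _ that] f\<eta>[OF that] by (simp add: P'_def)
      then show "lookup (app (diag (\<lambda>t. if P' t then 1 else 0)) f) t = lookup f t"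
        by auto
    qed
    then have fg': "f = app ?X g'"
      using arg_cong[OF XP, of "\<lambda>x. app x g"] fg by (simp add: g'_def)
    have g'n: "g' \<in> Vs n {1..n}"
      unfolding g'_def using g by (rule diag_Vs)
    have P: "P t" if "lookup g' t \<noteq> 0" for t
      using that by (auto simp: g'_def split: if_splits)
    \<comment> \<open>The weights above i exclude all letters of index above i. Then the eigenvalue
      \<alpha> - i of E_00 says that there are i odd letters among \<theta>_1, ..., \<theta>_i,
      hence all of them.\<close>
    have level: "valid i t \<and> i \<in> fst t" if t: "lookup g' t \<noteq> 0" for t
    proof -
      obtain T e where Te: "t = (T, e)" by (cases t)
      have v: "valid n (T, e)" using VsD[OF g'n t] by (simp add: Te)
      have vi: "valid i (T, e)"
      proof (rule valid_level_from_weights[OF v ii(2)])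
        fix c assume c: "c \<in> {Suc i..n}"
        then have "\<gamma> c t = \<beta> c" using P[OF t] by (auto simp: P_def \<nu>_def)
        then show "(\<Sum>k\<in>{1..<c}. of_nat (e (c, k))) + (if c \<in> T then 1 else 0)
            - (\<Sum>M\<in>{Suc c..n}. of_nat (e (M, c))) = (0 :: complex)"
          by (cases "c \<in> T") (simp_all add: \<gamma>_def Te algebra_simps)
      qed
      then have T: "T \<subseteq> {1..i}" by (simp add: valid_def)
      have "(\<Sum>M\<in>{1..n}. if M \<in> T then 1 else 0) = (of_nat (card T) :: complex)"
      proof -
        have "{1..n} \<inter> T = T" using T ii by auto
        then show ?thesis by (simp add: sum.If_cases)
      qed
      moreover have "\<eta> t = \<alpha> - of_nat i" using P[OF t] by (simp add: P_def)
      ultimately have "(of_nat (card T) :: complex) = of_nat i" by (simp add: \<eta>_def Te)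
      then have "card T = card {1..i}" by simp
      then have "T = {1..i}" using T by (intro card_subset_eq) auto
      then show ?thesis using vi ii by (simp add: Te)
    qed
    have g'i: "g' \<in> Vs i {1..i}"
      by (rule VsI) (use level in \<open>auto simp: valid_def\<close>)
    have "app (?Y i) g' = app (tht i) g'"
      using mod_lower_odd[OF _ order.refl g'i] i by simp
    also have "\<dots> = 0"
      unfolding tht_def app_mop pmext_def
      by (rule sum.neutral) (use level in \<open>auto simp: in_keys_iff\<close>)
    finally have Yg: "app (?Y i) g' = 0" .
    have hg: "app (mG \<alpha> \<beta> i i i + mH \<alpha> \<beta> i) g' = 0"
    proof -
      have "app (mG \<alpha> \<beta> i i i + mH \<alpha> \<beta> i) g' = app (mG \<alpha> \<beta> n i i + mH \<alpha> \<beta> n) g'"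
        using mod_drop(1)[OF ii(2) g'i ii(1) ii(1)] mod_drop(4)[OF ii(2) g'i] by simp
      also have "\<dots> = app (diag (\<lambda>t. \<gamma> i t + \<eta> t)) g'"
        by (simp only: G[OF i] H diag_add)
      also have "\<dots> = 0"
      proof (rule poly_mapping_eqI)
        fix t
        have "\<gamma> i t + \<eta> t = 0" if "lookup g' t \<noteq> 0"
        proof -
          have 1: "\<gamma> i t = \<omega> i + 1" "\<eta> t = \<alpha> - of_nat i"
            using P[OF that] i by (auto simp: P_def \<nu>_def)
          \<comment> \<open>Adding s turns \<beta> i into \<beta> j + i - j, so that E_00 + E_ii has
            the eigenvalue \<alpha> + \<beta> j + 1 - j on the preimage, not the one formed with
            \<beta> i.\<close>
          have 2: "\<omega> i = \<beta> j + of_nat i - of_nat j"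
            using s by (auto simp: \<omega>_def algebra_simps)
          show ?thesis using a unfolding 1 2 by (simp add: algebra_simps)
        qed
        then show "lookup (app (diag (\<lambda>t. \<gamma> i t + \<eta> t)) g') t = lookup 0 t"
          by auto
      qed
      finally show ?thesis .
    qed
    have "app (?Y i) f = app (?Y i * mX \<alpha> \<beta> i i) g'"
      using fg' mod_drop(2)[OF ii(2) g'i ii(1)] by simp
    also have "?Y i * mX \<alpha> \<beta> i i = mG \<alpha> \<beta> i i i + mH \<alpha> \<beta> i - mX \<alpha> \<beta> i i * ?Y i"
      using gl.XY[OF ii(1) ii(1)] by (simp add: algebra_simps)
    also have "app \<dots> g' = 0"
      using hg Yg by simp
    finally show False using Yf by simp
  qed
  then show ?thesis
    using Xn Vs_mono[OF f ii(2)] ii by (intro that[of f]) auto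
qed

section \<open>Exactness for typical initial segments\<close>

context gl1n
begin

lemma G_Yt_upper:
  assumes "a \<in> {1..N}" "b \<in> {1..N}" "a < b"
  shows "k \<le> N \<Longrightarrow> G a b * Yt k = Yt k * G a b"
proof (induction k)
  case (Suc k)
  have "G a b * Yt (Suc k) = Yt (Suc k) * G a b + (if b = Suc k then Y a * Yt k else 0)"
    using Suc GY[OF assms(1,2), of "Suc k", THEN nest] by (simp add: mult.assoc distrib_right)
  then show ?case using Y_Yt_zero[of a k] assms Suc.prems by auto
qed simp

text \<open>The bracket replaces Y_b by Y_a. As long as Y_a is not among the factors the result need
  not vanish, but multiplication by Y_a kills it; this weaker statement carries the induction up to
  k = a, from where on the commutator is zero.\<close>

lemma G_Yt_lower:
  assumes "a \<in> {1..N}" "b \<in> {1..N}" "b < a"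
  shows "k \<le> N \<Longrightarrow> (k < a \<longrightarrow> Y a * (G a b * Yt k - Yt k * G a b) = 0) \<and>
    (a \<le> k \<longrightarrow> G a b * Yt k = Yt k * G a b)"
proof (induction k)
  case (Suc k)
  let ?Z = "\<lambda>k. G a b * Yt k - Yt k * G a b"
  have Z: "?Z (Suc k) = Y (Suc k) * ?Z k + (if b = Suc k then Y a * Yt k else 0)"
    using Suc GY[OF assms(1,2), of "Suc k", THEN nest]
    by (simp add: mult.assoc distrib_right right_diff_distrib)
  have YZ: "Y a * (Y (Suc k) * ?Z k) = - (Y (Suc k) * (Y a * ?Z k))"
    using YY[of a "Suc k", THEN nest] assms Suc.prems by (simp add: mult.assoc)
  have YY: "Y a * (Y a * x) = 0" for x
    using YY0[of a, THEN nest] assms by simp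
  consider "Suc k < a" | "Suc k = a" | "a \<le> k" by linarith
  then show ?case
  proof cases
    case 1
    then have "Y a * ?Z (Suc k) = 0"
      unfolding Z distrib_left YZ using Suc by (simp add: YY)
    with 1 show ?thesis by simp
  next
    case 2
    then have "?Z (Suc k) = 0"
      unfolding Z using Suc assms by auto
    with 2 show ?thesis by simp
  next
    case 3
    then have "?Z (Suc k) = 0"
      unfolding Z using Suc assms by auto
    with 3 show ?thesis by simp
  qed
qed simp

text \<open>The product of all odd lowering operators spans a top exterior power, on which gl(N)
  acts through the trace.\<close>

lemma G_Yt:
  assumes "a \<in> {1..N}" "b \<in> {1..N}"
  shows "G a b * Yt N = Yt N * G a b + (if a = b then Yt N else 0)"
  using G_Yt_upper[OF assms, of N] G_Yt_lower[OF assms, of N] G_diag_Yt[OF assms(1), of N] assms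
  by (cases a b rule: linorder_cases) auto

lemma G_Xt_lower:
  assumes "a \<in> {1..N}" "b \<in> {1..N}" "b < a"
  shows "k \<le> N \<Longrightarrow> G a b * Xt k = Xt k * G a b"
proof (induction k)
  case (Suc k)
  have "G a b * Xt (Suc k) = Xt k * (G a b * X (Suc k))"
    using Suc by (simp flip: mult.assoc)
  also have "\<dots> = Xt (Suc k) * G a b - (if a = Suc k then Xt k * X b else 0)"
    using Suc.prems GX[OF assms(1,2), of "Suc k"] by (simp add: right_diff_distrib mult.assoc)
  finally show ?case using Xt_X_zero[of b k] assms Suc.prems by auto
qed simp

definition "Tl k = prod_list (map X [Suc k..<Suc N])"

lemma Tl_step: "k < N \<Longrightarrow> Tl k = X (Suc k) * Tl (Suc k)"
  by (simp add: Tl_def upt_conv_Cons del: upt_Suc)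

lemma Tl_zero: "Tl 0 = Xt N"
proof -
  have "prod_list (map X [Suc 0..<Suc k]) = Xt k" for k
    by (induction k) auto
  then show ?thesis by (simp add: Tl_def)
qed

text \<open>The sign depends on the number of factors; it is left open because only the vanishing of
  products matters.\<close>

lemma X_Tl:
  assumes "j \<in> {1..N}"
  shows "X j * Tl k = Tl k * X j \<or> X j * Tl k = - (Tl k * X j)"
proof -
  have *: "X j * prod_list (map X l) = prod_list (map X l) * X j \<or>
      X j * prod_list (map X l) = - (prod_list (map X l) * X j)" if "set l \<subseteq> {1..N}" for l
    using that
  proof (induction l)
    case (Cons c l)
    have "X j * X c = - (X c * X j)" using XX[OF assms, of c] Cons.prems by simp
    from this[THEN nest] have "X j * prod_list (map X (c # l)) = - (X c * (X j * prod_list (map X l)))"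
      by (simp add: mult.assoc)
    with Cons show ?case by (auto simp: mult.assoc)
  qed simp
  show ?thesis unfolding Tl_def by (rule *) auto
qed

end

text \<open>The inner pair with index k + 1 acts on Y_k ... Y_1 vac as E_{k+1,k+1} + E_00, because
  X_{k+1} kills this vector; the eigenvalues are \<beta> (k + 1) and \<alpha> - k.\<close>

lemma Xt_Yt_vac:
  assumes "k \<le> i"
  shows "app (top_right (mX \<alpha> \<beta> i) k * top_left (mY \<alpha> \<beta> i) k) vac =
    vscale (\<Prod>j\<in>{1..k}. \<alpha> + \<beta> j + 1 - of_nat j) vac"
  using assms
proof (induction k)
  case (Suc k)
  interpret gl: gl1n i "mG \<alpha> \<beta> i" "mX \<alpha> \<beta> i" "mY \<alpha> \<beta> i" "mH \<alpha> \<beta> i" by (rule mod_gl1n)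
  have k: "Suc k \<in> {1..i}" using Suc.prems by auto
  let ?v = "app (gl.Yt k) vac"
  have "app (mX \<alpha> \<beta> i (Suc k)) ?v = 0"
    by (rule X_Yt_app[OF mod_gl1n k]) (use k in \<open>auto intro: mod_vac\<close>)
  then have "app (mX \<alpha> \<beta> i (Suc k) * mY \<alpha> \<beta> i (Suc k)) ?v =
      app (mG \<alpha> \<beta> i (Suc k) (Suc k) * gl.Yt k) vac + app (mH \<alpha> \<beta> i * gl.Yt k) vac"
    using gl.XY[OF k k] by simp
  also have "app (mG \<alpha> \<beta> i (Suc k) (Suc k) * gl.Yt k) vac = vscale (\<beta> (Suc k)) ?v"
    using gl.G_diag_Yt[OF k, of k] k mod_vac(2)[OF k] by simp
  also have "app (mH \<alpha> \<beta> i * gl.Yt k) vac = vscale \<alpha> ?v - vscale (of_nat k) ?v"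
  proof -
    have "of_nat k = (scal (of_nat k) :: state lin)" for k
      by (induction k) (simp_all add: scal_hom)
    then show ?thesis using gl.H_Yt[of k] k by (simp add: mod_vac(3))
  qed
  also have "vscale (\<beta> (Suc k)) ?v + (vscale \<alpha> ?v - vscale (of_nat k) ?v) = vscale (\<alpha> + \<beta> (Suc k) + 1 - of_nat (Suc k)) ?v"
    by (rule poly_mapping_eqI) (simp add: lookup_add lookup_minus algebra_simps)
  finally have "app (mX \<alpha> \<beta> i (Suc k) * mY \<alpha> \<beta> i (Suc k)) ?v = vscale (\<alpha> + \<beta> (Suc k) + 1 - of_nat (Suc k)) ?v" .
  then have "app (gl.Xt (Suc k) * gl.Yt (Suc k)) vac = vscale (\<alpha> + \<beta> (Suc k) + 1 - of_nat (Suc k)) (app (gl.Xt k) ?v)"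
    by (simp del: mX.simps mY.simps)
  with Suc show ?case by (simp del: mX.simps mY.simps add: mult.commute)
qed simp

section \<open>Freeness over the exterior algebra in X_1, ..., X_i\<close>

context
  fixes \<alpha> :: complex and \<beta> :: "nat \<Rightarrow> complex" and i n :: nat and c :: complex
  assumes i: "1 \<le> i" "i \<le> n"
    and c: "c = (\<Prod>j\<in>{1..i}. \<alpha> + \<beta> j + 1 - of_nat j)" "c \<noteq> 0"
begin

interpretation gl: gl1n i "mG \<alpha> \<beta> i" "mX \<alpha> \<beta> i" "mY \<alpha> \<beta> i" "mH \<alpha> \<beta> i" by (rule mod_gl1n)

lemma zop_top_commute:
  assumes "i < M"
  shows "zop M k * gl.Yt r = gl.Yt r * zop M k" "zop M k * gl.Xt r = gl.Xt r * zop M k"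
proof -
  show "zop M k * gl.Yt r = gl.Yt r * zop M k"
  proof (induction r)
    case (Suc r)
    then show ?case using mod_boson(5)[OF assms, of \<alpha> \<beta> "Suc r" k, symmetric, THEN nest] by (simp add: mult.assoc del: mY.simps)
  qed simp
  show "zop M k * gl.Xt r = gl.Xt r * zop M k"
  proof (induction r)
    case (Suc r)
    have "zop M k * gl.Xt (Suc r) = gl.Xt r * (zop M k * mX \<alpha> \<beta> i (Suc r))"
      using Suc by (simp del: mX.simps flip: mult.assoc)
    then show ?case using mod_boson(3)[OF assms, of \<alpha> \<beta> "Suc r" k] by (simp add: mult.assoc del: mX.simps)
  qed simp
qed

text \<open>By \<open>Vs_induct\<close> it is enough to pass the even lowering letters: for M \<le>
  i they are operators E_Mk with k < M, which commute with both products, and for M > i they commute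
  with every operator of level i.\<close>

lemma Xt_Yt_scalar:
  assumes "f \<in> Vs n {}"
  shows "app (gl.Xt i) (app (gl.Yt i) f) = vscale c f"
  using assms
proof (induction rule: Vs_induct)
  case (vac d)
  show ?case using Xt_Yt_vac[of i i \<alpha> \<beta>] c by (simp add: mult.commute)
next
  case (z M k g)
  show ?case
  proof (cases "M \<le> i")
    case True
    then have Mk: "M \<in> {1..i}" "k \<in> {1..i}" using z by auto
    have zG: "app (zop M k) g = app (mG \<alpha> \<beta> i M k) g"
      using mod_lower[OF z(1,2) True z(4)] by simp
    have "gl.Xt i * (gl.Yt i * mG \<alpha> \<beta> i M k) = mG \<alpha> \<beta> i M k * (gl.Xt i * gl.Yt i)"
      using gl.G_Yt[OF Mk] gl.G_Xt_lower[OF Mk z(2) order.refl, THEN nest] z(2) by (simp add: mult.assoc)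
    from arg_cong[OF this, of "\<lambda>x. app x g"] show ?thesis
      using z(5) by (simp add: zG)
  next
    case False
    then have "gl.Xt i * (gl.Yt i * zop M k) = zop M k * (gl.Xt i * gl.Yt i)"
      using zop_top_commute[of M k i] by (metis mult.assoc not_le)
    from arg_cong[OF this, of "\<lambda>x. app x g"] show ?thesis
      using z(5) by simp
  qed
qed (simp_all add: vscale_add)

text \<open>The span of the vectors X_{k_1} ... X_{k_r} Y_i ... Y_1 f with f free of odd letters. It
  is shown to be stable under gl(1|i) and under the remaining letters z_Mk, and since c is nonzero
  it contains the vacuum; hence it contains all of \<open>Vs n {1..i}\<close>.\<close>

inductive_set R where
  base: "f \<in> Vs n {} \<Longrightarrow> app (gl.Yt i) f \<in> R"
| add: "u \<in> R \<Longrightarrow> v \<in> R \<Longrightarrow> u + v \<in> R"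
| X: "k \<in> {1..i} \<Longrightarrow> u \<in> R \<Longrightarrow> app (mX \<alpha> \<beta> i k) u \<in> R"

lemma R_vscale: "u \<in> R \<Longrightarrow> vscale d u \<in> R"
proof (induction rule: R.induct)
  case (base f)
  then show ?case using R.base[of "vscale d f"] by auto
next
  case (X k u)
  then show ?case using R.X[of k "vscale d u"] by auto
qed (auto simp: vscale_add intro: R.add)

lemma R_uminus: "u \<in> R \<Longrightarrow> - u \<in> R"
  using R_vscale[of u "- 1"] by (metis (no_types) add.right_inverse add_eq_0_iff vscale_add_left vscale_one vscale_zero(2))

lemma R_diff: "u \<in> R \<Longrightarrow> v \<in> R \<Longrightarrow> u - v \<in> R"
  using R.add[of u "- v"] R_uminus[of v] by simp

lemma R_zero: "0 \<in> R"
  using R.base[of 0] by simp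

lemma R_G:
  assumes "a \<in> {1..i}" "b \<in> {1..i}"
  shows "u \<in> R \<Longrightarrow> app (mG \<alpha> \<beta> i a b) u \<in> R"
proof (induction rule: R.induct)
  case (base f)
  have "app (mG \<alpha> \<beta> i a b) (app (gl.Yt i) f) =
      app (gl.Yt i) (app (mG \<alpha> \<beta> i a b) f) + (if a = b then app (gl.Yt i) f else 0)"
    using arg_cong[OF gl.G_Yt[OF assms], of "\<lambda>x. app x f"] by (simp split: if_splits)
  moreover have "app (mG \<alpha> \<beta> i a b) f \<in> Vs n {}"
    using mod_theta_free(1)[OF i(2) base assms] .
  ultimately show ?case using base by (auto intro: R.base R.add)
next
  case (X k u)
  have "app (mG \<alpha> \<beta> i a b) (app (mX \<alpha> \<beta> i k) u) =
      app (mX \<alpha> \<beta> i k) (app (mG \<alpha> \<beta> i a b) u) + - (if a = k then app (mX \<alpha> \<beta> i b) u else 0)"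
    using arg_cong[OF gl.GX[OF assms X(1)], of "\<lambda>x. app x u"] by (simp split: if_splits)
  then show ?case using X assms by (auto intro!: R.add R.X R_diff R_uminus R_zero)
qed (auto intro: R.add)

lemma R_H: "u \<in> R \<Longrightarrow> app (mH \<alpha> \<beta> i) u \<in> R"
proof (induction rule: R.induct)
  case (base f)
  have "of_nat k = (scal (of_nat k) :: state lin)" for k
    by (induction k) (simp_all add: scal_hom)
  then have "app (mH \<alpha> \<beta> i) (app (gl.Yt i) f) =
      app (gl.Yt i) (app (mH \<alpha> \<beta> i) f) + vscale (- of_nat i) (app (gl.Yt i) f)"
    using arg_cong[OF gl.H_Yt[OF order.refl], of "\<lambda>x. app x f"]
    by (simp del: app_vscale) (rule poly_mapping_eqI, simp add: lookup_add lookup_minus)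
  moreover have "app (mH \<alpha> \<beta> i) f \<in> Vs n {}"
    unfolding mH_diag using base by (rule diag_Vs)
  ultimately show ?case using base by (auto intro!: R.base R.add R_vscale simp del: app_vscale)
next
  case (X k u)
  have "app (mH \<alpha> \<beta> i) (app (mX \<alpha> \<beta> i k) u) =
      app (mX \<alpha> \<beta> i k) (app (mH \<alpha> \<beta> i) u) + app (mX \<alpha> \<beta> i k) u"
    using arg_cong[OF gl.HX[OF X(1)], of "\<lambda>x. app x u"] by simp
  then show ?case using X by (auto intro!: R.add R.X)
qed (auto intro: R.add)

lemma R_Y:
  assumes "a \<in> {1..i}"
  shows "u \<in> R \<Longrightarrow> app (mY \<alpha> \<beta> i a) u \<in> R"
proof (induction rule: R.induct)
  case (base f)
  have "mY \<alpha> \<beta> i a * gl.Yt i = 0"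
    by (rule gl.Y_Yt_zero) (use assms in auto)
  from arg_cong[OF this, of "\<lambda>x. app x f"] show ?case by (simp add: R_zero)
next
  case (X k u)
  have "mY \<alpha> \<beta> i a * mX \<alpha> \<beta> i k = - (mX \<alpha> \<beta> i k * mY \<alpha> \<beta> i a) + mG \<alpha> \<beta> i a k + (if k = a then mH \<alpha> \<beta> i else 0)"
    using gl.XY[OF X(1) assms] by simp
  from arg_cong[OF this, of "\<lambda>x. app x u"]
  have "app (mY \<alpha> \<beta> i a) (app (mX \<alpha> \<beta> i k) u) = - app (mX \<alpha> \<beta> i k) (app (mY \<alpha> \<beta> i a) u)
      + app (mG \<alpha> \<beta> i a k) u + (if k = a then app (mH \<alpha> \<beta> i) u else 0)"
    by (simp split: if_splits)
  then show ?case using X assms by (auto intro!: R.add R.X R_diff R_uminus R_zero R_G R_H)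
qed (auto intro: R.add)

lemma R_z:
  assumes "i < M" "M \<le> n" "k \<in> {1..<M}"
  shows "u \<in> R \<Longrightarrow> app (zop M k) u \<in> R"
proof (induction rule: R.induct)
  case (base f)
  have "app (zop M k) (app (gl.Yt i) f) = app (gl.Yt i) (app (zop M k) f)"
    using arg_cong[OF zop_top_commute(1)[OF assms(1)], of "\<lambda>x. app x f"] by simp
  then show ?case using base assms by (auto intro!: R.base zop_Vs)
next
  case (X r u)
  have "app (zop M k) (app (mX \<alpha> \<beta> i r) u) = app (mX \<alpha> \<beta> i r) (app (zop M k) u)"
    using arg_cong[OF mod_boson(3)[OF assms(1)], of "\<lambda>x. app x u"] by simp
  then show ?case using X by (auto intro!: R.X)
qed (auto intro: R.add)

lemma Xt_R: "u \<in> R \<Longrightarrow> k \<le> i \<Longrightarrow> app (gl.Xt k) u \<in> R"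
proof (induction k arbitrary: u)
  case (Suc k)
  then have "app (mX \<alpha> \<beta> i (Suc k)) u \<in> R" by (intro R.X) auto
  with Suc.IH Suc.prems show ?case by (simp del: mX.simps)
qed simp

lemma vac_R: "vac \<in> R"
proof -
  have "vscale (1 / c) (app (gl.Xt i) (app (gl.Yt i) vac)) \<in> R"
    by (intro R_vscale Xt_R R.base) auto
  then show ?thesis using Xt_Yt_scalar[of vac] c by simp
qed

lemma Vs_R: "f \<in> Vs n {1..i} \<Longrightarrow> f \<in> R"
proof (induction rule: Vs_induct)
  case (z M k g)
  show ?case
  proof (cases "M \<le> i")
    case True
    then show ?thesis using z R_G[of M k g] mod_lower[OF z(1,2) True z(4), of \<alpha> \<beta>] by auto
  next
    case False
    then show ?thesis using z R_z[of M k g] by auto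
  qed
next
  case (th M g)
  then show ?case using R_Y[of M g] mod_lower_odd[OF th(1) _ th(4), of i \<alpha> \<beta>] by auto
qed (auto intro: R_zero R.add R_vscale vac_R)

text \<open>A normal form for \<open>R\<close>: each of X_1, ..., X_k occurs at most once, larger
  indices to the left. In particular the last step splits off X_i.\<close>

primrec Rs :: "nat \<Rightarrow> (state \<Rightarrow>\<^sub>0 complex) set" where
  "Rs 0 = {app (gl.Yt i) f |f. f \<in> Vs n {}}"
| "Rs (Suc k) = {u + app (mX \<alpha> \<beta> i (Suc k)) v |u v. u \<in> Rs k \<and> v \<in> Rs k}"

lemma Rs_add: "u \<in> Rs k \<Longrightarrow> v \<in> Rs k \<Longrightarrow> u + v \<in> Rs k"
proof (induction k arbitrary: u v)
  case 0
  then obtain f g where "u = app (gl.Yt i) f" "f \<in> Vs n {}" "v = app (gl.Yt i) g" "g \<in> Vs n {}"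
    by auto
  then have "u + v = app (gl.Yt i) (f + g)" "f + g \<in> Vs n {}" by auto
  then show ?case unfolding Rs.simps by blast
next
  case (Suc k)
  let ?X = "mX \<alpha> \<beta> i (Suc k)"
  obtain u1 u2 v1 v2 where "u = u1 + app ?X u2" "v = v1 + app ?X v2" and *: "u1 \<in> Rs k" "u2 \<in> Rs k" "v1 \<in> Rs k" "v2 \<in> Rs k"
    using Suc.prems by (auto simp del: mX.simps)
  then have "u + v = (u1 + v1) + app ?X (u2 + v2)" by (simp del: mX.simps add: algebra_simps)
  moreover have "u1 + v1 \<in> Rs k" "u2 + v2 \<in> Rs k" using Suc.IH * by auto
  ultimately show ?case unfolding Rs.simps by blast
qed

lemma Rs_zero: "0 \<in> Rs k"
proof (induction k)
  case 0
  have "app (gl.Yt i) 0 = 0" "0 \<in> Vs n {}" by auto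
  then show ?case unfolding Rs.simps by (metis (mono_tags, lifting) mem_Collect_eq)
next
  case (Suc k)
  have "0 + app (mX \<alpha> \<beta> i (Suc k)) 0 = 0" by simp
  with Suc show ?case unfolding Rs.simps by (metis (mono_tags, lifting) mem_Collect_eq)
qed

lemma Rs_Suc: "u \<in> Rs k \<Longrightarrow> u \<in> Rs (Suc k)"
proof -
  assume "u \<in> Rs k"
  moreover have "u + app (mX \<alpha> \<beta> i (Suc k)) 0 = u" by simp
  ultimately show ?thesis using Rs_zero[of k] unfolding Rs.simps by (metis (mono_tags, lifting) mem_Collect_eq)
qed

lemma Rs_uminus: "u \<in> Rs k \<Longrightarrow> - u \<in> Rs k"
proof (induction k arbitrary: u)
  case 0
  then obtain f where "u = app (gl.Yt i) f" "f \<in> Vs n {}" by auto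
  then have "- u = app (gl.Yt i) (- f)" "- f \<in> Vs n {}" by auto
  then show ?case unfolding Rs.simps by blast
next
  case (Suc k)
  let ?X = "mX \<alpha> \<beta> i (Suc k)"
  obtain u1 u2 where "u = u1 + app ?X u2" and *: "u1 \<in> Rs k" "u2 \<in> Rs k"
    using Suc.prems by (auto simp del: mX.simps)
  then have "- u = - u1 + app ?X (- u2)" by (simp del: mX.simps)
  then show ?case using Suc.IH * unfolding Rs.simps by blast
qed

lemma Rs_X: "1 \<le> j \<Longrightarrow> j \<le> k \<Longrightarrow> k \<le> i \<Longrightarrow> u \<in> Rs k \<Longrightarrow> app (mX \<alpha> \<beta> i j) u \<in> Rs k"
proof (induction k arbitrary: u)
  case (Suc k)
  let ?X = "mX \<alpha> \<beta> i (Suc k)"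
  obtain u1 u2 where u: "u = u1 + app ?X u2" and *: "u1 \<in> Rs k" "u2 \<in> Rs k"
    using Suc.prems by (auto simp del: mX.simps)
  show ?case
  proof (cases "j = Suc k")
    case True
    have "app ?X (app ?X u2) = 0"
      using arg_cong[OF gl.XX0[of "Suc k"], of "\<lambda>x. app x u2"] Suc.prems by (simp del: mX.simps)
    then have "app (mX \<alpha> \<beta> i j) u = 0 + app ?X u1"
      using True by (simp add: u del: mX.simps)
    then show ?thesis using Rs_zero *(1) unfolding Rs.simps by blast
  next
    case False
    have "app (mX \<alpha> \<beta> i j) (app ?X u2) = - app ?X (app (mX \<alpha> \<beta> i j) u2)"
      using arg_cong[OF gl.XX[of j "Suc k"], of "\<lambda>x. app x u2"] Suc.prems False by (simp del: mX.simps)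
    then have "app (mX \<alpha> \<beta> i j) u = app (mX \<alpha> \<beta> i j) u1 + app ?X (- app (mX \<alpha> \<beta> i j) u2)"
      by (simp add: u del: mX.simps)
    moreover have "app (mX \<alpha> \<beta> i j) u1 \<in> Rs k" "- app (mX \<alpha> \<beta> i j) u2 \<in> Rs k"
      using Suc * False by (auto intro!: Rs_uminus)
    ultimately show ?thesis unfolding Rs.simps by blast
  qed
qed simp

lemma R_Rs: "u \<in> R \<Longrightarrow> u \<in> Rs i"
proof (induction rule: R.induct)
  case (base f)
  have "app (gl.Yt i) f \<in> Rs k" for k
    by (induction k) (use base in \<open>auto intro: Rs_Suc simp del: Rs.simps(2)\<close>)
  then show ?case .
next
  case (X k u)
  then show ?case by (intro Rs_X) auto
qed (auto intro: Rs_add)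

lemma Rs_Vs: "u \<in> Rs k \<Longrightarrow> k \<le> i \<Longrightarrow> u \<in> Vs n {1..i}"
proof (induction k arbitrary: u)
  case 0
  then show ?case using i by (auto intro!: Yt_Vs intro: Vs_mono)
next
  case (Suc k)
  then obtain u1 u2 where "u = u1 + app (mX \<alpha> \<beta> i (Suc k)) u2" "u1 \<in> Rs k" "u2 \<in> Rs k"
    by (auto simp del: mX.simps)
  then show ?case using Suc i by (auto intro!: Vs_add mod_Vs(2) simp del: mX.simps)
qed

text \<open>For k = 0 this is the nonzero scalar c. For u = u1 + X u2 with X = X_{k+1}, applying X
  to the equation removes u2, as X X = 0, and leaves \<open>Tl k\<close> on u1; so u1 = 0, and the
  equation itself says, up to sign, that \<open>Tl k\<close> kills u2.\<close>

lemma Tl_injective: "u \<in> Rs k \<Longrightarrow> k \<le> i \<Longrightarrow> app (gl.Tl k) u = 0 \<Longrightarrow> u = 0"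
proof (induction k arbitrary: u)
  case 0
  then obtain f where f: "u = app (gl.Yt i) f" "f \<in> Vs n {}" by auto
  then have "vscale c f = 0" using Xt_Yt_scalar[OF f(2)] 0 by (simp add: gl.Tl_zero)
  then have "vscale (1 / c) (vscale c f) = 0" by simp
  then show ?case using c f by simp
next
  case (Suc k)
  let ?X = "mX \<alpha> \<beta> i (Suc k)"
  have k: "Suc k \<in> {1..i}" "k < i" using Suc.prems by auto
  obtain u1 u2 where u: "u = u1 + app ?X u2" and *: "u1 \<in> Rs k" "u2 \<in> Rs k"
    using Suc.prems by (auto simp del: mX.simps)
  note Tl = gl.Tl_step[OF k(2)]
  have XX: "?X * (?X * x) = 0" for x using gl.XX0[OF k(1), THEN nest] by simp
  have swap: "app ?X (app (gl.Tl (Suc k)) v) = app (gl.Tl (Suc k)) (app ?X v) \<or>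
      app ?X (app (gl.Tl (Suc k)) v) = - app (gl.Tl (Suc k)) (app ?X v)" for v
    using gl.X_Tl[OF k(1), of "Suc k"] by (metis app_lin(5,6))
  have "app ?X (app (gl.Tl (Suc k)) (app ?X u2)) = 0"
    using swap[of "app ?X u2"] arg_cong[OF gl.XX0[OF k(1)], of "\<lambda>x. app x u2"] by (auto simp del: mX.simps)
  moreover have "app ?X (app (gl.Tl (Suc k)) u) = 0"
    using Suc.prems by simp
  ultimately have "app (gl.Tl k) u1 = 0"
    by (simp add: Tl u del: mX.simps)
  then have u1: "u1 = 0" using Suc.IH *(1) k by auto
  have "app (gl.Tl (Suc k)) (app ?X u2) = 0"
    using Suc.prems u u1 by (simp del: mX.simps)
  then have "app (gl.Tl k) u2 = 0"
    using swap[of u2] by (auto simp add: Tl simp del: mX.simps)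
  then have "u2 = 0" using Suc.IH *(2) k by auto
  with u u1 show ?case by simp
qed

text \<open>Write f = u + X_i v in normal form. Then X_i u = 0, and for k = i - 1 the product
  \<open>Tl k\<close> is X_i itself, which is injective on such u.\<close>

lemma exact_level:
  assumes "f \<in> Vs n {1..i}" "app (mX \<alpha> \<beta> i i) f = 0"
  obtains g where "g \<in> Vs n {1..i}" "f = app (mX \<alpha> \<beta> i i) g"
proof -
  obtain r where r: "i = Suc r" using i by (cases i) auto
  have "f \<in> Rs (Suc r)" using R_Rs[OF Vs_R[OF assms(1)]] r by simp
  then obtain u v where "f = u + app (mX \<alpha> \<beta> i (Suc r)) v" and uv': "u \<in> Rs r" "v \<in> Rs r"
    unfolding Rs.simps by blast
  then have uv: "f = u + app (mX \<alpha> \<beta> i i) v" "u \<in> Rs r" "v \<in> Rs r"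
    unfolding r[symmetric] by blast+
  have ri: "r \<le> i" using r by simp
  have "app (mX \<alpha> \<beta> i i) (app (mX \<alpha> \<beta> i i) v) = 0"
    using arg_cong[OF gl.XX0[of i], of "\<lambda>x. app x v"] i by simp
  then have "app (mX \<alpha> \<beta> i i) u = 0" using assms(2) uv by simp
  moreover have "gl.Tl r = mX \<alpha> \<beta> i i"
    unfolding gl.Tl_def by (subst (2) r) (simp add: r[symmetric])
  ultimately have "u = 0" using Tl_injective[OF uv(2) ri] by simp
  then show ?thesis using that[of v] uv(1) Rs_Vs[OF uv(3) ri] by simp
qed

end

theorem exact_if_typical:
  assumes i: "i \<in> {1..n}" and f: "f \<in> Vs n {1..n}" "app (mX \<alpha> \<beta> n i) f = 0"
    and ne: "\<And>j. j \<in> {1..i} \<Longrightarrow> \<alpha> + \<beta> j + 1 - of_nat j \<noteq> 0"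
  shows "\<exists>g\<in>Vs n {1..n}. f = app (mX \<alpha> \<beta> n i) g"
proof -
  have i': "1 \<le> i" "i \<le> n" using i by auto
  obtain g f0 where g: "g \<in> Vs n {1..n}" "f0 \<in> Vs n {1..n}" "f = app (mX \<alpha> \<beta> n i) g + f0"
    "app (mX \<alpha> \<beta> n i) f0 = 0" "\<And>s. lookup f0 s \<noteq> 0 \<Longrightarrow> deg_above n i s = 0"
    using koszul_reduction[OF i f] by blast
  have X: "app (mX \<alpha> \<beta> n i) v = app (mX \<alpha> \<beta> i i) v" if "v \<in> Vs n {1..i}" for v
  proof -
    have "app (dth M) v = 0" if "M \<in> {Suc i..n}" for M
      using \<open>v \<in> Vs n {1..i}\<close> by (rule dth_kill) (use that in auto)
    then show ?thesis using mX_eq[OF i'(2,1), of \<alpha> \<beta>] by simp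
  qed
  have f0: "f0 \<in> Vs n {1..i}"
  proof (rule VsI)
    fix s assume s: "lookup f0 s \<noteq> 0"
    have "M \<in> {1..i}" if M: "M \<in> fst s" for M
    proof -
      have "M \<in> {1..n}" using VsD[OF g(2) s] M by auto
      moreover have "M \<notin> {Suc i..n}" using deg_above_zero(2)[OF g(5)[OF s]] M by blast
      ultimately show ?thesis by auto
    qed
    then show "valid n s \<and> fst s \<subseteq> {1..i}" using VsD[OF g(2) s] by auto
  qed
  obtain h where h: "h \<in> Vs n {1..i}" "f0 = app (mX \<alpha> \<beta> i i) h"
  proof (rule exact_level[OF i' refl _ f0])
    show "(\<Prod>j\<in>{1..i}. \<alpha> + \<beta> j + 1 - of_nat j) \<noteq> 0" using ne by (simp add: prod_zero_iff)
    show "app (mX \<alpha> \<beta> i i) f0 = 0" using g(4) X[OF f0] by simp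
  qed
  then have "f = app (mX \<alpha> \<beta> n i) (g + h)" using g(3) X by simp
  moreover have "h \<in> Vs n {1..n}" using h(1) by (rule Vs_mono) (use i' in auto)
  ultimately show ?thesis using g(1) by blast
qed

section \<open>Homomorphisms out of the enveloping algebra\<close>

definition word_eval :: "(complex \<Rightarrow> 'r::ring_1) \<Rightarrow> ('a \<Rightarrow> 'r) \<Rightarrow> ('a free_monoid \<Rightarrow>\<^sub>0 complex) \<Rightarrow> 'r" where
  "word_eval sc r = pmext (\<lambda>w c. sc c * prod_list (map r (letters w)))"

lemma U_surj: "\<exists>t. u = U_class t"
  unfolding U_class_def by (metis Quotient3_abs_rep[OF Quotient3_U_gl])

text \<open>The rings in question carry no scalar multiplication; complex numbers enter through a
  homomorphism into the centre, \<open>scal\<close> for operators and \<open>usc\<close> for the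
  enveloping algebra.\<close>

locale central_scalars =
  fixes sc :: "complex \<Rightarrow> 'r::ring_1"
  assumes sc_one: "sc 1 = 1" and sc_add: "sc (c + d) = sc c + sc d" and sc_mult: "sc (c * d) = sc c * sc d"
    and sc_central: "sc c * v = v * sc c"
begin

lemma sc_zero [simp]: "sc 0 = 0"
  using sc_add[of 0 0] by simp

lemma sc_diff: "sc (c - d) = sc c - sc d"
  using sc_add[of "c - d" d] by simp

lemma word_eval_add: "word_eval sc r (s + t) = word_eval sc r s + word_eval sc r t"
  unfolding word_eval_def by (rule pmext_add) (simp_all add: sc_add distrib_right)

lemma word_eval_single: "word_eval sc r (Poly_Mapping.single w c) = sc c * prod_list (map r (letters w))"
  unfolding word_eval_def by (subst pmext_single) simp_all

lemma word_eval_zero [simp]: "word_eval sc r 0 = 0"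
  by (simp add: word_eval_def)

lemma word_eval_uminus: "word_eval sc r (- t) = - word_eval sc r t"
  using word_eval_add[of r t "- t"] by (simp add: add_eq_0_iff)

lemma word_eval_diff: "word_eval sc r (s - t) = word_eval sc r s - word_eval sc r t"
  using word_eval_add[of r s "- t"] by (simp add: word_eval_uminus)

lemma word_eval_one [simp]: "word_eval sc r 1 = 1"
  by (subst single_one[symmetric], subst word_eval_single) (simp add: zero_free_monoid_def sc_one)

lemma word_eval_mult: "word_eval sc r (s * t) = word_eval sc r s * word_eval sc r t"
proof (induction s rule: pm_induct)
  case (plus v c s)
  have "word_eval sc r (Poly_Mapping.single v c * t) = word_eval sc r (Poly_Mapping.single v c) * word_eval sc r t"
  proof (induction t rule: pm_induct)
    case (plus w d t)
    have "word_eval sc r (Poly_Mapping.single v c * Poly_Mapping.single w d) =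
        word_eval sc r (Poly_Mapping.single v c) * word_eval sc r (Poly_Mapping.single w d)"
      by (simp add: mult_single word_eval_single plus_free_monoid_def sc_mult mult.assoc)
        (simp add: sc_central[of d] mult.assoc)
    with plus show ?case by (simp add: distrib_left word_eval_add)
  qed simp
  with plus show ?case by (simp add: distrib_right word_eval_add)
qed simp

lemma word_eval_power: "word_eval sc r (t ^ k) = word_eval sc r t ^ k"
  by (induction k) (simp_all add: word_eval_mult)

lemma word_eval_gen: "word_eval sc r (gen x) = r x"
  by (simp add: gen_def word_eval_single sc_one)

lemma word_eval_scalar: "word_eval sc r (scalar c) = sc c"
  by (simp add: scalar_def word_eval_single zero_free_monoid_def)

text \<open>The universal property of the enveloping algebra. With operators as target it gives the
  action on Fock space, with the algebra itself as target the automorphisms induced by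
  conjugation.\<close>

lemma U_lift:
  fixes r :: "('m::finite, 'n::finite) gl \<Rightarrow> 'r"
  assumes add: "\<And>x y. r (x + y) = r x + r y" and smult: "\<And>c x. r (mscale c x) = sc c * r x"
    and bracket: "\<And>x y p q. p \<in> {0, 1} \<Longrightarrow> q \<in> {0, 1} \<Longrightarrow> x \<in> homogeneous p \<Longrightarrow> y \<in> homogeneous q \<Longrightarrow>
      r x * r y - (-1) ^ (p * q) * (r y * r x) = r (sbracket x y)"
  obtains \<phi> :: "('m, 'n) U_gl \<Rightarrow> 'r" where "\<phi> 1 = 1" "\<And>u v. \<phi> (u + v) = \<phi> u + \<phi> v"
    "\<And>u v. \<phi> (u * v) = \<phi> u * \<phi> v" "\<And>x. \<phi> (\<iota> x) = r x" "\<And>c. \<phi> (U_class (scalar c)) = sc c"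
proof -
  let ?e = "word_eval sc r"
  have rel: "?e t = 0" if "t \<in> U_relations" for t
    using that unfolding U_relations_def
  proof (elim UnE CollectE exE conjE)
    fix x y p q
    assume t: "t = gen x * gen y - (-1) ^ (p * q) * (gen y * gen x) - gen (sbracket x y)"
      and "p \<in> {0, 1}" "q \<in> {0, 1}" "x \<in> homogeneous p" "y \<in> homogeneous q"
    from bracket[OF this(2-)] show ?thesis
      by (simp add: t word_eval_diff word_eval_mult word_eval_gen word_eval_power word_eval_uminus)
  qed (simp_all add: word_eval_diff word_eval_mult word_eval_gen word_eval_scalar add smult)
  have ideal: "?e t = 0" if "t \<in> ideal_gen U_relations" for t
    using that by induction (simp_all add: word_eval_add word_eval_mult rel)
  have wd: "?e s = ?e t" if "U_class s = U_class t" for s t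
  proof -
    have "U_eq s t" using that by (simp add: U_class_def U_gl.abs_eq_iff)
    then have "?e (s - t) = 0" by (intro ideal) (simp add: U_eq_def)
    then show ?thesis by (simp add: word_eval_diff)
  qed
  define \<phi> where "\<phi> u = ?e (SOME t. U_class t = u)" for u
  have \<phi>: "\<phi> (U_class t) = ?e t" for t
    unfolding \<phi>_def by (rule wd) (rule someI[of _ t], rule refl)
  show ?thesis
  proof (rule that[of \<phi>])
    show "\<phi> 1 = 1" using \<phi>[of 1] by (simp add: U_class_hom)
    show "\<phi> (u + v) = \<phi> u + \<phi> v" "\<phi> (u * v) = \<phi> u * \<phi> v" for u v
    proof -
      obtain s t where "u = U_class s" "v = U_class t" using U_surj by metis
      then show "\<phi> (u + v) = \<phi> u + \<phi> v" "\<phi> (u * v) = \<phi> u * \<phi> v"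
        using \<phi> by (simp_all add: word_eval_add word_eval_mult flip: U_class_hom(3,4))
    qed
    show "\<phi> (\<iota> x) = r x" for x by (simp add: \<iota>_def \<phi> word_eval_gen)
    show "\<phi> (U_class (scalar c)) = sc c" for c by (simp add: \<phi> word_eval_scalar)
  qed
qed

end

definition usc :: "complex \<Rightarrow> ('m::finite, 'n::finite) U_gl" where
  "usc c = U_class (scalar c)"

lemma U_class_uminus: "U_class (- t) = - U_class t"
  using U_class_hom(3)[of t "- t"] by (simp add: U_class_hom(1) add_eq_0_iff)

lemma U_class_diff: "U_class (s - t) = U_class s - U_class t"
  using U_class_hom(3)[of s "- t"] by (simp add: U_class_uminus)

lemma U_class_sum: "U_class (\<Sum>i\<in>I. f i) = (\<Sum>i\<in>I. U_class (f i))"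
  by (induction I rule: infinite_finite_induct) (simp_all add: U_class_hom)

lemma scalar_central: "scalar c * t = t * scalar c"
  by (induction t rule: pm_induct) (simp_all add: distrib_left distrib_right scalar_def mult_single mult.commute)

interpretation usc: central_scalars usc
proof
  show "usc 1 = 1" by (simp add: usc_def scalar_def U_class_hom)
  show "usc (c + d) = usc c + usc d" for c d
    by (simp add: usc_def scalar_def single_add U_class_hom)
  show "usc (c * d) = usc c * usc d" for c d
    by (simp add: usc_def scalar_def mult_single flip: U_class_hom)
  show "usc c * v = v * usc c" for c v
  proof -
    obtain t where "v = U_class t" using U_surj by blast
    then show ?thesis by (simp add: usc_def scalar_central flip: U_class_hom)
  qed
qed

interpretation lin: central_scalars "scal :: complex \<Rightarrow> 's lin"
  by standard (rule scal_hom scal_central)+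

lemma U_relation_zero: "t \<in> U_relations \<Longrightarrow> U_class t = 0"
  using ideal_gen.mult[of t U_relations 1 1]
  by (simp add: U_class_def zero_U_gl.abs_eq U_gl.abs_eq_iff U_eq_def)

lemma \<iota>_add: "\<iota> (x + y) = \<iota> x + \<iota> y"
proof -
  have "U_class (gen (x + y) - gen x - gen y) = 0"
    by (rule U_relation_zero) (unfold U_relations_def, blast)
  then show ?thesis by (simp add: \<iota>_def U_class_diff U_class_hom algebra_simps)
qed

lemma \<iota>_mscale: "\<iota> (mscale c x) = usc c * \<iota> x"
proof -
  have "U_class (gen (mscale c x) - scalar c * gen x) = 0"
    by (rule U_relation_zero) (unfold U_relations_def, blast)
  then show ?thesis by (simp add: \<iota>_def usc_def U_class_diff U_class_hom)
qed

lemma \<iota>_bracket: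
  assumes "p \<in> {0, 1}" "q \<in> {0, 1}" "x \<in> homogeneous p" "y \<in> homogeneous q"
  shows "\<iota> x * \<iota> y - (-1) ^ (p * q) * (\<iota> y * \<iota> x) = \<iota> (sbracket x y)"
proof -
  have "U_class (gen x * gen y - (-1) ^ (p * q) * (gen y * gen x) - gen (sbracket x y)) = 0"
    by (rule U_relation_zero) (unfold U_relations_def, use assms in blast)
  moreover have "U_class ((-1) ^ k :: ('a, 'b) free_gl) = (-1) ^ k" for k
    by (induction k) (simp_all add: U_class_uminus U_class_hom)
  ultimately show ?thesis by (simp add: \<iota>_def U_class_diff U_class_hom)
qed

lemma U_induct [case_names scalar add mult]:
  assumes "\<And>c. P (usc c)" "\<And>u v. P u \<Longrightarrow> P v \<Longrightarrow> P (u + v)" "\<And>x u. P u \<Longrightarrow> P (\<iota> x * u)"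
  shows "P u"
proof -
  have word: "P (U_class (Poly_Mapping.single (Word xs) c))" for xs c
  proof (induction xs)
    case Nil
    show ?case using assms(1)[of c] by (simp add: usc_def scalar_def zero_free_monoid_def)
  next
    case (Cons x xs)
    have "U_class (Poly_Mapping.single (Word (x # xs)) c) = \<iota> x * U_class (Poly_Mapping.single (Word xs) c)"
      by (simp add: \<iota>_def gen_def mult_single plus_free_monoid_def flip: U_class_hom)
    with assms(3)[OF Cons] show ?case by simp
  qed
  obtain t where t: "u = U_class t" using U_surj by blast
  have "P (U_class t)"
  proof (induction t rule: pm_induct)
    case zero
    show ?case using assms(1)[of 0] by (simp add: U_class_hom)
  next
    case (plus k x f)
    show ?case using assms(2)[OF word[of "letters k" x] plus] by (simp add: U_class_hom)
  qed
  with t show ?thesis by simp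
qed

section \<open>The Verma module as a quotient by a left ideal\<close>

inductive_set verma_ideal :: "('m::{finite,linorder}, 'n::{finite,linorder}) weight \<Rightarrow> ('m, 'n) U_gl set" for \<Lambda> where
  zero: "0 \<in> verma_ideal \<Lambda>"
| add: "u \<in> verma_ideal \<Lambda> \<Longrightarrow> v \<in> verma_ideal \<Lambda> \<Longrightarrow> u + v \<in> verma_ideal \<Lambda>"
| gen: "t \<in> borel \<Longrightarrow> u * (\<iota> t - usc (wt_eval \<Lambda> t)) \<in> verma_ideal \<Lambda>"

lemma verma_ideal_lmult: "u \<in> verma_ideal \<Lambda> \<Longrightarrow> w * u \<in> verma_ideal \<Lambda>"
proof (induction rule: verma_ideal.induct)
  case (gen t u)
  then show ?case using verma_ideal.gen[of t "w * u"] by (simp add: mult.assoc)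
qed (simp_all add: distrib_left verma_ideal.zero verma_ideal.add)

lemma verma_ideal_uminus: "u \<in> verma_ideal \<Lambda> \<Longrightarrow> - u \<in> verma_ideal \<Lambda>"
  using verma_ideal_lmult[of u \<Lambda> "- 1"] by simp

lemma verma_ideal_diff: "u \<in> verma_ideal \<Lambda> \<Longrightarrow> v \<in> verma_ideal \<Lambda> \<Longrightarrow> u - v \<in> verma_ideal \<Lambda>"
  using verma_ideal.add[of u \<Lambda> "- v"] verma_ideal_uminus[of v] by simp

lemma verma_ideal_sum: "(\<And>i. i \<in> I \<Longrightarrow> f i \<in> verma_ideal \<Lambda>) \<Longrightarrow> (\<Sum>i\<in>I. f i) \<in> verma_ideal \<Lambda>"
  by (induction I rule: infinite_finite_induct) (auto intro: verma_ideal.intros)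

text \<open>Peel off the first letter x of a word x w, writing \<Lambda> also for the character on
  words: x w - \<Lambda>(x) \<Lambda>(w) is x (w - \<Lambda>(w)) + \<Lambda>(w) (x -
  \<Lambda>(x)).\<close>

lemma verma_ideal_free_borel:
  assumes "t \<in> free_borel"
  shows "U_class t - usc (C_act \<Lambda> t 1) \<in> verma_ideal \<Lambda>"
proof -
  have word: "U_class (Poly_Mapping.single (Word xs) c) - usc (c * prod_list (map (wt_eval \<Lambda>) xs)) \<in> verma_ideal \<Lambda>"
    if "set xs \<subseteq> borel" for xs c
    using that
  proof (induction xs arbitrary: c)
    case Nil
    show ?case by (simp add: usc_def scalar_def zero_free_monoid_def verma_ideal.zero)
  next
    case (Cons x xs)
    let ?w = "U_class (Poly_Mapping.single (Word xs) c)" and ?p = "c * prod_list (map (wt_eval \<Lambda>) xs)"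
    have "U_class (Poly_Mapping.single (Word (x # xs)) c) = \<iota> x * ?w"
      by (simp add: \<iota>_def gen_def mult_single plus_free_monoid_def flip: U_class_hom)
    then have "U_class (Poly_Mapping.single (Word (x # xs)) c) - usc (c * prod_list (map (wt_eval \<Lambda>) (x # xs)))
        = \<iota> x * (?w - usc ?p) + usc ?p * (\<iota> x - usc (wt_eval \<Lambda> x))"
      by (simp add: algebra_simps usc.sc_mult[symmetric] usc.sc_central[of ?p "\<iota> x"])
    moreover have "\<iota> x * (?w - usc ?p) \<in> verma_ideal \<Lambda>"
      using Cons by (intro verma_ideal_lmult) auto
    moreover have "usc ?p * (\<iota> x - usc (wt_eval \<Lambda> x)) \<in> verma_ideal \<Lambda>"
      using Cons.prems by (intro verma_ideal.gen) auto
    ultimately show ?case by (simp add: verma_ideal.add)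
  qed
  let ?K = "Poly_Mapping.keys t"
  have "U_class t = (\<Sum>w\<in>?K. U_class (Poly_Mapping.single w (lookup t w)))"
    unfolding U_class_sum[symmetric] pmext_def[symmetric] by (rule arg_cong[OF pmext_decompose])
  moreover have "usc (\<Sum>w\<in>A. f w) = (\<Sum>w\<in>A. usc (f w))" for A and f :: "('a, 'b) gl free_monoid \<Rightarrow> complex"
    by (induction A rule: infinite_finite_induct) (simp_all add: usc.sc_add)
  ultimately have "U_class t - usc (C_act \<Lambda> t 1) =
      (\<Sum>w\<in>?K. U_class (Poly_Mapping.single (Word (letters w)) (lookup t w)) - usc (lookup t w * prod_list (map (wt_eval \<Lambda>) (letters w))))"
    by (simp add: C_act_def sum_subtractf)
  also have "\<dots> \<in> verma_ideal \<Lambda>"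
    using assms by (intro verma_ideal_sum word) (auto simp: free_borel_def)
  finally show ?thesis .
qed

text \<open>The map that sends the tensor of u and z to u z, before passing to quotients. Its
  inverse modulo the relations sends u to the tensor of u and 1, see
  \<open>frag_pre_eval\<close>.\<close>

definition pre_eval :: "('m::{finite,linorder}, 'n::{finite,linorder}) pre_verma \<Rightarrow> ('m, 'n) U_gl" where
  "pre_eval = pmext (\<lambda>(u, z) k. of_int k * (u * usc z))"

lemma pre_eval_add: "pre_eval (c + d) = pre_eval c + pre_eval d"
  unfolding pre_eval_def by (rule pmext_add) (auto simp: distrib_right)

lemma pre_eval_zero [simp]: "pre_eval 0 = 0"
  by (simp add: pre_eval_def)

lemma pre_eval_uminus: "pre_eval (- c) = - pre_eval c"
  using pre_eval_add[of c "- c"] by (simp add: add_eq_0_iff)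

lemma pre_eval_diff: "pre_eval (c - d) = pre_eval c - pre_eval d"
  using pre_eval_add[of c "- d"] by (simp add: pre_eval_uminus)

lemma pre_eval_frag [simp]: "pre_eval (frag_of (u, z)) = u * usc z"
  unfolding pre_eval_def by (subst pmext_single) auto

lemma pre_eval_act: "pre_eval (pre_act x c) = \<iota> x * pre_eval c"
  unfolding pre_act_def using subset_UNIV[of "Poly_Mapping.keys c"]
proof (induction c rule: frag_induction)
  case (diff a b)
  then show ?case by (simp add: frag_extend_diff pre_eval_diff right_diff_distrib)
qed (auto simp: mult.assoc)

lemma verma_relations_closed:
  "0 \<in> verma_relations \<Lambda>"
  "c \<in> verma_relations \<Lambda> \<Longrightarrow> d \<in> verma_relations \<Lambda> \<Longrightarrow> c + d \<in> verma_relations \<Lambda>"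
  "c \<in> verma_relations \<Lambda> \<Longrightarrow> - c \<in> verma_relations \<Lambda>"
  "c \<in> verma_relations \<Lambda> \<Longrightarrow> d \<in> verma_relations \<Lambda> \<Longrightarrow> c - d \<in> verma_relations \<Lambda>"
proof -
  let ?T = "tensor_relations free_borel (\<lambda>u t. u * U_class t) (C_act \<Lambda>)"
  show zero: "0 \<in> verma_relations \<Lambda>"
    using generate.one[of pre_verma] by (simp add: verma_relations_def pre_verma_def)
  show add: "c + d \<in> verma_relations \<Lambda>" if "c \<in> verma_relations \<Lambda>" "d \<in> verma_relations \<Lambda>" for c d
    using generate.eng[of c pre_verma ?T d] that by (simp add: verma_relations_def pre_verma_def)
  show uminus: "- c \<in> verma_relations \<Lambda>" if "c \<in> verma_relations \<Lambda>" for c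
    using that unfolding verma_relations_def
  proof (induction rule: generate.induct)
    case one
    then show ?case using zero by (simp add: verma_relations_def pre_verma_def)
  next
    case (incl h)
    then show ?case using generate.inv[of h ?T pre_verma] by (simp add: pre_verma_def)
  next
    case (inv h)
    then show ?case using generate.incl[of h ?T pre_verma] by (simp add: pre_verma_def)
  next
    case (eng h1 h2)
    then show ?case using generate.eng[of "- h1" pre_verma ?T "- h2"] by (simp add: pre_verma_def add.commute)
  qed
  show "c - d \<in> verma_relations \<Lambda>" if "c \<in> verma_relations \<Lambda>" "d \<in> verma_relations \<Lambda>"
    using add[OF that(1) uminus[OF that(2)]] by simp
qed

lemma tensor_relation_in:
  "c \<in> tensor_relations free_borel (\<lambda>u t. u * U_class t) (C_act \<Lambda>) \<Longrightarrow> c \<in> verma_relations \<Lambda>"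
  unfolding verma_relations_def by (rule generate.incl)

lemma frag_diff_relation: "frag_of (u - v, z) - (frag_of (u, z) - frag_of (v, z)) \<in> verma_relations \<Lambda>"
proof -
  have "frag_of ((u - v) + v, z) - frag_of (u - v, z) - frag_of (v, z) \<in> verma_relations \<Lambda>"
    by (rule tensor_relation_in) (unfold tensor_relations_def, blast)
  from verma_relations_closed(3)[OF this] show ?thesis by (simp add: algebra_simps)
qed

lemma frag_scalar_relation: "frag_of (u * usc z, 1) - frag_of (u, z) \<in> verma_relations \<Lambda>"
proof -
  have "C_act \<Lambda> (scalar z) 1 = z"
    by (simp add: C_act_def scalar_def zero_free_monoid_def)
  moreover have "scalar z \<in> free_borel"
    by (simp add: free_borel_def scalar_def zero_free_monoid_def)
  then have "frag_of (u * U_class (scalar z), 1) - frag_of (u, C_act \<Lambda> (scalar z) 1) \<in> verma_relations \<Lambda>"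
    by (intro tensor_relation_in) (unfold tensor_relations_def, blast)
  ultimately show ?thesis by (simp add: usc_def)
qed

lemma frag_pre_eval: "frag_of (pre_eval c, 1) - c \<in> verma_relations \<Lambda>"
  using subset_UNIV[of "Poly_Mapping.keys c"]
proof (induction c rule: frag_induction)
  case zero
  have "frag_of (0 - 0, 1) - (frag_of (0, 1) - frag_of (0, 1)) \<in> verma_relations \<Lambda>"
    by (rule frag_diff_relation)
  then show ?case by simp
next
  case (one x)
  then show ?case using frag_scalar_relation[of "fst x" "snd x" \<Lambda>] pre_eval_frag[of "fst x" "snd x"] by simp
next
  case (diff a b)
  have "frag_of (pre_eval a - pre_eval b, 1) - (a - b) =
      (frag_of (pre_eval a - pre_eval b, 1) - (frag_of (pre_eval a, 1) - frag_of (pre_eval b, 1)))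
      + ((frag_of (pre_eval a, 1) - a) - (frag_of (pre_eval b, 1) - b))"
    by simp
  also have "\<dots> \<in> verma_relations \<Lambda>"
    by (rule verma_relations_closed(2)[OF frag_diff_relation verma_relations_closed(4)[OF diff(1,2)]])
  finally show ?case by (simp add: pre_eval_diff)
qed

lemma pre_eval_relations: "c \<in> verma_relations \<Lambda> \<Longrightarrow> pre_eval c \<in> verma_ideal \<Lambda>"
proof -
  have T: "pre_eval c \<in> verma_ideal \<Lambda>"
    if c: "c \<in> tensor_relations free_borel (\<lambda>u t. u * U_class t) (C_act \<Lambda>)" for c
  proof -
    consider (1) a a' z where "c = frag_of (a + a', z) - frag_of (a, z) - frag_of (a', z)"
      | (2) a z z' where "c = frag_of (a, z + z') - frag_of (a, z) - frag_of (a, z')"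
      | (3) a t z where "t \<in> free_borel" "c = frag_of (a * U_class t, z) - frag_of (a, C_act \<Lambda> t z)"
      using c unfolding tensor_relations_def by blast
    then show ?thesis
    proof cases
      case 3
      have "C_act \<Lambda> t z = C_act \<Lambda> t 1 * z" by (simp add: C_act_def)
      then have "pre_eval c = (usc z * a) * (U_class t - usc (C_act \<Lambda> t 1))"
        by (simp add: 3 pre_eval_diff usc.sc_mult algebra_simps usc.sc_central[of z] mult.assoc)
      then show ?thesis using verma_ideal_lmult[OF verma_ideal_free_borel[OF 3(1)]] by simp
    qed (simp_all add: pre_eval_diff distrib_left distrib_right usc.sc_add verma_ideal.zero)
  qed
  assume "c \<in> verma_relations \<Lambda>"
  then show ?thesis
    unfolding verma_relations_def
  proof (induction rule: generate.induct)
    case one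
    show ?case by (simp add: pre_verma_def verma_ideal.zero)
  next
    case (incl h)
    then show ?case by (rule T)
  next
    case (inv h)
    then show ?case using T[of h] by (simp add: pre_verma_def pre_eval_uminus verma_ideal_uminus)
  next
    case (eng h1 h2)
    then show ?case by (simp add: pre_verma_def pre_eval_add verma_ideal.add)
  qed
qed

lemma frag_verma_ideal: "u \<in> verma_ideal \<Lambda> \<Longrightarrow> frag_of (u, 1) \<in> verma_relations \<Lambda>"
proof (induction rule: verma_ideal.induct)
  case zero
  then show ?case using frag_pre_eval[of 0 \<Lambda>] by simp
next
  case (add u v)
  have "frag_of (u + v, 1) = (frag_of (u + v, 1) - frag_of (u, 1) - frag_of (v, 1)) + frag_of (u, 1) + frag_of (v, 1)"
    by simp
  also have "\<dots> \<in> verma_relations \<Lambda>"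
    by (intro verma_relations_closed add.IH tensor_relation_in) (unfold tensor_relations_def, blast)
  finally show ?case .
next
  case (gen t u)
  let ?c = "wt_eval \<Lambda> t"
  have "C_act \<Lambda> (gen t) 1 = ?c" "gen t \<in> free_borel"
    using gen by (simp_all add: C_act_def gen_def free_borel_def)
  moreover from this have "frag_of (u * U_class (gen t), 1) - frag_of (u, C_act \<Lambda> (gen t) 1) \<in> verma_relations \<Lambda>"
    by (intro tensor_relation_in) (unfold tensor_relations_def, blast)
  ultimately have 1: "frag_of (u * \<iota> t, 1) - frag_of (u, ?c) \<in> verma_relations \<Lambda>"
    by (simp add: \<iota>_def)
  have "frag_of (u * (\<iota> t - usc ?c), 1) =
      (frag_of (u * \<iota> t - u * usc ?c, 1) - (frag_of (u * \<iota> t, 1) - frag_of (u * usc ?c, 1)))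
      + (frag_of (u * \<iota> t, 1) - frag_of (u, ?c)) - (frag_of (u * usc ?c, 1) - frag_of (u, ?c))"
    by (simp add: right_diff_distrib)
  also have "\<dots> \<in> verma_relations \<Lambda>"
    by (intro verma_relations_closed frag_diff_relation 1 frag_scalar_relation)
  finally show ?case .
qed

lemma in_verma_relations_iff: "c \<in> verma_relations \<Lambda> \<longleftrightarrow> pre_eval c \<in> verma_ideal \<Lambda>"
proof
  assume "pre_eval c \<in> verma_ideal \<Lambda>"
  from verma_relations_closed(4)[OF frag_verma_ideal[OF this] frag_pre_eval[of c \<Lambda>]]
  show "c \<in> verma_relations \<Lambda>" by simp
qed (rule pre_eval_relations)

text \<open>Equality of kernel and image for x on the quotient by the left ideal, pulled back to the
  algebra, so that cosets no longer appear.\<close>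

definition exact_at :: "('m::{finite,linorder}, 'n::{finite,linorder}) weight \<Rightarrow> ('m, 'n) gl \<Rightarrow> bool" where
  "exact_at \<Lambda> x \<longleftrightarrow> (\<forall>u. \<iota> x * u \<in> verma_ideal \<Lambda> \<longleftrightarrow> (\<exists>v. u - \<iota> x * v \<in> verma_ideal \<Lambda>))"

lemma X_mod_verma_iff:
  "x \<in> X_mod (verma \<Lambda>) (verma_act \<Lambda>) \<longleftrightarrow> x \<in> self_commuting \<and> \<not> exact_at \<Lambda> x"
proof -
  let ?R = "verma_relations \<Lambda>"
  let ?C = "\<lambda>c. ?R #>\<^bsub>pre_verma\<^esub> c"
  have C: "?C c = {h + c |h. h \<in> ?R}" for c
    by (auto simp: r_coset_def pre_verma_def)
  have C_eq: "?C c = ?C d \<longleftrightarrow> c - d \<in> ?R" for c d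
  proof
    assume eq: "?C c = ?C d"
    have "c \<in> ?C c" unfolding C using verma_relations_closed(1) by force
    then obtain h where "h \<in> ?R" "c = h + d" unfolding eq unfolding C by blast
    then show "c - d \<in> ?R" by simp
  next
    assume cd: "c - d \<in> ?R"
    have "h + c = (h + (c - d)) + d" "h + d = (h - (c - d)) + c" for h by simp_all
    then show "?C c = ?C d"
      unfolding C using cd verma_relations_closed(2,4) by blast
  qed
  have carrier: "carrier (verma \<Lambda>) = range ?C"
    by (auto simp: verma_def FactGroup_def RCOSETS_def pre_verma_def)
  have one: "\<one>\<^bsub>verma \<Lambda>\<^esub> = ?C 0"
    by (simp add: verma_def FactGroup_def C)
  have im: "verma_act \<Lambda> x ` carrier (verma \<Lambda>) = range (\<lambda>d. ?C (pre_act x d))"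
    by (simp add: carrier image_image verma_act_coset)
  have "verma_act \<Lambda> x ` carrier (verma \<Lambda>) = kernel (verma \<Lambda>) (verma \<Lambda>) (verma_act \<Lambda> x)
      \<longleftrightarrow> (\<forall>c. (\<exists>d. ?C c = ?C (pre_act x d)) \<longleftrightarrow> ?C (pre_act x c) = ?C 0)" (is "?A \<longleftrightarrow> ?B")
  proof
    assume A: ?A
    show ?B
    proof
      fix c
      have "?C c \<in> verma_act \<Lambda> x ` carrier (verma \<Lambda>) \<longleftrightarrow> (\<exists>d. ?C c = ?C (pre_act x d))"
        unfolding im by blast
      moreover have "?C c \<in> kernel (verma \<Lambda>) (verma \<Lambda>) (verma_act \<Lambda> x) \<longleftrightarrow> ?C (pre_act x c) = ?C 0"
        unfolding kernel_def by (simp add: one verma_act_coset carrier)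
      ultimately show "(\<exists>d. ?C c = ?C (pre_act x d)) \<longleftrightarrow> ?C (pre_act x c) = ?C 0"
        using A by blast
    qed
  next
    assume B: ?B
    show ?A
      unfolding im unfolding kernel_def one carrier
    proof (intro equalityI subsetI)
      fix D assume "D \<in> range (\<lambda>d. ?C (pre_act x d))"
      then obtain d where "D = ?C (pre_act x d)" by blast
      then show "D \<in> {D \<in> range ?C. verma_act \<Lambda> x D = ?C 0}"
        using B by (auto simp: verma_act_coset)
    next
      fix D assume "D \<in> {D \<in> range ?C. verma_act \<Lambda> x D = ?C 0}"
      then obtain c where "D = ?C c" "?C (pre_act x c) = ?C 0" by (auto simp: verma_act_coset)
      then show "D \<in> range (\<lambda>d. ?C (pre_act x d))" using B by blast
    qed
  qed
  also have "\<dots> \<longleftrightarrow> (\<forall>c. (\<exists>d. pre_eval c - \<iota> x * pre_eval d \<in> verma_ideal \<Lambda>) \<longleftrightarrow> \<iota> x * pre_eval c \<in> verma_ideal \<Lambda>)"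
    unfolding C_eq in_verma_relations_iff by (simp add: pre_eval_diff pre_eval_act)
  also have "\<dots> \<longleftrightarrow> exact_at \<Lambda> x"
  proof -
    have surj: "\<exists>c. u = pre_eval c" for u :: "('a, 'b) U_gl"
      using pre_eval_frag[of u 1] by (metis mult.right_neutral usc.sc_one)
    show ?thesis unfolding exact_at_def by (metis surj)
  qed
  finally show ?thesis by (auto simp: X_mod_def)
qed

section \<open>Matrix units\<close>

definition munit :: "'m + 'n \<Rightarrow> 'm + 'n \<Rightarrow> ('m::finite, 'n::finite) gl" where
  "munit i j = (\<chi> k l. if k = i \<and> l = j then 1 else 0)"

definition par :: "'m + 'n \<Rightarrow> 'm + 'n \<Rightarrow> nat" where
  "par i j = (parity i + parity j) mod 2"

lemma par_01: "par i j \<in> {0, 1}"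
  by (auto simp: par_def)

lemma mscale_nth [simp]: "mscale c x $ i $ j = c * x $ i $ j"
  by (simp add: mscale_def map_matrix_def)

lemma gpart_homogeneous:
  assumes "x \<in> homogeneous p" "p \<in> {0, 1}" "q \<in> {0, 1}"
  shows "gpart q x = (if q = p then x else 0)"
proof -
  have x: "gpart p x = x" using assms(1) by (simp add: homogeneous_def)
  show ?thesis
  proof (cases "q = p")
    case False
    have "gpart q (gpart p x) = 0"
      using False by (auto simp: gpart_def vec_eq_iff)
    then show ?thesis using False x by simp
  qed (use x in simp)
qed

lemma homogeneous_zero: "x \<in> homogeneous p \<Longrightarrow> x $ i $ j \<noteq> 0 \<Longrightarrow> par i j = p"
  unfolding homogeneous_def gpart_def par_def by (auto simp: vec_eq_iff) metis

lemma sbracket_homogeneous: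
  assumes "x \<in> homogeneous p" "y \<in> homogeneous q" "p \<in> {0, 1}" "q \<in> {0, 1}"
  shows "sbracket x y = x ** y - mscale ((-1) ^ (p * q)) (y ** x)"
proof -
  have z: "mscale c 0 = 0" for c by (simp add: vec_eq_iff)
  have "sbracket x y = (\<Sum>p'\<in>{0, 1}. \<Sum>q'\<in>{0, 1}. if p' = p \<and> q' = q then x ** y - mscale ((-1) ^ (p * q)) (y ** x) else 0)"
    unfolding sbracket_def
    by (intro sum.cong refl) (simp add: gpart_homogeneous[OF assms(1,3)] gpart_homogeneous[OF assms(2,4)] z)
  also have "\<dots> = x ** y - mscale ((-1) ^ (p * q)) (y ** x)"
    using assms(3,4) by auto
  finally show ?thesis .
qed

lemma munit_homogeneous: "munit i j \<in> homogeneous (par i j)"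
  by (auto simp: homogeneous_def gpart_def munit_def par_def vec_eq_iff)

lemma munit_mult: "munit i j ** munit k l = (if j = k then munit i l else 0)"
proof -
  have "(\<Sum>m\<in>UNIV. (if a = i \<and> m = j then 1 else 0) * (if m = k \<and> b = l then 1 else 0)) =
      (if j = k \<and> a = i \<and> b = l then 1 else (0 :: complex))" for a b
  proof -
    have "(if a = i \<and> m = j then 1 else 0) * (if m = k \<and> b = l then 1 else 0) =
        (if m = j then (if j = k \<and> a = i \<and> b = l then 1 else 0) else (0 :: complex))" for m
      by auto
    then show ?thesis by (simp add: sum.delta)
  qed
  then show ?thesis
    by (auto simp: matrix_matrix_mult_def munit_def vec_eq_iff)
qed

lemma matrix_expansion: "x = (\<Sum>i\<in>UNIV. \<Sum>j\<in>UNIV. mscale (x $ i $ j) (munit i j))"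
proof -
  have "(\<Sum>i\<in>UNIV. \<Sum>j\<in>UNIV. mscale (x $ i $ j) (munit i j) $ a $ b) = x $ a $ b" for a b
  proof -
    have "mscale (x $ i $ j) (munit i j) $ a $ b = (if i = a then if j = b then x $ a $ b else 0 else 0)" for i j
      by (simp add: munit_def)
    moreover have "(\<Sum>j\<in>UNIV. if i = a then if j = b then x $ a $ b else 0 else 0) = (if i = a then x $ a $ b else 0)" for i
      by (cases "i = a") (simp_all add: sum.delta)
    ultimately show ?thesis by (simp add: sum.delta)
  qed
  then show ?thesis by (simp add: vec_eq_iff)
qed

lemma \<iota>_zero: "\<iota> 0 = 0"
  using \<iota>_add[of 0 0] by simp

lemma \<iota>_uminus: "\<iota> (- x) = - \<iota> x"
  using \<iota>_add[of x "- x"] by (simp add: \<iota>_zero add_eq_0_iff)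

lemma \<iota>_diff: "\<iota> (x - y) = \<iota> x - \<iota> y"
  using \<iota>_add[of x "- y"] by (simp add: \<iota>_uminus)

lemma \<iota>_sum: "\<iota> (\<Sum>i\<in>I. f i) = (\<Sum>i\<in>I. \<iota> (f i))"
  by (induction I rule: infinite_finite_induct) (simp_all add: \<iota>_add \<iota>_zero)

lemma usc_uminus: "usc (- c) = - usc c"
  using usc.sc_diff[of 0 c] by simp

lemma usc_sign: "usc ((-1) ^ k) = (-1) ^ k"
  by (induction k) (simp_all add: usc.sc_one usc.sc_mult usc_uminus)

lemma \<iota>_munit_bracket:
  "\<iota> (munit i j) * \<iota> (munit k l) = (-1) ^ (par i j * par k l) * (\<iota> (munit k l) * \<iota> (munit i j))
    + (if j = k then \<iota> (munit i l) else 0) - (-1) ^ (par i j * par k l) * (if l = i then \<iota> (munit k j) else 0)"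
proof -
  have "\<iota> (sbracket (munit i j) (munit k l)) =
      (if j = k then \<iota> (munit i l) else 0) - (-1) ^ (par i j * par k l) * (if l = i then \<iota> (munit k j) else 0)"
    unfolding sbracket_homogeneous[OF munit_homogeneous munit_homogeneous par_01 par_01] munit_mult
    by (simp add: \<iota>_diff \<iota>_mscale usc_sign \<iota>_zero)
  with \<iota>_bracket[OF par_01 par_01 munit_homogeneous munit_homogeneous, of i j k l] show ?thesis
    by (simp add: algebra_simps)
qed

lemma U_half: "u + u = 0 \<Longrightarrow> u = 0" for u :: "('m::finite, 'n::finite) U_gl"
proof -
  assume "u + u = 0"
  then have "usc (1 / 2) * (u + u) = 0" by simp
  then have "(usc (1 / 2) + usc (1 / 2)) * u = 0" by (simp add: algebra_simps)
  then show ?thesis by (simp add: usc.sc_one flip: usc.sc_add)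
qed

section \<open>Ranks in a finite linear order\<close>

text \<open>Transports the abstract order of the index type to 1, ..., n, where the recursively
  defined model operators live; \<open>un\<close> is the inverse.\<close>

definition rk :: "'n::{finite,linorder} \<Rightarrow> nat" where
  "rk j = card {k. k \<le> j}"

lemma rk_less: "j < k \<Longrightarrow> rk j < rk k"
  unfolding rk_def by (rule psubset_card_mono, simp, rule psubsetI, force) (use not_less in blast)

lemma rk_less_iff: "rk j < rk k \<longleftrightarrow> j < k"
  using rk_less[of j k] rk_less[of k j] by (metis less_irrefl linorder_neqE order_less_asym)

lemma rk_eq_iff [simp]: "rk j = rk k \<longleftrightarrow> j = k"
  using rk_less_iff[of j k] rk_less_iff[of k j] by (metis less_irrefl linorder_neqE)

lemma rk_le_iff: "rk j \<le> rk k \<longleftrightarrow> j \<le> k"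
  using rk_less_iff[of k j] by (simp flip: not_less)

lemma rk_range: "rk (j :: 'n::{finite,linorder}) \<in> {1..CARD('n)}"
proof -
  have "card {j} \<le> rk j" unfolding rk_def by (rule card_mono) auto
  moreover have "rk j \<le> CARD('n)" unfolding rk_def by (rule card_mono) auto
  ultimately show ?thesis by simp
qed

lemma rk_image: "range (rk :: 'n::{finite,linorder} \<Rightarrow> nat) = {1..CARD('n)}"
proof (rule card_subset_eq)
  show "range (rk :: 'n \<Rightarrow> nat) \<subseteq> {1..CARD('n)}" using rk_range[where 'n = 'n] by auto
  have "inj (rk :: 'n \<Rightarrow> nat)" by (rule injI) simp
  then show "card (range (rk :: 'n \<Rightarrow> nat)) = card {1..CARD('n)}" by (simp add: card_image)
qed simp

definition un :: "nat \<Rightarrow> 'n::{finite,linorder}" where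
  "un = inv_into UNIV rk"

lemma un_rk [simp]: "un (rk j) = j"
  unfolding un_def by (rule inv_f_f) (rule injI, simp)

lemma rk_un: "a \<in> {1..CARD('n)} \<Longrightarrow> rk (un a :: 'n::{finite,linorder}) = a"
  unfolding un_def by (rule f_inv_into_f) (simp add: rk_image)

lemma un_eq_iff: "a \<in> {1..CARD('n)} \<Longrightarrow> b \<in> {1..CARD('n)} \<Longrightarrow> (un a :: 'n::{finite,linorder}) = un b \<longleftrightarrow> a = b"
  by (metis rk_un)

lemma un_less_iff: "a \<in> {1..CARD('n)} \<Longrightarrow> b \<in> {1..CARD('n)} \<Longrightarrow> (un a :: 'n::{finite,linorder}) < un b \<longleftrightarrow> a < b"
  by (metis rk_un rk_less_iff)

section \<open>The enveloping algebra and the model\<close>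

lemma parity_simps [simp]: "parity (Inl a) = 0" "parity (Inr b) = 1"
  by (simp_all add: parity_def)

definition uG :: "nat \<Rightarrow> nat \<Rightarrow> (1, 'n::{finite,linorder}) U_gl" where
  "uG a b = \<iota> (munit (Inr (un a)) (Inr (un b)))"
definition uX :: "nat \<Rightarrow> (1, 'n::{finite,linorder}) U_gl" where
  "uX b = \<iota> (munit (Inl 1) (Inr (un b)))"
definition uY :: "nat \<Rightarrow> (1, 'n::{finite,linorder}) U_gl" where
  "uY a = \<iota> (munit (Inr (un a)) (Inl 1))"
definition uH :: "(1, 'n::{finite,linorder}) U_gl" where
  "uH = \<iota> (munit (Inl 1) (Inl 1))"

lemma U_gl1n: "gl1n CARD('n::{finite,linorder}) uG uX uY (uH :: (1, 'n) U_gl)"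
proof
  note defs = uG_def uX_def uY_def uH_def
  fix a b c e
  assume a: "a \<in> {1..CARD('n)}"
  have "uX a * uX a + uX a * uX a = (0 :: (1, 'n) U_gl)"
    unfolding defs using \<iota>_munit_bracket[of "Inl 1" "Inr (un a)" "Inl 1" "Inr (un a)"]
    by (simp add: par_def eq_neg_iff_add_eq_0)
  then show "uX a * uX a = (0 :: (1, 'n) U_gl)" by (rule U_half)
  have "uY a * uY a + uY a * uY a = (0 :: (1, 'n) U_gl)"
    unfolding defs using \<iota>_munit_bracket[of "Inr (un a)" "Inl 1" "Inr (un a)" "Inl 1"]
    by (simp add: par_def eq_neg_iff_add_eq_0)
  then show "uY a * uY a = (0 :: (1, 'n) U_gl)" by (rule U_half)
  show "uH * uX a = uX a * uH + (uX a :: (1, 'n) U_gl)"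
    unfolding defs by (subst \<iota>_munit_bracket) (simp add: par_def)
  show "uH * uY a = uY a * uH - (uY a :: (1, 'n) U_gl)"
    unfolding defs by (subst \<iota>_munit_bracket) (simp add: par_def)
  assume b: "b \<in> {1..CARD('n)}"
  note ab = un_eq_iff[OF a b] un_eq_iff[OF b a]
  show "uX a * uY b = - (uY b * uX a) + uG b a + (if a = b then (uH :: (1, 'n) U_gl) else 0)"
    unfolding defs by (subst \<iota>_munit_bracket) (auto simp: par_def ab)
  show "uX a * uX b = - (uX b * (uX a :: (1, 'n) U_gl))"
    unfolding defs by (subst \<iota>_munit_bracket) (simp add: par_def)
  show "uY a * uY b = - (uY b * (uY a :: (1, 'n) U_gl))"
    unfolding defs by (subst \<iota>_munit_bracket) (simp add: par_def)
  show "uH * uG a b = uG a b * (uH :: (1, 'n) U_gl)"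
    unfolding defs by (subst \<iota>_munit_bracket) (simp add: par_def)
  assume c: "c \<in> {1..CARD('n)}"
  note ac = un_eq_iff[OF a c] un_eq_iff[OF c a] and bc = un_eq_iff[OF b c] un_eq_iff[OF c b]
  show "uG a b * uX c = uX c * uG a b - (if a = c then (uX b :: (1, 'n) U_gl) else 0)"
    unfolding defs by (subst \<iota>_munit_bracket) (auto simp: par_def ac)
  show "uG a b * uY c = uY c * uG a b + (if b = c then (uY a :: (1, 'n) U_gl) else 0)"
    unfolding defs by (subst \<iota>_munit_bracket) (auto simp: par_def bc)
  assume e: "e \<in> {1..CARD('n)}"
  note ae = un_eq_iff[OF a e] un_eq_iff[OF e a]
  show "uG a b * uG c e = uG c e * uG a b + (if b = c then uG a e else 0) - (if a = e then (uG c b :: (1, 'n) U_gl) else 0)"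
    unfolding defs by (subst \<iota>_munit_bracket) (auto simp: par_def bc ae)
qed

definition mU :: "complex \<Rightarrow> (nat \<Rightarrow> complex) \<Rightarrow> 1 + 'n \<Rightarrow> 1 + 'n::{finite,linorder} \<Rightarrow> state lin" where
  "mU \<alpha> \<beta> i j = (case i of
      Inl _ \<Rightarrow> (case j of Inl _ \<Rightarrow> mH \<alpha> \<beta> CARD('n) | Inr b \<Rightarrow> mX \<alpha> \<beta> CARD('n) (rk b))
    | Inr a \<Rightarrow> (case j of Inl _ \<Rightarrow> mY \<alpha> \<beta> CARD('n) (rk a) | Inr b \<Rightarrow> mG \<alpha> \<beta> CARD('n) (rk a) (rk b)))"

lemma mU_simps [simp]:
  fixes a b :: "'n::{finite,linorder}"
  shows "mU \<alpha> \<beta> (Inl u) (Inl v :: 1 + 'n) = mH \<alpha> \<beta> CARD('n)" "mU \<alpha> \<beta> (Inl u) (Inr b) = mX \<alpha> \<beta> CARD('n) (rk b)"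
  "mU \<alpha> \<beta> (Inr a) (Inl u) = mY \<alpha> \<beta> CARD('n) (rk a)" "mU \<alpha> \<beta> (Inr a) (Inr b) = mG \<alpha> \<beta> CARD('n) (rk a) (rk b)"
  by (simp_all add: mU_def)

lemma mU_bracket:
  fixes i j k l :: "1 + 'n::{finite,linorder}"
  shows "mU \<alpha> \<beta> i j * mU \<alpha> \<beta> k l = (-1) ^ (par i j * par k l) * (mU \<alpha> \<beta> k l * mU \<alpha> \<beta> i j)
    + (if j = k then mU \<alpha> \<beta> i l else 0) - (-1) ^ (par i j * par k l) * (if l = i then mU \<alpha> \<beta> k j else 0)"
proof -
  interpret gl1n "CARD('n)" "mG \<alpha> \<beta> CARD('n)" "mX \<alpha> \<beta> CARD('n)" "mY \<alpha> \<beta> CARD('n)" "mH \<alpha> \<beta> CARD('n)"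
    by (rule mod_gl1n)
  note r = rk_range[where 'n = 'n]
  have XX': "mX \<alpha> \<beta> CARD('n) (rk b) * mX \<alpha> \<beta> CARD('n) (rk c) = - (mX \<alpha> \<beta> CARD('n) (rk c) * mX \<alpha> \<beta> CARD('n) (rk b))" for b c :: 'n
    by (rule XX[OF r r])
  have YY': "mY \<alpha> \<beta> CARD('n) (rk b) * mY \<alpha> \<beta> CARD('n) (rk c) = - (mY \<alpha> \<beta> CARD('n) (rk c) * mY \<alpha> \<beta> CARD('n) (rk b))" for b c :: 'n
    by (rule YY[OF r r])
  have GG': "mG \<alpha> \<beta> CARD('n) (rk a) (rk b) * mG \<alpha> \<beta> CARD('n) (rk c) (rk d) = mG \<alpha> \<beta> CARD('n) (rk c) (rk d) * mG \<alpha> \<beta> CARD('n) (rk a) (rk b)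
      + (if b = c then mG \<alpha> \<beta> CARD('n) (rk a) (rk d) else 0) - (if d = a then mG \<alpha> \<beta> CARD('n) (rk c) (rk b) else 0)" for a b c d :: 'n
    using GG[OF r r r r, of a b c d] by auto
  show ?thesis
    by (cases i; cases j; cases k; cases l)
      (simp_all add: num1_eq_iff par_def XY[OF r r] HG[OF r r] HX[OF r] HY[OF r] GX[OF r r r] GY[OF r r r],
        (rule XX' | rule YY' | (subst GG', simp) | simp)+)
qed

definition mrep :: "complex \<Rightarrow> (nat \<Rightarrow> complex) \<Rightarrow> (1, 'n::{finite,linorder}) gl \<Rightarrow> state lin" where
  "mrep \<alpha> \<beta> x = (\<Sum>i\<in>UNIV. \<Sum>j\<in>UNIV. cm (x $ i $ j) (mU \<alpha> \<beta> i j))"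

lemma mrep_add: "mrep \<alpha> \<beta> (x + y) = mrep \<alpha> \<beta> x + mrep \<alpha> \<beta> y"
  by (simp add: mrep_def cm_add sum.distrib)

lemma cm_sum: "cm c (\<Sum>i\<in>I. f i) = (\<Sum>i\<in>I. cm c (f i))"
  by (simp add: cm_def sum_distrib_left)

lemma cm_sum_left: "cm (\<Sum>i\<in>I. c i) A = (\<Sum>i\<in>I. cm (c i) A)"
  by (induction I rule: infinite_finite_induct) (simp_all add: cm_add cm_simps)

lemma mrep_mscale: "mrep \<alpha> \<beta> (mscale c x) = scal c * mrep \<alpha> \<beta> x"
  by (simp add: mrep_def cm_sum cm_simps flip: cm_def)

lemma mrep_munit: "mrep \<alpha> \<beta> (munit i j) = mU \<alpha> \<beta> i j"
proof -
  have "cm (munit i j $ k $ l) (mU \<alpha> \<beta> k l) = (if k = i then if l = j then mU \<alpha> \<beta> i j else 0 else 0)" for k l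
    by (simp add: munit_def cm_simps)
  moreover have "(\<Sum>l\<in>UNIV. if k = i then if l = j then mU \<alpha> \<beta> i j else 0 else 0) = (if k = i then mU \<alpha> \<beta> i j else 0)" for k
    by (cases "k = i") (simp_all add: sum.delta)
  ultimately show ?thesis by (simp add: mrep_def sum.delta)
qed

lemma sum_collapse:
  "(\<Sum>k\<in>UNIV. \<Sum>l\<in>UNIV. if j = k then F k l else 0) = (\<Sum>l\<in>UNIV. F j l)"
  for F :: "'a::finite \<Rightarrow> 'b::finite \<Rightarrow> 'c::comm_monoid_add"
  by (subst sum.swap) (simp add: sum.delta)

lemma mrep_bracket:
  assumes "p \<in> {0, 1}" "q \<in> {0, 1}" "x \<in> homogeneous p" "y \<in> homogeneous q"
  shows "mrep \<alpha> \<beta> x * mrep \<alpha> \<beta> y - (-1) ^ (p * q) * (mrep \<alpha> \<beta> y * mrep \<alpha> \<beta> x) = mrep \<alpha> \<beta> (sbracket x y)"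
proof -
  let ?m = "mU \<alpha> \<beta>" and ?\<epsilon> = "(-1) ^ (p * q) :: complex"
  have sign: "(-1) ^ k * A = cm ((-1) ^ k) A" for k and A :: "state lin"
    by (induction k) (simp_all add: cm_simps cm_add mult.assoc)
  have prod: "mrep \<alpha> \<beta> u * mrep \<alpha> \<beta> v =
      (\<Sum>i\<in>UNIV. \<Sum>j\<in>UNIV. \<Sum>k\<in>UNIV. \<Sum>l\<in>UNIV. cm (u $ i $ j * v $ k $ l) (?m i j * ?m k l))" for u v
    unfolding mrep_def sum_distrib_right unfolding sum_distrib_left
    by (intro sum.cong refl) (simp add: cm_simps mult.commute)
  have swap: "mrep \<alpha> \<beta> y * mrep \<alpha> \<beta> x =
      (\<Sum>i\<in>UNIV. \<Sum>j\<in>UNIV. \<Sum>k\<in>UNIV. \<Sum>l\<in>UNIV. cm (x $ i $ j * y $ k $ l) (?m k l * ?m i j))"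
    unfolding mrep_def sum_distrib_left unfolding sum_distrib_right
    by (intro sum.cong refl) (simp add: cm_simps mult.commute)
  have "mrep \<alpha> \<beta> x * mrep \<alpha> \<beta> y - (-1) ^ (p * q) * (mrep \<alpha> \<beta> y * mrep \<alpha> \<beta> x) =
      (\<Sum>i\<in>UNIV. \<Sum>j\<in>UNIV. \<Sum>k\<in>UNIV. \<Sum>l\<in>UNIV. cm (x $ i $ j * y $ k $ l) (?m i j * ?m k l - cm ?\<epsilon> (?m k l * ?m i j)))"
    unfolding prod[of x y] swap sign by (simp add: cm_sum cm_simps sum_subtractf mult.commute)
  also have "\<dots> = (\<Sum>i\<in>UNIV. \<Sum>j\<in>UNIV. \<Sum>k\<in>UNIV. \<Sum>l\<in>UNIV.
      (if j = k then cm (x $ i $ j * y $ k $ l) (?m i l) else 0) - (if l = i then cm (?\<epsilon> * (y $ k $ l * x $ i $ j)) (?m k j) else 0))"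
  proof (intro sum.cong refl)
    fix i j k l
    show "cm (x $ i $ j * y $ k $ l) (?m i j * ?m k l - cm ?\<epsilon> (?m k l * ?m i j)) =
      (if j = k then cm (x $ i $ j * y $ k $ l) (?m i l) else 0) - (if l = i then cm (?\<epsilon> * (y $ k $ l * x $ i $ j)) (?m k j) else 0)"
    \<comment> \<open>If both entries are nonzero, homogeneity forces the parities of the two matrix
      units to be p and q, so the sign in \<open>mU_bracket\<close> is the global one.\<close>
    proof (cases "x $ i $ j = 0 \<or> y $ k $ l = 0")
      case False
      then have "par i j = p" "par k l = q"
        using homogeneous_zero assms(3,4) by blast+
      then have "?m i j * ?m k l - cm ?\<epsilon> (?m k l * ?m i j) =
          (if j = k then ?m i l else 0) - cm ?\<epsilon> (if l = i then ?m k j else 0)"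
        using mU_bracket[of \<alpha> \<beta> i j k l] by (simp add: sign)
      then show ?thesis by (simp add: cm_simps mult_ac)
    qed (auto simp: cm_simps)
  qed
  also have "\<dots> = (\<Sum>i\<in>UNIV. \<Sum>l\<in>UNIV. \<Sum>j\<in>UNIV. cm (x $ i $ j * y $ j $ l) (?m i l))
      - (\<Sum>k\<in>UNIV. \<Sum>j\<in>UNIV. \<Sum>i\<in>UNIV. cm (?\<epsilon> * (y $ k $ i * x $ i $ j)) (?m k j))"
  proof -
    have "(\<Sum>i\<in>UNIV. \<Sum>j\<in>UNIV. \<Sum>k\<in>UNIV. \<Sum>l\<in>UNIV. if j = k then cm (x $ i $ j * y $ k $ l) (?m i l) else 0)
        = (\<Sum>i\<in>UNIV. \<Sum>j\<in>UNIV. \<Sum>l\<in>UNIV. cm (x $ i $ j * y $ j $ l) (?m i l))"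
      by (simp only: sum_collapse)
    also have "\<dots> = (\<Sum>i\<in>UNIV. \<Sum>l\<in>UNIV. \<Sum>j\<in>UNIV. cm (x $ i $ j * y $ j $ l) (?m i l))"
      by (rule sum.cong[OF refl], rule sum.swap)
    finally have 1: "(\<Sum>i\<in>UNIV. \<Sum>j\<in>UNIV. \<Sum>k\<in>UNIV. \<Sum>l\<in>UNIV. if j = k then cm (x $ i $ j * y $ k $ l) (?m i l) else 0)
        = (\<Sum>i\<in>UNIV. \<Sum>l\<in>UNIV. \<Sum>j\<in>UNIV. cm (x $ i $ j * y $ j $ l) (?m i l))" .
    have "(\<Sum>i\<in>UNIV. \<Sum>j\<in>UNIV. \<Sum>k\<in>UNIV. \<Sum>l\<in>UNIV. if l = i then cm (?\<epsilon> * (y $ k $ l * x $ i $ j)) (?m k j) else 0)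
        = (\<Sum>i\<in>UNIV. \<Sum>j\<in>UNIV. \<Sum>k\<in>UNIV. cm (?\<epsilon> * (y $ k $ i * x $ i $ j)) (?m k j))"
      by (simp add: sum.delta)
    also have "\<dots> = (\<Sum>i\<in>UNIV. \<Sum>k\<in>UNIV. \<Sum>j\<in>UNIV. cm (?\<epsilon> * (y $ k $ i * x $ i $ j)) (?m k j))"
      by (rule sum.cong[OF refl], rule sum.swap)
    also have "\<dots> = (\<Sum>k\<in>UNIV. \<Sum>i\<in>UNIV. \<Sum>j\<in>UNIV. cm (?\<epsilon> * (y $ k $ i * x $ i $ j)) (?m k j))"
      by (rule sum.swap)
    also have "\<dots> = (\<Sum>k\<in>UNIV. \<Sum>j\<in>UNIV. \<Sum>i\<in>UNIV. cm (?\<epsilon> * (y $ k $ i * x $ i $ j)) (?m k j))"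
      by (rule sum.cong[OF refl], rule sum.swap)
    finally show ?thesis using 1 by (simp add: sum_subtractf)
  qed
  also have "\<dots> = mrep \<alpha> \<beta> (x ** y) + mrep \<alpha> \<beta> (- mscale ?\<epsilon> (y ** x))"
    by (simp add: mrep_def matrix_matrix_mult_def cm_sum_left sum_distrib_left cm_add sum_negf)
  also have "\<dots> = mrep \<alpha> \<beta> (sbracket x y)"
    unfolding sbracket_homogeneous[OF assms(3,4,1,2)] by (simp flip: mrep_add)
  finally show ?thesis .
qed

lemma borel_entry:
  fixes t :: "(1, 'n::{finite,linorder}) gl"
  assumes "t \<in> borel" "t $ i $ j \<noteq> 0"
  shows "i = j \<or> (i = Inl 1 \<and> (\<exists>b. j = Inr b)) \<or> (\<exists>a b. i = Inr a \<and> j = Inr b \<and> a < b)"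
proof (cases "i = j")
  case False
  have inj: "i = k \<and> j = l" if "axis i 1 - axis j 1 = (axis k 1 - axis l 1 :: (1, 'n) weight)" for k l
  proof -
    have "(axis i 1 - axis j 1 :: (1, 'n) weight) $ i = (axis k 1 - axis l 1) $ i"
      "(axis i 1 - axis j 1 :: (1, 'n) weight) $ j = (axis k 1 - axis l 1) $ j"
      using that by simp_all
    then show ?thesis using False by (auto simp: axis_def split: if_splits)
  qed
  have "axis i 1 - axis j 1 \<in> pos_even_roots \<union> (pos_odd_roots :: (1, 'n) weight set)"
    using assms False unfolding borel_def by blast
  then consider k l :: 1 where "axis i 1 - axis j 1 = (eps k - eps l :: (1, 'n) weight)" "k < l"
    | a b :: 'n where "axis i 1 - axis j 1 = (del a - del b :: (1, 'n) weight)" "a < b"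
    | k b where "axis i 1 - axis j 1 = (eps k - del b :: (1, 'n) weight)"
    unfolding pos_even_roots_def pos_odd_roots_def by blast
  then show ?thesis
  proof cases
    case 1
    then show ?thesis using num1_eqI[of k l] by simp
  next
    case 2
    then show ?thesis using inj[of "Inr a" "Inr b"] by (auto simp: del_def)
  next
    case 3
    then show ?thesis using inj[of "Inl k" "Inr b"] num1_eqI[of k 1] by (auto simp: eps_def del_def)
  qed
qed simp

lemma munit_borel:
  "munit i i \<in> (borel :: (1, 'n::{finite,linorder}) gl set)"
  "munit (Inl 1) (Inr b) \<in> (borel :: (1, 'n) gl set)"
  "a < b \<Longrightarrow> munit (Inr a) (Inr b) \<in> (borel :: (1, 'n) gl set)"
  by (auto simp: borel_def munit_def pos_even_roots_def pos_odd_roots_def eps_def del_def split: if_splits)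

lemma wt_eval_munit: "wt_eval \<mu> (munit i j) = (if i = j then \<mu> $ i else 0)"
proof -
  have "\<mu> $ k * munit i j $ k $ k = (if k = i then if i = j then \<mu> $ i else 0 else 0)" for k
    by (auto simp: munit_def)
  then show ?thesis by (simp add: wt_eval_def sum.delta)
qed

section \<open>The Poincare-Birkhoff-Witt map\<close>

text \<open>Blocks of larger index stand further to the left, so the odd generators appear in
  decreasing order. A state has its odd letters in increasing order, and the sign accounts for
  moving \<theta>_N past the smaller ones.\<close>

definition pbw_block :: "nat \<Rightarrow> state \<Rightarrow> (1, 'n::{finite,linorder}) U_gl" where
  "pbw_block N s = usc (if N \<in> fst s then jw_sign (fst s) N else 1) * (if N \<in> fst s then uY N else 1)
     * prod_list (map (\<lambda>k. uG N k ^ snd s (N, k)) [1..<N])"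

primrec pbw_mon :: "nat \<Rightarrow> state \<Rightarrow> (1, 'n::{finite,linorder}) U_gl" where
  "pbw_mon 0 s = 1"
| "pbw_mon (Suc N) s = pbw_block (Suc N) s * pbw_mon N s"

definition pbw :: "(state \<Rightarrow>\<^sub>0 complex) \<Rightarrow> (1, 'n::{finite,linorder}) U_gl" where
  "pbw = pmext (\<lambda>s c. usc c * pbw_mon CARD('n) s)"

lemma pbw_add: "pbw (f + g) = pbw f + pbw g"
  unfolding pbw_def by (rule pmext_add) (simp_all add: usc.sc_add distrib_right)

lemma pbw_single: "(pbw (Poly_Mapping.single s c) :: (1, 'n::{finite,linorder}) U_gl) = usc c * pbw_mon CARD('n) s"
  unfolding pbw_def by (subst pmext_single) simp_all

lemma pbw_zero [simp]: "pbw 0 = 0"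
  by (simp add: pbw_def)

lemma pbw_uminus: "pbw (- f) = - pbw f"
  using pbw_add[of f "- f"] by (simp add: add_eq_0_iff)

lemma pbw_diff: "pbw (f - g) = pbw f - pbw g"
  using pbw_add[of f "- g"] by (simp add: pbw_uminus)

lemma pbw_vscale: "pbw (vscale c f) = usc c * pbw f"
proof (induction f rule: pm_induct)
  case (plus k x f)
  then show ?case by (simp add: vscale_add pbw_add pbw_single usc.sc_mult distrib_left mult.assoc)
qed simp

lemma pbw_vac: "pbw vac = (1 :: (1, 'n::{finite,linorder}) U_gl)"
proof -
  have "pbw_mon N ({}, \<lambda>_. 0) = (1 :: (1, 'n) U_gl)" for N
  proof (induction N)
    case (Suc N)
    have "prod_list (map (\<lambda>k. 1 :: (1, 'n) U_gl) l) = 1" for l :: "nat list" by (induction l) auto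
    with Suc show ?case by (simp add: pbw_block_def usc.sc_one del: upt_Suc)
  qed simp
  then show ?thesis by (simp add: vac_def pbw_single usc.sc_one)
qed

lemma prod_list_one: "(\<And>x. x \<in> set l \<Longrightarrow> f x = 1) \<Longrightarrow> prod_list (map f l) = (1 :: 'a::monoid_mult)"
  by (induction l) auto

lemma pbw_mon_valid: "valid M s \<Longrightarrow> M \<le> N \<Longrightarrow> pbw_mon N s = (pbw_mon M s :: (1, 'n::{finite,linorder}) U_gl)"
proof (induction N)
  case (Suc N)
  show ?case
  proof (cases "M = Suc N")
    case False
    have "Suc N \<notin> fst s" using Suc.prems False by (auto simp: valid_def)
    moreover have "snd s (Suc N, k) = 0" for k
    proof (rule ccontr)
      assume "snd s (Suc N, k) \<noteq> 0"
      then have "Suc N \<le> M" using Suc.prems unfolding valid_def by blast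
      then show False using Suc.prems False by simp
    qed
    ultimately have "pbw_block (Suc N) s = (1 :: (1, 'n) U_gl)"
      unfolding pbw_block_def by (subst prod_list_one) (simp_all add: usc.sc_one)
    then show ?thesis using Suc False by simp
  qed simp
qed simp

lemma pbw_mon_cong:
  assumes "\<And>N. N \<le> M \<Longrightarrow> N \<in> fst s \<longleftrightarrow> N \<in> fst s'" "\<And>N k. N \<le> M \<Longrightarrow> snd s (N, k) = snd s' (N, k)"
  shows "pbw_mon M s = (pbw_mon M s' :: (1, 'n::{finite,linorder}) U_gl)"
  using assms
proof (induction M)
  case (Suc M)
  have "{K \<in> fst s. K < Suc M} = {K \<in> fst s'. K < Suc M}" using Suc.prems(1) by auto
  then have "jw_sign (fst s) (Suc M) = jw_sign (fst s') (Suc M)" by (simp add: jw_sign_def)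
  moreover have "Suc M \<in> fst s \<longleftrightarrow> Suc M \<in> fst s'" "\<And>k. snd s (Suc M, k) = snd s' (Suc M, k)"
    using Suc.prems by auto
  ultimately have "pbw_block (Suc M) s = (pbw_block (Suc M) s' :: (1, 'n) U_gl)" by (simp add: pbw_block_def)
  moreover have "pbw_mon M s = (pbw_mon M s' :: (1, 'n) U_gl)" using Suc by auto
  ultimately show ?case by simp
qed simp

lemma prod_list_insert_power:
  fixes g :: "nat \<Rightarrow> 'a::monoid_mult"
  assumes "distinct l" "k \<in> set l" "\<And>j. j \<in> set l \<Longrightarrow> g k * g j = g j * g k"
  shows "prod_list (map (\<lambda>j. g j ^ (if j = k then Suc (e j) else e j)) l) = g k * prod_list (map (\<lambda>j. g j ^ e j) l)"
  using assms
proof (induction l)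
  case (Cons j l)
  show ?case
  proof (cases "j = k")
    case True
    then have "prod_list (map (\<lambda>j. g j ^ (if j = k then Suc (e j) else e j)) l) = prod_list (map (\<lambda>j. g j ^ e j) l)"
      using Cons.prems by (intro arg_cong[of _ _ prod_list] map_cong) auto
    then show ?thesis using True by (simp add: mult.assoc)
  next
    case False
    have c: "g k * g j ^ p = g j ^ p * g k" for p
      using Cons.prems(3)[of j] by (simp add: power_commuting_commutes)
    have "prod_list (map (\<lambda>j. g j ^ (if j = k then Suc (e j) else e j)) (j # l)) =
        g j ^ e j * (g k * prod_list (map (\<lambda>j. g j ^ e j) l))"
      using Cons False by simp
    also have "\<dots> = g k * (g j ^ e j * prod_list (map (\<lambda>j. g j ^ e j) l))"
      using c[of "e j"] by (simp flip: mult.assoc)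
    finally show ?thesis by simp
  qed
qed simp

context
  fixes \<Lambda> :: "(1, 'n::{finite,linorder}) weight"
begin

definition "\<alpha>\<^sub>\<Lambda> = \<Lambda> $ Inl 1"
definition "\<beta>\<^sub>\<Lambda> a = \<Lambda> $ Inr (un a :: 'n)"
abbreviation "mmG \<equiv> mG \<alpha>\<^sub>\<Lambda> \<beta>\<^sub>\<Lambda> CARD('n)"
abbreviation "mmX \<equiv> mX \<alpha>\<^sub>\<Lambda> \<beta>\<^sub>\<Lambda> CARD('n)"
abbreviation "mmY \<equiv> mY \<alpha>\<^sub>\<Lambda> \<beta>\<^sub>\<Lambda> CARD('n)"
abbreviation "mmH \<equiv> mH \<alpha>\<^sub>\<Lambda> \<beta>\<^sub>\<Lambda> CARD('n)"

interpretation U: gl1n "CARD('n)" uG uX uY "uH :: (1, 'n) U_gl" by (rule U_gl1n)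
interpretation M: gl1n "CARD('n)" mmG mmX mmY mmH by (rule mod_gl1n)

text \<open>On level M the generator E_Mk can be merged into the leftmost block, because it commutes
  with E_M0 and with all E_Mj, j < M. The equality thus holds in the algebra itself, without passing
  to the quotient.\<close>

lemma pbw_lower:
  assumes "1 \<le> k" "k < M" "M \<le> CARD('n)" "g \<in> Vs M \<Theta>"
  shows "uG M k * pbw g = (pbw (app (zop M k) g) :: (1, 'n) U_gl)"
proof -
  have "uG M k * pbw_mon CARD('n) s = (pbw_mon CARD('n) (T, e((M, k) := Suc (e (M, k)))) :: (1, 'n) U_gl)"
    if v: "valid M s" and s: "s = (T, e)" for s T e
  proof -
    let ?s = "(T, e((M, k) := Suc (e (M, k))))"
    have v': "valid M ?s" using v assms by (auto simp: valid_def s)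
    obtain M' where M': "M = Suc M'" using assms by (cases M) auto
    have low: "pbw_mon M' ?s = (pbw_mon M' s :: (1, 'n) U_gl)"
      by (rule pbw_mon_cong) (auto simp: s M')
    have comm: "uG M k * uG M j = uG M j * (uG M k :: (1, 'n) U_gl)" if "j \<in> set [1..<M]" for j
      using U.GG[of M k M j] assms that by auto
    have "pbw_block M ?s = usc (if M \<in> T then jw_sign T M else 1) * (if M \<in> T then uY M else 1)
        * prod_list (map (\<lambda>j. (uG M j :: (1, 'n) U_gl) ^ (if j = k then Suc (e (M, j)) else e (M, j))) [1..<M])"
      unfolding pbw_block_def by (simp cong: if_cong)
    also have "\<dots> = usc (if M \<in> T then jw_sign T M else 1) * (if M \<in> T then uY M else 1)
        * (uG M k * prod_list (map (\<lambda>j. uG M j ^ e (M, j)) [1..<M]))"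
      using assms by (subst prod_list_insert_power) (simp_all add: comm)
    also have "\<dots> = uG M k * pbw_block M s"
    proof -
      have "uY M * uG M k = uG M k * (uY M :: (1, 'n) U_gl)"
        using U.GY[of M k M] assms by simp
      note this[THEN nest]
      then show ?thesis
        by (simp add: pbw_block_def s usc.sc_central[of _ "uG M k"] mult.assoc usc.sc_central[of _ "uG M k", THEN nest])
    qed
    finally show ?thesis
      unfolding pbw_mon_valid[OF v assms(3)] pbw_mon_valid[OF v' assms(3)] unfolding M' pbw_mon.simps
      by (simp only: low[unfolded M'] mult.assoc)
  qed
  note mon = this
  have single: "uG M k * pbw (Poly_Mapping.single s c) = (pbw (app (zop M k) (Poly_Mapping.single s c)) :: (1, 'n) U_gl)"
    if "valid M s" for s c
  proof -
    obtain T e where s: "s = (T, e)" by (cases s)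
    show ?thesis
      unfolding pbw_single zop_def app_mop_single
      using mon[OF that s] usc.sc_central[of c "uG M k :: (1, 'n) U_gl", symmetric, THEN nest]
      by (simp add: pbw_single s mult.assoc)
  qed
  have "uG M k * pbw (\<Sum>s\<in>A. Poly_Mapping.single s (lookup g s)) = (pbw (app (zop M k) (\<Sum>s\<in>A. Poly_Mapping.single s (lookup g s))) :: (1, 'n) U_gl)"
    if "finite A" "A \<subseteq> Poly_Mapping.keys g" for A
    using that
  proof (induction A rule: finite_induct)
    case (insert s A)
    then have "valid M s" using assms(4) by (auto simp: Vs_def)
    with insert single[of s] show ?case by (simp add: pbw_add distrib_left)
  qed simp
  from this[of "Poly_Mapping.keys g"] show ?thesis
    using pmext_decompose[of g] by (simp add: pmext_def)
qed

lemma pbw_lower_odd: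
  assumes "1 \<le> M" "M \<le> CARD('n)" "g \<in> Vs M \<Theta>"
  shows "uY M * pbw g = (pbw (app (tht M) g) :: (1, 'n) U_gl)"
proof -
  obtain M' where M': "M = Suc M'" using assms by (cases M) auto
  have single: "uY M * pbw (Poly_Mapping.single s c) = (pbw (app (tht M) (Poly_Mapping.single s c)) :: (1, 'n) U_gl)"
    if v: "valid M s" for s c
  proof -
    obtain T e where s: "s = (T, e)" by (cases s)
    have YY: "uY M * (uY M * w) = (0 :: (1, 'n) U_gl)" for w
      using U.YY0[of M, THEN nest] assms by simp
    have Yc: "uY M * (usc d * w) = usc d * (uY M * w :: (1, 'n) U_gl)" for d w
      using usc.sc_central[of d "uY M :: (1, 'n) U_gl", symmetric, THEN nest] by (simp add: mult.assoc)
    show ?thesis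
    proof (cases "M \<in> T")
      case True
      have "uY M * (pbw_block M s * w) = (0 :: (1, 'n) U_gl)" for w
        using True by (simp add: pbw_block_def s Yc YY mult.assoc del: upt_Suc)
      then have z: "uY M * pbw_mon CARD('n) s = (0 :: (1, 'n) U_gl)"
        unfolding pbw_mon_valid[OF v assms(2)] by (simp add: M')
      show ?thesis
        unfolding pbw_single Yc z using True by (simp add: tht_def s)
    next
      case False
      let ?s = "(insert M T, e)"
      have v': "valid M ?s" using v assms by (auto simp: valid_def s)
      have low: "pbw_mon M' ?s = (pbw_mon M' s :: (1, 'n) U_gl)"
        by (rule pbw_mon_cong) (auto simp: s M')
      have "pbw_block M ?s = usc (jw_sign T M) * (uY M * (pbw_block M s :: (1, 'n) U_gl))"
        using False by (simp add: pbw_block_def s jw_sign_insert usc.sc_one mult.assoc)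
      then have mon: "pbw_mon CARD('n) ?s = usc (jw_sign T M) * (uY M * (pbw_mon CARD('n) s :: (1, 'n) U_gl))"
        unfolding pbw_mon_valid[OF v assms(2)] pbw_mon_valid[OF v' assms(2)]
        unfolding M' pbw_mon.simps by (simp only: low[unfolded M'] mult.assoc)
      have "app (tht M) (Poly_Mapping.single s c) = Poly_Mapping.single ?s (c * jw_sign T M)"
        using False by (simp add: tht_def s mult.commute)
      then have "pbw (app (tht M) (Poly_Mapping.single s c)) = usc (c * (jw_sign T M * jw_sign T M)) * (uY M * (pbw_mon CARD('n) s :: (1, 'n) U_gl))"
        unfolding usc.sc_mult by (simp only: pbw_single mon usc.sc_mult mult.assoc)
      then show ?thesis
        unfolding pbw_single Yc by simp
    qed
  qed
  have "uY M * pbw (\<Sum>s\<in>A. Poly_Mapping.single s (lookup g s)) = (pbw (app (tht M) (\<Sum>s\<in>A. Poly_Mapping.single s (lookup g s))) :: (1, 'n) U_gl)"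
    if "finite A" "A \<subseteq> Poly_Mapping.keys g" for A
    using that
  proof (induction A rule: finite_induct)
    case (insert s A)
    then have "valid M s" using assms(3) by (auto simp: Vs_def)
    with insert single[of s] show ?case by (simp add: pbw_add distrib_left)
  qed simp
  from this[of "Poly_Mapping.keys g"] show ?thesis
    using pmext_decompose[of g] by (simp add: pmext_def)
qed

abbreviation "L \<equiv> verma_ideal \<Lambda>"

lemma L_munit:
  assumes "munit i j \<in> borel"
  shows "i \<noteq> j \<Longrightarrow> u * \<iota> (munit i j) \<in> L" "u * \<iota> (munit i i) - u * usc (\<Lambda> $ i) \<in> L"
proof -
  show "u * \<iota> (munit i j) \<in> L" if "i \<noteq> j"
    using verma_ideal.gen[OF assms, of u \<Lambda>] that by (simp add: wt_eval_munit)
  show "u * \<iota> (munit i i) - u * usc (\<Lambda> $ i) \<in> L"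
    using verma_ideal.gen[OF munit_borel(1)[of i], of u \<Lambda>] by (simp add: wt_eval_munit right_diff_distrib)
qed

lemma L_gens:
  "a \<in> {1..CARD('n)} \<Longrightarrow> b \<in> {1..CARD('n)} \<Longrightarrow> a < b \<Longrightarrow> u * uG a b \<in> L"
  "u * uX b \<in> L" "u * uG b b - u * usc (\<beta>\<^sub>\<Lambda> b) \<in> L" "u * uH - u * usc \<alpha>\<^sub>\<Lambda> \<in> L"
  unfolding uG_def uX_def uH_def \<alpha>\<^sub>\<Lambda>_def \<beta>\<^sub>\<Lambda>_def
  using L_munit(1)[OF munit_borel(2)] L_munit(2)[OF munit_borel(1)] L_munit(1)[OF munit_borel(3)] un_less_iff[where 'n = 'n, of a b]
  by auto

lemma L_zero: "0 \<in> L" by (rule verma_ideal.zero)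

text \<open>A generator of column b > N can be moved right through the letters of level N to the
  highest weight vector. The nonzero brackets on the way are again generators of column b, of the
  form E_Mb with M < b, so the three families are treated together.\<close>

lemma raise_kill:
  assumes "f \<in> Vs N \<Theta>" "N \<le> CARD('n)"
  shows "\<forall>b\<in>{Suc N..CARD('n)}. (\<forall>a\<in>{1..<b}. uG a b * pbw f \<in> L) \<and> uX b * pbw f \<in> L \<and> uG b b * pbw f - usc (\<beta>\<^sub>\<Lambda> b) * pbw f \<in> L"
  using assms(1)
proof (induction rule: Vs_induct)
  case zero
  show ?case by (simp add: L_zero)
next
  case (add f g)
  show ?case
  proof (intro ballI conjI)
    fix b assume b: "b \<in> {Suc N..CARD('n)}"
    show "uG a b * pbw (f + g) \<in> L" if "a \<in> {1..<b}" for a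
      unfolding pbw_add distrib_left by (intro verma_ideal.add) (use add b that in blast)+
    show "uX b * pbw (f + g) \<in> L"
      unfolding pbw_add distrib_left by (intro verma_ideal.add) (use add b in blast)+
    have eq: "uG b b * pbw (f + g) - usc (\<beta>\<^sub>\<Lambda> b) * (pbw (f + g) :: (1, 'n) U_gl) =
        (uG b b * pbw f - usc (\<beta>\<^sub>\<Lambda> b) * pbw f) + (uG b b * pbw g - usc (\<beta>\<^sub>\<Lambda> b) * pbw g)"
      by (simp add: pbw_add distrib_left)
    show "uG b b * pbw (f + g) - usc (\<beta>\<^sub>\<Lambda> b) * pbw (f + g) \<in> L"
      unfolding eq by (intro verma_ideal.add) (use add b in blast)+
  qed
next
  case (vac c)
  have c: "w * pbw (vscale c vac) = usc c * w" for w :: "(1, 'n) U_gl"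
    by (simp add: pbw_vscale pbw_vac usc.sc_central)
  show ?case
  proof (intro ballI conjI)
    fix b assume b: "b \<in> {Suc N..CARD('n)}"
    show "uG a b * pbw (vscale c vac) \<in> L" if "a \<in> {1..<b}" for a
      unfolding c using that b by (intro L_gens(1)) auto
    show "uX b * pbw (vscale c vac) \<in> L" unfolding c by (rule L_gens(2))
    show "uG b b * pbw (vscale c vac) - usc (\<beta>\<^sub>\<Lambda> b) * pbw (vscale c vac) \<in> L"
      unfolding c by (rule L_gens(3))
  qed
next
  case (z M k g)
  have M: "M \<le> CARD('n)" using z assms by simp
  note low = pbw_lower[OF z(1,2) M z(4), symmetric]
  show ?case
  proof (intro ballI conjI)
    fix b assume b: "b \<in> {Suc N..CARD('n)}"
    have kM: "k \<in> {1..CARD('n)}" "M \<in> {1..CARD('n)}" "b \<in> {1..CARD('n)}" "M \<noteq> b" "k \<noteq> b" "M \<in> {1..<b}" using z b M by auto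
    have IH: "uG a b * pbw g \<in> L" if "a \<in> {1..<b}" for a using z(5) b that by blast
    have IH': "uX b * pbw g \<in> L" "uG b b * pbw g - usc (\<beta>\<^sub>\<Lambda> b) * pbw g \<in> L" using z(5) b by blast+
    show "uG a b * pbw (app (zop M k) g) \<in> L" if a: "a \<in> {1..<b}" for a
    proof -
      have "uG a b * (uG M k * (pbw g :: (1, 'n) U_gl)) = uG M k * (uG a b * pbw g) - (if a = k then uG M b * pbw g else 0)"
        using U.GG[of a b M k, THEN nest, of "pbw g"] a kM by (auto simp: algebra_simps)
      also have "\<dots> \<in> L"
        using IH[OF a] IH[OF kM(6)] by (auto intro!: verma_ideal_diff verma_ideal_lmult L_zero)
      finally show ?thesis by (simp add: low)
    qed
    have "uX b * (uG M k * (pbw g :: (1, 'n) U_gl)) = uG M k * (uX b * pbw g)"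
      using U.GX[of M k b, THEN nest, of "pbw g"] kM by (simp add: mult.assoc)
    then show "uX b * pbw (app (zop M k) g) \<in> L" using IH'(1) by (simp add: low verma_ideal_lmult)
    have "uG b b * (uG M k * (pbw g :: (1, 'n) U_gl)) = uG M k * (uG b b * pbw g)"
      using U.GG[of b b M k, THEN nest, of "pbw g"] kM by (simp add: mult.assoc)
    moreover have "usc d * (uG M k * w) = (uG M k * (usc d * w) :: (1, 'n) U_gl)" for d w
      using usc.sc_central[of d "uG M k", THEN nest, of w] by (simp add: mult.assoc)
    ultimately have "uG b b * pbw (app (zop M k) g) - usc (\<beta>\<^sub>\<Lambda> b) * (pbw (app (zop M k) g) :: (1, 'n) U_gl) =
        uG M k * (uG b b * pbw g - usc (\<beta>\<^sub>\<Lambda> b) * pbw g)"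
      by (simp add: low right_diff_distrib)
    then show "uG b b * pbw (app (zop M k) g) - usc (\<beta>\<^sub>\<Lambda> b) * pbw (app (zop M k) g) \<in> L"
      using IH'(2) by (simp add: verma_ideal_lmult)
  qed
next
  case (th M g)
  have M: "M \<le> CARD('n)" using th assms by simp
  note low = pbw_lower_odd[OF th(1) M th(4), symmetric]
  show ?case
  proof (intro ballI conjI)
    fix b assume b: "b \<in> {Suc N..CARD('n)}"
    have kM: "M \<in> {1..CARD('n)}" "b \<in> {1..CARD('n)}" "M \<noteq> b" "M \<in> {1..<b}" using th b M by auto
    have IH: "uG a b * pbw g \<in> L" if "a \<in> {1..<b}" for a using th(5) b that by blast
    have IH': "uX b * pbw g \<in> L" "uG b b * pbw g - usc (\<beta>\<^sub>\<Lambda> b) * pbw g \<in> L" using th(5) b by blast+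
    show "uG a b * pbw (app (tht M) g) \<in> L" if a: "a \<in> {1..<b}" for a
    proof -
      have "uG a b * (uY M * (pbw g :: (1, 'n) U_gl)) = uY M * (uG a b * pbw g)"
        using U.GY[of a b M, THEN nest, of "pbw g"] a kM by (auto simp: mult.assoc)
      then show ?thesis using IH[OF a] by (simp add: low verma_ideal_lmult)
    qed
    have "uX b * (uY M * (pbw g :: (1, 'n) U_gl)) = - (uY M * (uX b * pbw g)) + uG M b * pbw g"
      using U.XY[of b M, THEN nest, of "pbw g"] kM by (simp add: left_diff_distrib mult.assoc)
    also have "\<dots> \<in> L"
      by (intro verma_ideal.add verma_ideal_uminus verma_ideal_lmult[OF IH'(1)] IH[OF kM(4)])
    finally show "uX b * pbw (app (tht M) g) \<in> L" by (simp add: low)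
    have "uG b b * (uY M * (pbw g :: (1, 'n) U_gl)) = uY M * (uG b b * pbw g)"
      using U.GY[of b b M, THEN nest, of "pbw g"] kM by (simp add: mult.assoc)
    moreover have "usc d * (uY M * w) = (uY M * (usc d * w) :: (1, 'n) U_gl)" for d w
      using usc.sc_central[of d "uY M", THEN nest, of w] by (simp add: mult.assoc)
    ultimately have "uG b b * pbw (app (tht M) g) - usc (\<beta>\<^sub>\<Lambda> b) * (pbw (app (tht M) g) :: (1, 'n) U_gl) =
        uY M * (uG b b * pbw g - usc (\<beta>\<^sub>\<Lambda> b) * pbw g)"
      by (simp add: low right_diff_distrib)
    then show "uG b b * pbw (app (tht M) g) - usc (\<beta>\<^sub>\<Lambda> b) * pbw (app (tht M) g) \<in> L"
      using IH'(2) by (simp add: verma_ideal_lmult)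
  qed
qed

lemma model_raise_kill:
  assumes "f \<in> Vs M \<Theta>" "M < b" "b \<le> CARD('n)"
  shows "1 \<le> a \<Longrightarrow> a < b \<Longrightarrow> app (mmG a b) f = 0" "app (mmX b) f = 0" "app (mmG b b) f = vscale (\<beta>\<^sub>\<Lambda> b) f"
proof -
  obtain b' where b': "b = Suc b'" using assms by (cases b) auto
  have f: "f \<in> Vs b \<Theta>" using assms by (auto intro: Vs_mono)
  have kill: "app (dop b k) f = 0" "app (dth b) f = 0" for k
    using assms by (auto intro: dop_kill dth_kill)
  note kill = kill[unfolded b']
  note drop = mod_drop[OF assms(3) f, where \<alpha> = \<alpha>\<^sub>\<Lambda> and \<beta> = \<beta>\<^sub>\<Lambda>]
  show "app (mmG a b) f = 0" if "1 \<le> a" "a < b"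
    using drop(1)[of a b] that by (simp add: b' kill)
  show "app (mmX b) f = 0"
    using drop(2)[of b] by (simp add: b' kill)
  show "app (mmG b b) f = vscale (\<beta>\<^sub>\<Lambda> b) f"
    using drop(1)[of b b] by (simp add: b' kill)
qed

text \<open>Compatibility is stated for one vector f at a time, since the induction over letters
  needs several generators at the same shorter vector.\<close>

definition equivariant_at :: "(1, 'n) U_gl \<Rightarrow> state lin \<Rightarrow> (state \<Rightarrow>\<^sub>0 complex) \<Rightarrow> bool" where
  "equivariant_at uA A f \<longleftrightarrow> uA * pbw f - pbw (app A f) \<in> L"

lemma equivariant_at_zero: "equivariant_at 0 0 f"
  by (simp add: equivariant_at_def L_zero)

lemma equivariant_at_add: "equivariant_at uA A f \<Longrightarrow> equivariant_at uB B f \<Longrightarrow> equivariant_at (uA + uB) (A + B) f"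
  unfolding equivariant_at_def by (drule (1) verma_ideal.add) (simp add: pbw_add algebra_simps)

lemma equivariant_at_uminus: "equivariant_at uA A f \<Longrightarrow> equivariant_at (- uA) (- A) f"
  unfolding equivariant_at_def by (drule verma_ideal_uminus) (simp add: pbw_uminus)

lemma equivariant_at_diff: "equivariant_at uA A f \<Longrightarrow> equivariant_at uB B f \<Longrightarrow> equivariant_at (uA - uB) (A - B) f"
  using equivariant_at_add[of uA A f "- uB" "- B"] equivariant_at_uminus[of uB B f] by simp

lemma equivariant_at_if: "(P \<Longrightarrow> equivariant_at uA A f) \<Longrightarrow> equivariant_at (if P then uA else 0) (if P then A else 0) f"
  by (simp add: equivariant_at_zero)

lemma equivariant_at_vec_add: "equivariant_at uA A f \<Longrightarrow> equivariant_at uA A g \<Longrightarrow> equivariant_at uA A (f + g)"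
  unfolding equivariant_at_def by (drule (1) verma_ideal.add) (simp add: pbw_add algebra_simps)

text \<open>Both algebra and model move the generator past the new letter by the same commutation
  rule, with the bracket B already known at g. The letter must also be multiplied correctly onto
  \<open>app A g\<close>, which is the last hypothesis.\<close>

lemma equivariant_at_letter:
  assumes u: "uA * ul = ul * uA + uB" and m: "A * l = l * A + B"
    and "equivariant_at uA A g" "equivariant_at uB B g"
    and l: "ul * pbw g = pbw (app l g)" "ul * pbw (app A g) = pbw (app l (app A g))"
  shows "equivariant_at uA A (app l g)"
proof -
  have "app A (app l g) = app l (app A g) + app B g"
    using arg_cong[OF m, of "\<lambda>x. app x g"] by simp
  moreover have "uA * pbw (app l g) = ul * (uA * pbw g) + uB * pbw g"
    unfolding l(1)[symmetric] using u[THEN nest] by (simp add: distrib_right mult.assoc)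
  ultimately have "uA * pbw (app l g) - pbw (app A (app l g)) =
      ul * (uA * pbw g - pbw (app A g)) + (uB * pbw g - pbw (app B g))"
    by (simp add: pbw_add right_diff_distrib l(2))
  also have "\<dots> \<in> L"
    using assms(3,4) unfolding equivariant_at_def by (intro verma_ideal.add verma_ideal_lmult)
  finally show ?thesis by (simp add: equivariant_at_def)
qed

lemma equivariant_at_letter_odd:
  assumes u: "uA * ul = - (ul * uA) + uB" and m: "A * l = - (l * A) + B"
    and "equivariant_at uA A g" "equivariant_at uB B g"
    and l: "ul * pbw g = pbw (app l g)" "ul * pbw (app A g) = pbw (app l (app A g))"
  shows "equivariant_at uA A (app l g)"
proof -
  have "app A (app l g) = - app l (app A g) + app B g"
    using arg_cong[OF m, of "\<lambda>x. app x g"] by simp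
  moreover have "uA * pbw (app l g) = - (ul * (uA * pbw g)) + uB * pbw g"
    unfolding l(1)[symmetric] using u[THEN nest] by (simp add: distrib_right left_diff_distrib mult.assoc)
  ultimately have "uA * pbw (app l g) - pbw (app A (app l g)) =
      - (ul * (uA * pbw g - pbw (app A g))) + (uB * pbw g - pbw (app B g))"
    by (simp add: pbw_add pbw_diff pbw_uminus right_diff_distrib l(2))
  also have "\<dots> \<in> L"
    using assms(3,4) unfolding equivariant_at_def by (intro verma_ideal.add verma_ideal_lmult verma_ideal_uminus)
  finally show ?thesis by (simp add: equivariant_at_def)
qed

lemma equivariant_at_outer:
  assumes f: "f \<in> Vs M \<Theta>" "M \<le> CARD('n)" and a: "a \<in> {1..CARD('n)}" and b: "b \<in> {1..CARD('n)}"
  shows "M < a \<or> M < b \<Longrightarrow> equivariant_at (uG a b) (mmG a b) f" "M < b \<Longrightarrow> equivariant_at (uX b) (mmX b) f"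
    "M < a \<Longrightarrow> equivariant_at (uY a) (mmY a) f"
proof -
  have lower: "equivariant_at (uG a b) (mmG a b) f" if "b < a" "M \<le> a"
  proof -
    have "f \<in> Vs a \<Theta>" using f that by (auto intro: Vs_mono)
    then show ?thesis
      using pbw_lower[of b a f \<Theta>] mod_lower[of b a "CARD('n)" f \<Theta>] a b that by (simp add: equivariant_at_def L_zero)
  qed
  show "equivariant_at (uG a b) (mmG a b) f" if "M < a \<or> M < b"
  proof (cases a b rule: linorder_cases)
    case less
    then have "b \<in> {Suc M..CARD('n)}" using that b by auto
    then show ?thesis
      using raise_kill[OF f] model_raise_kill(1)[OF f(1), of b a] less a by (auto simp: equivariant_at_def)
  next
    case equal
    then have "b \<in> {Suc M..CARD('n)}" using that b by auto
    then show ?thesis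
      using raise_kill[OF f] model_raise_kill(3)[OF f(1), of b] equal by (auto simp: equivariant_at_def pbw_vscale)
  next
    case greater
    then show ?thesis using that by (intro lower) auto
  qed
  show "equivariant_at (uX b) (mmX b) f" if "M < b"
    using raise_kill[OF f] model_raise_kill(2)[OF f(1), of b] that b by (auto simp: equivariant_at_def)
  show "equivariant_at (uY a) (mmY a) f" if "M < a"
  proof -
    have "f \<in> Vs a \<Theta>" using f that by (auto intro: Vs_mono)
    then show ?thesis
      using pbw_lower_odd[of a f \<Theta>] mod_lower_odd[of a "CARD('n)" f \<Theta>] a by (simp add: equivariant_at_def L_zero)
  qed
qed

lemma mm_Vs:
  assumes "f \<in> Vs M {1..CARD('n)}" "M \<le> CARD('n)"
  shows "a \<in> {1..M} \<Longrightarrow> b \<in> {1..M} \<Longrightarrow> app (mmG a b) f \<in> Vs M {1..CARD('n)}"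
    "b \<in> {1..M} \<Longrightarrow> app (mmX b) f \<in> Vs M {1..CARD('n)}"
    "a \<in> {1..M} \<Longrightarrow> app (mmY a) f \<in> Vs M {1..CARD('n)}"
    "app (mmH) f \<in> Vs M {1..CARD('n)}"
proof -
  have sub: "{1..M} \<subseteq> {1..CARD('n)}" using assms(2) by auto
  note V = mod_Vs[OF sub order.refl assms(1)] and drop = mod_drop[OF assms(2,1)]
  show "a \<in> {1..M} \<Longrightarrow> b \<in> {1..M} \<Longrightarrow> app (mmG a b) f \<in> Vs M {1..CARD('n)}"
    "b \<in> {1..M} \<Longrightarrow> app (mmX b) f \<in> Vs M {1..CARD('n)}"
    "a \<in> {1..M} \<Longrightarrow> app (mmY a) f \<in> Vs M {1..CARD('n)}"
    "app (mmH) f \<in> Vs M {1..CARD('n)}"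
    using V drop by simp_all
qed

definition equivariant :: "(state \<Rightarrow>\<^sub>0 complex) \<Rightarrow> bool" where
  "equivariant f \<longleftrightarrow> (\<forall>a\<in>{1..CARD('n)}. \<forall>b\<in>{1..CARD('n)}. equivariant_at (uG a b) (mmG a b) f) \<and>
    (\<forall>b\<in>{1..CARD('n)}. equivariant_at (uX b) (mmX b) f) \<and> (\<forall>a\<in>{1..CARD('n)}. equivariant_at (uY a) (mmY a) f) \<and> equivariant_at uH mmH f"

lemma pbw_equivariant: "f \<in> Vs CARD('n) {1..CARD('n)} \<Longrightarrow> equivariant f"
proof (induction rule: Vs_induct)
  case zero
  show ?case by (simp add: equivariant_def equivariant_at_def L_zero)
next
  case (add f g)
  then show ?case by (simp add: equivariant_def equivariant_at_vec_add)
next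
  case (vac c)
  have v: "vscale c vac \<in> Vs 0 {}" by auto
  have "app mmH (vscale c vac) = vscale (c * \<alpha>\<^sub>\<Lambda>) vac"
    by (rule poly_mapping_eqI) (simp add: mod_vac(3))
  then have "uH * pbw (vscale c vac) - pbw (app mmH (vscale c vac)) = usc c * uH - usc c * (usc \<alpha>\<^sub>\<Lambda> :: (1, 'n) U_gl)"
    by (simp add: pbw_vscale pbw_vac usc.sc_mult usc.sc_central[of c uH])
  then have "equivariant_at uH mmH (vscale c vac)" using L_gens(4) by (simp add: equivariant_at_def)
  then show ?case
    unfolding equivariant_def using equivariant_at_outer[OF v] by auto
next
  case (z M k g)
  have M: "M \<le> CARD('n)" and kM: "k \<in> {1..M}" "M \<in> {1..M}" "k \<in> {1..CARD('n)}" "M \<in> {1..CARD('n)}" "k \<noteq> M" using z by auto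
  let ?f = "app (zop M k) g"
  have f: "?f \<in> Vs M {1..CARD('n)}" using z by (intro zop_Vs) auto
  have zl: "uG M k * (pbw h :: (1, 'n) U_gl) = pbw (app (mmG M k) h)" if "h \<in> Vs M {1..CARD('n)}" for h
    using pbw_lower[OF z(1,2) M that] mod_lower[OF z(1,2) M that] by simp
  have fe: "?f = app (mmG M k) g" using mod_lower[OF z(1,2) M z(4)] by simp
  note g = z(4) and IH = z(5)[unfolded equivariant_def]
  have E: "\<And>a b. a \<in> {1..CARD('n)} \<Longrightarrow> b \<in> {1..CARD('n)} \<Longrightarrow> equivariant_at (uG a b) (mmG a b) g" "\<And>b. b \<in> {1..CARD('n)} \<Longrightarrow> equivariant_at (uX b) (mmX b) g"
    "\<And>a. a \<in> {1..CARD('n)} \<Longrightarrow> equivariant_at (uY a) (mmY a) g" "equivariant_at uH mmH g" using IH by blast+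
  have "equivariant_at (uG a b) (mmG a b) ?f" if a: "a \<in> {1..CARD('n)}" and b: "b \<in> {1..CARD('n)}" for a b
  proof (cases "M < a \<or> M < b")
    case True
    then show ?thesis using equivariant_at_outer(1)[OF f M a b] by simp
  next
    case False
    \<comment> \<open>With both indices at most M the generator preserves level M, so that the
      letter z_Mk is still the leftmost one in front of its result.\<close>
    then have ab: "a \<in> {1..M}" "b \<in> {1..M}" using a b by auto
    show ?thesis unfolding fe
    proof (rule equivariant_at_letter)
      show "uG a b * uG M k = uG M k * uG a b + ((if b = M then uG a k else 0) - (if a = k then (uG M b :: (1, 'n) U_gl) else 0))"
        using U.GG[OF a b kM(4,3)] by simp
      show "mmG a b * mmG M k = mmG M k * mmG a b + ((if b = M then mmG a k else 0) - (if a = k then mmG M b else 0))"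
        using M.GG[OF a b kM(4,3)] by simp
      show "equivariant_at ((if b = M then uG a k else 0) - (if a = k then uG M b else 0)) ((if b = M then mmG a k else 0) - (if a = k then mmG M b else 0)) g"
        using a b kM by (intro equivariant_at_diff equivariant_at_if E) auto
    qed (use E a b zl g mm_Vs(1)[OF g M ab] in auto)
  qed
  moreover have "equivariant_at (uX b) (mmX b) ?f" if b: "b \<in> {1..CARD('n)}" for b
  proof (cases "M < b")
    case True
    then show ?thesis using equivariant_at_outer(2)[OF f M b b] by simp
  next
    case False
    then have b': "b \<in> {1..M}" using b by auto
    show ?thesis unfolding fe
    proof (rule equivariant_at_letter)
      show "uX b * uG M k = uG M k * uX b + (if M = b then (uX k :: (1, 'n) U_gl) else 0)"
        using U.GX[OF kM(4,3) b] by simp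
      show "mmX b * mmG M k = mmG M k * mmX b + (if M = b then mmX k else 0)"
        using M.GX[OF kM(4,3) b] by simp
      show "equivariant_at (if M = b then uX k else 0) (if M = b then mmX k else 0) g"
        using kM by (intro equivariant_at_if E) auto
    qed (use E b zl g mm_Vs(2)[OF g M b'] in auto)
  qed
  moreover have "equivariant_at (uY a) (mmY a) ?f" if a: "a \<in> {1..CARD('n)}" for a
  proof (cases "M < a")
    case True
    then show ?thesis using equivariant_at_outer(3)[OF f M a a] by simp
  next
    case False
    then have a': "a \<in> {1..M}" using a by auto
    show ?thesis unfolding fe
    proof (rule equivariant_at_letter)
      show "uY a * uG M k = uG M k * uY a + - (if k = a then (uY M :: (1, 'n) U_gl) else 0)"
        using U.GY[OF kM(4,3) a] by simp
      show "mmY a * mmG M k = mmG M k * mmY a + - (if k = a then mmY M else 0)"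
        using M.GY[OF kM(4,3) a] by simp
      show "equivariant_at (- (if k = a then uY M else 0)) (- (if k = a then mmY M else 0)) g"
        using kM by (intro equivariant_at_uminus equivariant_at_if E) auto
    qed (use E a zl g mm_Vs(3)[OF g M a'] in auto)
  qed
  moreover have "equivariant_at uH mmH ?f"
    unfolding fe
  proof (rule equivariant_at_letter)
    show "uH * uG M k = uG M k * uH + (0 :: (1, 'n) U_gl)" using U.HG[OF kM(4,3)] by simp
    show "mmH * mmG M k = mmG M k * mmH + 0" using M.HG[OF kM(4,3)] by simp
  qed (use E zl g mm_Vs(4)[OF g M] equivariant_at_zero in auto)
  ultimately show ?case by (simp add: equivariant_def)
next
  case (th M g)
  have M: "M \<le> CARD('n)" and kM: "M \<in> {1..M}" "M \<in> {1..CARD('n)}" using th by auto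
  let ?f = "app (tht M) g"
  have f: "?f \<in> Vs M {1..CARD('n)}" using th by (intro tht_Vs) auto
  have zl: "uY M * (pbw h :: (1, 'n) U_gl) = pbw (app (mmY M) h)" if "h \<in> Vs M {1..CARD('n)}" for h
    using pbw_lower_odd[OF th(1) M that] mod_lower_odd[OF th(1) M that] by simp
  have fe: "?f = app (mmY M) g" using mod_lower_odd[OF th(1) M th(4)] by simp
  note g = th(4) and IH = th(5)[unfolded equivariant_def]
  have E: "\<And>a b. a \<in> {1..CARD('n)} \<Longrightarrow> b \<in> {1..CARD('n)} \<Longrightarrow> equivariant_at (uG a b) (mmG a b) g" "\<And>b. b \<in> {1..CARD('n)} \<Longrightarrow> equivariant_at (uX b) (mmX b) g"
    "\<And>a. a \<in> {1..CARD('n)} \<Longrightarrow> equivariant_at (uY a) (mmY a) g" "equivariant_at uH mmH g" using IH by blast+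
  have "equivariant_at (uG a b) (mmG a b) ?f" if a: "a \<in> {1..CARD('n)}" and b: "b \<in> {1..CARD('n)}" for a b
  proof (cases "M < a \<or> M < b")
    case True
    then show ?thesis using equivariant_at_outer(1)[OF f M a b] by simp
  next
    case False
    then have ab: "a \<in> {1..M}" "b \<in> {1..M}" using a b by auto
    show ?thesis unfolding fe
    proof (rule equivariant_at_letter)
      show "uG a b * uY M = uY M * uG a b + (if b = M then (uY a :: (1, 'n) U_gl) else 0)"
        using U.GY[OF a b kM(2)] by simp
      show "mmG a b * mmY M = mmY M * mmG a b + (if b = M then mmY a else 0)"
        using M.GY[OF a b kM(2)] by simp
      show "equivariant_at (if b = M then uY a else 0) (if b = M then mmY a else 0) g"
        using a by (intro equivariant_at_if E) auto
    qed (use E a b zl g mm_Vs(1)[OF g M ab] in auto)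
  qed
  moreover have "equivariant_at (uX b) (mmX b) ?f" if b: "b \<in> {1..CARD('n)}" for b
  proof (cases "M < b")
    case True
    then show ?thesis using equivariant_at_outer(2)[OF f M b b] by simp
  next
    case False
    then have b': "b \<in> {1..M}" using b by auto
    show ?thesis unfolding fe
    proof (rule equivariant_at_letter_odd)
      show "uX b * uY M = - (uY M * uX b) + (uG M b + (if b = M then (uH :: (1, 'n) U_gl) else 0))"
        using U.XY[OF b kM(2)] by simp
      show "mmX b * mmY M = - (mmY M * mmX b) + (mmG M b + (if b = M then mmH else 0))"
        using M.XY[OF b kM(2)] by simp
      show "equivariant_at (uG M b + (if b = M then uH else 0)) (mmG M b + (if b = M then mmH else 0)) g"
        using b kM by (intro equivariant_at_add equivariant_at_if E) auto
    qed (use E b zl g mm_Vs(2)[OF g M b'] in auto)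
  qed
  moreover have "equivariant_at (uY a) (mmY a) ?f" if a: "a \<in> {1..CARD('n)}" for a
  proof (cases "M < a")
    case True
    then show ?thesis using equivariant_at_outer(3)[OF f M a a] by simp
  next
    case False
    then have a': "a \<in> {1..M}" using a by auto
    show ?thesis unfolding fe
    proof (rule equivariant_at_letter_odd)
      show "uY a * uY M = - (uY M * uY a) + (0 :: (1, 'n) U_gl)"
        using U.YY[OF a kM(2)] by simp
      show "mmY a * mmY M = - (mmY M * mmY a) + 0"
        using M.YY[OF a kM(2)] by simp
    qed (use E a zl g mm_Vs(3)[OF g M a'] equivariant_at_zero in auto)
  qed
  moreover have "equivariant_at uH mmH ?f"
    unfolding fe
  proof (rule equivariant_at_letter)
    show "uH * uY M = uY M * uH + - (uY M :: (1, 'n) U_gl)" using U.HY[OF kM(2)] by simp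
    show "mmH * mmY M = mmY M * mmH + - mmY M" using M.HY[OF kM(2)] by simp
    show "equivariant_at (- uY M) (- mmY M) g" using kM by (intro equivariant_at_uminus E)
  qed (use E zl g mm_Vs(4)[OF g M] in auto)
  ultimately show ?case by (simp add: equivariant_def)
qed

end

section \<open>The Verma module is the Fock space model\<close>

lemma vscale_sum_left: "vscale (\<Sum>i\<in>I. c i) f = (\<Sum>i\<in>I. vscale (c i) f)"
  by (induction I rule: infinite_finite_induct) (simp_all add: vscale_add_left)

lemma app_cm: "app (cm c A) f = vscale c (app A f)"
  by (simp add: cm_def)

context
  fixes \<Lambda> :: "(1, 'n::{finite,linorder}) weight"
begin

abbreviation "mm \<equiv> mU (\<alpha>\<^sub>\<Lambda> \<Lambda>) (\<beta>\<^sub>\<Lambda> \<Lambda>) :: 1 + 'n \<Rightarrow> 1 + 'n \<Rightarrow> state lin"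
abbreviation "mR \<equiv> mrep (\<alpha>\<^sub>\<Lambda> \<Lambda>) (\<beta>\<^sub>\<Lambda> \<Lambda>) :: (1, 'n) gl \<Rightarrow> state lin"

lemma mR_Vs: "f \<in> Vs CARD('n) {1..CARD('n)} \<Longrightarrow> app (mR x) f \<in> Vs CARD('n) {1..CARD('n)}"
proof -
  assume f: "f \<in> Vs CARD('n) {1..CARD('n)}"
  have "app (mm i j) f \<in> Vs CARD('n) {1..CARD('n)}" for i j
    using mod_Vs[OF order.refl order.refl f] rk_range[where 'n = 'n] by (cases i; cases j) simp_all
  then show ?thesis unfolding mrep_def app_sum app_cm by (intro Vs_sum Vs_vscale)
qed

lemma mR_vac:
  assumes "t \<in> borel"
  shows "app (mR t) vac = vscale (wt_eval \<Lambda> t) vac"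
proof -
  have "vscale (t $ i $ j) (app (mm i j) vac) = (if j = i then vscale (\<Lambda> $ i * t $ i $ i) vac else 0)" for i j
  proof (cases "t $ i $ j = 0")
    case False
    note r = rk_range[where 'n = 'n]
    have "app (mm i i) vac = vscale (\<Lambda> $ i) vac"
    proof (cases i)
      case (Inl a)
      moreover have "a = 1" by (simp add: num1_eq_iff)
      ultimately show ?thesis by (simp add: mod_vac(3) \<alpha>\<^sub>\<Lambda>_def)
    qed (simp add: mod_vac(2)[OF r] \<beta>\<^sub>\<Lambda>_def)
    moreover have "app (mm i j) vac = 0" if "i \<noteq> j"
      using borel_entry[OF assms False] that mod_vac(1)[OF r r] mod_vac(4)[OF r] by (auto simp: rk_less_iff)
    ultimately show ?thesis by (auto simp: mult.commute)
  qed auto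
  then show ?thesis
    unfolding mrep_def app_sum app_cm by (simp add: sum.delta wt_eval_def vscale_sum_left)
qed

lemma equivariant_at_mR:
  assumes "f \<in> Vs CARD('n) {1..CARD('n)}"
  shows "equivariant_at \<Lambda> (\<iota> x) (mR x) f"
proof -
  note E = pbw_equivariant[OF assms, of \<Lambda>, unfolded equivariant_def] and r = rk_range[where 'n = 'n]
  have unit: "equivariant_at \<Lambda> (\<iota> (munit i j)) (mm i j) f" for i j
  proof (cases i; cases j)
    fix u v :: 1 assume "i = Inl u" "j = Inl v"
    moreover have "u = 1" "v = 1" by (simp_all add: num1_eq_iff)
    ultimately show ?thesis using E by (simp add: uH_def)
  next
    fix u :: 1 and b assume "i = Inl u" "j = Inr b"
    moreover have "u = 1" by (simp add: num1_eq_iff)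
    ultimately show ?thesis using E r[of b] by (auto simp: uX_def dest!: bspec[of _ _ "rk b"])
  next
    fix u :: 1 and a assume "i = Inr a" "j = Inl u"
    moreover have "u = 1" by (simp add: num1_eq_iff)
    ultimately show ?thesis using E r[of a] by (auto simp: uY_def dest!: bspec[of _ _ "rk a"])
  next
    fix a b assume "i = Inr a" "j = Inr b"
    moreover have "equivariant_at \<Lambda> (uG (rk a) (rk b)) (mG (\<alpha>\<^sub>\<Lambda> \<Lambda>) (\<beta>\<^sub>\<Lambda> \<Lambda>) CARD('n) (rk a) (rk b)) f"
      using E r by blast
    ultimately show ?thesis by (simp add: uG_def)
  qed
  have cm: "equivariant_at \<Lambda> (usc c * u) (cm c A) f" if "equivariant_at \<Lambda> u A f" for c u A
    using verma_ideal_lmult[OF that[unfolded equivariant_at_def], of "usc c"]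
    by (simp add: equivariant_at_def app_cm pbw_vscale right_diff_distrib mult.assoc)
  have sum: "equivariant_at \<Lambda> (\<Sum>i\<in>I. u i) (\<Sum>i\<in>I. A i) f" if "\<And>i. equivariant_at \<Lambda> (u i) (A i) f"
    for I :: "(1 + 'n) set" and u A
    by (induction I rule: infinite_finite_induct) (simp_all add: equivariant_at_zero equivariant_at_add that)
  have "\<iota> x = (\<Sum>i\<in>UNIV. \<Sum>j\<in>UNIV. usc (x $ i $ j) * \<iota> (munit i j))"
    by (subst matrix_expansion) (simp add: \<iota>_sum \<iota>_mscale)
  then show ?thesis
    unfolding mrep_def by (auto intro!: sum cm unit)
qed

text \<open>\<open>ev\<close> is the map \<open>u \<mapsto> u v\<close>, where \<open>v = vac\<close> is the highest weight vector.\<close>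

lemma verma_model:
  obtains ev :: "(1, 'n) U_gl \<Rightarrow> (state \<Rightarrow>\<^sub>0 complex)" where
    "\<And>u v. ev (u + v) = ev u + ev v" "\<And>x u. ev (\<iota> x * u) = app (mR x) (ev u)"
    "\<And>u. ev u \<in> Vs CARD('n) {1..CARD('n)}" "\<And>f. f \<in> Vs CARD('n) {1..CARD('n)} \<Longrightarrow> \<exists>u. ev u = f" "\<And>u. ev u = 0 \<longleftrightarrow> u \<in> verma_ideal \<Lambda>"
proof -
  obtain \<phi> :: "(1, 'n) U_gl \<Rightarrow> state lin" where \<phi>: "\<phi> 1 = 1" "\<And>u v. \<phi> (u + v) = \<phi> u + \<phi> v"
    "\<And>u v. \<phi> (u * v) = \<phi> u * \<phi> v" "\<And>x. \<phi> (\<iota> x) = mR x" "\<And>c. \<phi> (U_class (scalar c)) = scal c"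
    by (rule lin.U_lift[of mR]) (auto simp: mrep_add mrep_mscale mrep_bracket simp del: insert_iff)
  note \<phi>_usc = \<phi>(5)[folded usc_def]
  have \<phi>_uminus: "\<phi> (- u) = - \<phi> u" for u
    using \<phi>(2)[of u "- u"] \<phi>(2)[of 0 0] by (simp add: add_eq_0_iff)
  have \<phi>_diff: "\<phi> (u - v) = \<phi> u - \<phi> v" for u v
    using \<phi>(2)[of u "- v"] by (simp add: \<phi>_uminus)
  define ev where "ev u = app (\<phi> u) vac" for u
  have vac: "vac \<in> Vs CARD('n) {1..CARD('n)}" by auto
  have \<phi>_Vs: "app (\<phi> u) f \<in> Vs CARD('n) {1..CARD('n)}" if "f \<in> Vs CARD('n) {1..CARD('n)}" for u f
    using that by (induction u rule: U_induct) (auto simp: \<phi>_usc \<phi> simp del: One_nat_def intro!: Vs_vscale Vs_add mR_Vs)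
  \<comment> \<open>For f = \<open>vac\<close> this says that u agrees with
    \<open>pbw (ev u)\<close> modulo the left ideal, so the kernel of \<open>ev\<close> is contained
    in the ideal.\<close>
  have equi: "u * pbw f - pbw (app (\<phi> u) f) \<in> verma_ideal \<Lambda>" if f: "f \<in> Vs CARD('n) {1..CARD('n)}" for u f
  proof (induction u rule: U_induct)
    case (scalar c)
    show ?case by (simp add: \<phi>_usc pbw_vscale verma_ideal.zero)
  next
    case (add u v)
    from verma_ideal.add[OF this] show ?case by (simp add: \<phi> pbw_add algebra_simps)
  next
    case (mult x u)
    have "\<iota> x * u * pbw f - pbw (app (\<phi> (\<iota> x * u)) f) =
        \<iota> x * (u * pbw f - pbw (app (\<phi> u) f)) + (\<iota> x * pbw (app (\<phi> u) f) - pbw (app (mR x) (app (\<phi> u) f)))"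
      by (simp add: \<phi> right_diff_distrib mult.assoc)
    also have "\<dots> \<in> verma_ideal \<Lambda>"
      using equivariant_at_mR[OF \<phi>_Vs[OF f]] by (intro verma_ideal.add verma_ideal_lmult mult) (simp add: equivariant_at_def)
    finally show ?case .
  qed
  show ?thesis
  proof (rule that[of ev])
    show "ev (u + v) = ev u + ev v" for u v by (simp add: ev_def \<phi>)
    show "ev (\<iota> x * u) = app (mR x) (ev u)" for x u by (simp add: ev_def \<phi>)
    show "ev u \<in> Vs CARD('n) {1..CARD('n)}" for u unfolding ev_def by (rule \<phi>_Vs[OF vac])
    show "ev u = 0 \<longleftrightarrow> u \<in> verma_ideal \<Lambda>" for u
    proof
      assume "ev u = 0"
      with equi[OF vac, of u] show "u \<in> verma_ideal \<Lambda>" by (simp add: ev_def pbw_vac)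
    next
      assume "u \<in> verma_ideal \<Lambda>"
      then show "ev u = 0"
      proof (induction rule: verma_ideal.induct)
        case zero
        show ?case using \<phi>(2)[of 0 0] by (simp add: ev_def)
      next
        case (add u v)
        then show ?case by (simp add: ev_def \<phi>)
      next
        case (gen t u)
        then show ?case by (simp add: ev_def \<phi> \<phi>_diff \<phi>_usc mR_vac)
      qed
    qed
    show "\<exists>u. ev u = f" if "f \<in> Vs CARD('n) {1..CARD('n)}" for f
      using that
    proof (induction rule: Vs_induct)
      case zero
      show ?case using \<phi>(2)[of 0 0] by (intro exI[of _ 0]) (simp add: ev_def)
    next
      case (add f g)
      then obtain u v where "ev u = f" "ev v = g" by blast
      then show ?case by (intro exI[of _ "u + v"]) (simp add: ev_def \<phi>)
    next
      case (vac c)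
      show ?case by (rule exI[of _ "usc c"]) (simp add: ev_def \<phi>_usc)
    next
      case (z M k g)
      then obtain u where u: "ev u = g" by blast
      have "mR (munit (Inr (un M)) (Inr (un k))) = mG (\<alpha>\<^sub>\<Lambda> \<Lambda>) (\<beta>\<^sub>\<Lambda> \<Lambda>) CARD('n) M k"
        using z by (simp add: mrep_munit rk_un)
      then have "ev (\<iota> (munit (Inr (un M)) (Inr (un k))) * u) = app (zop M k) g"
        using u mod_lower[OF z(1-4)] by (simp add: ev_def \<phi>)
      then show ?case by blast
    next
      case (th M g)
      then obtain u where u: "ev u = g" by blast
      have "mR (munit (Inr (un M)) (Inl 1)) = mY (\<alpha>\<^sub>\<Lambda> \<Lambda>) (\<beta>\<^sub>\<Lambda> \<Lambda>) CARD('n) M"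
        using th by (simp add: mrep_munit rk_un)
      then have "ev (\<iota> (munit (Inr (un M)) (Inl 1)) * u) = app (tht M) g"
        using u mod_lower_odd[OF th(1,2,4)] by (simp add: ev_def \<phi>)
      then show ?case by blast
    qed
  qed
qed

lemma exact_at_model:
  "exact_at \<Lambda> x \<longleftrightarrow> (\<forall>f\<in>Vs CARD('n) {1..CARD('n)}. app (mR x) f = 0 \<longleftrightarrow> (\<exists>g\<in>Vs CARD('n) {1..CARD('n)}. f = app (mR x) g))"
proof -
  obtain ev :: "(1, 'n) U_gl \<Rightarrow> (state \<Rightarrow>\<^sub>0 complex)" where ev:
    "\<And>u v. ev (u + v) = ev u + ev v" "\<And>x u. ev (\<iota> x * u) = app (mR x) (ev u)"
    "\<And>u. ev u \<in> Vs CARD('n) {1..CARD('n)}" "\<And>f. f \<in> Vs CARD('n) {1..CARD('n)} \<Longrightarrow> \<exists>u. ev u = f" "\<And>u. ev u = 0 \<longleftrightarrow> u \<in> verma_ideal \<Lambda>"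
    using verma_model by blast
  have diff: "ev (u - v) = ev u - ev v" for u v
    using ev(1)[of "u - v" v] by simp
  have "exact_at \<Lambda> x \<longleftrightarrow> (\<forall>u. app (mR x) (ev u) = 0 \<longleftrightarrow> (\<exists>v. ev u = app (mR x) (ev v)))"
    unfolding exact_at_def ev(5)[symmetric] diff ev(2) by simp
  also have "\<dots> \<longleftrightarrow> (\<forall>f\<in>Vs CARD('n) {1..CARD('n)}. app (mR x) f = 0 \<longleftrightarrow> (\<exists>g\<in>Vs CARD('n) {1..CARD('n)}. f = app (mR x) g))"
  proof -
    have "Vs CARD('n) {1..CARD('n)} = range ev" 
      using ev(3) ev(4)[THEN exE] by (intro equalityI subsetI) (blast, auto)
    then show ?thesis by (simp only: ball_simps bex_simps simp_thms)
  qed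
  finally show ?thesis .
qed

lemma exact_at_munit:
  "exact_at \<Lambda> (munit (Inl 1) (Inr i)) \<longleftrightarrow> (\<forall>f\<in>Vs CARD('n) {1..CARD('n)}. app (mX (\<alpha>\<^sub>\<Lambda> \<Lambda>) (\<beta>\<^sub>\<Lambda> \<Lambda>) CARD('n) (rk i)) f = 0 \<longrightarrow>
     (\<exists>g\<in>Vs CARD('n) {1..CARD('n)}. f = app (mX (\<alpha>\<^sub>\<Lambda> \<Lambda>) (\<beta>\<^sub>\<Lambda> \<Lambda>) CARD('n) (rk i)) g))"
proof -
  have "app (mX a b CARD('n) (rk i)) (app (mX a b CARD('n) (rk i)) g) = 0" for a b g
    using arg_cong[OF mX_sq[OF rk_range], of "\<lambda>A. app A g"] by simp
  then show ?thesis unfolding exact_at_model mrep_munit mU_simps by (auto simp del: One_nat_def)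
qed

end

section \<open>Conjugation by the Borel subgroup\<close>

text \<open>With the even index numbered 0, \<open>borel\<close> consists of the upper triangular
  matrices.\<close>

definition rk1 :: "1 + 'n::{finite,linorder} \<Rightarrow> nat" where
  "rk1 k = (case k of Inl _ \<Rightarrow> 0 | Inr a \<Rightarrow> rk a)"

lemma rk1_simps [simp]: "rk1 (Inl u) = 0" "rk1 (Inr a) = rk a"
  by (simp_all add: rk1_def)

lemma rk_pos: "0 < rk a"
  using rk_range[of a] by simp

lemma rk1_eq_iff: "rk1 i = rk1 j \<longleftrightarrow> i = j"
  by (cases i; cases j) (simp_all add: num1_eq_iff rk_pos[THEN less_imp_neq, symmetric] rk_pos[THEN less_imp_neq])

lemma borel_iff: "x \<in> borel \<longleftrightarrow> (\<forall>i j. rk1 j < rk1 i \<longrightarrow> x $ i $ j = 0)"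
  for x :: "(1, 'n::{finite,linorder}) gl"
proof
  assume x: "x \<in> borel"
  show "\<forall>i j. rk1 j < rk1 i \<longrightarrow> x $ i $ j = 0"
    using borel_entry[OF x] by (fastforce simp: rk_less_iff)
next
  assume x: "\<forall>i j. rk1 j < rk1 i \<longrightarrow> x $ i $ j = 0"
  show "x \<in> borel"
    unfolding borel_def
  proof (intro CollectI allI impI)
    fix i j assume "x $ i $ j \<noteq> 0"
    then have le: "rk1 i \<le> rk1 j" using x not_less by blast
    have unit: "munit i j \<in> (borel :: (1, 'n) gl set)"
    proof (cases i; cases j)
      fix u v :: 1 assume ij: "i = Inl u" "j = Inl v"
      moreover have "u = v" by (simp add: num1_eq_iff)
      ultimately show ?thesis by (simp add: munit_borel)
    next
      fix u :: 1 and b assume "i = Inl u" "j = Inr b"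
      moreover have "u = 1" by (simp add: num1_eq_iff)
      ultimately show ?thesis by (simp add: munit_borel)
    next
      fix u :: 1 and a assume "i = Inr a" "j = Inl u"
      then show ?thesis using le rk_pos[of a] by simp
    next
      fix a b assume ij: "i = Inr a" "j = Inr b"
      then have "a = b \<or> a < b" using le by (auto simp: rk_le_iff)
      then show ?thesis using ij munit_borel(1)[of i] munit_borel(3)[of a b] by auto
    qed
    then show "i = j \<or> axis i 1 - axis j 1 \<in> pos_even_roots \<union> pos_odd_roots"
      unfolding borel_def munit_def by auto
  qed
qed

lemma sum_single: "(\<And>k. k \<noteq> j \<Longrightarrow> f k = 0) \<Longrightarrow> (\<Sum>k\<in>UNIV. f k) = f j"
  for f :: "'a::finite \<Rightarrow> 'b::comm_monoid_add"
  by (subst sum.remove[of _ j]) (auto intro: sum.neutral)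

lemma borel_mult:
  fixes x y :: "(1, 'n::{finite,linorder}) gl"
  assumes "x \<in> borel" "y \<in> borel"
  shows "x ** y \<in> borel" "(x ** y) $ i $ i = x $ i $ i * y $ i $ i"
proof -
  have x: "x $ i $ j = 0" if "rk1 j < rk1 i" for i j using assms(1) that unfolding borel_iff by blast
  have y: "y $ i $ j = 0" if "rk1 j < rk1 i" for i j using assms(2) that unfolding borel_iff by blast
  show "x ** y \<in> borel"
    unfolding borel_iff
  proof (intro allI impI)
    fix i j :: "1 + 'n" assume ij: "rk1 j < rk1 i"
    have "x $ i $ k * y $ k $ j = 0" for k
      using ij x[where i = i and j = k] y[where i = k and j = j] by (cases "rk1 k < rk1 i") auto
    then show "(x ** y) $ i $ j = 0"
      unfolding matrix_matrix_mult_def vec_lambda_beta by (intro sum.neutral) blast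
  qed
  have "x $ i $ k * y $ k $ i = 0" if "k \<noteq> i" for k
  proof -
    have "rk1 k < rk1 i \<or> rk1 i < rk1 k" using that rk1_eq_iff[of k i] by linarith
    then show ?thesis using x[where i = i and j = k] y[where i = k and j = i] by auto
  qed
  from sum_single[of i "\<lambda>k. x $ i $ k * y $ k $ i", OF this]
  show "(x ** y) $ i $ i = x $ i $ i * y $ i $ i" by (simp add: matrix_matrix_mult_def)
qed

text \<open>Column by column: in the (i, j) entry of c b = 1 with i \<ge> j only c_ij b_jj survives,
  as earlier columns of c are already triangular. The diagonal entry shows that b_jj is
  nonzero.\<close>

lemma borel_inverse:
  fixes b c :: "(1, 'n::{finite,linorder}) gl"
  assumes b: "b \<in> borel" and cb: "c ** b = mat 1"
  shows "c \<in> borel"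
proof -
  have entry: "(\<Sum>k\<in>UNIV. c $ i $ k * b $ k $ j) = (if i = j then 1 else 0)" for i j
    using arg_cong[OF cb, of "\<lambda>m. m $ i $ j"] by (simp add: matrix_matrix_mult_def mat_def)
  have "\<forall>i. rk1 j < rk1 i \<longrightarrow> c $ i $ j = 0" for j :: "1 + 'n"
  proof (induction "rk1 j" arbitrary: j rule: less_induct)
    case less
    have collapse: "(\<Sum>k\<in>UNIV. c $ i $ k * b $ k $ j) = c $ i $ j * b $ j $ j" if "rk1 j \<le> rk1 i" for i
    proof -
      have "c $ i $ k * b $ k $ j = 0" if "k \<noteq> j" for k
      proof -
        have "rk1 k < rk1 j \<or> rk1 j < rk1 k" using that rk1_eq_iff[of k j] by linarith
        then show ?thesis
        proof
          assume "rk1 k < rk1 j"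
          moreover from less[OF this] \<open>rk1 j \<le> rk1 i\<close> have "c $ i $ k = 0"
            using \<open>rk1 k < rk1 j\<close> by auto
          ultimately show ?thesis by simp
        next
          assume "rk1 j < rk1 k"
          then show ?thesis using b unfolding borel_iff by simp
        qed
      qed
      then show ?thesis by (rule sum_single)
    qed
    have "c $ j $ j * b $ j $ j = 1" using entry[of j j] collapse[of j] by simp
    moreover have "c $ i $ j * b $ j $ j = 0" if "rk1 j < rk1 i" for i
      using entry[of i j] collapse[of i] that by auto
    ultimately show ?case by (metis mult_zero_right mult_eq_0_iff zero_neq_one)
  qed
  then show ?thesis unfolding borel_iff by blast
qed

text \<open>Conjugation by this matrix is the parity automorphism. Homogeneity becomes commutation
  or anticommutation with it, which is easily passed to products and inverses.\<close>

definition parity_mat :: "('m::finite, 'n::finite) gl" where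
  "parity_mat = (\<chi> i j. if i = j then (-1) ^ parity i else 0)"

lemma homogeneous_iff:
  assumes "p \<in> {0, 1}"
  shows "x \<in> homogeneous p \<longleftrightarrow> parity_mat ** x = mscale ((-1) ^ p) (x ** parity_mat)"
proof -
  have l: "(parity_mat ** x) $ i $ j = (-1) ^ parity i * x $ i $ j" for i j
  proof -
    have "parity_mat $ i $ k * x $ k $ j = (if k = i then (-1) ^ parity i * x $ i $ j else 0)" for k
      by (simp add: parity_mat_def)
    then show ?thesis by (simp add: matrix_matrix_mult_def sum.delta)
  qed
  have r: "(x ** parity_mat) $ i $ j = (-1) ^ parity j * x $ i $ j" for i j
  proof -
    have "x $ i $ k * parity_mat $ k $ j = (if k = j then (-1) ^ parity j * x $ i $ j else 0)" for k
      by (simp add: parity_mat_def)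
    then show ?thesis by (simp add: matrix_matrix_mult_def sum.delta)
  qed
  have "(x $ i $ j \<noteq> 0 \<longrightarrow> (parity i + parity j) mod 2 = p) \<longleftrightarrow>
      (-1) ^ parity i * x $ i $ j = (-1) ^ p * ((-1) ^ parity j * x $ i $ j)" for i j
    using assms by (cases i; cases j) (auto simp: parity_def)
  then show ?thesis
    by (auto simp: vec_eq_iff l r homogeneous_def gpart_def)
qed

lemma gl_zero:
  fixes y :: "('m::finite, 'n::finite) gl"
  shows "0 ** y = 0" "y ** 0 = 0" "mscale c 0 = (0 :: ('m, 'n) gl)"
  by (simp_all add: vec_eq_iff matrix_matrix_mult_def)

lemma gl_mult_distrib:
  fixes x y z :: "('m::finite, 'n::finite) gl"
  shows "(x + y) ** z = x ** z + y ** z" "(x - y) ** z = x ** z - y ** z" "z ** (x - y) = z ** x - z ** y"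
  by (simp_all add: vec_eq_iff matrix_matrix_mult_def algebra_simps sum.distrib sum_subtractf)

lemma mscale_mult [simp]: "mscale c x ** y = mscale c (x ** y)" "x ** mscale c y = mscale c (x ** y)"
  by (simp_all add: vec_eq_iff matrix_matrix_mult_def sum_distrib_left mult.assoc mult.left_commute)

lemma mscale_one [simp]: "mscale 1 x = x"
  by (simp add: vec_eq_iff)

lemma homogeneous_mult:
  assumes "p \<in> {0, 1}" "b \<in> homogeneous 0" "x \<in> homogeneous p" "c \<in> homogeneous 0"
  shows "b ** x ** c \<in> homogeneous p"
proof -
  have "parity_mat ** b = b ** parity_mat" "parity_mat ** c = c ** parity_mat"
    using assms(2,4) by (simp_all add: homogeneous_iff)
  moreover have "parity_mat ** x = mscale ((-1) ^ p) (x ** parity_mat)"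
    using assms(1,3) by (simp add: homogeneous_iff)
  moreover have "parity_mat ** (b ** x ** c) = (parity_mat ** b) ** x ** c"
    "(b ** parity_mat) ** x ** c = b ** (parity_mat ** x) ** c"
    "b ** (x ** parity_mat) ** c = b ** x ** (parity_mat ** c)"
    by (simp_all only: matrix_mul_assoc)
  ultimately have "parity_mat ** (b ** x ** c) = mscale ((-1) ^ p) (b ** x ** (c ** parity_mat))"
    by simp
  then have "parity_mat ** (b ** x ** c) = mscale ((-1) ^ p) (b ** x ** c ** parity_mat)"
    by (simp only: matrix_mul_assoc)
  then show ?thesis using assms(1) by (simp add: homogeneous_iff)
qed

lemma homogeneous_inverse:
  assumes "b \<in> homogeneous 0" "b ** c = mat 1" "c ** b = mat 1"
  shows "c \<in> homogeneous 0"
proof -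
  have "parity_mat ** b = b ** parity_mat" using assms(1) by (simp add: homogeneous_iff)
  then have "c ** (parity_mat ** b) ** c = c ** (b ** parity_mat) ** c" by simp
  moreover have "c ** (parity_mat ** b) ** c = c ** parity_mat ** (b ** c)"
    "c ** (b ** parity_mat) ** c = (c ** b) ** parity_mat ** c"
    by (simp_all only: matrix_mul_assoc)
  ultimately show ?thesis by (simp add: homogeneous_iff assms)
qed

text \<open>Conjugation induces an automorphism of the enveloping algebra. It maps upper triangular
  matrices to such matrices with the same diagonal, so it fixes the generators' values under
  \<Lambda> and preserves the left ideal; the conjugation by c inverts it.\<close>

lemma exact_at_conj_imp:
  fixes b c :: "(1, 'n::{finite,linorder}) gl"
  assumes bc: "b ** c = mat 1" "c ** b = mat 1" and b: "b \<in> borel" "b \<in> homogeneous 0"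
    and c: "c \<in> borel" "c \<in> homogeneous 0"
    and ex: "exact_at \<Lambda> x"
  shows "exact_at \<Lambda> (b ** x ** c)"
proof -
  have lift: "\<exists>\<psi> :: (1, 'n) U_gl \<Rightarrow> (1, 'n) U_gl. (\<forall>u v. \<psi> (u + v) = \<psi> u + \<psi> v) \<and> (\<forall>u v. \<psi> (u * v) = \<psi> u * \<psi> v) \<and>
      (\<forall>y. \<psi> (\<iota> y) = \<iota> (d ** y ** e)) \<and> (\<forall>k. \<psi> (usc k) = usc k) \<and> (\<forall>u\<in>verma_ideal \<Lambda>. \<psi> u \<in> verma_ideal \<Lambda>)"
    if de: "d ** e = mat 1" "e ** d = mat 1" and d: "d \<in> borel" "d \<in> homogeneous 0"
      and e: "e \<in> borel" "e \<in> homogeneous 0" for d e :: "(1, 'n) gl"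
  proof -
    have mult: "d ** (y ** z) ** e = (d ** y ** e) ** (d ** z ** e)" for y z
    proof -
      have "(d ** y ** e) ** (d ** z ** e) = d ** y ** (e ** d) ** z ** e" by (simp only: matrix_mul_assoc)
      then show ?thesis by (simp add: de matrix_mul_assoc)
    qed
    obtain \<psi> :: "(1, 'n) U_gl \<Rightarrow> (1, 'n) U_gl" where \<psi>: "\<psi> 1 = 1" "\<And>u v. \<psi> (u + v) = \<psi> u + \<psi> v"
      "\<And>u v. \<psi> (u * v) = \<psi> u * \<psi> v" "\<And>y. \<psi> (\<iota> y) = \<iota> (d ** y ** e)" "\<And>k. \<psi> (U_class (scalar k)) = usc k"
    proof (rule usc.U_lift[of "\<lambda>y. \<iota> (d ** y ** e)"])
      fix y z :: "(1, 'n) gl"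
      show "\<iota> (d ** (y + z) ** e) = \<iota> (d ** y ** e) + \<iota> (d ** z ** e)"
        by (simp add: matrix_add_ldistrib gl_mult_distrib \<iota>_add)
    next
      fix k and y :: "(1, 'n) gl"
      show "\<iota> (d ** mscale k y ** e) = usc k * \<iota> (d ** y ** e)" by (simp add: \<iota>_mscale)
    next
      fix y z :: "(1, 'n) gl" and p q :: nat
      assume pq: "p \<in> {0, 1}" "q \<in> {0, 1}" and yz: "y \<in> homogeneous p" "z \<in> homogeneous q"
      have "d ** sbracket y z ** e = sbracket (d ** y ** e) (d ** z ** e)"
        unfolding sbracket_homogeneous[OF yz pq] sbracket_homogeneous[OF homogeneous_mult[OF pq(1) d(2) yz(1) e(2)] homogeneous_mult[OF pq(2) d(2) yz(2) e(2)] pq]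
        unfolding mult[symmetric] gl_mult_distrib mscale_mult ..
      then show "\<iota> (d ** y ** e) * \<iota> (d ** z ** e) - (-1) ^ (p * q) * (\<iota> (d ** z ** e) * \<iota> (d ** y ** e)) = \<iota> (d ** sbracket y z ** e)"
        using \<iota>_bracket[OF pq homogeneous_mult[OF pq(1) d(2) yz(1) e(2)] homogeneous_mult[OF pq(2) d(2) yz(2) e(2)]] by simp
    qed (rule that)
    note \<psi>_usc = \<psi>(5)[folded usc_def]
    have \<psi>_diff: "\<psi> (u - v) = \<psi> u - \<psi> v" for u v
      using \<psi>(2)[of "u - v" v] by simp
    have "\<psi> u \<in> verma_ideal \<Lambda>" if "u \<in> verma_ideal \<Lambda>" for u
      using that
    proof (induction rule: verma_ideal.induct)
      case zero
      show ?case using \<psi>(2)[of 0 0] by (simp add: verma_ideal.zero)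
    next
      case (add u v)
      then show ?case by (simp add: \<psi> verma_ideal.add)
    next
      case (gen t u)
      have "d ** t ** e \<in> borel" by (intro borel_mult gen d e)
      moreover have "(d ** t ** e) $ k $ k = t $ k $ k" for k
      proof -
        have "(d ** t ** e) $ k $ k = t $ k $ k * (d ** e) $ k $ k"
          using borel_mult(2)[OF borel_mult(1)[OF d(1) gen] e(1)] borel_mult(2)[OF d(1) gen] borel_mult(2)[OF d(1) e(1)]
          by simp
        then show ?thesis by (simp add: de mat_def)
      qed
      ultimately show ?case
        using verma_ideal.gen[of "d ** t ** e" "\<psi> u" \<Lambda>] by (simp add: \<psi> \<psi>_diff \<psi>_usc wt_eval_def)
    qed
    with \<psi> \<psi>_usc show ?thesis by blast
  qed
  obtain \<psi> :: "(1, 'n) U_gl \<Rightarrow> (1, 'n) U_gl" where \<psi>: "\<And>u v. \<psi> (u + v) = \<psi> u + \<psi> v" "\<And>u v. \<psi> (u * v) = \<psi> u * \<psi> v"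
      "\<And>y. \<psi> (\<iota> y) = \<iota> (b ** y ** c)" "\<And>k. \<psi> (usc k) = usc k" "\<And>u. u \<in> verma_ideal \<Lambda> \<Longrightarrow> \<psi> u \<in> verma_ideal \<Lambda>"
    using lift[OF bc b c] by blast
  obtain \<theta> :: "(1, 'n) U_gl \<Rightarrow> (1, 'n) U_gl" where \<theta>: "\<And>u v. \<theta> (u + v) = \<theta> u + \<theta> v" "\<And>u v. \<theta> (u * v) = \<theta> u * \<theta> v"
      "\<And>y. \<theta> (\<iota> y) = \<iota> (c ** y ** b)" "\<And>k. \<theta> (usc k) = usc k" "\<And>u. u \<in> verma_ideal \<Lambda> \<Longrightarrow> \<theta> u \<in> verma_ideal \<Lambda>"
    using lift[OF bc(2,1) c b] by blast
  have "b ** (c ** y ** b) ** c = (b ** c) ** y ** (b ** c)" "c ** (b ** y ** c) ** b = (c ** b) ** y ** (c ** b)" for y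
    by (simp_all only: matrix_mul_assoc)
  then have inv: "b ** (c ** y ** b) ** c = y" "c ** (b ** y ** c) ** b = y" for y
    by (simp_all add: bc)
  have \<psi>\<theta>: "\<psi> (\<theta> u) = u" and \<theta>\<psi>: "\<theta> (\<psi> u) = u" for u
    by (induction u rule: U_induct) (simp_all add: \<psi> \<theta> inv)
  have diff: "\<psi> (u - v) = \<psi> u - \<psi> v" "\<theta> (u - v) = \<theta> u - \<theta> v" for u v
    using \<psi>(1)[of "u - v" v] \<theta>(1)[of "u - v" v] by simp_all
  have \<psi>_iff: "\<psi> u \<in> verma_ideal \<Lambda> \<longleftrightarrow> u \<in> verma_ideal \<Lambda>" for u
    using \<psi>(5) \<theta>(5) \<theta>\<psi> by metis
  have "\<iota> (b ** x ** c) * u \<in> verma_ideal \<Lambda> \<longleftrightarrow> \<iota> x * \<theta> u \<in> verma_ideal \<Lambda>" for u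
    using \<psi>_iff[of "\<iota> x * \<theta> u"] by (simp add: \<psi> \<psi>\<theta>)
  moreover have "u - \<iota> (b ** x ** c) * v \<in> verma_ideal \<Lambda> \<longleftrightarrow> \<theta> u - \<iota> x * \<theta> v \<in> verma_ideal \<Lambda>" for u v
    using \<psi>_iff[of "\<theta> u - \<iota> x * \<theta> v"] by (simp add: \<psi> diff \<psi>\<theta>)
  ultimately show ?thesis
    using ex unfolding exact_at_def by (metis \<theta>\<psi>)
qed

lemma borel_group0_inverse:
  fixes b :: "(1, 'n::{finite,linorder}) gl"
  assumes "b \<in> borel_group0"
  shows "b ** matrix_inv b = mat 1" "matrix_inv b ** b = mat 1"
    "matrix_inv b \<in> borel" "matrix_inv b \<in> homogeneous 0"
proof -
  have "invertible b" using assms by (simp add: borel_group0_def)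
  then have "b ** matrix_inv b = mat 1 \<and> matrix_inv b ** b = mat 1"
    unfolding invertible_def matrix_inv_def by (rule someI_ex)
  then show 1: "b ** matrix_inv b = mat 1" "matrix_inv b ** b = mat 1" by blast+
  show "matrix_inv b \<in> borel" "matrix_inv b \<in> homogeneous 0"
    using borel_inverse[OF _ 1(2)] homogeneous_inverse[OF _ 1] assms by (simp_all add: borel_group0_def)
qed

lemma exact_at_conj:
  fixes b :: "(1, 'n::{finite,linorder}) gl"
  assumes "b \<in> borel_group0"
  shows "exact_at \<Lambda> (b ** x ** matrix_inv b) \<longleftrightarrow> exact_at \<Lambda> x"
proof
  note i = borel_group0_inverse[OF assms]
  have b: "b \<in> borel" "b \<in> homogeneous 0" using assms by (simp_all add: borel_group0_def)
  show "exact_at \<Lambda> x" if "exact_at \<Lambda> (b ** x ** matrix_inv b)"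
  proof -
    have "matrix_inv b ** (b ** x ** matrix_inv b) ** b = (matrix_inv b ** b) ** x ** (matrix_inv b ** b)"
      by (simp only: matrix_mul_assoc)
    with exact_at_conj_imp[OF i(2,1,3,4) b that] show ?thesis by (simp add: i)
  qed
  show "exact_at \<Lambda> (b ** x ** matrix_inv b)" if "exact_at \<Lambda> x"
    using exact_at_conj_imp[OF i(1,2) b i(3,4) that] .
qed

lemma exact_at_mscale:
  assumes "c \<noteq> 0"
  shows "exact_at \<Lambda> (mscale c x) \<longleftrightarrow> exact_at \<Lambda> x"
proof -
  have inv: "usc (1 / c) * (usc c * u) = u" "usc c * (usc (1 / c) * u) = u" for u :: "('a, 'b) U_gl"
    using assms by (simp_all add: usc.sc_one flip: mult.assoc usc.sc_mult)
  have "usc c * u \<in> verma_ideal \<Lambda> \<longleftrightarrow> u \<in> verma_ideal \<Lambda>" for u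
    using verma_ideal_lmult[of u \<Lambda> "usc c"] verma_ideal_lmult[of "usc c * u" \<Lambda> "usc (1 / c)"] by (auto simp: inv)
  moreover have "(\<exists>v. u - usc c * (\<iota> x * v) \<in> verma_ideal \<Lambda>) \<longleftrightarrow> (\<exists>v. u - \<iota> x * v \<in> verma_ideal \<Lambda>)" for u
  proof -
    have "usc c * (\<iota> x * v) = \<iota> x * (usc c * v)" for v
      by (simp add: usc.sc_central[of c "\<iota> x"] flip: mult.assoc)
    then show ?thesis using inv(2) by metis
  qed
  ultimately show ?thesis by (simp add: exact_at_def \<iota>_mscale mult.assoc)
qed

section \<open>Root vectors\<close>

lemma mat_1_borel_group0: "mat 1 \<in> (borel_group0 :: (1, 'n::{finite,linorder}) gl set)"
proof -
  have "invertible (mat 1 :: (1, 'n) gl)" by (auto simp: invertible_def intro: exI[of _ "mat 1"])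
  moreover have "mat 1 \<in> (borel :: (1, 'n) gl set)" by (auto simp: borel_iff mat_def)
  moreover have "mat 1 \<in> (homogeneous 0 :: (1, 'n) gl set)" by (simp add: homogeneous_iff)
  ultimately show ?thesis by (simp add: borel_group0_def)
qed

lemma sbracket_cartan:
  fixes h x :: "('a::finite, 'b::finite) gl"
  assumes "h \<in> cartan"
  shows "sbracket h x $ i $ j = (h $ i $ i - h $ j $ j) * x $ i $ j"
proof -
  have h0: "h $ k $ l = 0" if "k \<noteq> l" for k l using assms that by (simp add: cartan_def)
  have even: "(parity k + parity l) mod 2 = 0" if "h $ k $ l \<noteq> 0" for k l
    using h0[of k l] that by (cases "k = l") (auto simp flip: mult_2)
  then have "gpart 0 h = h" "gpart 1 h = 0"
    by (force simp: gpart_def vec_eq_iff)+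
  then have "sbracket h x = h ** (gpart 0 x + gpart 1 x) - (gpart 0 x + gpart 1 x) ** h"
    by (simp add: sbracket_def gl_zero matrix_add_ldistrib gl_mult_distrib)
  moreover have "gpart 0 x + gpart 1 x = x" by (auto simp: gpart_def vec_eq_iff)
  ultimately have "sbracket h x = h ** x - x ** h" by simp
  moreover have "(h ** x) $ i $ j = h $ i $ i * x $ i $ j"
    unfolding matrix_matrix_mult_def vec_lambda_beta by (rule sum_single) (simp add: h0)
  moreover have "(x ** h) $ i $ j = x $ i $ j * h $ j $ j"
    unfolding matrix_matrix_mult_def vec_lambda_beta by (rule sum_single) (simp add: h0)
  ultimately show ?thesis by (simp add: left_diff_distrib mult.commute[of "x $ i $ j"])
qed

lemma wt_eval_root: "wt_eval (eps 1 - del i) h = h $ Inl 1 $ Inl 1 - h $ Inr i $ Inr i"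
proof -
  have "(eps 1 - del i) $ k * h $ k $ k = (if k = Inl 1 then h $ Inl 1 $ Inl 1 else 0) - (if k = Inr i then h $ Inr i $ Inr i else 0)" for k
    by (auto simp: eps_def del_def axis_def)
  then show ?thesis by (simp add: wt_eval_def sum_subtractf)
qed

lemma wt_form_root: "wt_form \<mu> (eps 1 - del i) = \<mu> $ Inl 1 + \<mu> $ Inr i"
proof -
  have "(-1) ^ parity k * \<mu> $ k * (eps 1 - del i) $ k = (if k = Inl 1 then \<mu> $ Inl 1 else 0) + (if k = Inr i then \<mu> $ Inr i else 0)" for k
    by (auto simp: eps_def del_def axis_def)
  then show ?thesis by (simp add: wt_form_def sum.distrib)
qed

lemma root_space_eq: "root_space (eps 1 - del i) = range (\<lambda>c. mscale c (munit (Inl 1) (Inr i)) :: (1, 'n::finite) gl)"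
proof (intro equalityI subsetI)
  fix x :: "(1, 'n) gl" assume x: "x \<in> root_space (eps 1 - del i)"
  have x: "(h $ a $ a - h $ b $ b) * x $ a $ b = (h $ Inl 1 $ Inl 1 - h $ Inr i $ Inr i) * x $ a $ b" if "h \<in> cartan" for h a b
  proof -
    have eq: "sbracket h x = mscale (wt_eval (eps 1 - del i) h) x"
      using x that unfolding root_space_def by blast
    from sbracket_cartan[OF that, of x a b] show ?thesis
      unfolding eq wt_eval_root mscale_nth by (rule sym)
  qed
  have "x $ a $ b = 0" if "a \<noteq> Inl 1 \<or> b \<noteq> Inr i" for a b
  proof -
    \<comment> \<open>Testing with E_00 forces a nonzero entry into row 0, and testing with E_ii
      then forces it into column i.\<close>
    have "munit k k \<in> (cartan :: (1, 'n) gl set)" for k by (auto simp: cartan_def munit_def)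
    from x[OF this[of "Inl 1"], of a b] x[OF this[of "Inr i"], of a b] that show ?thesis
      by (auto simp: munit_def split: if_splits)
  qed
  then have "x = mscale (x $ Inl 1 $ Inr i) (munit (Inl 1) (Inr i))"
    by (auto simp: vec_eq_iff munit_def)
  then show "x \<in> range (\<lambda>c. mscale c (munit (Inl 1) (Inr i)))" by blast
next
  fix x :: "(1, 'n) gl" assume "x \<in> range (\<lambda>c. mscale c (munit (Inl 1) (Inr i)))"
  then obtain c where c: "x = mscale c (munit (Inl 1) (Inr i))" by blast
  then have "(h $ a $ a - h $ b $ b) * x $ a $ b = (h $ Inl 1 $ Inl 1 - h $ Inr i $ Inr i) * x $ a $ b" for a b and h :: "(1, 'n) gl"
    by (simp add: munit_def)
  then show "x \<in> root_space (eps 1 - del i)"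
    by (simp add: root_space_def vec_eq_iff sbracket_cartan wt_eval_root)
qed

lemma iso_sets_root: "{eps 1 - del i} \<in> (iso_sets :: (1, 'n::finite) weight set set)"
proof -
  have "(eps 1 - del i :: (1, 'n) weight) $ Inl 1 = 1" "(eps 1 - del i :: (1, 'n) weight) $ Inr i = - 1"
    by (simp_all add: eps_def del_def axis_def)
  moreover from this have "(eps 1 - del i :: (1, 'n) weight) \<noteq> 0" by (metis zero_index zero_neq_one)
  moreover have "(eps 1 - del i :: (1, 'n) weight) \<in> odd_roots"
    unfolding odd_roots_def pos_odd_roots_def by blast
  ultimately show ?thesis by (simp add: iso_sets_def wt_form_root)
qed

lemma conj_root_vector_self_commuting:
  assumes "b \<in> borel_group0"
  shows "b ** mscale c (munit (Inl 1) (Inr i)) ** matrix_inv b \<in> (self_commuting :: (1, 'n::{finite,linorder}) gl set)" (is "?y \<in> _")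
proof -
  note inv = borel_group0_inverse[OF assms]
  have "mscale c (munit (Inl 1) (Inr i)) \<in> (homogeneous 1 :: (1, 'n) gl set)"
    by (auto simp: homogeneous_def gpart_def vec_eq_iff munit_def)
  then have y: "?y \<in> homogeneous 1"
    using assms inv by (intro homogeneous_mult) (auto simp: borel_group0_def)
  have sq: "(b ** x ** matrix_inv b) ** (b ** x ** matrix_inv b) = b ** (x ** x) ** matrix_inv b" for x
  proof -
    have "(b ** x ** matrix_inv b) ** (b ** x ** matrix_inv b) = b ** x ** (matrix_inv b ** b) ** x ** matrix_inv b"
      by (simp only: matrix_mul_assoc)
    then show ?thesis by (simp add: inv(2) matrix_mul_assoc)
  qed
  have "?y ** ?y = 0"
    unfolding sq by (simp add: munit_mult gl_zero)
  then have "sbracket ?y ?y = 0"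
    unfolding sbracket_homogeneous[OF y y insertI2[OF singletonI] insertI2[OF singletonI]]
    by (simp add: vec_eq_iff)
  with y show ?thesis by (simp add: self_commuting_def)
qed

text \<open>Every point of the orbit is a conjugate of a nonzero multiple of one matrix unit, and
  exactness is invariant under both changes; so the condition on the whole orbit is decided at one
  point.\<close>

lemma S_set_singleton_iff:
  "{eps 1 - del i} \<in> S_set \<Lambda> \<longleftrightarrow> \<not> exact_at \<Lambda> (munit (Inl 1) (Inr i) :: (1, 'n::{finite,linorder}) gl)"
proof -
  let ?e = "munit (Inl 1) (Inr i) :: (1, 'n) gl"
  have e: "mscale c ?e \<noteq> 0 \<longleftrightarrow> c \<noteq> 0" for c
    by (auto simp: vec_eq_iff munit_def)
  have \<Phi>: "\<Phi> {eps 1 - del i} = {b ** mscale c ?e ** matrix_inv b |b c. b \<in> borel_group0 \<and> c \<noteq> 0}"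
  proof (intro equalityI subsetI)
    fix y assume "y \<in> \<Phi> {eps 1 - del i :: (1, 'n) weight}"
    then obtain b x where "y = b ** x (eps 1 - del i) ** matrix_inv b" "b \<in> borel_group0"
      "x (eps 1 - del i) \<in> root_space (eps 1 - del i)" "x (eps 1 - del i) \<noteq> 0"
      unfolding \<Phi>_def by auto
    moreover from this obtain c where c: "x (eps 1 - del i) = mscale c ?e" unfolding root_space_eq by blast
    ultimately have "y = b ** mscale c ?e ** matrix_inv b" "b \<in> borel_group0" "c \<noteq> 0"
      using e[of c] by simp_all
    then show "y \<in> {b ** mscale c ?e ** matrix_inv b |b c. b \<in> borel_group0 \<and> c \<noteq> 0}" by blast
  next
    fix y assume "y \<in> {b ** mscale c ?e ** matrix_inv b |b c. b \<in> borel_group0 \<and> c \<noteq> 0}"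
    then obtain b c where y: "y = b ** mscale c ?e ** matrix_inv b" "b \<in> borel_group0" "c \<noteq> 0" by blast
    then have "y = b ** (\<Sum>\<alpha>\<in>{eps 1 - del i :: (1, 'n) weight}. mscale c ?e) ** matrix_inv b" by simp
    moreover have "mscale c ?e \<in> root_space (eps 1 - del i)" unfolding root_space_eq by blast
    ultimately show "y \<in> \<Phi> {eps 1 - del i}"
      unfolding \<Phi>_def using e y(2,3) by (intro CollectI exI[of _ b] exI[of _ "\<lambda>_. mscale c ?e"]) auto
  qed
  have ex: "exact_at \<Lambda> (b ** mscale c ?e ** matrix_inv b) \<longleftrightarrow> exact_at \<Lambda> ?e"
    if "b \<in> borel_group0" "c \<noteq> 0" for b c
    by (simp only: exact_at_conj[OF that(1)] exact_at_mscale[OF that(2)])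
  have "\<Phi> {eps 1 - del i} \<subseteq> X_mod (verma \<Lambda>) (verma_act \<Lambda>) \<longleftrightarrow> \<not> exact_at \<Lambda> ?e"
  proof
    assume sub: "\<Phi> {eps 1 - del i} \<subseteq> X_mod (verma \<Lambda>) (verma_act \<Lambda>)"
    have "mat 1 ** mscale 1 ?e ** matrix_inv (mat 1) \<in> \<Phi> {eps 1 - del i}"
      unfolding \<Phi> by (intro CollectI exI[of _ "mat 1"] exI[of _ 1]) (simp add: mat_1_borel_group0)
    with sub have "mat 1 ** mscale 1 ?e ** matrix_inv (mat 1) \<in> X_mod (verma \<Lambda>) (verma_act \<Lambda>)" ..
    then show "\<not> exact_at \<Lambda> ?e"
      using ex[OF mat_1_borel_group0, of 1] by (simp only: X_mod_verma_iff) simp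
  next
    assume "\<not> exact_at \<Lambda> ?e"
    then have "b ** mscale c ?e ** matrix_inv b \<in> X_mod (verma \<Lambda>) (verma_act \<Lambda>)" if "b \<in> borel_group0" "c \<noteq> 0" for b c
      using conj_root_vector_self_commuting[OF that(1)] ex[OF that] by (simp only: X_mod_verma_iff) simp
    then show "\<Phi> {eps 1 - del i} \<subseteq> X_mod (verma \<Lambda>) (verma_act \<Lambda>)"
      unfolding \<Phi> by blast
  qed
  then show ?thesis by (simp add: S_set_def iso_sets_root)
qed

section \<open>The Weyl vector\<close>

lemma rk_card:
  fixes i :: "'n::{finite,linorder}"
  shows "of_nat (card {a. a < i}) = (of_nat (rk i) - 1 :: complex)" "of_nat (card {b. i < b}) = (of_nat CARD('n) - of_nat (rk i) :: complex)"
proof -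
  have "{k. k \<le> i} = insert i {a. a < i}" by auto
  then have "rk i = Suc (card {a. a < i})" by (simp add: rk_def)
  then show "of_nat (card {a. a < i}) = (of_nat (rk i) - 1 :: complex)" by simp
  have "(UNIV :: 'n set) = {k. k \<le> i} \<union> {b. i < b}" by auto
  then have "CARD('n) = rk i + card {b. i < b}"
    unfolding rk_def by (metis card_Un_disjoint finite disjoint_iff mem_Collect_eq not_less)
  then show "of_nat (card {b. i < b}) = (of_nat CARD('n) - of_nat (rk i) :: complex)" by simp
qed

lemma sum_pos_even_roots:
  fixes i :: "'n::{finite,linorder}"
  shows "(\<Sum>\<alpha>\<in>(pos_even_roots :: (1, 'n) weight set). \<alpha> $ Inl 1) = 0"
    "(\<Sum>\<alpha>\<in>(pos_even_roots :: (1, 'n) weight set). \<alpha> $ Inr i) = of_nat CARD('n) + 1 - 2 * of_nat (rk i)" (is "?l = ?r")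
proof -
  let ?P = "{(a, b). a < b} :: ('n \<times> 'n) set" and ?f = "\<lambda>(a, b). del a - del b :: (1, 'n) weight"
  have P: "pos_even_roots = ?f ` ?P"
    unfolding pos_even_roots_def by (auto simp: num1_eq_iff)
  have inj: "inj_on ?f ?P"
  proof (rule inj_onI)
    fix u v assume u: "u \<in> ?P" and eq: "?f u = ?f v"
    obtain a b c d where uv: "u = (a, b)" "v = (c, d)" by fastforce
    from u eq have "a < b" and eq: "del a - del b = (del c - del d :: (1, 'n) weight)" by (simp_all add: uv)
    show "u = v"
      using \<open>a < b\<close> arg_cong[OF eq, of "\<lambda>v. v $ Inr a"] arg_cong[OF eq, of "\<lambda>v. v $ Inr b"]
      by (auto simp: uv del_def axis_def split: if_splits)
  qed
  show "(\<Sum>\<alpha>\<in>(pos_even_roots :: (1, 'n) weight set). \<alpha> $ Inl 1) = 0"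
    unfolding P by (rule sum.neutral) (auto simp: del_def axis_def)
  have ind: "(\<Sum>p\<in>?P. if Q p then 1 else 0 :: complex) = of_nat (card {p \<in> ?P. Q p})" for Q
    by (simp flip: sum.inter_filter)
  have "{p \<in> ?P. fst p = i} = Pair i ` {b. i < b}" "{p \<in> ?P. snd p = i} = (\<lambda>a. (a, i)) ` {a. a < i}"
    by auto
  then have card: "card {p \<in> ?P. fst p = i} = card {b. i < b}" "card {p \<in> ?P. snd p = i} = card {a. a < i}"
    by (simp_all add: card_image inj_on_def)
  have "(\<Sum>\<alpha>\<in>(pos_even_roots :: (1, 'n) weight set). \<alpha> $ Inr i) = (\<Sum>p\<in>?P. (if fst p = i then 1 else 0) - (if snd p = i then 1 else 0))"
    unfolding P sum.reindex[OF inj] by (rule sum.cong) (auto simp: del_def axis_def)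
  then show "?l = ?r"
    by (simp only: sum_subtractf ind card rk_card) simp
qed

lemma sum_pos_odd_roots:
  fixes i :: "'n::finite"
  shows "(\<Sum>\<alpha>\<in>(pos_odd_roots :: (1, 'n) weight set). \<alpha> $ Inl 1) = of_nat CARD('n)"
    "(\<Sum>\<alpha>\<in>(pos_odd_roots :: (1, 'n) weight set). \<alpha> $ Inr i) = - 1"
proof -
  let ?f = "\<lambda>j. eps 1 - del j :: (1, 'n) weight"
  have P: "pos_odd_roots = range ?f"
    unfolding pos_odd_roots_def by (auto simp: num1_eq_iff)
  have inj: "inj ?f"
  proof (rule injI)
    fix a b :: 'n assume eq: "eps 1 - del a = (eps 1 - del b :: (1, 'n) weight)"
    show "a = b"
      using arg_cong[OF eq, of "\<lambda>v. v $ Inr a"] by (auto simp: eps_def del_def axis_def split: if_splits)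
  qed
  show "(\<Sum>\<alpha>\<in>(pos_odd_roots :: (1, 'n) weight set). \<alpha> $ Inl 1) = of_nat CARD('n)"
    unfolding P sum.reindex[OF inj] by (simp add: eps_def del_def axis_def)
  have "(\<Sum>\<alpha>\<in>(pos_odd_roots :: (1, 'n) weight set). \<alpha> $ Inr i) = ?f i $ Inr i"
    unfolding P sum.reindex[OF inj] o_def by (rule sum_single) (simp add: eps_def del_def axis_def)
  then show "(\<Sum>\<alpha>\<in>(pos_odd_roots :: (1, 'n) weight set). \<alpha> $ Inr i) = - 1"
    by (simp add: eps_def del_def axis_def)
qed

text \<open>The coordinates of the Weyl vector are - n/2 at \<epsilon>_1 and n/2 + 1 - r at the
  \<delta> of rank r, so their sum is 1 - r.\<close>

lemma wt_form_rho:
  "wt_form (\<Lambda> + rho) (eps 1 - del i) = \<Lambda> $ Inl 1 + \<Lambda> $ Inr i + 1 - of_nat (rk i)"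
  for \<Lambda> :: "(1, 'n::{finite,linorder}) weight"
proof -
  have rho: "(rho :: (1, 'n) weight) $ k = ((\<Sum>\<alpha>\<in>pos_even_roots. \<alpha> $ k) - (\<Sum>\<alpha>\<in>pos_odd_roots. \<alpha> $ k)) / 2" for k
    by (simp only: rho_def vector_minus_component vector_scaleR_component sum_component)
      (simp add: scaleR_conv_of_real diff_divide_distrib)
  show ?thesis
    unfolding wt_form_root vector_add_component rho sum_pos_even_roots sum_pos_odd_roots
    by (simp add: field_simps)
qed

theorem theorem5p15:
  fixes \<Lambda> :: "(1, 'n::{finite,linorder}) weight" and p i :: 'n
  assumes "atypical \<Lambda>"
    and "wt_form (\<Lambda> + rho) (eps 1 - del p) = 0"
    and "\<And>j. j < p \<Longrightarrow> wt_form (\<Lambda> + rho) (eps 1 - del j) \<noteq> 0"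
  shows "{eps 1 - del i} \<in> S_set \<Lambda> \<longleftrightarrow>
    p \<le> i \<and> wt_form (\<Lambda> + rho) (eps 1 - del i) \<in> \<int>\<^sub>\<le>\<^sub>0"
proof -
  let ?a = "\<lambda>j. wt_form (\<Lambda> + rho) (eps 1 - del j)" and ?\<alpha> = "\<alpha>\<^sub>\<Lambda> \<Lambda>" and ?\<beta> = "\<beta>\<^sub>\<Lambda> \<Lambda>"
  have a: "?a j = ?\<alpha> + ?\<beta> (rk j) + 1 - of_nat (rk j)" for j
    by (simp add: wt_form_rho \<alpha>\<^sub>\<Lambda>_def \<beta>\<^sub>\<Lambda>_def)
  have "\<not> exact_at \<Lambda> (munit (Inl 1) (Inr i)) \<longleftrightarrow> p \<le> i \<and> ?a i \<in> \<int>\<^sub>\<le>\<^sub>0"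
  proof
    assume R: "p \<le> i \<and> ?a i \<in> \<int>\<^sub>\<le>\<^sub>0"
    then obtain s :: nat where s: "?a i = - of_nat s" using nonpos_Ints_cases' by blast
    \<comment> \<open>The index p serves as the j of \<open>not_exact\<close>: the difference of its
      value 0 and the value - s at i is the required natural number.\<close>
    have "?\<beta> (rk p) - ?\<beta> (rk i) + of_nat (rk i) - of_nat (rk p) = ?a p - ?a i"
      by (simp add: a)
    then have s': "?\<beta> (rk p) - ?\<beta> (rk i) + of_nat (rk i) - of_nat (rk p) = of_nat s"
      using s assms(2) by simp
    have "1 \<le> rk p" "rk p \<le> rk i" using R rk_range[of p] by (auto simp: rk_le_iff)
    from not_exact[OF rk_range this s'] a[of p] assms(2) show "\<not> exact_at \<Lambda> (munit (Inl 1) (Inr i))"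
      unfolding exact_at_munit by metis
  next
    assume L: "\<not> exact_at \<Lambda> (munit (Inl 1) (Inr i))"
    show "p \<le> i \<and> ?a i \<in> \<int>\<^sub>\<le>\<^sub>0"
    proof (rule ccontr)
      assume R: "\<not> (p \<le> i \<and> ?a i \<in> \<int>\<^sub>\<le>\<^sub>0)"
      have "exact_at \<Lambda> (munit (Inl 1) (Inr i))"
        unfolding exact_at_munit
      proof (intro ballI impI)
        fix f assume f: "f \<in> Vs CARD('n) {1..CARD('n)}" "app (mX ?\<alpha> ?\<beta> CARD('n) (rk i)) f = 0"
        show "\<exists>g\<in>Vs CARD('n) {1..CARD('n)}. f = app (mX ?\<alpha> ?\<beta> CARD('n) (rk i)) g"
        proof (cases "p \<le> i")
          case True
          have "?\<alpha> + ?\<beta> (rk i) + 1 - of_nat (rk i) + of_nat m \<noteq> 0" for m :: nat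
          proof
            assume "?\<alpha> + ?\<beta> (rk i) + 1 - of_nat (rk i) + of_nat m = 0"
            then have "?a i = - of_nat m" by (simp add: a eq_neg_iff_add_eq_0)
            then show False using R True by simp
          qed
          then show ?thesis by (rule exact_if_not_nonpos[OF rk_range f])
        next
          case False
          \<comment> \<open>Since i < p, all ranks up to that of i belong to indices below p, where
            the minimality of p applies.\<close>
          have "?\<alpha> + ?\<beta> j + 1 - of_nat j \<noteq> 0" if j: "j \<in> {1..rk i}" for j
          proof -
            have "j \<in> {1..CARD('n)}" using j rk_range[of i] by auto
            then have rk: "rk (un j :: 'n) = j" by (rule rk_un)
            have "rk i < rk p" using False by (simp add: rk_less_iff)
            then have "rk (un j :: 'n) < rk p" using j rk by simp
            then have "(un j :: 'n) < p" by (simp only: rk_less_iff)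
            from assms(3)[OF this] show ?thesis unfolding a rk .
          qed
          then show ?thesis by (rule exact_if_typical[OF rk_range f])
        qed
      qed
      with L show False by contradiction
    qed
  qed
  then show ?thesis unfolding S_set_singleton_iff .
qed

end
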